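(* Let $\varphi_1$ be a Jacob's ladder, write $[Y]^k=\varphi_1^{-k}(Y)$, let $\epsilon>0$ be a fixed (small) number, and fix $k\in\mathbb{N}$ and $\sigma\geq\frac12+\epsilon$. Then the following two statements are equivalent: (i) there are no positive integers $x,y,z,n$ with $n\geq3$ and $x^n+y^n=z^n$; (ii) for all positive integers $x,y,z,n$ with $n\ge3$, $$\lim_{\tau\to\infty}\frac{1}{\tau}\int_{\frac{x^n+y^n}{z^n}\frac{\tau}{k(1-c)\zeta(2\sigma)}}^{\left[\frac{x^n+y^n}{z^n}\frac{\tau}{k(1-c)\zeta(2\sigma)}\right]^k}\left\{\zeta(2\sigma)\left|\zeta\left(\tfrac12+it\right)\right|^2+(1-c)|\zeta(\sigma+it)|^2\right\}{\rm d}t\neq1 .$$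
   Context: $\zeta$ is the Riemann zeta-function and $c$ is Euler's constant. Jacob's ladder (defined in the author's earlier work): let $Z(t)=e^{i\vartheta(t)}\zeta(\frac12+it)$ be Hardy's function; for an admissible function $\mu$ (with $\mu(y)\ge 7y\ln y$), the nonlinear integral equation $\int_0^{\mu[x(T)]}Z^2(t)e^{-\frac{2}{x(T)}t}{\rm d}t=\int_0^T Z^2(t){\rm d}t$ has a solution $x(T)=\varphi(T)$, and $\varphi_1(T)=\frac12\varphi(T)$ is called a Jacob's ladder; it is increasing for sufficiently large $T$, so $\varphi_1^{-1}$ exists there; $\varphi_1^{-k}$ denotes the $k$-fold iterate of $\varphi_1^{-1}$. *)

theory Defs
  imports "HOL-Complex_Analysis.Complex_Analysis"
begin

section \<open>The Riemann zeta-function\<close>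

text \<open>
  The zeta-function is the analytic continuation of the Dirichlet series
  $\sum_{n \ge 1} n^{-s}$ from $\mathrm{Re}\,s > 1$ to the plane without the point \<open>1\<close>;
  the value at the pole \<open>1\<close> is the dummy value \<open>0\<close>.  Existence and uniqueness of the
  continuation are \<open>is_zeta_ex1\<close> below.
\<close>

definition is_zeta :: "(complex \<Rightarrow> complex) \<Rightarrow> bool" where
  "is_zeta f \<longleftrightarrow>
     f holomorphic_on (- {1}) \<and>
     (\<forall>s. Re s > 1 \<longrightarrow> (\<lambda>n. of_nat (Suc n) powr (- s)) sums f s) \<and>
     f 1 = 0"

definition zeta :: "complex \<Rightarrow> complex" where
  "zeta = (THE f. is_zeta f)"

lemma is_zeta_unique:
  assumes "is_zeta f" "is_zeta g"
  shows   "f = g"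
proof
  fix s
  show "f s = g s"
  proof (cases "s = 1")
    case False
    have conn: "connected (- {1 :: complex})"
      by (intro connected_punctured_universe) simp
    show ?thesis
    proof (rule analytic_continuation_open[where s = "{s. Re s > 1}" and s' = "- {1}"
          and f = f and g = g])
      show "{s. Re s > 1} \<noteq> {}"
        by (auto intro!: exI[of _ "2 :: complex"])
      show "f z = g z" if "z \<in> {s. Re s > 1}" for z
        using assms that by (auto simp: is_zeta_def intro: sums_unique2)
    qed (use assms conn False in \<open>auto simp: is_zeta_def open_halfspace_Re_gt\<close>)
  qed (use assms in \<open>auto simp: is_zeta_def\<close>)
qed

subsection \<open>Existence of the continuation\<close>

lemma holomorphic_suminf_halfplane:
  fixes h :: "nat \<Rightarrow> complex \<Rightarrow> complex" and a :: real
  assumes hol: "\<And>n. h n holomorphic_on {s. Re s > a}"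
    and bound: "\<And>R. \<exists>C\<ge>0. \<forall>n s. norm s \<le> R \<longrightarrow> Re s > a \<longrightarrow>
                   norm (h n s) \<le> C * of_nat (Suc n) powr (a - Re s - 1)"
  shows "(\<lambda>s. \<Sum>n. h n s) holomorphic_on {s. Re s > a}"
    and "\<And>s. Re s > a \<Longrightarrow> summable (\<lambda>n. h n s)"
proof -
  have unif: "\<exists>d>0. cball s0 d \<subseteq> {s. Re s > a} \<and>
          uniform_limit (cball s0 d) (\<lambda>n s. \<Sum>i<n. h i s) (\<lambda>s. \<Sum>n. h n s) sequentially"
    if s0: "Re s0 > a" for s0
  proof -
    define d where "d = (Re s0 - a) / 2"
    have d: "d > 0"
      using s0 by (simp add: d_def)
    have Re: "Re s \<ge> a + d" and nrm: "norm s \<le> norm s0 + d" if "s \<in> cball s0 d" for s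
    proof -
      have dd: "norm (s0 - s) \<le> d"
        using that by (simp add: dist_norm)
      then have "Re s0 - Re s \<le> d"
        using complex_Re_le_cmod[of "s0 - s"] by simp
      then show "Re s \<ge> a + d"
        by (simp add: d_def field_simps)
      show "norm s \<le> norm s0 + d"
        using dd norm_triangle_ineq3[of s0 s] by linarith
    qed
    obtain C where C: "C \<ge> 0" "\<And>n s. norm s \<le> norm s0 + d \<Longrightarrow> Re s > a \<Longrightarrow>
                   norm (h n s) \<le> C * of_nat (Suc n) powr (a - Re s - 1)"
      using bound[of "norm s0 + d"] by blast
    have "uniform_limit (cball s0 d) (\<lambda>n s. \<Sum>i<n. h i s) (\<lambda>s. \<Sum>n. h n s) sequentially"
    proof (rule Weierstrass_m_test)
      show "summable (\<lambda>n. C * of_nat (Suc n) powr (- d - 1))"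
        using d summable_real_powr_iff[of "- d - 1"]
        by (intro summable_mult) (subst summable_Suc_iff, simp)
      show "norm (h n s) \<le> C * of_nat (Suc n) powr (- d - 1)" if "s \<in> cball s0 d" for n s
      proof -
        have "norm (h n s) \<le> C * of_nat (Suc n) powr (a - Re s - 1)"
          using Re[OF that] nrm[OF that] d by (intro C(2)) auto
        also have "\<dots> \<le> C * of_nat (Suc n) powr (- d - 1)"
          using Re[OF that] C(1) by (intro mult_left_mono powr_mono) auto
        finally show ?thesis .
      qed
    qed
    moreover have "cball s0 d \<subseteq> {s. Re s > a}"
      using Re d by fastforce
    ultimately show ?thesis
      using d by blast
  qed
  show "(\<lambda>s. \<Sum>n. h n s) holomorphic_on {s. Re s > a}"
    by (rule holomorphic_uniform_sequence[where f = "\<lambda>n s. \<Sum>i<n. h i s"])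
       (use unif hol in \<open>auto intro!: holomorphic_intros simp: open_halfspace_Re_gt\<close>)
  show "summable (\<lambda>n. h n s)" if s: "Re s > a" for s
  proof -
    obtain d where "d > 0"
      "uniform_limit (cball s d) (\<lambda>n s. \<Sum>i<n. h i s) (\<lambda>s. \<Sum>n. h n s) sequentially"
      using unif[OF s] by blast
    then have "(\<lambda>n. \<Sum>i<n. h i s) \<longlonglongrightarrow> (\<Sum>n. h n s)"
      by (intro tendsto_uniform_limitI[where x = s]) auto
    then show ?thesis
      by (auto simp: summable_def sums_def)
  qed
qed

text \<open>The remainder of the binomial expansion of $(N + 1)^{1 - s}$ in powers of $1/N$.\<close>

definition zeta_rem :: "nat \<Rightarrow> nat \<Rightarrow> complex \<Rightarrow> complex" where
  "zeta_rem m N s = (of_nat N + 1) powr (1 - s) -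
     (\<Sum>i\<le>m. ((1 - s) gchoose i) * of_nat N powr (1 - s - of_nat i))"

lemma powr_Taylor_bound:
  fixes a :: complex and N m :: nat
  assumes N: "N > 0"
  shows "norm ((1 + 1 / of_nat N) powr a - (\<Sum>i\<le>m. (a gchoose i) * (1 / of_nat N) ^ i))
           \<le> (norm a + real m) ^ Suc m * 2 powr (norm a + real m + 1) * (1 / real N) ^ Suc m"
proof -
  define S where "S = closed_segment (1 :: complex) 2"
  have SD: "\<exists>t. z = of_real t \<and> 1 \<le> t \<and> t \<le> 2" if "z \<in> S" for z
  proof -
    have "S = of_real ` closed_segment 1 2"
      unfolding S_def by (metis closed_segment_of_real of_real_1 of_real_numeral)
    then show ?thesis
      using that by (auto simp: closed_segment_eq_real_ivl)
  qed
  have SI: "of_real t \<in> S" if "1 \<le> t" "t \<le> 2" for t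
  proof -
    have "S = of_real ` closed_segment 1 2"
      unfolding S_def by (metis closed_segment_of_real of_real_1 of_real_numeral)
    then show ?thesis
      using that by (auto simp: closed_segment_eq_real_ivl)
  qed
  define f where "f = (\<lambda>i z. (\<Prod>j<i. a - of_nat j) * z powr (a - of_nat i))"
  define B where "B = (norm a + real m) ^ Suc m * 2 powr (norm a + real m + 1)"
  define w where "w = (1 / of_nat N :: complex)"
  have w: "1 + w \<in> S"
  proof -
    have "1 + w = of_real (1 + 1 / real N)"
      by (simp add: w_def)
    also have "\<dots> \<in> S"
      using N by (intro SI) (auto simp: field_simps)
    finally show ?thesis .
  qed
  have "norm (f 0 (1 + w) - (\<Sum>i\<le>m. f i 1 * ((1 + w) - 1) ^ i / fact i))
          \<le> B * norm ((1 + w) - 1) ^ Suc m / fact m"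
  proof (rule complex_Taylor[where S = S])
    show "convex S"
      by (simp add: S_def)
    show "(f i has_field_derivative f (Suc i) z) (at z within S)" if zS: "z \<in> S" and "i \<le> m" for i z
    proof -
      obtain t where t: "z = of_real t" "1 \<le> t"
        using SD[OF zS] by blast
      then have z: "z \<notin> \<real>\<^sub>\<le>\<^sub>0"
        by auto
      have "(f i has_field_derivative
              (\<Prod>j<i. a - of_nat j) * ((a - of_nat i) * z powr (a - of_nat i - 1))) (at z)"
        unfolding f_def by (intro DERIV_cmult has_field_derivative_powr z)
      also have "(\<Prod>j<i. a - of_nat j) * ((a - of_nat i) * z powr (a - of_nat i - 1)) = f (Suc i) z"
        by (simp add: f_def algebra_simps)
      finally show ?thesis
        by (rule has_field_derivative_at_within)
    qed
    show "norm (f (Suc m) z) \<le> B" if zS: "z \<in> S" for z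
    proof -
      obtain t where t: "z = of_real t" "1 \<le> t" "t \<le> 2"
        using SD[OF zS] by blast
      have 1: "norm (\<Prod>j<Suc m. a - of_nat j) \<le> (norm a + real m) ^ Suc m"
      proof -
        have "norm (\<Prod>j<Suc m. a - of_nat j) = (\<Prod>j<Suc m. norm (a - of_nat j))"
          by (rule prod_norm[symmetric])
        also have "\<dots> \<le> (\<Prod>j<Suc m. norm a + real m)"
        proof (intro prod_mono conjI norm_ge_zero)
          fix j assume "j \<in> {..<Suc m}"
          then show "norm (a - of_nat j) \<le> norm a + real m"
            using norm_triangle_ineq4[of a "of_nat j"] by simp
        qed
        finally show ?thesis by simp
      qed
      have "norm (z powr (a - of_nat (Suc m))) = t powr Re (a - of_nat (Suc m))"
        using t by (subst norm_powr_real_powr) auto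
      also have "\<dots> \<le> t powr (norm a + real m + 1)"
        using t complex_Re_le_cmod[of a] by (intro powr_mono) auto
      also have "\<dots> \<le> 2 powr (norm a + real m + 1)"
        using t by (intro powr_mono2) auto
      finally have 2: "norm (z powr (a - of_nat (Suc m))) \<le> 2 powr (norm a + real m + 1)" .
      show ?thesis
        unfolding f_def B_def norm_mult by (intro mult_mono 1 2) auto
    qed
    show "1 \<in> S"
      by (simp add: S_def)
    show "1 + w \<in> S" by (fact w)
  qed
  moreover have "f i 1 * ((1 + w) - 1) ^ i / fact i = (a gchoose i) * w ^ i" for i
    by (simp add: f_def gbinomial_prod_rev atLeast0LessThan)
  moreover have "f 0 (1 + w) = (1 + w) powr a"
    by (simp add: f_def)
  moreover have "B * norm ((1 + w) - 1) ^ Suc m / fact m \<le> B * (1 / real N) ^ Suc m"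
  proof -
    have nn: "0 \<le> B * (1 / real N) ^ Suc m"
      by (simp add: B_def)
    have "B * norm ((1 + w) - 1) ^ Suc m / fact m = B * (1 / real N) ^ Suc m / fact m"
      by (simp add: w_def norm_divide)
    also have "\<dots> \<le> B * (1 / real N) ^ Suc m / 1"
      using nn by (intro divide_left_mono) auto
    finally show ?thesis by simp
  qed
  ultimately show ?thesis
    by (simp add: w_def B_def)
qed

lemma zeta_rem_bound:
  assumes R: "norm s \<le> R"
  shows "norm (zeta_rem m (Suc n) s) \<le>
           ((R + 1 + real m) ^ Suc m * 2 powr (R + 1 + real m + 1)) *
             of_nat (Suc n) powr ((1 - real m) - Re s - 1)"
proof -
  define N where "N = Suc n"
  define a where "a = 1 - s"
  have N: "N > 0" by (simp add: N_def)
  have a: "norm a \<le> R + 1"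
    using norm_triangle_ineq4[of 1 s] R by (simp add: a_def)
  have "(of_nat N + 1 :: complex) = of_nat N * (1 + 1 / of_nat N)"
    using N by (simp add: field_simps)
  then have "(of_nat N + 1 :: complex) powr a = of_nat N powr a * (1 + 1 / of_nat N) powr a"
    using powr_times_real_left[of "of_nat N" "1 + 1 / of_nat N" a] by simp
  moreover have "of_nat N powr (a - of_nat i) = of_nat N powr a * (1 / of_nat N) ^ i" for i
    using N by (simp add: powr_diff powr_nat' power_one_over divide_simps)
  ultimately have eq: "zeta_rem m N s = of_nat N powr a *
      ((1 + 1 / of_nat N) powr a - (\<Sum>i\<le>m. (a gchoose i) * (1 / of_nat N) ^ i))"
    by (simp add: zeta_rem_def a_def[symmetric] algebra_simps sum_distrib_left)
  have "norm (zeta_rem m N s) \<le> real N powr (1 - Re s) *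
     ((norm a + real m) ^ Suc m * 2 powr (norm a + real m + 1) * (1 / real N) ^ Suc m)"
    unfolding eq norm_mult
    by (intro mult_mono powr_Taylor_bound N)
       (auto simp: norm_powr_real_powr a_def)
  also have "\<dots> \<le> real N powr (1 - Re s) *
     ((R + 1 + real m) ^ Suc m * 2 powr (R + 1 + real m + 1) * (1 / real N) ^ Suc m)"
  proof (intro mult_left_mono mult_right_mono mult_mono power_mono powr_mono)
    have "0 \<le> R + 1"
      using a norm_ge_zero[of a] by linarith
    then show "0 \<le> (R + 1 + real m) ^ Suc m"
      by (intro zero_le_power) auto
  qed (use a in auto)
  also have "(1 / real N) ^ Suc m = real N powr (- real (Suc m))"
    using N by (simp add: powr_minus powr_realpow power_one_over inverse_eq_divide del: power_Suc of_nat_Suc)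
  also have "real N powr (1 - Re s) *
     ((R + 1 + real m) ^ Suc m * 2 powr (R + 1 + real m + 1) * real N powr (- real (Suc m))) =
     ((R + 1 + real m) ^ Suc m * 2 powr (R + 1 + real m + 1)) *
     (real N powr (1 - Re s) * real N powr (- real (Suc m)))"
    by (simp only: mult_ac)
  also have "real N powr (1 - Re s) * real N powr (- real (Suc m)) =
             real N powr ((1 - real m) - Re s - 1)"
    by (subst powr_add[symmetric]) (simp add: algebra_simps)
  finally show ?thesis
    by (simp add: N_def)
qed

lemma zeta_rem_suminf:
  shows "(\<lambda>s. \<Sum>n. zeta_rem m (Suc n) s) holomorphic_on {s. Re s > 1 - real m}"
    and "Re s > 1 - real m \<Longrightarrow> summable (\<lambda>n. zeta_rem m (Suc n) s)"
proof -
  have hol: "zeta_rem m (Suc n) holomorphic_on {s. Re s > 1 - real m}" for n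
    unfolding zeta_rem_def gbinomial_prod_rev by (auto intro!: holomorphic_intros)
  have bound: "\<exists>C\<ge>0. \<forall>n s. norm s \<le> R \<longrightarrow> Re s > 1 - real m \<longrightarrow>
      norm (zeta_rem m (Suc n) s) \<le> C * of_nat (Suc n) powr ((1 - real m) - Re s - 1)" for R
  proof (cases "R \<ge> 0")
    case True
    then show ?thesis
      using zeta_rem_bound[of _ R m]
      by (intro exI[of _ "(R + 1 + real m) ^ Suc m * 2 powr (R + 1 + real m + 1)"]) auto
  next
    case False
    have "norm s > R" for s :: complex
      using False norm_ge_zero[of s] by linarith
    then show ?thesis
      by (intro exI[of _ 0]) (auto simp: not_le[symmetric])
  qed
  show "(\<lambda>s. \<Sum>n. zeta_rem m (Suc n) s) holomorphic_on {s. Re s > 1 - real m}"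
    using hol bound by (rule holomorphic_suminf_halfplane(1))
  show "summable (\<lambda>n. zeta_rem m (Suc n) s)" if "Re s > 1 - real m"
    using hol bound that by (rule holomorphic_suminf_halfplane(2))
qed

lemma dirichlet_suminf:
  shows "(\<lambda>s. \<Sum>n. of_nat (Suc n) powr (- s)) holomorphic_on {s :: complex. Re s > 1}"
    and "Re (s :: complex) > 1 \<Longrightarrow> summable (\<lambda>n. of_nat (Suc n) powr (- s))"
proof -
  have hol: "(\<lambda>s. of_nat (Suc n) powr (- s)) holomorphic_on {s :: complex. Re s > 1}" for n
    by (auto intro!: holomorphic_intros)
  have bound: "\<exists>C\<ge>0. \<forall>n s. norm s \<le> R \<longrightarrow> Re s > 1 \<longrightarrow>
      norm (of_nat (Suc n) powr (- s)) \<le> C * of_nat (Suc n) powr (1 - Re s - 1)" for R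
    by (intro exI[of _ 1]) (auto simp: norm_powr_real_powr simp del: of_nat_Suc)
  show "(\<lambda>s. \<Sum>n. of_nat (Suc n) powr (- s)) holomorphic_on {s :: complex. Re s > 1}"
    using hol bound by (rule holomorphic_suminf_halfplane(1))
  show "summable (\<lambda>n. of_nat (Suc n) powr (- s))" if "Re s > 1"
    using hol bound that by (rule holomorphic_suminf_halfplane(2))
qed

lemma zeta_recurrence:
  fixes s :: complex
  assumes s: "Re s > 1"
  defines "D \<equiv> \<lambda>s. \<Sum>n. of_nat (Suc n) powr (- s) :: complex"
  shows "(s - 1) * D s = 1 + (\<Sum>i=2..Suc m. ((1 - s) gchoose i) * D (s + of_nat (i - 1)))
           + (\<Sum>n. zeta_rem (Suc m) (Suc n) s)"
proof -
  have D: "(\<lambda>n. of_nat (Suc n) powr (- s')) sums D s'" if "Re s' > 1" for s'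
    unfolding D_def by (intro summable_sums dirichlet_suminf that)
  have tel: "(\<lambda>n. of_nat (Suc (Suc n)) powr (1 - s) - of_nat (Suc n) powr (1 - s)) sums (-1 :: complex)"
  proof -
    have "(\<lambda>n. of_nat n powr (1 - s)) \<longlonglongrightarrow> 0"
    proof (rule tendsto_norm_zero_cancel)
      have "(\<lambda>n. real n powr (1 - Re s)) \<longlonglongrightarrow> 0"
        using s by (intro tendsto_neg_powr filterlim_real_sequentially) auto
      then show "(\<lambda>n. norm (of_nat n powr (1 - s))) \<longlonglongrightarrow> 0"
        by (simp add: norm_powr_real_powr)
    qed
    then have "(\<lambda>n. of_nat (Suc n) powr (1 - s)) \<longlonglongrightarrow> 0"
      by (rule LIMSEQ_Suc)
    from telescope_sums[OF this] show ?thesis by simp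
  qed
  have rem: "(\<lambda>n. zeta_rem (Suc m) (Suc n) s) sums (\<Sum>n. zeta_rem (Suc m) (Suc n) s)"
    using s by (intro summable_sums zeta_rem_suminf) auto
  have main: "(\<lambda>n. \<Sum>i=1..Suc m. ((1 - s) gchoose i) * of_nat (Suc n) powr (- (s + of_nat (i - 1))))
          sums (\<Sum>i=1..Suc m. ((1 - s) gchoose i) * D (s + of_nat (i - 1)))"
    using s by (intro sums_sum sums_mult D) auto
  have eq: "(\<Sum>i=1..Suc m. ((1 - s) gchoose i) * of_nat (Suc n) powr (- (s + of_nat (i - 1)))) +
            zeta_rem (Suc m) (Suc n) s =
            of_nat (Suc (Suc n)) powr (1 - s) - of_nat (Suc n) powr (1 - s)" for n
  proof -
    have "(\<Sum>i\<le>Suc m. ((1 - s) gchoose i) * of_nat (Suc n) powr (1 - s - of_nat i)) =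
          of_nat (Suc n) powr (1 - s) +
          (\<Sum>i=1..Suc m. ((1 - s) gchoose i) * of_nat (Suc n) powr (1 - s - of_nat i))"
      by (simp add: atMost_atLeast0 sum.atLeast_Suc_atMost del: sum.cl_ivl_Suc)
    moreover have "(\<Sum>i=1..Suc m. ((1 - s) gchoose i) * of_nat (Suc n) powr (1 - s - of_nat i)) =
        (\<Sum>i=1..Suc m. ((1 - s) gchoose i) * of_nat (Suc n) powr (- (s + of_nat (i - 1))))"
      by (intro sum.cong refl) (auto simp: of_nat_diff algebra_simps)
    moreover have "of_nat (Suc n) + 1 = (of_nat (Suc (Suc n)) :: complex)"
      by simp
    ultimately show ?thesis
      unfolding zeta_rem_def by (simp only: algebra_simps)
  qed
  have "(\<Sum>i=1..Suc m. ((1 - s) gchoose i) * D (s + of_nat (i - 1)))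
          + (\<Sum>n. zeta_rem (Suc m) (Suc n) s) = -1"
    using sums_add[OF main rem] tel unfolding eq by (rule sums_unique2)
  moreover have "(\<Sum>i=1..Suc m. ((1 - s) gchoose i) * D (s + of_nat (i - 1))) =
      (1 - s) * D s + (\<Sum>i=2..Suc m. ((1 - s) gchoose i) * D (s + of_nat (i - 1)))"
    by (subst sum.atLeast_Suc_atMost) (auto simp: numeral_2_eq_2)
  ultimately have "(1 - s) * D s + (\<Sum>i=2..Suc m. ((1 - s) gchoose i) * D (s + of_nat (i - 1)))
          + (\<Sum>n. zeta_rem (Suc m) (Suc n) s) = -1"
    by simp
  then show ?thesis
    by (simp add: algebra_simps add_eq_0_iff eq_neg_iff_add_eq_0)
qed

lemma zeta_continuation_step:
  fixes m :: nat
  defines "D \<equiv> \<lambda>s. \<Sum>n. of_nat (Suc n) powr (- s) :: complex"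
  shows "\<exists>g. g holomorphic_on {s. Re s > 1 - real m} \<and> (\<forall>s. Re s > 1 \<longrightarrow> g s = (s - 1) * D s)"
proof (induction m)
  case 0
  show ?case
    unfolding D_def
    by (intro exI[of _ "\<lambda>s. (s - 1) * (\<Sum>n. of_nat (Suc n) powr (- s))"] conjI)
       (use dirichlet_suminf(1) in \<open>auto intro!: holomorphic_intros\<close>)
next
  case (Suc m)
  then obtain g where g: "g holomorphic_on {s. Re s > 1 - real m}"
      "\<And>s. Re s > 1 \<Longrightarrow> g s = (s - 1) * D s"
    by blast
  define g' where "g' = (\<lambda>s.
    1 + (\<Sum>i=2..Suc m. - ((1 - s) gchoose (i - 1)) / of_nat i * g (s + of_nat (i - 1)))
      + (\<Sum>n. zeta_rem (Suc m) (Suc n) s))"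
  have shift: "(\<lambda>s. g (s + of_nat (i - 1))) holomorphic_on {s. Re s > 1 - real (Suc m)}"
    if "i \<in> {2..Suc m}" for i
    by (rule holomorphic_on_compose_gen[OF _ g(1), unfolded o_def])
       (use that in \<open>auto intro!: holomorphic_intros\<close>)
  have "g' holomorphic_on {s. Re s > 1 - real (Suc m)}"
    unfolding g'_def gbinomial_prod_rev
    by (intro holomorphic_intros zeta_rem_suminf(1) shift) auto
  moreover have "g' s = (s - 1) * D s" if s: "Re s > 1" for s
  proof -
    have "- ((1 - s) gchoose (i - 1)) / of_nat i * g (s + of_nat (i - 1)) =
          ((1 - s) gchoose i) * D (s + of_nat (i - 1))" if "i \<in> {2..Suc m}" for i
    proof -
      obtain j where j: "i = Suc j" "j \<ge> 1"
        using \<open>i \<in> _\<close> by (cases i) auto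
      have g_eq: "g (s + of_nat j) = (s + of_nat j - 1) * D (s + of_nat j)"
        using s by (intro g(2)) auto
      have absorb: "of_nat (Suc j) * ((1 - s) gchoose Suc j) = (1 - s - of_nat j) * ((1 - s) gchoose j)"
        by (simp only: gbinomial_absorption gbinomial_absorb_comp)
      have "- ((1 - s) gchoose j) * g (s + of_nat j) =
            (1 - s - of_nat j) * ((1 - s) gchoose j) * D (s + of_nat j)"
        unfolding g_eq by (simp add: algebra_simps)
      also have "\<dots> = of_nat (Suc j) * (((1 - s) gchoose Suc j) * D (s + of_nat j))"
        unfolding absorb[symmetric] by (rule mult.assoc)
      finally have "- ((1 - s) gchoose j) * g (s + of_nat j) / of_nat (Suc j) =
                      ((1 - s) gchoose Suc j) * D (s + of_nat j)"
        by (simp del: of_nat_Suc)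
      then show ?thesis
        unfolding j by (simp del: of_nat_Suc)
    qed
    then have "g' s = 1 + (\<Sum>i=2..Suc m. ((1 - s) gchoose i) * D (s + of_nat (i - 1)))
                  + (\<Sum>n. zeta_rem (Suc m) (Suc n) s)"
      unfolding g'_def by (intro arg_cong2[of _ _ _ _ "(+)"] sum.cong refl) auto
    also have "\<dots> = (s - 1) * D s"
      using zeta_recurrence[OF s, of m] by (simp add: D_def)
    finally show ?thesis .
  qed
  ultimately show ?case by blast
qed

lemma is_zeta_exists: "\<exists>f. is_zeta f"
proof -
  define D where "D = (\<lambda>s. \<Sum>n. of_nat (Suc n) powr (- s) :: complex)"
  obtain G where G: "\<And>m. G m holomorphic_on {s. Re s > 1 - real m}"
      "\<And>m s. Re s > 1 \<Longrightarrow> G m s = (s - 1) * D s"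
    using zeta_continuation_step unfolding D_def by metis
  have agree: "G m s = G m' s" if le: "m \<le> m'" and s: "Re s > 1 - real m" for m m' s
  proof (rule analytic_continuation_open[where s = "{s. Re s > 1}" and s' = "{s. Re s > 1 - real m}"
          and f = "G m" and g = "G m'"])
    show "{s. Re s > 1} \<noteq> {}"
      by (auto intro!: exI[of _ "2 :: complex"])
    show "connected {s. Re s > 1 - real m}"
      by (intro convex_connected convex_halfspace_Re_gt)
    show "G m' holomorphic_on {s. Re s > 1 - real m}"
      by (rule holomorphic_on_subset[OF G(1)]) (use le in auto)
    show "G m z = G m' z" if "z \<in> {s. Re s > 1}" for z
      using that by (simp only: mem_Collect_eq G(2))
    show "G m holomorphic_on {s. Re s > 1 - real m}"
      by (rule G(1))
  qed (use s in \<open>auto simp: open_halfspace_Re_gt\<close>)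
  define M where "M = (\<lambda>s. nat \<lceil>2 - Re s\<rceil>)"
  have M: "Re s > 1 - real (M s)" for s
    unfolding M_def by linarith
  define g where "g = (\<lambda>s. G (M s) s)"
  have g_eq: "g s = G m s" if s: "Re s > 1 - real m" for s m
  proof (cases "m \<le> M s")
    case True
    show ?thesis
      unfolding g_def by (rule agree[OF True s, symmetric])
  next
    case False
    then have "M s \<le> m"
      by simp
    then show ?thesis
      unfolding g_def by (rule agree[OF _ M])
  qed
  have "g holomorphic_on (\<Union>m. {s. Re s > 1 - real m})"
  proof (rule holomorphic_on_UN_open)
    show "g holomorphic_on {s. Re s > 1 - real m}" for m
    proof (rule holomorphic_transform[OF G(1)])
      fix s assume "s \<in> {s. Re s > 1 - real m}"
      then show "G m s = g s"
        by (intro g_eq[symmetric]) simp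
    qed
  qed (auto simp: open_halfspace_Re_gt)
  also have "(\<Union>m. {s. Re s > 1 - real m}) = UNIV"
    using M by auto
  finally have g: "g holomorphic_on UNIV" .
  define f where "f = (\<lambda>s. if s = 1 then 0 else g s / (s - 1))"
  have "(\<lambda>s. g s / (s - 1)) holomorphic_on (- {1})"
    using holomorphic_on_subset[OF g] by (auto intro!: holomorphic_intros)
  then have "f holomorphic_on (- {1})"
    by (rule holomorphic_transform) (auto simp: f_def)
  moreover have "(\<lambda>n. of_nat (Suc n) powr (- s)) sums f s" if s: "Re s > 1" for s
  proof -
    have "f s = D s"
      using s g_eq[of 0 s] G(2)[of s 0] by (auto simp: f_def)
    then show ?thesis
      using summable_sums[OF dirichlet_suminf(2)[OF s]] by (simp add: D_def)
  qed
  ultimately have "is_zeta f"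
    by (auto simp: is_zeta_def f_def)
  then show ?thesis by blast
qed

theorem is_zeta_ex1: "\<exists>!f. is_zeta f"
  using is_zeta_exists is_zeta_unique by blast

lemma is_zeta_zeta: "is_zeta zeta"
  unfolding zeta_def by (rule theI'[OF is_zeta_ex1])


section \<open>Hardy's function and Jacob's ladders\<close>

text \<open>
  \<open>ln_Gamma\<close> is the branch of $\ln \Gamma$ that is analytic off the nonpositive real axis and real on the
  positive reals, so this is the usual continuous Riemann-Siegel theta function with \<open>\<theta>(0) = 0\<close>.
\<close>

definition hardy_theta :: "real \<Rightarrow> real" where
  "hardy_theta t = - t / 2 * ln pi + Im (ln_Gamma (Complex (1/4) (t/2)))"

definition hardy_Z :: "real \<Rightarrow> complex" where
  "hardy_Z t = exp (\<i> * of_real (hardy_theta t)) * zeta (Complex (1/2) t)"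

text \<open>
  The functions \<open>\<mu>\<close> with which the ladder equation is formed.  Monotonicity of \<open>\<mu>\<close>, together
  with $Z^2 \ge 0$, makes the left-hand side of the equation increasing in \<open>x(T)\<close>;
  divergence of \<open>\<mu>\<close> to infinity follows from the lower bound.
\<close>

definition ladder_admissible :: "real \<Rightarrow> (real \<Rightarrow> real) \<Rightarrow> bool" where
  "ladder_admissible y0 \<mu> \<longleftrightarrow>
     y0 > 0 \<and> continuous_on {y0..} \<mu> \<and> mono_on {y0..} \<mu> \<and> (\<forall>y\<ge>y0. \<mu> y \<ge> 7 * y * ln y)"

text \<open>
  \<open>x\<close> solves the integral equation for all \<open>T \<ge> T0\<close>, with values in the domain \<open>[y0, \<infinity>)\<close> of \<open>\<mu>\<close>.
  Hardy's function takes real values; the integrals are taken in the complex numbers only because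
  that fact is not built into the type of \<open>hardy_Z\<close>.
\<close>

definition solves_ladder_equation ::
  "real \<Rightarrow> (real \<Rightarrow> real) \<Rightarrow> real \<Rightarrow> (real \<Rightarrow> real) \<Rightarrow> bool" where
  "solves_ladder_equation y0 \<mu> T0 x \<longleftrightarrow>
     (\<forall>T\<ge>T0. x T \<ge> y0 \<and>
        integral {0..\<mu> (x T)} (\<lambda>t. (hardy_Z t)\<^sup>2 * of_real (exp (- (2 / x T) * t))) =
        integral {0..T} (\<lambda>t. (hardy_Z t)\<^sup>2))"

definition jacobs_ladder :: "real \<Rightarrow> (real \<Rightarrow> real) \<Rightarrow> bool" where
  "jacobs_ladder T0 \<phi>1 \<longleftrightarrow> T0 > 0 \<and>
     (\<exists>y0 \<mu> \<phi>. ladder_admissible y0 \<mu> \<and> solves_ladder_equation y0 \<mu> T0 \<phi> \<and>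
               (\<forall>T\<ge>T0. \<phi>1 T = \<phi> T / 2))"

text \<open>
  The inverse of \<open>\<phi>1\<close> restricted to \<open>[T0, \<infinity>)\<close>, where \<open>\<phi>1\<close> is increasing; it is
  meaningful for arguments \<open>Y \<ge> \<phi>1 T0\<close>, hence for all large \<open>Y\<close>.
\<close>

definition ladder_inv :: "real \<Rightarrow> (real \<Rightarrow> real) \<Rightarrow> real \<Rightarrow> real" where
  "ladder_inv T0 \<phi>1 = inv_into {T0..} \<phi>1"

end

theory Submission
  imports Defs "HOL-Probability.Probability" "HOL-Real_Asymp.Real_Asymp"
begin

text \<open>
  The limit always exists and equals $r = (x^n + y^n) / z^n$, so both statements say that \<open>r\<close> is
  never \<open>1\<close>.

  The main input is $I(T) = \int_0^T |\zeta(1/2 + it)|^2 dt = T \ln (T / 2\pi) + (2c - 1) T + o(T)$.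
  By the functional equation, contour shifts express the Laplace transform of $|\zeta(1/2 + it)|^2$ at
  complex \<open>z\<close> through the Lambert series $\sum d(n) e^{-2 \pi i n e^{-iz}}$, which is compared with the
  transform of the density $\ln (t / 2\pi) + 2c$; smoothing with Gaussians, whose Fourier transforms
  sample the two transforms on a vertical line, recovers \<open>I\<close>.

  The ladder equation for $T = \varphi_1^{-1}(Y)$ reads $I(T) = \int_0^{\mu(2Y)} |\zeta(1/2 + it)|^2 e^{-t/Y} dt$, and
  the right-hand side is $Y \ln (Y / 2\pi) + c Y + o(Y)$.  Hence $I(T) - I(Y) \sim (1 - c) Y$ and
  $T \sim Y$, while $|\zeta(\sigma + it)|^2$ contributes only \<open>o(Y)\<close> over an interval of length \<open>o(Y)\<close>.
  Iterating \<open>k\<close> times multiplies the increment of \<open>I\<close> by \<open>k\<close>.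
\<close>

section \<open>The zeta-function to the right of \<open>Re s = -1\<close>\<close>

text \<open>The increment \<open>(1 - c) Y\<close> is of lower order than the quantities whose
  difference it is: the terms \<open>Y ln Y\<close> cancel and the linear terms decide. The mean
  square has linear constant \<open>2 c - 1\<close>, while averaging the density
  \<open>ln (t / 2 pi) + 2 c\<close> under the exponential weight of mean \<open>Y\<close> adds
  Gamma'(1) = - c and gives \<open>c\<close>; the gap is \<open>1 - c\<close>. Hence the mean square
  is needed up to \<open>o(T)\<close>, whereas the behaviour of its Laplace transform at real points
  alone would give, by a Tauberian theorem of Karamata type, only the leading term. This forces
  complex \<open>z\<close> and an error bound along whole vertical lines, of the form
  \<open>C |z|^2 x^(-5/2)\<close> with \<open>x = Re z\<close>. The growth in \<open>|z|\<close> is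
  harmless under a Gaussian, and the loss in \<open>x\<close> still leaves room between the width of
  the Gaussian and \<open>T\<close>. For \<open>|zeta(sigma + it)|^2\<close> a convexity argument
  with a free scale \<open>X\<close> transfers information from the critical line, where the ladder
  equation fixes the mass of the window.\<close>

lemma zeta_holomorphic: "1 \<notin> A \<Longrightarrow> zeta holomorphic_on A"
  using is_zeta_zeta by (auto simp: is_zeta_def intro: holomorphic_on_subset)

lemma zeta_sums: "Re s > 1 \<Longrightarrow> (\<lambda>n. of_nat (Suc n) powr (- s)) sums zeta s"
  using is_zeta_zeta by (auto simp: is_zeta_def)

lemma zeta_continuous_on:
  assumes "continuous_on A f" "\<And>x. x \<in> A \<Longrightarrow> f x \<noteq> 1"
  shows "continuous_on A (\<lambda>x. zeta (f x))"
proof -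
  have "continuous_on (- {1}) zeta"
    by (intro holomorphic_on_imp_continuous_on zeta_holomorphic) auto
  then show ?thesis
    using assms by (intro continuous_on_compose2[of "- {1}" zeta A f]) auto
qed

text \<open>By uniqueness of the continuation: \<open>\<lambda>s. cnj (zeta (cnj s))\<close> is
  again holomorphic off 1, has the same Dirichlet series because the coefficients are real, and
  takes the same value 0 at the pole.\<close>

lemma cnj_zeta: "cnj (zeta s) = zeta (cnj s)"
proof -
  have "is_zeta (\<lambda>s. cnj (zeta (cnj s)))"
    unfolding is_zeta_def
  proof (intro conjI allI impI)
    have "zeta holomorphic_on (- {1})"
      by (intro zeta_holomorphic) auto
    moreover have img: "cnj ` (- {1}) = - {1 :: complex}"
    proof (intro equalityI subsetI)
      fix x :: complex assume "x \<in> - {1}"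
      then show "x \<in> cnj ` (- {1})"
        by (intro image_eqI[of x cnj "cnj x"]) (auto dest: arg_cong[of _ _ cnj])
    qed auto
    ultimately have "(cnj \<circ> zeta \<circ> cnj) holomorphic_on - {1}"
      by (intro holomorphic_on_compose_cnj_cnj) (auto simp: open_Compl)
    then show "(\<lambda>s. cnj (zeta (cnj s))) holomorphic_on (- {1})"
      by (simp add: o_def)
  next
    fix s :: complex
    assume "Re s > 1"
    then have "(\<lambda>n. cnj (of_nat (Suc n) powr (- cnj s))) sums cnj (zeta (cnj s))"
      by (subst sums_cnj) (intro zeta_sums, simp)
    moreover have "cnj (of_nat (Suc n) powr (- cnj s)) = of_nat (Suc n) powr (- s)" for n
      by (simp add: cnj_powr)
    ultimately show "(\<lambda>n. of_nat (Suc n) powr (- s)) sums cnj (zeta (cnj s))"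
      by simp
  next
    show "cnj (zeta (cnj 1)) = 0"
      using is_zeta_zeta by (simp add: is_zeta_def)
  qed
  then have "(\<lambda>s. cnj (zeta (cnj s))) = zeta"
    by (rule is_zeta_unique[OF _ is_zeta_zeta])
  then show ?thesis
    by (metis complex_cnj_cnj)
qed

section \<open>Real arguments beyond 1 and growth up to the critical line\<close>

lemma zeta_real_sums:
  assumes "x > 1"
  shows "(\<lambda>n. real (Suc n) powr (- x)) sums Re (zeta (of_real x))"
proof -
  have "(\<lambda>n. Re (of_nat (Suc n) powr (- of_real x))) sums Re (zeta (of_real x))"
    using assms by (intro sums_Re zeta_sums) auto
  moreover have "Re (of_nat (Suc n) powr (- of_real x)) = real (Suc n) powr (- x)" for n
    using powr_of_real[of "real (Suc n)" "- x"] by (simp del: of_nat_Suc)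
  ultimately show ?thesis by simp
qed

lemma zeta_real_pos:
  assumes "x > 1"
  shows "Re (zeta (of_real x)) > 0"
proof -
  have "0 < (\<Sum>n. real (Suc n) powr (- x))"
    using zeta_real_sums[OF assms] by (intro suminf_pos sums_summable) auto
  then show ?thesis
    using zeta_real_sums[OF assms] by (simp add: sums_iff)
qed

text \<open>For \<open>m = 0\<close> the identity \<open>zeta_recurrence\<close> contains no shifted
  zeta values, and its remainder series converges for \<open>Re s > 0\<close>, so it extends there
  by continuation. It is the source of the growth bound up to the critical line.\<close>

lemma zeta_eq_suminf_rem:
  assumes "Re s > 0" "s \<noteq> 1"
  shows "(s - 1) * zeta s = 1 + (\<Sum>n. zeta_rem 1 (Suc n) s)"
proof (rule analytic_continuation_open[where s = "{s. Re s > 1}" and s' = "{s. Re s > 0} - {1}"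
          and f = "\<lambda>s. (s - 1) * zeta s" and g = "\<lambda>s. 1 + (\<Sum>n. zeta_rem 1 (Suc n) s)"])
  show "{s. Re s > 1} \<noteq> {}"
    by (auto intro!: exI[of _ "2 :: complex"])
  show "connected ({s. Re s > 0} - {1})"
    by (intro connected_open_delete convex_connected convex_halfspace_Re_gt open_halfspace_Re_gt) auto
  show "(\<lambda>s. (s - 1) * zeta s) holomorphic_on {s. Re s > 0} - {1}"
    by (intro holomorphic_intros zeta_holomorphic) auto
  show "(\<lambda>s. 1 + (\<Sum>n. zeta_rem 1 (Suc n) s)) holomorphic_on {s. Re s > 0} - {1}"
    using zeta_rem_suminf(1)[of 1] by (intro holomorphic_intros) (auto elim: holomorphic_on_subset)
  show "(z - 1) * zeta z = 1 + (\<Sum>n. zeta_rem 1 (Suc n) z)" if "z \<in> {s. Re s > 1}" for z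
    using zeta_recurrence[of z 0] zeta_sums[of z] that by (simp add: sums_iff)
qed (use assms in \<open>auto simp: open_halfspace_Re_gt open_delete\<close>)

text \<open>The constant in \<open>zeta_rem_bound\<close> is exponential in \<open>norm s\<close>.
  Expanding \<open>z powr (1 - s)\<close> directly from \<open>N\<close> to \<open>N + 1\<close>
  leaves its second derivative, whose coefficient \<open>(1 - s) * (- s)\<close> is only quadratic
  in \<open>s\<close>; the modulus of the power decreases along the segment because
  \<open>Re s \<ge> 0\<close>.\<close>

lemma zeta_rem_1_bound:
  assumes N: "N > 0" and s: "Re s \<ge> 0"
  shows "norm (zeta_rem 1 N s) \<le> norm (1 - s) * norm s * real N powr (- Re s - 1)"
proof -
  define S where "S = closed_segment (of_nat N :: complex) (of_nat N + 1)"
  have S: "\<exists>t. z = of_real t \<and> real N \<le> t" if "z \<in> S" for z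
  proof -
    have "S = of_real ` closed_segment (real N) (real N + 1)"
      unfolding S_def by (metis closed_segment_of_real of_real_1 of_real_add of_real_of_nat_eq)
    then show ?thesis
      using that by (auto simp: closed_segment_eq_real_ivl)
  qed
  define f :: "nat \<Rightarrow> complex \<Rightarrow> complex" where
    "f = (\<lambda>i z. (\<Prod>j<i. 1 - s - of_nat j) * z powr (1 - s - of_nat i))"
  define B where "B = norm (1 - s) * norm s * real N powr (- Re s - 1)"
  have "norm (f 0 (of_nat N + 1) - (\<Sum>i\<le>1. f i (of_nat N) * ((of_nat N + 1) - of_nat N) ^ i / fact i))
          \<le> B * norm ((of_nat N + 1) - of_nat N :: complex) ^ Suc 1 / fact 1"
  proof (rule complex_Taylor[where S = S])
    show "convex S" "of_nat N \<in> S" "of_nat N + 1 \<in> S"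
      by (simp_all add: S_def)
    show "(f i has_field_derivative f (Suc i) z) (at z within S)" if zS: "z \<in> S" and "i \<le> 1" for i z
    proof -
      obtain t where t: "z = of_real t" "real N \<le> t"
        using S[OF zS] by blast
      then have z: "z \<notin> \<real>\<^sub>\<le>\<^sub>0"
        using N by auto
      have "(f i has_field_derivative
              (\<Prod>j<i. 1 - s - of_nat j) * ((1 - s - of_nat i) * z powr (1 - s - of_nat i - 1))) (at z)"
        unfolding f_def by (intro DERIV_cmult has_field_derivative_powr z)
      also have "(\<Prod>j<i. 1 - s - of_nat j) * ((1 - s - of_nat i) * z powr (1 - s - of_nat i - 1)) = f (Suc i) z"
        by (simp add: f_def algebra_simps)
      finally show ?thesis
        by (rule has_field_derivative_at_within)
    qed
    show "norm (f (Suc 1) z) \<le> B" if zS: "z \<in> S" for z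
    proof -
      obtain t where t: "z = of_real t" "real N \<le> t"
        using S[OF zS] by blast
      have "norm (z powr (- s - 1)) = t powr (- Re s - 1)"
        using t N by (subst norm_powr_real_powr) auto
      also have "\<dots> \<le> real N powr (- Re s - 1)"
        using t N s by (intro powr_mono2') auto
      finally have "norm (z powr (- s - 1)) \<le> real N powr (- Re s - 1)" .
      then have "norm ((1 - s) * (- s)) * norm (z powr (- s - 1)) \<le> B"
        unfolding B_def by (simp add: norm_mult mult_left_mono)
      moreover have "f (Suc 1) z = (1 - s) * (- s) * z powr (- s - 1)"
        by (simp add: f_def numeral_2_eq_2 minus_diff_commute)
      ultimately show ?thesis
        by (simp only: norm_mult)
    qed
  qed
  then show ?thesis
    by (simp add: f_def B_def zeta_rem_def gbinomial_prod_rev algebra_simps)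
qed

text \<open>Divide \<open>zeta_eq_suminf_rem\<close> by \<open>s - 1\<close>: the quadratic
  remainder becomes linear in \<open>norm s\<close>. The summable exponent \<open>- 3/2\<close>
  comes from \<open>Re s \<ge> 1/2\<close>.\<close>

lemma zeta_half_plane_bound:
  obtains K where "K \<ge> 1" "\<And>s. Re s \<ge> 1/2 \<Longrightarrow> norm (s - 1) \<ge> 1/2 \<Longrightarrow> norm (zeta s) \<le> K * norm s"
proof -
  define S where "S = (\<Sum>n. real (Suc n) powr (- 3/2))"
  have sm: "summable (\<lambda>n. real (Suc n) powr (- 3/2))"
    using summable_real_powr_iff[of "- 3/2"] by (subst summable_Suc_iff) simp
  have S: "S \<ge> 0"
    unfolding S_def by (intro suminf_nonneg sm) auto
  have "norm (zeta s) \<le> (4 + S) * norm s" if s: "Re s \<ge> 1/2" "norm (s - 1) \<ge> 1/2" for s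
  proof -
    have ns: "norm s \<ge> 1/2"
      using s complex_Re_le_cmod[of s] by linarith
    have b: "norm (zeta_rem 1 (Suc n) s) \<le> norm (1 - s) * norm s * real (Suc n) powr (- 3/2)" for n
    proof -
      have "norm (zeta_rem 1 (Suc n) s) \<le> norm (1 - s) * norm s * real (Suc n) powr (- Re s - 1)"
        using s by (intro zeta_rem_1_bound) auto
      also have "\<dots> \<le> norm (1 - s) * norm s * real (Suc n) powr (- 3/2)"
        using s by (intro mult_left_mono powr_mono) auto
      finally show ?thesis .
    qed
    have "norm (\<Sum>n. zeta_rem 1 (Suc n) s) \<le> (\<Sum>n. norm (1 - s) * norm s * real (Suc n) powr (- 3/2))"
      using b by (intro norm_suminf_le summable_mult sm)
    also have "\<dots> = norm (1 - s) * norm s * S"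
      unfolding S_def by (intro suminf_mult sm)
    finally have 1: "norm ((s - 1) * zeta s) \<le> 1 + norm (1 - s) * norm s * S"
      using s by (subst zeta_eq_suminf_rem) (auto intro: order.trans[OF norm_triangle_ineq])
    have "norm (s - 1) * norm (zeta s) \<le> norm (s - 1) * (norm s * S) + norm (s - 1) * (4 * norm s)"
    proof -
      \<comment> \<open>Both moduli are at least \<open>1/2\<close>, so the summand 1 is absorbed at
        the cost of the constant 4.\<close>
      have "1 \<le> norm (s - 1) * (4 * norm s)"
        using mult_mono[of "1/2" "norm (s - 1)" 2 "4 * norm s"] s ns by simp
      then show ?thesis
        using 1 unfolding norm_mult norm_minus_commute[of 1 s] mult.assoc by linarith
    qed
    then have "norm (s - 1) * norm (zeta s) \<le> norm (s - 1) * ((4 + S) * norm s)"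
      by (simp add: algebra_simps)
    then show ?thesis
      using s by (subst (asm) mult_le_cancel_left_pos) auto
  qed
  then show thesis
    using S by (intro that[of "4 + S"]) auto
qed

text \<open>
  Trapezoidal Euler-Maclaurin summation. The error terms are combinations of binomial remainders,
  so their sum continues to \<open>Re s > -1\<close>.
\<close>

lemma zeta_LIMSEQ:
  assumes s: "Re s > -1" "s \<noteq> 1"
  shows "(\<lambda>N. (\<Sum>n=1..Suc N. of_nat n powr (-s)) - of_nat (Suc N) powr (-s) / 2 -
              of_nat (Suc N) powr (1 - s) / (1 - s)) \<longlonglongrightarrow> zeta s"
proof -
  \<comment> \<open>The \<open>N powr (- s - 1)\<close> terms of the two remainders cancel; what is
    left is the error of the trapezoidal rule for \<open>(1 - s) * t powr (- s)\<close> on a unit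
    interval.\<close>
  define e where "e = (\<lambda>n s. zeta_rem 2 (Suc n) s - (1 - s) / 2 * zeta_rem 1 (Suc n) (s + 1))"
  define E where "E = (\<lambda>s. (\<Sum>n. zeta_rem 2 (Suc n) s) - (1 - s) / 2 * (\<Sum>n. zeta_rem 1 (Suc n) (s + 1)))"
  have E: "(\<lambda>n. e n s) sums E s" if "Re s > -1" for s
    unfolding e_def E_def using zeta_rem_suminf(2)[of 2 s] zeta_rem_suminf(2)[of 1 "s + 1"] that
    by (intro sums_diff sums_mult summable_sums) auto
  have e: "e n s = of_nat (Suc (Suc n)) powr (1 - s) - of_nat (Suc n) powr (1 - s)
       - (1 - s) * (of_nat (Suc n) powr (-s) + of_nat (Suc (Suc n)) powr (-s)) / 2" for n s
  proof -
    have g2: "(1 - s) gchoose 2 = (1 - s) * (- s) / 2"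
      by (simp add: gbinomial_prod_rev numeral_2_eq_2)
    have eqs: "1 - s - 1 = - s" "1 - (s + 1) = - s" "1 - s - 2 = - s - 1"
      by (simp_all add: algebra_simps)
    show ?thesis
      unfolding e_def zeta_rem_def numeral_2_eq_2[symmetric]
      by (simp add: g2 eqs numeral_2_eq_2 sum.atMost_Suc[of _ 0] add_ac)
         (simp add: g2[unfolded numeral_2_eq_2] eqs[unfolded numeral_2_eq_2] field_simps)
  qed
  have partial: "(\<Sum>n<N. e n s) = of_nat (Suc N) powr (1 - s) - 1 - (1 - s) *
      ((\<Sum>n=1..Suc N. of_nat n powr (-s)) - 1 / 2 - of_nat (Suc N) powr (-s) / 2)" for N s
  proof (induction N)
    case (Suc N)
    have split: "(\<Sum>n=1..Suc (Suc N). of_nat n powr (-s)) =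
        (\<Sum>n=1..Suc N. of_nat n powr (-s)) + of_nat (Suc (Suc N)) powr (-s)"
      by simp
    show ?case
      unfolding sum.lessThan_Suc Suc.IH e[of N] split
      by algebra
  qed (simp add: field_simps)
  have partial': "(s - 1) * ((\<Sum>n=1..Suc N. of_nat n powr (-s)) - of_nat (Suc N) powr (-s) / 2 -
              of_nat (Suc N) powr (1 - s) / (1 - s)) = 1 + (\<Sum>n<N. e n s) + (s - 1) / 2"
    if "s \<noteq> 1" for N s
    unfolding partial using that by (simp add: divide_simps) (simp add: algebra_simps)
  \<comment> \<open>Both sides continue to \<open>Re s > -1\<close>. They agree where the Dirichlet
    series converges, because there the two boundary powers in \<open>partial'\<close> tend to
    0.\<close>
  have key: "(s - 1) * zeta s = 1 + E s + (s - 1) / 2" if "Re s > -1" "s \<noteq> 1" for s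
  proof (rule analytic_continuation_open[where s = "{s. Re s > 1}" and s' = "{s. Re s > -1} - {1}"
          and f = "\<lambda>s. (s - 1) * zeta s" and g = "\<lambda>s. 1 + E s + (s - 1) / 2"])
    show "{s. Re s > 1} \<noteq> {}"
      by (auto intro!: exI[of _ "2 :: complex"])
    show "connected ({s. Re s > -1} - {1})"
      by (intro connected_open_delete convex_connected convex_halfspace_Re_gt open_halfspace_Re_gt) auto
    show "(\<lambda>s. (s - 1) * zeta s) holomorphic_on {s. Re s > -1} - {1}"
      by (intro holomorphic_intros zeta_holomorphic) auto
    have "(\<lambda>s. \<Sum>n. zeta_rem 1 (Suc n) (s + 1)) holomorphic_on {s. Re s > -1}"
      by (rule holomorphic_on_compose_gen[OF _ zeta_rem_suminf(1)[of 1], unfolded o_def])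
         (auto intro!: holomorphic_intros)
    moreover have "(\<lambda>s. \<Sum>n. zeta_rem 2 (Suc n) s) holomorphic_on {s. Re s > -1}"
      using zeta_rem_suminf(1)[of 2] by simp
    ultimately have "E holomorphic_on {s. Re s > -1}"
      unfolding E_def by (intro holomorphic_intros) auto
    then show "(\<lambda>s. 1 + E s + (s - 1) / 2) holomorphic_on {s. Re s > -1} - {1}"
      by (intro holomorphic_intros) (auto elim: holomorphic_on_subset)
    show "(z - 1) * zeta z = 1 + E z + (z - 1) / 2" if "z \<in> {s. Re s > 1}" for z
    proof -
      have z: "Re z > 1" "z \<noteq> 1" using that by auto
      have t0: "(\<lambda>N. of_nat (Suc N) powr w) \<longlonglongrightarrow> 0" if "Re w < 0" for w :: complex
      proof (rule tendsto_norm_zero_cancel)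
        have "(\<lambda>n. real (Suc n) powr (Re w)) \<longlonglongrightarrow> 0"
          using that by (intro LIMSEQ_Suc tendsto_neg_powr filterlim_real_sequentially) auto
        then show "(\<lambda>n. norm (of_nat (Suc n) powr w)) \<longlonglongrightarrow> 0"
          by (simp add: norm_powr_real_powr del: of_nat_Suc)
      qed
      have "(\<lambda>N. \<Sum>n<N. of_nat (Suc n) powr (- z)) \<longlonglongrightarrow> zeta z"
        using zeta_sums[OF z(1)] by (simp add: sums_def)
      then have "(\<lambda>N. \<Sum>n<Suc N. of_nat (Suc n) powr (- z)) \<longlonglongrightarrow> zeta z"
        by (rule LIMSEQ_Suc)
      moreover have "(\<Sum>n<Suc N. of_nat (Suc n) powr (- z)) = (\<Sum>n=1..Suc N. of_nat n powr (-z))" for N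
        by (rule sum.reindex_bij_witness[of _ "\<lambda>n. n - 1" Suc]) auto
      ultimately have zl: "(\<lambda>N. \<Sum>n=1..Suc N. of_nat n powr (-z)) \<longlonglongrightarrow> zeta z"
        by simp
      have "(\<lambda>N. (z - 1) * ((\<Sum>n=1..Suc N. of_nat n powr (-z)) - of_nat (Suc N) powr (-z) / 2 -
              of_nat (Suc N) powr (1 - z) / (1 - z))) \<longlonglongrightarrow> (z - 1) * (zeta z - 0 / 2 - 0 / (1 - z))"
        using z by (intro tendsto_intros zl t0) auto
      moreover have "(\<lambda>N. 1 + (\<Sum>n<N. e n z) + (z - 1) / 2) \<longlonglongrightarrow> 1 + E z + (z - 1) / 2"
        using E[of z] z by (intro tendsto_intros) (auto simp: sums_def)
      ultimately show ?thesis
        unfolding partial'[OF z(2)] by (auto dest: LIMSEQ_unique)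
    qed
  qed (use that in \<open>auto simp: open_halfspace_Re_gt open_delete\<close>)
  have "(\<lambda>N. (1 + (\<Sum>n<N. e n s) + (s - 1) / 2) / (s - 1)) \<longlonglongrightarrow> (1 + E s + (s - 1) / 2) / (s - 1)"
    using E[of s] s by (intro tendsto_intros) (auto simp: sums_def)
  then show ?thesis
    using s unfolding partial'[OF s(2), symmetric] key[OF s, symmetric] by simp
qed

section \<open>The functional equation\<close>

text \<open>Differentiate the reflection formula for \<open>Gamma z * Gamma (1 - z)\<close>.
  Together with the series of \<open>Digamma\<close> it produces the partial fractions of the
  cotangent.\<close>

lemma Digamma_reflection:
  fixes z :: complex
  assumes "z \<notin> \<int>"
  shows "Digamma z - Digamma (1 - z) = - of_real pi * cos (of_real pi * z) / sin (of_real pi * z)"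
proof -
  have z: "z \<notin> \<int>\<^sub>\<le>\<^sub>0" "1 - z \<notin> \<int>\<^sub>\<le>\<^sub>0"
    using assms Ints_diff[of 1 "1 - z"] by (auto dest: nonpos_Ints_Int)
  have sin0: "sin (of_real pi * z) \<noteq> 0"
    using assms by (auto simp: sin_eq_0 Ints_def)
  have "((\<lambda>z. Gamma z * Gamma (1 - z)) has_field_derivative
          Gamma z * Gamma (1 - z) * (Digamma z - Digamma (1 - z))) (at z)"
    using z by (auto intro!: derivative_eq_intros simp: algebra_simps)
  moreover have "((\<lambda>z. of_real pi / sin (of_real pi * z)) has_field_derivative
          - of_real pi * (of_real pi * cos (of_real pi * z)) / sin (of_real pi * z) ^ 2) (at z)"
    using sin0 by (auto intro!: derivative_eq_intros simp: power2_eq_square)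
  ultimately have "Gamma z * Gamma (1 - z) * (Digamma z - Digamma (1 - z)) =
      - of_real pi * (of_real pi * cos (of_real pi * z)) / sin (of_real pi * z) ^ 2"
    unfolding Gamma_reflection_complex by (rule DERIV_unique)
  then have eq: "of_real pi / S * X = - of_real pi * (of_real pi * C) / S ^ 2"
    if "S = sin (of_real pi * z)" "X = Digamma z - Digamma (1 - z)" "C = cos (of_real pi * z)" for S X C
    unfolding Gamma_reflection_complex that .
  have "X = - of_real pi * C / S"
    if "of_real pi / S * X = - of_real pi * (of_real pi * C) / S ^ 2" "S \<noteq> 0" for X S C :: complex
  proof -
    have "of_real pi * (X * S) = of_real pi * (- (of_real pi * C))"
      using that by (simp add: divide_simps power2_eq_square)
    then have "X * S = - (of_real pi * C)"
      by (subst (asm) mult_cancel_left) auto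
    then show ?thesis
      using that by (simp add: divide_simps)
  qed
  from this[OF eq[OF refl refl refl] sin0] show ?thesis .
qed

text \<open>At \<open>z = \<i> * y\<close> the series of \<open>Digamma (1 + z)\<close> and
  \<open>Digamma (1 - z)\<close> differ term by term by \<open>\<i>\<close> times the summands here,
  and reflection evaluates the difference. The imaginary argument turns trigonometric into
  hyperbolic functions.\<close>

lemma coth_partial_fractions:
  assumes y: "y > (0::real)"
  shows "(\<lambda>k. 2 * y / ((real (Suc k))\<^sup>2 + y\<^sup>2)) sums (pi * cosh (pi * y) / sinh (pi * y) - 1 / y)"
proof -
  define z where "z = \<i> * of_real y"
  have z: "z \<notin> \<int>" "1 - z \<noteq> 0" "1 + z \<noteq> 0" "z \<noteq> 0"
    using y by (auto simp: z_def complex_eq_iff elim!: Ints_cases)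
  have D: "(\<lambda>k. inverse (of_nat (Suc k)) - inverse (w + of_nat k)) sums (Digamma w + euler_mascheroni)"
    if "w \<noteq> 0" for w :: complex
    using summable_sums[OF summable_Digamma[OF that]] by (simp add: Digamma_def)
  have "(\<lambda>k. inverse (1 - z + of_nat k) - inverse (1 + z + of_nat k)) sums (Digamma (1 + z) - Digamma (1 - z))"
    using sums_diff[OF D[OF z(3)] D[OF z(2)]] by simp
  moreover have "inverse (1 - z + of_nat k) - inverse (1 + z + of_nat k) =
      \<i> * of_real (2 * y / ((real (Suc k))\<^sup>2 + y\<^sup>2))" for k
  proof -
    have nz: "1 - z + of_nat k \<noteq> 0" "1 + z + of_nat k \<noteq> 0"
      using y by (auto simp: z_def complex_eq_iff)
    have "(1 - z + of_nat k) * (1 + z + of_nat k) = of_real ((real (Suc k))\<^sup>2 + y\<^sup>2)"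
      by (simp add: z_def algebra_simps power2_eq_square)
    moreover have "inverse (1 - z + of_nat k) - inverse (1 + z + of_nat k) =
        2 * z / ((1 - z + of_nat k) * (1 + z + of_nat k))"
      using nz by (simp add: field_simps)
    ultimately show ?thesis
      by (simp add: z_def)
  qed
  moreover have "Digamma (1 + z) - Digamma (1 - z) = \<i> * of_real (pi * cosh (pi * y) / sinh (pi * y) - 1 / y)"
  proof -
    have "Digamma (1 + z) = Digamma z + 1 / z"
      using Digamma_plus1[OF z(4)] by (simp add: add.commute)
    then have "Digamma (1 + z) - Digamma (1 - z) = 1 / z + (Digamma z - Digamma (1 - z))"
      by simp
    also have "\<dots> = 1 / z - of_real pi * cos (of_real pi * z) / sin (of_real pi * z)"
      unfolding Digamma_reflection[OF z(1)] by simp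
    also have "of_real pi * z = \<i> * of_real (pi * y)"
      by (simp add: z_def)
    also have "cos (\<i> * of_real (pi * y)) = of_real (cosh (pi * y))"
      by (simp add: cosh_conv_cos[symmetric] cosh_field_def flip: exp_of_real)
    also have "sin (\<i> * of_real (pi * y)) = \<i> * of_real (sinh (pi * y))"
      by (simp add: sin_i_times sinh_field_def exp_minus flip: exp_of_real)
    also have "1 / z - of_real pi * of_real (cosh (pi * y)) / (\<i> * of_real (sinh (pi * y))) =
        \<i> * of_real (pi * cosh (pi * y) / sinh (pi * y) - 1 / y)"
      by (simp add: z_def divide_inverse algebra_simps)
    finally show ?thesis .
  qed
  ultimately have "(\<lambda>k. \<i> * of_real (2 * y / ((real (Suc k))\<^sup>2 + y\<^sup>2))) sums
      (\<i> * of_real (pi * cosh (pi * y) / sinh (pi * y) - 1 / y))"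
    by simp
  then have "(\<lambda>k. complex_of_real (2 * y / ((real (Suc k))\<^sup>2 + y\<^sup>2))) sums
      of_real (pi * cosh (pi * y) / sinh (pi * y) - 1 / y)"
    by (subst (asm) sums_mult_iff) auto
  then show ?thesis
    by (simp only: sums_of_real_iff)
qed

text \<open>\<open>1 / (exp x - 1) + 1/2\<close> is half of coth at \<open>x / 2\<close>. The poles
  at multiples of \<open>2 * pi * \<i>\<close> bring in the powers of \<open>2 * pi\<close> and the
  Dirichlet series on the other side of the functional equation.\<close>

lemma bose_partial_fractions:
  assumes x: "x > (0::real)"
  shows "(\<lambda>m. 2 * x / (x\<^sup>2 + (2 * pi * real (Suc m))\<^sup>2)) sums (1 / (exp x - 1) - 1 / x + 1 / 2)"
proof -
  define y where "y = x / (2 * pi)"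
  have y: "y > 0" using x by (simp add: y_def)
  have "(\<lambda>k. 2 * y / ((real (Suc k))\<^sup>2 + y\<^sup>2) / (2 * pi)) sums
      ((pi * cosh (pi * y) / sinh (pi * y) - 1 / y) / (2 * pi))"
    by (intro sums_divide coth_partial_fractions y)
  moreover have "2 * y / ((real (Suc k))\<^sup>2 + y\<^sup>2) / (2 * pi) = 2 * x / (x\<^sup>2 + (2 * pi * real (Suc k))\<^sup>2)" for k
  proof -
    have "0 < (real (Suc k))\<^sup>2 + y\<^sup>2"
      using y by (intro add_pos_pos) auto
    moreover have "x\<^sup>2 + (2 * pi * real (Suc k))\<^sup>2 = (2 * pi)\<^sup>2 * ((real (Suc k))\<^sup>2 + y\<^sup>2)"
      by (simp add: y_def power_mult_distrib power_divide distrib_left del: of_nat_Suc)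
    moreover have "x = 2 * pi * y" by (simp add: y_def)
    ultimately show ?thesis
      by (simp add: power2_eq_square del: of_nat_Suc)
  qed
  moreover have "(pi * cosh (pi * y) / sinh (pi * y) - 1 / y) / (2 * pi) = 1 / (exp x - 1) - 1 / x + 1 / 2"
  proof -
    have s: "sinh (x / 2) > 0" using x by simp
    have e: "exp x - 1 > 0" using x by simp
    have half: "(p / 2) / (q / 2) = p / q" for p q :: real
      by simp
    have "cosh (x / 2) / sinh (x / 2) = (exp (x/2) + exp (-(x/2))) / (exp (x/2) - exp (-(x/2)))"
      unfolding cosh_field_def sinh_field_def by (rule half)
    also have "\<dots> = (exp (x/2) * (exp (x/2) + exp (-(x/2)))) / (exp (x/2) * (exp (x/2) - exp (-(x/2))))"
      by simp
    also have "\<dots> = (exp x + 1) / (exp x - 1)"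
      by (simp add: algebra_simps flip: exp_add)
    also have "\<dots> = 1 + 2 / (exp x - 1)"
      using e by (simp add: field_simps)
    finally have coth0: "cosh (x / 2) / sinh (x / 2) = 1 + 2 / (exp x - 1)" .
    have coth: "pi * cosh (pi * y) / sinh (pi * y) = pi * (1 + 2 / (exp x - 1))"
    proof -
      have "pi * y = x / 2" by (simp add: y_def)
      then show ?thesis
        using arg_cong[OF coth0, of "(*) pi"] by (simp only: times_divide_eq_right)
    qed
    have "(pi * (1 + 2 / E) - 1 / y) / (2 * pi) = 1 / E - 1 / x + 1 / 2" if "E > 0" for E
      using x that by (simp add: y_def field_simps)
    from this[OF e] show ?thesis
      unfolding coth .
  qed
  ultimately show ?thesis by simp
qed

text \<open>The substitution \<open>w = u^2 / (u^2 + c^2)\<close> leads to a Beta integral whose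
  parameters satisfy \<open>a + b = 1\<close>, so reflection turns it into a cosine. Like the other
  Mellin integrals here it takes values in \<open>ennreal\<close>, where exchanges with nonnegative
  sums and increasing limits carry no integrability conditions.\<close>

lemma nn_integral_powr_div_add_square:
  fixes s c :: real
  assumes s: "-1 < s" "s < 1" and c: "c > 0"
  shows "(\<integral>\<^sup>+x\<in>{0<..}. ennreal (2 * x powr s / (x\<^sup>2 + c\<^sup>2)) \<partial>lborel) =
           ennreal (c powr (s - 1) * pi / cos (pi * s / 2))"
proof -
  define a b where "a = (1 + s) / 2" and "b = (1 - s) / 2"
  have ab: "a > 0" "b > 0" using s by (auto simp: a_def b_def)
  define g where "g = (\<lambda>u::real. u\<^sup>2 / (u\<^sup>2 + c\<^sup>2))"
  define g' where "g' = (\<lambda>u::real. 2 * u * c\<^sup>2 / (u\<^sup>2 + c\<^sup>2)\<^sup>2)"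
  have pos: "u\<^sup>2 + c\<^sup>2 > 0" for u
    using c by (simp add: add_nonneg_pos)
  have img: "g ` {0<..} = {0<..<1}"
  proof (intro equalityI subsetI)
    fix w assume w: "w \<in> {0<..<(1::real)}"
    define u where "u = c * sqrt (w / (1 - w))"
    have "u > 0" using w c by (auto simp: u_def)
    moreover have "u\<^sup>2 = c\<^sup>2 * (w / (1 - w))"
      using w by (simp add: u_def power_mult_distrib)
    then have "g u = w"
      using w c by (simp add: g_def field_simps)
    ultimately show "w \<in> g ` {0<..}"
      by auto
  next
    fix w assume "w \<in> g ` {0<..}"
    then obtain u where "u > 0" "w = g u" by auto
    then show "w \<in> {0<..<1}"
      using pos[of u] c by (simp add: g_def)
  qed
  have inj: "inj_on g {0<..}"
  proof (rule inj_onI)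
    fix x y :: real assume xy: "x \<in> {0<..}" "y \<in> {0<..}" "g x = g y"
    then have "x\<^sup>2 * (y\<^sup>2 + c\<^sup>2) = y\<^sup>2 * (x\<^sup>2 + c\<^sup>2)"
      using pos[of x] pos[of y] by (simp add: g_def frac_eq_eq)
    then have "x\<^sup>2 = y\<^sup>2"
      using c by (simp add: algebra_simps)
    then show "x = y"
      using xy by (simp add: power2_eq_iff_nonneg)
  qed
  have der: "(g has_field_derivative g' x) (at x within {0<..})" for x
    unfolding g_def g'_def using pos[of x]
    by (auto intro!: derivative_eq_intros simp: power2_eq_square) (simp_all add: algebra_simps)
  have B: "((\<lambda>t. t powr (a - 1) * (1 - t) powr (b - 1)) has_integral Beta a b) {0<..<1}"
    using has_integral_Beta_real[OF ab] by (simp add: has_integral_Icc_iff_Ioo)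
  have Babs: "(\<lambda>t. t powr (a - 1) * (1 - t) powr (b - 1)) absolutely_integrable_on {0<..<1}"
    using B by (subst absolutely_integrable_on_iff_nonneg) (auto simp: has_integral_iff)
  have "(\<lambda>x. \<bar>g' x\<bar> * (g x powr (a - 1) * (1 - g x) powr (b - 1))) absolutely_integrable_on {0<..} \<and>
      integral {0<..} (\<lambda>x. \<bar>g' x\<bar> * (g x powr (a - 1) * (1 - g x) powr (b - 1))) = Beta a b"
    by (subst has_absolute_integral_change_of_variables_1'[OF _ der inj])
       (use Babs B in \<open>auto simp: img has_integral_iff\<close>)
  then have 1: "((\<lambda>x. \<bar>g' x\<bar> * (g x powr (a - 1) * (1 - g x) powr (b - 1))) has_integral Beta a b) {0<..}"
    by (auto simp: has_integral_iff dest: set_lebesgue_integral_eq_integral(1))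
  have eq: "\<bar>g' x\<bar> * (g x powr (a - 1) * (1 - g x) powr (b - 1)) = c powr (1 - s) * (2 * x powr s / (x\<^sup>2 + c\<^sup>2))"
    if x: "x > 0" for x
  proof -
    define q where "q = x\<^sup>2 + c\<^sup>2"
    have q: "q > 0" using pos by (simp add: q_def)
    have g1: "1 - g x = c\<^sup>2 / q"
    proof -
      have "1 - g x = (x\<^sup>2 + c\<^sup>2) / q - x\<^sup>2 / q"
        using q[THEN less_imp_neq] by (simp only: g_def q_def[symmetric]) simp
      then show ?thesis
        by (simp add: add_divide_distrib)
    qed
    have gx: "g x = x\<^sup>2 / q"
      by (simp add: g_def q_def)
    have sq: "x\<^sup>2 = x powr 2" "c\<^sup>2 = c powr 2"
      using x c by simp_all
    have "g x powr (a - 1) * (1 - g x) powr (b - 1) = x powr (2 * (a - 1)) * c powr (2 * (b - 1)) / (q powr (a - 1) * q powr (b - 1))"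
    proof -
      have "(u\<^sup>2) powr e = u powr (2 * e)" if "u > 0" for u e :: real
      proof -
        have "u\<^sup>2 = u powr 2" using that by simp
        then show ?thesis by (simp only: powr_powr)
      qed
      then show ?thesis
        unfolding g1 unfolding gx using x c q by (simp add: powr_divide)
    qed
    also have "2 * (a - 1) = s - 1"
      by (simp add: a_def field_simps)
    also have "2 * (b - 1) = - s - 1"
      by (simp add: b_def field_simps)
    also have "q powr (a - 1) * q powr (b - 1) = 1 / q"
    proof -
      have "q powr (a - 1) * q powr (b - 1) = q powr ((a - 1) + (b - 1))"
        by (rule powr_add[symmetric])
      also have "(a - 1) + (b - 1) = -1"
        by (simp add: a_def b_def field_simps)
      finally show ?thesis
        using q by (simp add: powr_neg_one)
    qed
    finally have gg: "g x powr (a - 1) * (1 - g x) powr (b - 1) = x powr (s - 1) * c powr (- s - 1) * q"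
      by simp
    have g'x: "\<bar>g' x\<bar> = 2 * x * c\<^sup>2 / (q * q)"
      using x by (simp add: g'_def q_def power2_eq_square)
    have "\<bar>g' x\<bar> * (g x powr (a - 1) * (1 - g x) powr (b - 1)) = 2 * (x * x powr (s - 1)) * (c\<^sup>2 * c powr (- s - 1)) / q"
      unfolding gg g'x using q by simp
    also have "x * x powr (s - 1) = x powr s"
      using x by (simp add: powr_diff)
    also have "c\<^sup>2 * c powr (- s - 1) = c powr (1 - s)"
      unfolding sq by (subst powr_add[symmetric]) (simp add: algebra_simps)
    finally show ?thesis
      by (simp add: q_def mult_ac)
  qed
  have "((\<lambda>x. c powr (1 - s) * (2 * x powr s / (x\<^sup>2 + c\<^sup>2))) has_integral Beta a b) {0<..}"
    using 1 by (rule has_integral_eq[rotated]) (rule eq, simp)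
  then have "((\<lambda>x. c powr (s - 1) * (c powr (1 - s) * (2 * x powr s / (x\<^sup>2 + c\<^sup>2)))) has_integral
      c powr (s - 1) * Beta a b) {0<..}"
    by (rule has_integral_mult_right)
  moreover have "c powr (s - 1) * (c powr (1 - s) * r) = r" for r
  proof -
    have "c powr (s - 1) * c powr (1 - s) = 1"
      by (subst powr_add[symmetric]) (use c in simp)
    then show ?thesis
      by (simp add: mult.assoc[symmetric])
  qed
  moreover have "Beta a b = pi / cos (pi * s / 2)"
  proof -
    have "Beta a b = Gamma a * Gamma (1 - a)"
      by (simp add: Beta_def a_def b_def field_simps)
    also have "\<dots> = pi / sin (pi * a)"
    proof -
      have "complex_of_real (Gamma a * Gamma (1 - a)) = of_real (pi / sin (pi * a))"
        using Gamma_reflection_complex[of "of_real a"]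
        by (simp add: Gamma_complex_of_real[symmetric] sin_of_real[symmetric])
      then show ?thesis
        by (simp only: of_real_eq_iff)
    qed
    also have "sin (pi * a) = cos (pi * s / 2)"
    proof -
      have "pi * a = pi / 2 + pi * s / 2"
        by (simp add: a_def field_simps)
      then show ?thesis
        by (simp only: sin_add) simp
    qed
    finally show ?thesis .
  qed
  ultimately have "((\<lambda>x. 2 * x powr s / (x\<^sup>2 + c\<^sup>2)) has_integral c powr (s - 1) * pi / cos (pi * s / 2)) {0<..}"
    by simp
  then show ?thesis
    using c by (intro nn_integral_has_integral_lebesgue') auto
qed

section \<open>Mellin integrals of exponentials with subtracted Taylor terms\<close>

lemma nn_integral_powr_exp:
  fixes s v :: real
  assumes s: "s > -1" and v: "v > 0"
  shows "(\<integral>\<^sup>+x\<in>{0<..}. ennreal (x powr s * exp (- v * x)) \<partial>lborel) = ennreal (Gamma (s + 1) * v powr (- s - 1))"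
proof -
  have "ennreal (Gamma (s + 1)) = (\<integral>\<^sup>+t. ennreal (indicator {0..} t * t powr s / exp t) \<partial>lborel)"
    using Gamma_conv_nn_integral_real[of "s + 1"] s by simp
  also have "\<dots> = ennreal \<bar>v\<bar> * (\<integral>\<^sup>+t. ennreal (indicator {0..} (0 + v * t) * (0 + v * t) powr s / exp (0 + v * t)) \<partial>lborel)"
    using v by (intro nn_integral_real_affine) auto
  also have "(\<integral>\<^sup>+t. ennreal (indicator {0..} (0 + v * t) * (0 + v * t) powr s / exp (0 + v * t)) \<partial>lborel)
      = (\<integral>\<^sup>+t. ennreal (v powr s) * (ennreal (t powr s * exp (- v * t)) * indicator {0<..} t) \<partial>lborel)"
  proof (intro nn_integral_cong_AE eventually_mono[OF AE_lborel_singleton[of 0]])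
    fix t :: real assume "t \<noteq> 0"
    then show "ennreal (indicator {0..} (0 + v * t) * (0 + v * t) powr s / exp (0 + v * t)) =
        ennreal (v powr s) * (ennreal (t powr s * exp (- v * t)) * indicator {0<..} t)"
      using v by (cases "t > 0")
        (auto simp: indicator_def zero_le_mult_iff powr_mult exp_minus divide_inverse mult.assoc ennreal_mult[symmetric])
  qed
  also have "\<dots> = ennreal (v powr s) * (\<integral>\<^sup>+x\<in>{0<..}. ennreal (x powr s * exp (- v * x)) \<partial>lborel)"
    by (rule nn_integral_cmult) auto
  also have "ennreal \<bar>v\<bar> * (ennreal (v powr s) * I) = ennreal (v powr (s + 1)) * I" for I
  proof -
    have "ennreal \<bar>v\<bar> * ennreal (v powr s) = ennreal (v powr (s + 1))"
      using v by (subst ennreal_mult[symmetric]) (auto simp: powr_add)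
    then show ?thesis
      by (simp only: mult.assoc[symmetric])
  qed
  finally have "ennreal (Gamma (s + 1)) = ennreal (v powr (s + 1)) * (\<integral>\<^sup>+x\<in>{0<..}. ennreal (x powr s * exp (- v * x)) \<partial>lborel)" .
  then have "ennreal (v powr (- s - 1)) * ennreal (Gamma (s + 1)) =
     ennreal (v powr (- s - 1)) * ennreal (v powr (s + 1)) * (\<integral>\<^sup>+x\<in>{0<..}. ennreal (x powr s * exp (- v * x)) \<partial>lborel)"
    by (simp add: mult.assoc)
  also have "ennreal (v powr (- s - 1)) * ennreal (v powr (s + 1)) = 1"
    by (subst ennreal_mult[symmetric], simp, simp, subst powr_add[symmetric]) (use v in simp)
  finally have "(\<integral>\<^sup>+x\<in>{0<..}. ennreal (x powr s * exp (- v * x)) \<partial>lborel) =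
      ennreal (v powr (- s - 1)) * ennreal (Gamma (s + 1))"
    by simp
  also have "\<dots> = ennreal (v powr (- s - 1) * Gamma (s + 1))"
    using s by (intro ennreal_mult[symmetric]) (auto intro: less_imp_le[OF Gamma_real_pos])
  finally show ?thesis
    by (simp only: mult.commute)
qed

text \<open>\<open>F v x\<close> is \<open>x\<close> times the integral of \<open>f u x\<close> over
  \<open>u\<close> from 0 to \<open>v\<close>, so Tonelli trades one power of \<open>x\<close> for
  one integration in \<open>v\<close>. Two applications lead from \<open>exp (- v * x)\<close> to
  \<open>1 - exp (- v * x)\<close> and then to \<open>v * x - (1 - exp (- v * x))\<close>, which are
  small enough at 0 to admit negative \<open>s\<close>.\<close>

lemma nn_integral_powr_step:
  fixes F f :: "real \<Rightarrow> real \<Rightarrow> real" and p q c v :: real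
  assumes meas: "(\<lambda>(u, x). f u x) \<in> borel_measurable (borel \<Otimes>\<^sub>M borel)"
    and der: "\<And>u x. x > 0 \<Longrightarrow> ((\<lambda>u. F u x) has_real_derivative x * f u x) (at u)"
    and F0: "\<And>x. x > 0 \<Longrightarrow> F 0 x = 0"
    and f: "\<And>u x. u \<ge> 0 \<Longrightarrow> x > 0 \<Longrightarrow> f u x \<ge> 0"
    and int: "\<And>u. u > 0 \<Longrightarrow> (\<integral>\<^sup>+x\<in>{0<..}. ennreal (f u x * x powr p) \<partial>lborel) = ennreal (c * u powr q)"
    and q: "q > -1" and v: "v > 0" and c: "c \<ge> 0"
  shows "(\<integral>\<^sup>+x\<in>{0<..}. ennreal (F v x * x powr (p - 1)) \<partial>lborel) = ennreal (c * v powr (q + 1) / (q + 1))"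
proof -
  have m1: "(\<lambda>u. f u x) \<in> borel_measurable borel" for x
    using measurable_compose[OF measurable_Pair2' meas, of x] by simp
  have m2: "(\<lambda>x. f u x) \<in> borel_measurable borel" for u
    using measurable_compose[OF measurable_Pair1' meas, of u] by simp
  have "(\<integral>\<^sup>+x\<in>{0<..}. ennreal (F v x * x powr (p - 1)) \<partial>lborel) =
        (\<integral>\<^sup>+x. \<integral>\<^sup>+u. ennreal (f u x * x powr p) * indicator {0<..} x * indicator {0..v} u \<partial>lborel \<partial>lborel)"
  proof (intro nn_integral_cong)
    fix x :: real
    show "ennreal (F v x * x powr (p - 1)) * indicator {0<..} x =
        (\<integral>\<^sup>+u. ennreal (f u x * x powr p) * indicator {0<..} x * indicator {0..v} u \<partial>lborel)"
    proof (cases "x > 0")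
      case x: True
      have xp: "x * x powr (p - 1) = x powr p"
        using x by (simp add: powr_diff)
      have "(\<integral>\<^sup>+u\<in>{0..v}. ennreal (f u x * x powr p) \<partial>lborel) = ennreal (F v x * x powr (p - 1) - F 0 x * x powr (p - 1))"
      proof (rule nn_integral_FTC_Icc)
        show "((\<lambda>u. F u x * x powr (p - 1)) has_real_derivative f u x * x powr p) (at u)" for u
        proof -
          have "((\<lambda>u. F u x * x powr (p - 1)) has_real_derivative f u x * (x * x powr (p - 1))) (at u)"
            using DERIV_cmult_right[OF der[OF x, of u], of "x powr (p - 1)"] by (simp add: mult_ac)
          then show ?thesis
            unfolding xp .
        qed
        show "(\<lambda>u. f u x * x powr p) \<in> borel_measurable borel"
          using m1[of x] by simp
        show "0 \<le> f u x * x powr p" if "u \<in> {0..v}" for u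
          using f[of u x] x that by simp
      qed (use v in auto)
      then show ?thesis
        using x F0[OF x] by (simp add: mult.commute)
    qed auto
  qed
  also have "\<dots> = (\<integral>\<^sup>+u. \<integral>\<^sup>+x. ennreal (f u x * x powr p) * indicator {0<..} x * indicator {0..v} u \<partial>lborel \<partial>lborel)"
  proof (rule lborel_pair.Fubini')
    have [measurable]: "(\<lambda>z. f (fst z) (snd z)) \<in> borel_measurable (borel \<Otimes>\<^sub>M borel)"
      using meas by (simp add: case_prod_unfold)
    have "(\<lambda>z. ennreal (f (fst z) (snd z) * snd z powr p) * indicator {0<..} (snd z) * indicator {0..v} (fst z))
        \<in> borel_measurable (borel \<Otimes>\<^sub>M borel)"
      by measurable
    then show "(\<lambda>(u, x). ennreal (f u x * x powr p) * indicator {0<..} x * indicator {0..v} u)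
        \<in> borel_measurable (lborel \<Otimes>\<^sub>M lborel)"
      by (simp add: case_prod_unfold cong: measurable_cong_sets)
  qed
  also have "\<dots> = (\<integral>\<^sup>+u\<in>{0..v}. ennreal (c * u powr q) \<partial>lborel)"
  proof (intro nn_integral_cong_AE eventually_mono[OF AE_lborel_singleton[of 0]])
    fix u :: real assume "u \<noteq> 0"
    have "(\<integral>\<^sup>+x. ennreal (f u x * x powr p) * indicator {0<..} x * indicator {0..v} u \<partial>lborel) =
      (\<integral>\<^sup>+x\<in>{0<..}. ennreal (f u x * x powr p) \<partial>lborel) * indicator {0..v} u"
      by (rule nn_integral_multc) (use m2[of u] in simp)
    then show "(\<integral>\<^sup>+x. ennreal (f u x * x powr p) * indicator {0<..} x * indicator {0..v} u \<partial>lborel) =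
        ennreal (c * u powr q) * indicator {0..v} u"
      using int[of u] \<open>u \<noteq> 0\<close> by (cases "u \<in> {0..v}") (auto simp: mult.commute)
  qed
  also have "\<dots> = ennreal (c * (v powr (q + 1) / (q + 1)))"
    using has_integral_mult_right[OF has_integral_powr_from_0[OF q, of v], of c] v c
    by (intro nn_integral_has_integral_lebesgue') auto
  finally show ?thesis by simp
qed

lemma Gamma_real_neg: "-1 < s \<Longrightarrow> s < 0 \<Longrightarrow> Gamma (s :: real) < 0"
proof -
  assume s: "-1 < s" "s < 0"
  then have "Gamma (s + 1) = s * Gamma s"
    by (intro Gamma_plus1) (auto elim!: nonpos_Ints_cases)
  then show ?thesis
    using Gamma_real_pos[of "s + 1"] s by (auto simp: zero_less_mult_iff)
qed

lemma nn_integral_powr_exp_1: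
  fixes s v :: real
  assumes s: "-1 < s" "s < 0" and v: "v > 0"
  shows "(\<integral>\<^sup>+x\<in>{0<..}. ennreal ((1 - exp (- v * x)) * x powr (s - 1)) \<partial>lborel) = ennreal (- Gamma s * v powr (- s))"
proof -
  have G: "Gamma (s + 1) = s * Gamma s"
    using s by (intro Gamma_plus1) (auto elim!: nonpos_Ints_cases)
  have "(\<integral>\<^sup>+x\<in>{0<..}. ennreal ((1 - exp (- v * x)) * x powr (s - 1)) \<partial>lborel) =
      ennreal (Gamma (s + 1) * v powr ((- s - 1) + 1) / ((- s - 1) + 1))"
  proof (rule nn_integral_powr_step[where f = "\<lambda>u x. exp (- u * x)" and F = "\<lambda>u x. 1 - exp (- u * x)"])
    show "(\<integral>\<^sup>+x\<in>{0<..}. ennreal (exp (- u * x) * x powr s) \<partial>lborel) = ennreal (Gamma (s + 1) * u powr (- s - 1))"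
      if "u > 0" for u
      using nn_integral_powr_exp[of s u] s that by (simp add: mult.commute)
  qed (use s v in \<open>auto intro!: derivative_eq_intros less_imp_le[OF Gamma_real_pos]\<close>)
  also have "Gamma (s + 1) * v powr ((- s - 1) + 1) / ((- s - 1) + 1) = - Gamma s * v powr (- s)"
    unfolding G using s by simp
  finally show ?thesis .
qed

lemma nn_integral_powr_exp_2:
  fixes s v :: real
  assumes s: "-1 < s" "s < 0" and v: "v > 0"
  shows "(\<integral>\<^sup>+x\<in>{0<..}. ennreal ((v * x - (1 - exp (- v * x))) * x powr (s - 2)) \<partial>lborel) =
     ennreal (- Gamma s * v powr (1 - s) / (1 - s))"
proof -
  have "(\<integral>\<^sup>+x\<in>{0<..}. ennreal ((v * x - (1 - exp (- v * x))) * x powr ((s - 1) - 1)) \<partial>lborel) =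
      ennreal (- Gamma s * v powr (- s + 1) / (- s + 1))"
  proof (rule nn_integral_powr_step[where f = "\<lambda>u x. 1 - exp (- u * x)" and F = "\<lambda>u x. u * x - (1 - exp (- u * x))"])
    show "(\<integral>\<^sup>+x\<in>{0<..}. ennreal ((1 - exp (- u * x)) * x powr (s - 1)) \<partial>lborel) = ennreal (- Gamma s * u powr (- s))"
      if "u > 0" for u
      by (rule nn_integral_powr_exp_1[OF s that])
  qed (use s v Gamma_real_neg[OF s] in \<open>auto intro!: derivative_eq_intros simp: algebra_simps\<close>)
  then show ?thesis by (simp add: add.commute)
qed


section \<open>The Mellin transform of the Bose kernel for exponents between -1 and 0\<close>

lemma sum_exp_geometric:
  fixes x :: real
  assumes "x > 0"
  shows "(\<Sum>n=1..M. exp (- real n * x)) = (1 - exp (- real M * x)) / (exp x - 1)"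
proof (induction M)
  case (Suc M)
  have e: "exp x - 1 > 0" using assms by simp
  have "exp (- real M * x) = exp x * exp (- real (Suc M) * x)"
    by (subst exp_add[symmetric]) (simp add: algebra_simps)
  moreover have "(1 - q * r) / (q - 1) + r = (1 - r) / (q - 1)" if "q - 1 > 0" for q r :: real
    using that by (simp add: field_simps)
  moreover have "(\<Sum>n=1..Suc M. exp (- real n * x)) = (\<Sum>n=1..M. exp (- real n * x)) + exp (- real (Suc M) * x)"
    by (simp del: of_nat_Suc)
  ultimately show ?case
    unfolding Suc.IH using e by (simp del: of_nat_Suc)
qed simp

lemma zeta_of_real: "zeta (of_real x) = of_real (Re (zeta (of_real x)))"
  using cnj_zeta[of "of_real x"] by (simp add: complex_eq_iff)

text \<open>For \<open>s < 0\<close> the kernel cannot be expanded into exponentials term by term.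
  Multiplied by \<open>1 - exp (- real (Suc N) * x)\<close>, however, it is a finite combination of
  functions with known Mellin transforms, and these add up to \<open>Gamma s\<close> times the
  truncated Euler-Maclaurin expression of \<open>zeta_LIMSEQ\<close>. The factor increases to 1, so
  monotone convergence gives the claim.\<close>

lemma zeta_mellin_real:
  fixes s :: real
  assumes s: "-1 < s" "s < 0"
  defines "g \<equiv> \<lambda>x. 1 / (exp x - 1) - 1 / x + 1 / 2 :: real"
  shows "(\<integral>\<^sup>+x\<in>{0<..}. ennreal (g x * x powr (s - 1)) \<partial>lborel) = ennreal (Gamma s * Re (zeta (of_real s)))"
    and "Gamma s * Re (zeta (of_real s)) \<ge> 0"
proof -
  have g0: "g x \<ge> 0" if "x > 0" for x
    unfolding g_def using that by (intro sums_le[OF _ sums_zero bose_partial_fractions]) auto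
  define A where "A = (\<lambda>N. (\<Sum>n=1..Suc N. real n powr (-s)) - real (Suc N) powr (-s) / 2 -
              real (Suc N) powr (1 - s) / (1 - s))"
  define h where "h = (\<lambda>N x. (1 - exp (- real (Suc N) * x)) * g x * x powr (s - 1))"
  have h0: "h N x \<ge> 0" if "x > 0" for N x
    unfolding h_def using g0[OF that] that by (intro mult_nonneg_nonneg) (auto simp del: of_nat_Suc)
  have b1: "has_bochner_integral lborel (\<lambda>x. indicator {0<..} x * ((1 - exp (- v * x)) * x powr (s - 1))) (- Gamma s * v powr (- s))"
    if "v > 0" for v
    using nn_integral_powr_exp_1[OF s that] Gamma_real_neg[OF s] that
    by (intro has_bochner_integral_nn_integral)
       (auto simp: indicator_def ennreal_mult'' mult_nonneg_nonneg mult_nonpos_nonneg intro!: AE_I2 nn_integral_cong elim!: trans[rotated])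
  have b2: "has_bochner_integral lborel (\<lambda>x. indicator {0<..} x * ((v * x - (1 - exp (- v * x))) * x powr (s - 2))) (- Gamma s * v powr (1 - s) / (1 - s))"
    if "v > 0" for v
  proof (rule has_bochner_integral_nn_integral)
    have "1 - v * x \<le> exp (- v * x)" for x
      using exp_ge_add_one_self[of "- v * x"] by simp
    then show "AE x in lborel. 0 \<le> indicator {0<..} x * ((v * x - (1 - exp (- v * x))) * x powr (s - 2))"
      by (intro AE_I2 mult_nonneg_nonneg) (auto simp: algebra_simps)
    show "0 \<le> - Gamma s * v powr (1 - s) / (1 - s)"
      using Gamma_real_neg[OF s] s by (intro divide_nonneg_nonneg mult_nonneg_nonneg) auto
    show "(\<integral>\<^sup>+x. ennreal (indicator {0<..} x * ((v * x - (1 - exp (- v * x))) * x powr (s - 2))) \<partial>lborel) = ennreal (- Gamma s * v powr (1 - s) / (1 - s))"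
      unfolding nn_integral_powr_exp_2[OF s that, symmetric]
      by (intro nn_integral_cong) (auto simp: indicator_def)
  qed auto
  have hb: "has_bochner_integral lborel (\<lambda>x. indicator {0<..} x * h N x) (Gamma s * A N)" for N
  proof -
    define M where "M = Suc N"
    have M: "real M > 0" by (simp add: M_def)
    have "has_bochner_integral lborel (\<lambda>x.
        - (\<Sum>n=1..M. indicator {0<..} x * ((1 - exp (- real n * x)) * x powr (s - 1)))
        + indicator {0<..} x * ((1 - exp (- real M * x)) * x powr (s - 1)) / 2
        + indicator {0<..} x * ((real M * x - (1 - exp (- real M * x))) * x powr (s - 2)))
        (- (\<Sum>n=1..M. - Gamma s * real n powr (- s)) + (- Gamma s * real M powr (- s)) / 2
          + (- Gamma s * real M powr (1 - s) / (1 - s)))"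
      using M by (intro has_bochner_integral_add has_bochner_integral_minus has_bochner_integral_sum
          has_bochner_integral_divide_zero b1 b2) auto
    also have "- (\<Sum>n=1..M. - Gamma s * real n powr (- s)) + (- Gamma s * real M powr (- s)) / 2
          + (- Gamma s * real M powr (1 - s) / (1 - s)) = Gamma s * A N"
      by (simp only: A_def M_def mult_minus_left sum_negf sum_distrib_left[symmetric] minus_divide_left
          right_diff_distrib times_divide_eq_right)
    \<comment> \<open>The two contributions of size \<open>M\<close> cancel, and the geometric sum
      leaves the common factor \<open>1 - exp (- real M * x)\<close>.\<close>
    also have "(\<lambda>x. - (\<Sum>n=1..M. indicator {0<..} x * ((1 - exp (- real n * x)) * x powr (s - 1)))
        + indicator {0<..} x * ((1 - exp (- real M * x)) * x powr (s - 1)) / 2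
        + indicator {0<..} x * ((real M * x - (1 - exp (- real M * x))) * x powr (s - 2)))
        = (\<lambda>x. indicator {0<..} x * h N x)"
    proof
      fix x :: real
      show "- (\<Sum>n=1..M. indicator {0<..} x * ((1 - exp (- real n * x)) * x powr (s - 1)))
        + indicator {0<..} x * ((1 - exp (- real M * x)) * x powr (s - 1)) / 2
        + indicator {0<..} x * ((real M * x - (1 - exp (- real M * x))) * x powr (s - 2)) = indicator {0<..} x * h N x"
      proof (cases "x > 0")
        case x: True
        define q where "q = x powr (s - 1)"
        define E where "E = exp (- real M * x)"
        have q2: "x powr (s - 2) = q / x"
        proof -
          have "x powr (s - 2) = x powr ((s - 1) - 1)"
            by simp
          then show ?thesis
            unfolding q_def using x by (simp only: powr_diff[of x "s - 1" 1]) simp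
        qed
        have "(\<Sum>n=1..M. (1 - exp (- real n * x)) * q) = (real M - (1 - E) / (exp x - 1)) * q"
          unfolding sum_distrib_right[symmetric] sum_subtractf sum_exp_geometric[OF x] E_def by simp
        then have "- (\<Sum>n=1..M. (1 - exp (- real n * x)) * q) + (1 - E) * q / 2 + (real M * x - (1 - E)) * (q / x)
           = - ((real M - (1 - E) / (exp x - 1)) * q) + (1 - E) * q / 2 + (real M * x - (1 - E)) * (q / x)"
          by simp
        also have "\<dots> = (1 - E) * (1 / (exp x - 1) - 1 / x + 1 / 2) * q"
        proof -
          have "- ((M' - d * v) * q) + d * q / 2 + (M' * x - d) * (q / x) = d * (v - 1 / x + 1 / 2) * q" for M' d v
            using x by (simp add: field_simps)
          from this[of "real M" "1 - E" "1 / (exp x - 1)"] show ?thesis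
            by (simp only: times_divide_eq_right mult_1_right)
        qed
        finally show ?thesis
          using x by (simp add: h_def g_def q_def[symmetric] q2 E_def M_def del: of_nat_Suc)
      qed auto
    qed
    finally show ?thesis .
  qed
  have nn: "(\<integral>\<^sup>+x\<in>{0<..}. ennreal (h N x) \<partial>lborel) = ennreal (Gamma s * A N)" for N
  proof -
    have "(\<integral>\<^sup>+x. ennreal (indicator {0<..} x * h N x) \<partial>lborel) = ennreal (Gamma s * A N)"
      using hb[of N] h0 by (subst nn_integral_eq_integral)
        (auto simp: has_bochner_integral_iff indicator_def)
    also have "(\<integral>\<^sup>+x. ennreal (indicator {0<..} x * h N x) \<partial>lborel) = (\<integral>\<^sup>+x\<in>{0<..}. ennreal (h N x) \<partial>lborel)"
      by (intro nn_integral_cong) (auto simp: indicator_def)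
    finally show ?thesis .
  qed
  have GA0: "Gamma s * A N \<ge> 0" for N
    using hb[of N] h0 by (auto simp: has_bochner_integral_iff indicator_def intro!: integral_nonneg_AE
        elim!: subst[where P = "\<lambda>x. 0 \<le> x"])
  have A: "A \<longlonglongrightarrow> Re (zeta (of_real s))"
  proof -
    have r: "of_nat m powr (of_real y) = (of_real (real m powr y) :: complex)" for m y
      using powr_of_real[of "real m" y] by simp
    have "(\<lambda>N. Re ((\<Sum>n=1..Suc N. of_nat n powr (- of_real s)) - of_nat (Suc N) powr (- of_real s) / 2 -
              of_nat (Suc N) powr (1 - of_real s) / (1 - of_real s))) \<longlonglongrightarrow> Re (zeta (of_real s))"
      using s by (intro tendsto_Re zeta_LIMSEQ) auto
    also have "(\<lambda>N. Re ((\<Sum>n=1..Suc N. of_nat n powr (- of_real s)) - of_nat (Suc N) powr (- of_real s) / 2 -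
              of_nat (Suc N) powr (1 - of_real s) / (1 - of_real s))) = A"
    proof
      fix N
      have "(\<Sum>n=1..Suc N. of_nat n powr (- of_real s)) - of_nat (Suc N) powr (- of_real s) / 2 -
              of_nat (Suc N) powr (1 - of_real s) / (1 - of_real s) = complex_of_real (A N)"
        using r[of _ "- s"] r[of "Suc N" "1 - s"] by (simp add: A_def del: of_nat_Suc sum.cl_ivl_Suc)
      then show "Re ((\<Sum>n=1..Suc N. of_nat n powr (- of_real s)) - of_nat (Suc N) powr (- of_real s) / 2 -
              of_nat (Suc N) powr (1 - of_real s) / (1 - of_real s)) = A N"
        by (simp only: Re_complex_of_real)
    qed
    finally show ?thesis .
  qed
  have GA: "(\<lambda>N. Gamma s * A N) \<longlonglongrightarrow> Gamma s * Re (zeta (of_real s))"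
    by (intro tendsto_intros A)
  show "Gamma s * Re (zeta (of_real s)) \<ge> 0"
    using GA0 by (intro LIMSEQ_le_const[OF GA]) auto
  have "(\<lambda>N. \<integral>\<^sup>+x\<in>{0<..}. ennreal (h N x) \<partial>lborel) \<longlonglongrightarrow> (\<integral>\<^sup>+x\<in>{0<..}. ennreal (g x * x powr (s - 1)) \<partial>lborel)"
  proof (rule nn_integral_LIMSEQ)
    show "incseq (\<lambda>N x. ennreal (h N x) * indicator {0<..} x)"
    proof (intro incseq_SucI le_funI)
      fix N and x :: real
      show "ennreal (h N x) * indicator {0<..} x \<le> ennreal (h (Suc N) x) * indicator {0<..} x"
        using g0[of x] by (auto simp: h_def indicator_def intro!: ennreal_leI mult_right_mono)
    qed
    show "(\<lambda>x. ennreal (h N x) * indicator {0<..} x) \<in> borel_measurable lborel" for N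
      unfolding h_def g_def by measurable
    show "(\<lambda>N. ennreal (h N x) * indicator {0<..} x) \<longlonglongrightarrow> ennreal (g x * x powr (s - 1)) * indicator {0<..} x" for x
    proof (cases "x > 0")
      case True
      have "(\<lambda>N. exp (- real (Suc N) * x)) \<longlonglongrightarrow> 0"
        using True by real_asymp
      then have "(\<lambda>N. (1 - exp (- real (Suc N) * x)) * g x * x powr (s - 1)) \<longlonglongrightarrow> (1 - 0) * g x * x powr (s - 1)"
        by (intro tendsto_intros)
      then show ?thesis
        using True by (simp add: h_def tendsto_ennrealI)
    qed auto
  qed
  then have "(\<lambda>N. ennreal (Gamma s * A N)) \<longlonglongrightarrow> (\<integral>\<^sup>+x\<in>{0<..}. ennreal (g x * x powr (s - 1)) \<partial>lborel)"
    by (simp only: nn)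
  moreover have "(\<lambda>N. ennreal (Gamma s * A N)) \<longlonglongrightarrow> ennreal (Gamma s * Re (zeta (of_real s)))"
    by (intro tendsto_ennrealI GA)
  ultimately show "(\<integral>\<^sup>+x\<in>{0<..}. ennreal (g x * x powr (s - 1)) \<partial>lborel) = ennreal (Gamma s * Re (zeta (of_real s)))"
    by (rule LIMSEQ_unique)
qed

text \<open>The integral of \<open>zeta_mellin_real\<close> is evaluated a second time, with the
  kernel expanded by \<open>bose_partial_fractions\<close>. All terms are nonnegative, and each
  scales like \<open>(2 * pi * m) powr (s - 1)\<close>, which sums over positive \<open>m\<close> to
  zeta at \<open>1 - s\<close>.\<close>

lemma zeta_functional_equation_real:
  fixes s :: real
  assumes s: "-1 < s" "s < 0"
  shows "Re (zeta (of_real (1 - s))) = 2 * (2 * pi) powr (- s) * cos (pi * s / 2) * Gamma s * Re (zeta (of_real s))"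
proof -
  define g where "g = (\<lambda>x. 1 / (exp x - 1) - 1 / x + 1 / 2 :: real)"
  define C where "C = (2 * pi) powr (s - 1) * pi / cos (pi * s / 2)"
  have cos0: "cos (pi * s / 2) > 0"
  proof (rule cos_gt_zero_pi)
    show "- (pi / 2) < pi * s / 2" "pi * s / 2 < pi / 2"
      using s pi_gt_zero mult_strict_left_mono[of "-1" s pi] mult_pos_neg[of pi s] by auto
  qed
  have C: "C \<ge> 0"
    using cos0 by (simp add: C_def)
  have sm: "(\<lambda>m. real (Suc m) powr (s - 1)) sums Re (zeta (of_real (1 - s)))"
    using zeta_real_sums[of "1 - s"] s by simp
  have "ennreal (Gamma s * Re (zeta (of_real s))) = (\<integral>\<^sup>+x\<in>{0<..}. ennreal (g x * x powr (s - 1)) \<partial>lborel)"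
    unfolding g_def zeta_mellin_real(1)[OF s] ..
  also have "\<dots> = (\<integral>\<^sup>+x. (\<Sum>m. ennreal (2 * x powr s / (x\<^sup>2 + (2 * pi * real (Suc m))\<^sup>2)) * indicator {0<..} x) \<partial>lborel)"
  proof (intro nn_integral_cong)
    fix x :: real
    show "ennreal (g x * x powr (s - 1)) * indicator {0<..} x =
      (\<Sum>m. ennreal (2 * x powr s / (x\<^sup>2 + (2 * pi * real (Suc m))\<^sup>2)) * indicator {0<..} x)"
    proof (cases "x > 0")
      case x: True
      have "(\<lambda>m. 2 * x / (x\<^sup>2 + (2 * pi * real (Suc m))\<^sup>2) * x powr (s - 1)) sums (g x * x powr (s - 1))"
        unfolding g_def by (intro sums_mult2 bose_partial_fractions x)
      moreover have eq: "2 * x / r * x powr (s - 1) = 2 * x powr s / r" for r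
      proof -
        have "x * x powr (s - 1) = x powr s"
          using x by (simp add: powr_diff)
        then show ?thesis by (simp add: mult.assoc)
      qed
      ultimately have "(\<lambda>m. 2 * x powr s / (x\<^sup>2 + (2 * pi * real (Suc m))\<^sup>2)) sums (g x * x powr (s - 1))"
        by (simp only: eq)
      then show ?thesis
        using x by (auto intro!: suminf_ennreal_eq[symmetric])
    qed auto
  qed
  also have "\<dots> = (\<Sum>m. \<integral>\<^sup>+x\<in>{0<..}. ennreal (2 * x powr s / (x\<^sup>2 + (2 * pi * real (Suc m))\<^sup>2)) \<partial>lborel)"
    by (intro nn_integral_suminf) measurable
  also have "\<dots> = (\<Sum>m. ennreal (C * real (Suc m) powr (s - 1)))"
  proof (intro suminf_cong)
    fix m
    have "(\<integral>\<^sup>+x\<in>{0<..}. ennreal (2 * x powr s / (x\<^sup>2 + (2 * pi * real (Suc m))\<^sup>2)) \<partial>lborel) =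
        ennreal ((2 * pi * real (Suc m)) powr (s - 1) * pi / cos (pi * s / 2))"
      using s by (intro nn_integral_powr_div_add_square) auto
    also have "(2 * pi * real (Suc m)) powr (s - 1) = (2 * pi) powr (s - 1) * real (Suc m) powr (s - 1)"
      by (rule powr_mult)
    finally show "(\<integral>\<^sup>+x\<in>{0<..}. ennreal (2 * x powr s / (x\<^sup>2 + (2 * pi * real (Suc m))\<^sup>2)) \<partial>lborel) =
        ennreal (C * real (Suc m) powr (s - 1))"
      by (simp add: C_def mult_ac)
  qed
  also have "\<dots> = ennreal (C * Re (zeta (of_real (1 - s))))"
    using C by (intro suminf_ennreal_eq sums_mult sm) auto
  finally have "Gamma s * Re (zeta (of_real s)) = C * Re (zeta (of_real (1 - s)))"
    using zeta_mellin_real(2)[OF s] C zeta_real_pos[of "1 - s"] s by (subst (asm) ennreal_inj) auto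
  moreover have "2 * (2 * pi) powr (- s) * cos (pi * s / 2) * C = 1"
  proof -
    have "(2 * pi) powr (s - 1) * (2 * pi) powr (- s) = 1 / (2 * pi)"
      by (subst powr_add[symmetric]) (simp add: powr_minus_divide)
    then have "2 * ((2 * pi) powr (s - 1) * (2 * pi) powr (- s)) * pi = 1"
      by simp
    then show ?thesis
      using cos0 by (simp add: C_def mult_ac)
  qed
  ultimately show ?thesis
    by (metis (no_types, lifting) mult.assoc mult_1)
qed

text \<open>Identity theorem: both sides are holomorphic on the half-plane without 0 and 1, where
  the poles of \<open>Gamma\<close> and of the two zeta values lie, and they agree on the real
  segment from -1 to 0, of which \<open>-1/2\<close> is a limit point.\<close>

lemma zeta_functional_equation:
  fixes s :: complex
  assumes s: "Re s > -1" "s \<noteq> 0" "s \<noteq> 1"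
  shows "zeta (1 - s) = 2 * of_real (2 * pi) powr (- s) * cos (of_real pi * s / 2) * Gamma s * zeta s"
proof -
  define f where "f = (\<lambda>s. zeta (1 - s) - 2 * of_real (2 * pi) powr (- s) * cos (of_real pi * s / 2) * Gamma s * zeta s)"
  define S where "S = {s. Re s > -1} - {0, 1 :: complex}"
  have "f s = 0"
  proof (rule analytic_continuation[where S = S and U = "of_real ` {-1<..<0}" and \<xi> = "of_real (-1/2)" and f = f])
    have nonpos: "z \<notin> \<int>\<^sub>\<le>\<^sub>0" if "z \<in> S" for z
      using that by (auto simp: S_def elim!: nonpos_Ints_cases)
    have "(\<lambda>s. zeta (1 - s)) holomorphic_on S"
      by (rule holomorphic_on_compose_gen[OF _ zeta_holomorphic[of "- {1}"], unfolded o_def])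
         (auto intro!: holomorphic_intros simp: S_def)
    then show "f holomorphic_on S"
      unfolding f_def using nonpos by (intro holomorphic_intros zeta_holomorphic) (auto simp: S_def)
    show "open S"
      unfolding S_def by (intro open_Diff open_halfspace_Re_gt) auto
    show "connected S"
      unfolding S_def by (intro connected_open_delete_finite open_halfspace_Re_gt convex_connected convex_halfspace_Re_gt) auto
    show "complex_of_real ` {-1<..<0} \<subseteq> S" "complex_of_real (-1/2) \<in> S"
      by (auto simp: S_def complex_eq_iff)
    show "s \<in> S"
      using s by (auto simp: S_def)
    show "complex_of_real (-1/2) islimpt of_real ` {-1<..<0}"
      unfolding islimpt_approachable
    proof (intro allI impI)
      fix e :: real assume e: "e > 0"
      define x where "x = -1/2 + min e 1 / 4"
      have "x \<in> {-1<..<0}" "x \<noteq> -1/2" "dist x (-1/2) < e"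
        using e by (auto simp: x_def dist_real_def)
      then show "\<exists>x'\<in>complex_of_real ` {- 1<..<0}. x' \<noteq> complex_of_real (-1/2) \<and> dist x' (complex_of_real (-1/2)) < e"
        unfolding dist_of_real by (intro bexI[of _ "of_real x"] conjI)
          (simp_all only: dist_of_real of_real_eq_iff imageI not_False_eq_True)
    qed
    show "f z = 0" if z: "z \<in> complex_of_real ` {-1<..<0}" for z
    proof -
      obtain x where x: "z = of_real x" "-1 < x" "x < 0"
        using z by auto
      have "zeta (1 - z) = of_real (Re (zeta (of_real (1 - x))))"
        unfolding x using zeta_of_real[of "1 - x"] by simp
      also have "\<dots> = of_real (2 * (2 * pi) powr (- x) * cos (pi * x / 2) * Gamma x * Re (zeta (of_real x)))"
        by (simp only: zeta_functional_equation_real[OF x(2,3)])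
      also have "\<dots> = 2 * of_real ((2 * pi) powr (- x)) * of_real (cos (pi * x / 2)) * of_real (Gamma x) * of_real (Re (zeta (of_real x)))"
        by simp
      also have "\<dots> = 2 * of_real (2 * pi) powr (- z) * cos (of_real pi * z / 2) * Gamma z * zeta z"
        unfolding zeta_of_real[symmetric] x
        using powr_of_real[of "2 * pi" "- x"] cos_of_real[of "pi * x / 2", where 'a = complex] Gamma_complex_of_real[of x]
        by simp
      finally show ?thesis
        by (simp add: f_def)
    qed
  qed
  then show ?thesis
    by (simp add: f_def)
qed

text \<open>With \<open>w = s / 2\<close>, duplication for \<open>Gamma s\<close> and reflection for
  \<open>Gamma (w + 1/2)\<close> cancel the cosine. What remains is
  \<open>exp (- \<i> * t * ln pi) * Gamma w / Gamma (cnj w)\<close>, a number of modulus 1 whose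
  argument is twice that of \<open>Gamma w\<close> up to the \<open>ln pi\<close> term.\<close>

lemma chi_critical_line:
  fixes t :: real
  defines "s \<equiv> Complex (1/2) t"
  shows "2 * of_real (2 * pi) powr (- s) * cos (of_real pi * s / 2) * Gamma s = exp (2 * \<i> * of_real (hardy_theta t))"
proof -
  define w where "w = s / 2"
  have w_eq: "w = Complex (1/4) (t/2)"
    by (simp add: w_def s_def complex_eq_iff)
  have cw: "1/2 - w = cnj w"
    by (simp add: w_eq complex_eq_iff)
  have np: "z \<notin> \<int>\<^sub>\<le>\<^sub>0" if "Re z > 0" for z :: complex
    using that by (auto elim!: nonpos_Ints_cases)
  have G0: "Gamma w \<noteq> 0" "Gamma (cnj w) \<noteq> 0" "Gamma (w + 1/2) \<noteq> 0"
    using np[of w] np[of "cnj w"] np[of "w + 1/2"] by (auto simp: Gamma_eq_zero_iff w_eq)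
  have dup: "Gamma w * Gamma (w + 1/2) = exp ((1 - 2 * w) * of_real (ln 2)) * of_real (sqrt pi) * Gamma (2 * w)"
    by (rule Gamma_legendre_duplication) (auto intro!: np simp: w_eq)
  have refl: "Gamma (w + 1/2) * Gamma (cnj w) = of_real pi / cos (of_real pi * w)"
  proof -
    have "Gamma (w + 1/2) * Gamma (1 - (w + 1/2)) = of_real pi / sin (of_real pi * (w + 1/2))"
      by (rule Gamma_reflection_complex)
    moreover have "1 - (w + 1/2) = cnj w"
      by (simp add: cw[symmetric])
    moreover have "sin (of_real pi * (w + 1/2)) = cos (of_real pi * w)"
      using sin_of_real[of "pi/2", where 'a = complex] cos_of_real[of "pi/2", where 'a = complex]
      by (simp add: distrib_left sin_add)
    ultimately show ?thesis by simp
  qed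
  have c0: "cos (of_real pi * w) \<noteq> 0"
    using refl G0 by auto
  have e1: "exp ((1 - 2 * w) * of_real (ln 2)) = 2 * exp (- s * of_real (ln 2))"
  proof -
    have "exp ((1 - 2 * w) * of_real (ln 2)) = exp (of_real (ln 2)) * exp (- s * of_real (ln 2) :: complex)"
      by (subst exp_add[symmetric]) (simp add: w_def algebra_simps)
    also have "exp (of_real (ln 2)) = (2 :: complex)"
      by (simp add: exp_of_real)
    finally show ?thesis .
  qed
  have e2: "of_real (2 * pi) powr (- s) = exp (- s * of_real (ln 2)) * exp (- s * of_real (ln pi))"
  proof -
    have "of_real (2 * pi) powr (- s) = exp (- s * of_real (ln (2 * pi)))"
      by (subst powr_def) (auto simp: Ln_of_real simp del: of_real_mult)
    also have "\<dots> = exp (- s * of_real (ln 2) + - s * of_real (ln pi))"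
      by (simp add: ln_mult algebra_simps)
    finally show ?thesis by (simp only: exp_add)
  qed
  have e3: "exp (- s * of_real (ln pi)) * of_real (sqrt pi) = exp (- \<i> * of_real (t * ln pi))"
  proof -
    have "of_real (sqrt pi) = (exp (of_real (ln pi / 2)) :: complex)"
    proof -
      have "sqrt pi = exp (ln pi / 2)"
        by (simp add: powr_half_sqrt[symmetric] powr_def)
      then show ?thesis by (simp only: exp_of_real)
    qed
    then have "exp (- s * of_real (ln pi)) * of_real (sqrt pi) = exp (- s * of_real (ln pi) + of_real (ln pi / 2))"
      by (simp only: mult_exp_exp)
    also have "- s * of_real (ln pi) + of_real (ln pi / 2) = - \<i> * of_real (t * ln pi)"
      by (simp add: s_def complex_eq_iff)
    finally show ?thesis .
  qed
  have e4: "exp (2 * \<i> * of_real (hardy_theta t)) = exp (- \<i> * of_real (t * ln pi)) * Gamma w / Gamma (cnj w)"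
  proof -
    define L where "L = ln_Gamma w"
    have GL: "Gamma w = exp L"
      unfolding L_def by (rule Gamma_complex_altdef[THEN trans]) (use np[of w] in \<open>auto simp: w_eq\<close>)
    have "Gamma (cnj w) = exp (cnj L)"
      using GL by (simp add: cnj_Gamma[symmetric] exp_cnj)
    then have "Gamma w / Gamma (cnj w) = exp (L - cnj L)"
      using GL by (simp add: exp_diff)
    also have "L - cnj L = 2 * \<i> * of_real (Im L)"
      by (simp add: complex_eq_iff)
    finally have *: "Gamma w / Gamma (cnj w) = exp (2 * \<i> * of_real (Im L))" .
    have "2 * \<i> * of_real (hardy_theta t) = - \<i> * of_real (t * ln pi) + 2 * \<i> * of_real (Im L)"
      by (simp add: hardy_theta_def L_def w_eq algebra_simps)
    then have "exp (2 * \<i> * of_real (hardy_theta t)) = exp (- \<i> * of_real (t * ln pi)) * exp (2 * \<i> * of_real (Im L))"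
      by (simp only: exp_add)
    then show ?thesis
      unfolding *[symmetric] by simp
  qed
  have "Gamma s = Gamma w * Gamma (w + 1/2) / (exp ((1 - 2 * w) * of_real (ln 2)) * of_real (sqrt pi))"
    unfolding dup by (simp add: w_def)
  also have "Gamma (w + 1/2) = of_real pi / (cos (of_real pi * w) * Gamma (cnj w))"
  proof -
    have "Gamma (w + 1/2) = of_real pi / cos (of_real pi * w) / Gamma (cnj w)"
      using refl nonzero_eq_divide_eq[OF G0(2)] by blast
    then show ?thesis by (simp only: divide_divide_eq_left)
  qed
  finally have "2 * of_real (2 * pi) powr (- s) * cos (of_real pi * s / 2) * Gamma s =
     exp (- s * of_real (ln pi)) * (of_real pi / of_real (sqrt pi)) * Gamma w / Gamma (cnj w)"
    unfolding e1 e2 using c0 by (simp add: w_def field_simps)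
  also have "of_real pi / of_real (sqrt pi) = (of_real (sqrt pi) :: complex)"
    by (simp add: real_div_sqrt flip: of_real_divide)
  finally show ?thesis
    unfolding e3 e4 .
qed

lemma zeta_chi_critical_line:
  "cnj (zeta (Complex (1/2) t)) = exp (2 * \<i> * of_real (hardy_theta t)) * zeta (Complex (1/2) t)"
proof -
  have "cnj (zeta (Complex (1/2) t)) = zeta (1 - Complex (1/2) t)"
    unfolding cnj_zeta by (rule arg_cong[of _ _ zeta]) (simp add: complex_eq_iff)
  also have "\<dots> = exp (2 * \<i> * of_real (hardy_theta t)) * zeta (Complex (1/2) t)"
  proof -
    have "Re (Complex (1/2) t) > -1" "Complex (1/2) t \<noteq> 0" "Complex (1/2) t \<noteq> 1"
      by (auto simp: complex_eq_iff)
    from zeta_functional_equation[OF this] show ?thesis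
      unfolding chi_critical_line .
  qed
  finally show ?thesis .
qed

text \<open>By \<open>zeta_chi_critical_line\<close> the squared phase times zeta is the conjugate
  of zeta. Through this identity the ladder equation becomes a statement about the squared
  modulus.\<close>

lemma hardy_Z_square: "(hardy_Z t)\<^sup>2 = of_real ((cmod (zeta (Complex (1/2) t)))\<^sup>2)"
proof -
  have "(hardy_Z t)\<^sup>2 = exp (2 * \<i> * of_real (hardy_theta t)) * zeta (Complex (1/2) t) * zeta (Complex (1/2) t)"
  proof -
    have "exp (2 * \<i> * of_real (hardy_theta t)) = exp (\<i> * of_real (hardy_theta t)) * exp (\<i> * of_real (hardy_theta t))"
      by (subst exp_add[symmetric]) (simp add: mult.assoc)
    then show ?thesis
      by (simp add: hardy_Z_def power2_eq_square mult_ac)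
  qed
  also have "\<dots> = zeta (Complex (1/2) t) * cnj (zeta (Complex (1/2) t))"
    unfolding zeta_chi_critical_line by (simp add: mult_ac)
  finally show ?thesis
    by (simp only: complex_norm_square)
qed

section \<open>The Gamma function on vertical lines and contour integration\<close>

lemma norm_Gamma_series:
  fixes a t :: real
  assumes a: "a > 0"
  shows "norm (Gamma_series (Complex a t) n) =
     Gamma_series a n * (\<Prod>i=0..n. (a + real i) / norm (Complex (a + real i) t))"
proof -
  have "norm (pochhammer (Complex a t) (n + 1)) = (\<Prod>i=0..n. norm (Complex (a + real i) t))"
  proof -
    have "Complex a t + of_nat i = Complex (a + real i) t" for i
      by (simp add: complex_eq_iff)
    then show ?thesis
      by (simp add: pochhammer_prod prod_norm[symmetric] atLeastLessThanSuc_atLeastAtMost)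
  qed
  moreover have "norm (exp (Complex a t * of_real (ln (of_nat n)))) = exp (a * ln (real n))"
    by simp
  moreover have "pochhammer a (n + 1) = (\<Prod>i=0..n. a + real i)"
    by (simp add: pochhammer_prod atLeastLessThanSuc_atLeastAtMost)
  moreover have "(\<Prod>i=0..n. a + real i) \<noteq> 0"
    using a by (auto simp: prod_zero_iff add_eq_0_iff)
  ultimately show ?thesis
    unfolding Gamma_series_def by (simp add: norm_divide norm_mult prod_dividef)
qed

text \<open>In the product of \<open>norm_Gamma_series\<close> each factor
  \<open>x / norm (Complex x t)\<close> increases with \<open>x\<close>; hence so does the quotient
  of \<open>norm (Gamma (Complex a t))\<close> by \<open>Gamma a\<close> as a function of
  \<open>a\<close>. This carries decay from single vertical lines to a strip, in the role of
  Stirling's formula.\<close>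

lemma norm_Gamma_mono:
  fixes a b t :: real
  assumes a: "0 < a" and ab: "a \<le> b"
  shows "norm (Gamma (Complex a t)) * Gamma b \<le> norm (Gamma (Complex b t)) * Gamma a"
proof (rule LIMSEQ_le)
  show "(\<lambda>n. norm (Gamma_series (Complex a t) n) * Gamma_series b n) \<longlonglongrightarrow> norm (Gamma (Complex a t)) * Gamma b"
    "(\<lambda>n. norm (Gamma_series (Complex b t) n) * Gamma_series a n) \<longlonglongrightarrow> norm (Gamma (Complex b t)) * Gamma a"
    by (intro tendsto_intros)+
  have pos: "Gamma_series c n \<ge> 0" if "c > 0" for c :: real and n
    unfolding Gamma_series_def using that by (intro divide_nonneg_nonneg mult_nonneg_nonneg pochhammer_nonneg) auto
  have ratio: "x / norm (Complex x t) \<le> y / norm (Complex y t)" if "0 < x" "x \<le> y" for x y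
  proof -
    have "x * sqrt (y\<^sup>2 + t\<^sup>2) = sqrt (x\<^sup>2 * (y\<^sup>2 + t\<^sup>2))" "y * sqrt (x\<^sup>2 + t\<^sup>2) = sqrt (y\<^sup>2 * (x\<^sup>2 + t\<^sup>2))"
      using that by (simp_all add: real_sqrt_mult)
    moreover have "x\<^sup>2 * (y\<^sup>2 + t\<^sup>2) \<le> y\<^sup>2 * (x\<^sup>2 + t\<^sup>2)"
      using that power_mono[of x y 2] mult_right_mono[of "x\<^sup>2" "y\<^sup>2" "t\<^sup>2"] by (simp add: algebra_simps)
    ultimately have "x * norm (Complex y t) \<le> y * norm (Complex x t)"
      by (simp add: cmod_def)
    moreover have "norm (Complex x t) > 0" "norm (Complex y t) > 0"
      using that by (auto simp: complex_eq_iff)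
    ultimately show ?thesis
      by (simp add: field_simps)
  qed
  show "\<exists>N. \<forall>n\<ge>N. norm (Gamma_series (Complex a t) n) * Gamma_series b n
      \<le> norm (Gamma_series (Complex b t) n) * Gamma_series a n"
  proof (intro exI allI impI)
    fix n
    have "(\<Prod>i=0..n. (a + real i) / norm (Complex (a + real i) t)) \<le> (\<Prod>i=0..n. (b + real i) / norm (Complex (b + real i) t))"
      using a ab by (intro prod_mono conjI ratio) auto
    then have "(Gamma_series a n * Gamma_series b n) * (\<Prod>i=0..n. (a + real i) / norm (Complex (a + real i) t))
      \<le> (Gamma_series a n * Gamma_series b n) * (\<Prod>i=0..n. (b + real i) / norm (Complex (b + real i) t))"
      using a ab by (intro mult_left_mono mult_nonneg_nonneg pos) auto
    then show "norm (Gamma_series (Complex a t) n) * Gamma_series b n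
      \<le> norm (Gamma_series (Complex b t) n) * Gamma_series a n"
      using a ab by (simp add: norm_Gamma_series mult_ac)
  qed
qed

text \<open>On this line \<open>1 - z = cnj z\<close>, so reflection gives the exact value
  \<open>pi / cosh (pi * t)\<close> of the squared modulus.\<close>

lemma norm_Gamma_half: "norm (Gamma (Complex (1/2) t)) \<le> 3 * exp (- pi * \<bar>t\<bar> / 2)"
proof -
  define z where "z = Complex (1/2) t"
  have "Gamma z * Gamma (1 - z) = of_real pi / sin (of_real pi * z)"
    by (rule Gamma_reflection_complex)
  moreover have "1 - z = cnj z"
    by (simp add: z_def complex_eq_iff)
  moreover have "sin (of_real pi * z) = of_real (cosh (pi * t))"
  proof -
    have "of_real pi * z = of_real (pi / 2) + \<i> * of_real (pi * t)"
      by (simp add: z_def complex_eq_iff)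
    then have "sin (of_real pi * z) = cos (\<i> * of_real (pi * t))"
      using sin_of_real[of "pi/2", where 'a = complex] cos_of_real[of "pi/2", where 'a = complex]
      by (simp only: sin_add) simp
    also have "\<dots> = of_real (cosh (pi * t))"
      by (simp add: cosh_conv_cos[symmetric] cosh_field_def flip: exp_of_real)
    finally show ?thesis .
  qed
  ultimately have "Gamma z * cnj (Gamma z) = of_real (pi / cosh (pi * t))"
    by (simp add: cnj_Gamma)
  then have "complex_of_real ((norm (Gamma z))\<^sup>2) = of_real (pi / cosh (pi * t))"
    by (simp only: complex_norm_square)
  then have eq: "(norm (Gamma z))\<^sup>2 = pi / cosh (pi * t)"
    by (simp only: of_real_eq_iff)
  have "exp (pi * \<bar>t\<bar>) / 2 \<le> cosh (pi * t)"
    by (cases "t \<ge> 0") (auto simp: cosh_field_def)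
  then have "pi / cosh (pi * t) \<le> pi / (exp (pi * \<bar>t\<bar>) / 2)"
    by (intro divide_left_mono mult_pos_pos) auto
  also have "\<dots> = 2 * pi * exp (- pi * \<bar>t\<bar>)"
    by (simp add: exp_minus field_simps)
  \<comment> \<open>The factor \<open>2 * pi\<close> is rounded up to the square of 3.\<close>
  also have "\<dots> \<le> 9 * exp (- pi * \<bar>t\<bar>)"
    using pi_less_4 by (intro mult_right_mono) auto
  also have "\<dots> = (3 * exp (- pi * \<bar>t\<bar> / 2))\<^sup>2"
    by (simp add: power_mult_distrib exp_double[symmetric])
  finally have "(norm (Gamma z))\<^sup>2 \<le> (3 * exp (- pi * \<bar>t\<bar> / 2))\<^sup>2"
    unfolding eq .
  then show ?thesis
    unfolding z_def by (rule power2_le_imp_le) auto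
qed

text \<open>Monotonicity in the abscissa bounds the strip by its right edge, where one application
  of the recurrence leads back to the line \<open>1/2\<close> and costs the factor
  \<open>1 + \<bar>t\<bar>\<close>.\<close>

lemma norm_Gamma_strip:
  obtains C where "C > 0"
    "\<And>a t. 1/2 \<le> a \<Longrightarrow> a \<le> 3/2 \<Longrightarrow> norm (Gamma (Complex a t)) \<le> C * (1 + \<bar>t\<bar>) * exp (- pi * \<bar>t\<bar> / 2)"
proof -
  have "compact (Gamma ` {1/2..3/2::real})"
    by (intro compact_continuous_image continuous_on_Gamma) (auto elim!: nonpos_Ints_cases)
  then obtain B where "\<forall>x\<in>Gamma ` {1/2..3/2::real}. norm x \<le> B"
    using compact_imp_bounded bounded_iff by metis
  then have B: "\<bar>Gamma (a::real)\<bar> \<le> B" if "1/2 \<le> a" "a \<le> 3/2" for a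
    using that by simp
  define G where "G = Gamma (3/2 :: real)"
  have G: "G > 0" by (simp add: G_def Gamma_real_pos)
  have B0: "B > 0"
    using B[of "3/2"] G abs_ge_self[of "Gamma (3/2 :: real)"] unfolding G_def by linarith
  have "norm (Gamma (Complex a t)) \<le> (3 * B / G) * (1 + \<bar>t\<bar>) * exp (- pi * \<bar>t\<bar> / 2)"
    if a: "1/2 \<le> a" "a \<le> 3/2" for a t
  proof -
    have np: "Complex (1/2) t \<notin> \<int>\<^sub>\<le>\<^sub>0"
      by (auto elim!: nonpos_Ints_cases simp: complex_eq_iff)
    have "Complex (3/2) t = Complex (1/2) t + 1"
      by (simp add: complex_eq_iff)
    then have "norm (Gamma (Complex (3/2) t)) = norm (Complex (1/2) t) * norm (Gamma (Complex (1/2) t))"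
      using Gamma_plus1[OF np] by (simp add: norm_mult)
    also have "\<dots> \<le> (1 + \<bar>t\<bar>) * (3 * exp (- pi * \<bar>t\<bar> / 2))"
      using cmod_le[of "Complex (1/2) t"] by (intro mult_mono norm_Gamma_half) auto
    finally have 1: "norm (Gamma (Complex (3/2) t)) \<le> (1 + \<bar>t\<bar>) * (3 * exp (- pi * \<bar>t\<bar> / 2))" .
    have "norm (Gamma (Complex a t)) * G \<le> norm (Gamma (Complex (3/2) t)) * Gamma a"
      unfolding G_def using a by (intro norm_Gamma_mono) auto
    also have "\<dots> \<le> ((1 + \<bar>t\<bar>) * (3 * exp (- pi * \<bar>t\<bar> / 2))) * B"
      using B[OF a] B0 a by (intro mult_mono 1) (auto intro: order.trans[OF abs_ge_self])
    finally show ?thesis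
      using G by (simp add: field_simps)
  qed
  then show thesis
    using B0 G by (intro that[of "3 * B / G"]) auto
qed

section \<open>Rectangular contours with estimated horizontal sides\<close>

lemma has_contour_integral_rectpath_bound:
  fixes f :: "complex \<Rightarrow> complex" and a b c d M1 M2 :: real
  assumes ab: "a < b" and cd: "c < d"
    and cont: "continuous_on (path_image (rectpath (Complex a c) (Complex b d))) f"
    and I: "(f has_contour_integral I) (rectpath (Complex a c) (Complex b d))"
    and M1: "\<And>x. a \<le> x \<Longrightarrow> x \<le> b \<Longrightarrow> norm (f (Complex x c)) \<le> M1"
    and M2: "\<And>x. a \<le> x \<Longrightarrow> x \<le> b \<Longrightarrow> norm (f (Complex x d)) \<le> M2"
  shows "norm (I - \<i> * (integral {c..d} (\<lambda>t. f (Complex b t)) - integral {c..d} (\<lambda>t. f (Complex a t))))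
          \<le> (b - a) * (M1 + M2)"
proof -
  define a1 a2 a3 a4 where "a1 = Complex a c" and "a2 = Complex b c" and "a3 = Complex b d" and "a4 = Complex a d"
  have rp: "rectpath (Complex a c) (Complex b d) = linepath a1 a2 +++ linepath a2 a3 +++ linepath a3 a4 +++ linepath a4 a1"
    by (simp add: rectpath_def Let_def a1_def a2_def a3_def a4_def)
  have img: "path_image (rectpath (Complex a c) (Complex b d)) =
     closed_segment a1 a2 \<union> closed_segment a2 a3 \<union> closed_segment a3 a4 \<union> closed_segment a4 a1"
    unfolding rp by (simp add: path_image_join Un_assoc)
  have int: "f contour_integrable_on linepath a1 a2" "f contour_integrable_on linepath a2 a3"
     "f contour_integrable_on linepath a3 a4" "f contour_integrable_on linepath a4 a1"
    using cont unfolding img by (auto intro!: contour_integrable_continuous_linepath elim: continuous_on_subset)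
  have "I = contour_integral (rectpath (Complex a c) (Complex b d)) f"
    using I by (simp add: contour_integral_unique)
  also have "\<dots> = contour_integral (linepath a1 a2) f + (contour_integral (linepath a2 a3) f +
      (contour_integral (linepath a3 a4) f + contour_integral (linepath a4 a1) f))"
    unfolding rp using int by (simp add: valid_path_join)
  finally have I_eq: "I = \<dots>" .
  have v1: "contour_integral (linepath a2 a3) f = \<i> * integral {c..d} (\<lambda>t. f (Complex b t))"
  proof -
    have "((\<lambda>x. f (Complex b x)) has_integral (- \<i> * contour_integral (linepath a2 a3) f)) {c..d}"
      using has_contour_integral_integral[OF int(2)] cd
      by (subst (asm) has_contour_integral_linepath_same_Re_iff[of _ b _ c d]) (auto simp: a2_def a3_def)
    then show ?thesis
      by (simp add: integral_unique mult.assoc[symmetric])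
  qed
  have v2: "contour_integral (linepath a4 a1) f = - \<i> * integral {c..d} (\<lambda>t. f (Complex a t))"
  proof -
    have "f contour_integrable_on linepath a1 a4"
      using contour_integrable_reversepath[OF valid_path_linepath int(4)] by simp
    then have "((\<lambda>x. f (Complex a x)) has_integral (- \<i> * contour_integral (linepath a1 a4) f)) {c..d}"
      using cd by (subst has_contour_integral_linepath_same_Re_iff[of a1 a a4 c d, symmetric])
        (auto simp: a1_def a4_def has_contour_integral_integral)
    then have "contour_integral (linepath a1 a4) f = \<i> * integral {c..d} (\<lambda>t. f (Complex a t))"
      by (simp add: integral_unique mult.assoc[symmetric])
    moreover have "contour_integral (linepath a4 a1) f = - contour_integral (linepath a1 a4) f"
      using contour_integral_reversepath[OF valid_path_linepath, of a1 a4 f] by simp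
    ultimately show ?thesis by simp
  qed
  have M0: "M1 \<ge> 0" "M2 \<ge> 0"
    using M1[of a] M2[of a] ab norm_ge_zero[of "f (Complex a c)"] norm_ge_zero[of "f (Complex a d)"] by linarith+
  have seg: "\<exists>x. z = Complex x v \<and> a \<le> x \<and> x \<le> b"
    if "z \<in> closed_segment (Complex u v) (Complex u' v)" "{u, u'} = {a, b}" for z u v u'
  proof -
    have "Im z = v \<and> Re z \<in> closed_segment u u'"
      using that(1) by (simp add: closed_segment_same_Im)
    moreover have "closed_segment u u' = {a..b}"
      using that(2) ab by (auto simp: doubleton_eq_iff closed_segment_eq_real_ivl)
    ultimately show ?thesis
      by (intro exI[of _ "Re z"]) (auto simp: complex_eq_iff)
  qed
  have h1: "norm (contour_integral (linepath a1 a2) f) \<le> M1 * norm (a2 - a1)"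
  proof (rule contour_integral_bound_linepath[OF int(1) M0(1)])
    fix z assume "z \<in> closed_segment a1 a2"
    then show "norm (f z) \<le> M1"
      using seg[of z a c b] M1 by (auto simp: a1_def a2_def)
  qed
  have h2: "norm (contour_integral (linepath a3 a4) f) \<le> M2 * norm (a4 - a3)"
  proof (rule contour_integral_bound_linepath[OF int(3) M0(2)])
    fix z assume "z \<in> closed_segment a3 a4"
    then show "norm (f z) \<le> M2"
      using seg[of z b d a] M2 by (auto simp: a3_def a4_def)
  qed
  have n: "norm (a2 - a1) = b - a" "norm (a4 - a3) = b - a"
    using ab by (simp_all add: a1_def a2_def a3_def a4_def cmod_def)
  have "I - \<i> * (integral {c..d} (\<lambda>t. f (Complex b t)) - integral {c..d} (\<lambda>t. f (Complex a t))) =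
      contour_integral (linepath a1 a2) f + contour_integral (linepath a3 a4) f"
    unfolding I_eq v1 v2 by (simp add: algebra_simps)
  also have "norm \<dots> \<le> (b - a) * (M1 + M2)"
    using norm_triangle_ineq[of "contour_integral (linepath a1 a2) f" "contour_integral (linepath a3 a4) f"] h1 h2
    unfolding n by (simp add: algebra_simps)
  finally show ?thesis .
qed

lemma path_image_rectpath_Complex:
  assumes "a \<le> b" "c \<le> d"
  shows "path_image (rectpath (Complex a c) (Complex b d)) \<subseteq> {z. a \<le> Re z \<and> Re z \<le> b \<and> c \<le> Im z \<and> Im z \<le> d}"
  using assms by (subst path_image_rectpath) auto

lemma Cauchy_rectangle_zero:
  fixes f :: "complex \<Rightarrow> complex" and a b c d M1 M2 :: real
  assumes ab: "a < b" and cd: "c < d" and S: "convex S" "f holomorphic_on S"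
    and sub: "{z. a \<le> Re z \<and> Re z \<le> b \<and> c \<le> Im z \<and> Im z \<le> d} \<subseteq> S"
    and M1: "\<And>x. a \<le> x \<Longrightarrow> x \<le> b \<Longrightarrow> norm (f (Complex x c)) \<le> M1"
    and M2: "\<And>x. a \<le> x \<Longrightarrow> x \<le> b \<Longrightarrow> norm (f (Complex x d)) \<le> M2"
  shows "norm (integral {c..d} (\<lambda>t. f (Complex b t)) - integral {c..d} (\<lambda>t. f (Complex a t)))
          \<le> (b - a) * (M1 + M2)"
proof -
  have img: "path_image (rectpath (Complex a c) (Complex b d)) \<subseteq> S"
    using path_image_rectpath_Complex[of a b c d] ab cd sub by auto
  have "(f has_contour_integral 0) (rectpath (Complex a c) (Complex b d))"
    by (rule Cauchy_theorem_convex_simple[OF S(2,1)]) (use img in auto)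
  moreover have "continuous_on (path_image (rectpath (Complex a c) (Complex b d))) f"
    using S img by (auto intro: holomorphic_on_imp_continuous_on continuous_on_subset)
  ultimately have "norm (0 - \<i> * (integral {c..d} (\<lambda>t. f (Complex b t)) - integral {c..d} (\<lambda>t. f (Complex a t))))
          \<le> (b - a) * (M1 + M2)"
    using ab cd M1 M2 by (intro has_contour_integral_rectpath_bound) auto
  then show ?thesis
    by (simp add: norm_mult norm_minus_commute)
qed

lemma Cauchy_rectangle_formula:
  fixes g :: "complex \<Rightarrow> complex" and a b c d M1 M2 :: real
  assumes S: "convex S" "open S" "g holomorphic_on S"
    and sub: "{z. a \<le> Re z \<and> Re z \<le> b \<and> c \<le> Im z \<and> Im z \<le> d} \<subseteq> S"
    and z: "a < Re z" "Re z < b" "c < Im z" "Im z < d"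
    and M1: "\<And>x. a \<le> x \<Longrightarrow> x \<le> b \<Longrightarrow> norm (g (Complex x c) / (Complex x c - z)) \<le> M1"
    and M2: "\<And>x. a \<le> x \<Longrightarrow> x \<le> b \<Longrightarrow> norm (g (Complex x d) / (Complex x d - z)) \<le> M2"
  shows "norm (2 * of_real pi * g z - (integral {c..d} (\<lambda>t. g (Complex b t) / (Complex b t - z))
            - integral {c..d} (\<lambda>t. g (Complex a t) / (Complex a t - z)))) \<le> (b - a) * (M1 + M2)"
proof -
  define p where "p = rectpath (Complex a c) (Complex b d)"
  have img: "path_image p \<subseteq> S - {z}"
    using z sub unfolding p_def by (subst path_image_rectpath) auto
  have "((\<lambda>w. g w / (w - z)) has_contour_integral (2 * pi * \<i> * winding_number p z * g z)) p"
    using z sub img S by (intro Cauchy_integral_formula_convex_simple[of S])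
      (auto simp: interior_open p_def)
  moreover have "winding_number p z = 1"
    unfolding p_def using z by (intro winding_number_rectpath) (auto simp: in_box_complex_iff)
  moreover have "continuous_on (path_image p) (\<lambda>w. g w / (w - z))"
    using img by (auto intro!: continuous_intros continuous_on_subset[OF holomorphic_on_imp_continuous_on[OF S(3)]])
  ultimately have "norm (2 * pi * \<i> * 1 * g z - \<i> * (integral {c..d} (\<lambda>t. g (Complex b t) / (Complex b t - z))
            - integral {c..d} (\<lambda>t. g (Complex a t) / (Complex a t - z)))) \<le> (b - a) * (M1 + M2)"
    using z M1 M2 unfolding p_def by (intro has_contour_integral_rectpath_bound) auto
  also have "2 * pi * \<i> * 1 * g z - \<i> * X = \<i> * (2 * of_real pi * g z - X)" for X
    by (simp add: algebra_simps)
  finally show ?thesis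
    by (simp add: norm_mult)
qed

text \<open>Dominated convergence. It is the bridge from gauge integrals over bounded sets, where
  the calculus and the contour integrals live, to Lebesgue integrals over unbounded ones.\<close>

lemma set_lebesgue_integral_limit:
  fixes F :: "real \<Rightarrow> complex"
  assumes F: "set_integrable lborel T F" and S: "\<And>n. S n \<in> sets borel" "\<And>n. S n \<subseteq> T"
    and ev: "\<And>t. t \<in> T \<Longrightarrow> eventually (\<lambda>n. t \<in> S n) sequentially"
  shows "(\<lambda>n. integral (S n) F) \<longlonglongrightarrow> (LINT t:T|lborel. F t)"
proof -
  have si: "set_integrable lborel (S n) F" for n
    by (rule set_integrable_subset[OF F]) (use S in auto)
  have "(\<lambda>n. LINT t|lborel. indicator (S n) t *\<^sub>R F t) \<longlonglongrightarrow> (LINT t|lborel. indicator T t *\<^sub>R F t)"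
  proof (rule integral_dominated_convergence[where w = "\<lambda>t. norm (indicator T t *\<^sub>R F t)"])
    show "integrable lborel (\<lambda>t. norm (indicator T t *\<^sub>R F t))"
      using F unfolding set_integrable_def by (rule integrable_norm)
    show "(\<lambda>t. indicator T t *\<^sub>R F t) \<in> borel_measurable lborel"
      using F unfolding set_integrable_def by (rule borel_measurable_integrable)
    show "(\<lambda>t. indicator (S n) t *\<^sub>R F t) \<in> borel_measurable lborel" for n
      using si[of n] unfolding set_integrable_def by (rule borel_measurable_integrable)
    show "AE t in lborel. (\<lambda>n. indicator (S n) t *\<^sub>R F t) \<longlonglongrightarrow> indicator T t *\<^sub>R F t"
    proof (rule AE_I2)
      fix t
      have "eventually (\<lambda>n. indicator (S n) t *\<^sub>R F t = indicator T t *\<^sub>R F t) sequentially"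
      proof (cases "t \<in> T")
        case True
        from ev[OF this] show ?thesis by eventually_elim (use True in auto)
      next
        case False
        then have "t \<notin> S n" for n using S by auto
        then show ?thesis using False by auto
      qed
      then show "(\<lambda>n. indicator (S n) t *\<^sub>R F t) \<longlonglongrightarrow> indicator T t *\<^sub>R F t"
        by (rule tendsto_eventually)
    qed
    show "AE t in lborel. norm (indicator (S n) t *\<^sub>R F t) \<le> norm (indicator T t *\<^sub>R F t)" for n
      using S(2)[of n] by (intro AE_I2) (auto simp: indicator_def)
  qed
  moreover have "integral (S n) F = (LINT t|lborel. indicator (S n) t *\<^sub>R F t)" for n
    using set_borel_integral_eq_integral(2)[OF si[of n]] by (simp add: set_lebesgue_integral_def)
  ultimately show ?thesis
    by (simp add: set_lebesgue_integral_def)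
qed

section \<open>Exponentially decaying integrands and shifts of vertical lines\<close>

lemma integrable_exp_neg_Ici:
  fixes \<alpha> c :: real
  assumes "\<alpha> > 0"
  shows "set_integrable lborel {c..} (\<lambda>t. exp (- \<alpha> * t))"
    and "(LINT t:{c..}|lborel. exp (- \<alpha> * t)) = exp (- \<alpha> * c) / \<alpha>"
proof -
  have nn: "(\<integral>\<^sup>+t. ennreal (indicator {c..} t * exp (- \<alpha> * t)) \<partial>lborel) = ennreal (exp (- \<alpha> * c) / \<alpha>)"
    using nn_integral_has_integral_lebesgue[OF _ has_integral_exp_minus_to_infinity[OF assms, of c]] by simp
  have "has_bochner_integral lborel (\<lambda>t. indicator {c..} t * exp (- \<alpha> * t)) (exp (- \<alpha> * c) / \<alpha>)"
    using nn assms by (intro has_bochner_integral_nn_integral) auto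
  then show "set_integrable lborel {c..} (\<lambda>t. exp (- \<alpha> * t))"
    "(LINT t:{c..}|lborel. exp (- \<alpha> * t)) = exp (- \<alpha> * c) / \<alpha>"
    by (simp_all add: has_bochner_integral_iff set_integrable_def set_lebesgue_integral_def)
qed

lemma integrable_exp_neg_abs:
  fixes \<alpha> :: real
  assumes "\<alpha> > 0"
  shows "integrable lborel (\<lambda>t. exp (- \<alpha> * \<bar>t\<bar>))"
    and "(LINT t|lborel. exp (- \<alpha> * \<bar>t\<bar>)) \<le> 2 / \<alpha>"
proof -
  define h where "h = (\<lambda>t. indicator {0..} t * exp (- \<alpha> * t))"
  have h: "integrable lborel h" "(LINT t|lborel. h t) = 1 / \<alpha>"
    using integrable_exp_neg_Ici[OF assms, of 0] by (simp_all add: h_def set_integrable_def set_lebesgue_integral_def)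
  have h': "integrable lborel (\<lambda>t. h (0 + (-1) * t))" "(LINT t|lborel. h (0 + (-1) * t)) = 1 / \<alpha>"
    using h lborel_integrable_real_affine[of h "-1" 0] lborel_integral_real_affine[of "-1" h 0] by simp_all
  have sum: "integrable lborel (\<lambda>t. h t + h (0 + (-1) * t))"
    by (intro Bochner_Integration.integrable_add h h')
  have le: "exp (- \<alpha> * \<bar>t\<bar>) \<le> h t + h (0 + (-1) * t)" for t
    by (auto simp: h_def indicator_def)
  show int: "integrable lborel (\<lambda>t. exp (- \<alpha> * \<bar>t\<bar>))"
    by (rule Bochner_Integration.integrable_bound[OF sum])
       (use le in \<open>auto intro!: AE_I2 order.trans[OF _ abs_ge_self]\<close>)
  have "(LINT t|lborel. exp (- \<alpha> * \<bar>t\<bar>)) \<le> (LINT t|lborel. h t + h (0 + (-1) * t))"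
    by (intro integral_mono int sum le)
  also have "\<dots> = 2 / \<alpha>"
    using h h' by simp
  finally show "(LINT t|lborel. exp (- \<alpha> * \<bar>t\<bar>)) \<le> 2 / \<alpha>" .
qed

text \<open>Lets a linear factor be paid for by an arbitrarily small share \<open>\<beta>\<close> of
  an exponential rate.\<close>

lemma add_le_exp:
  fixes \<beta> x :: real
  assumes "\<beta> > 0" "x \<ge> 0"
  shows "1 + x \<le> (1 + 1 / \<beta>) * exp (\<beta> * x)"
proof -
  have "1 + \<beta> * x \<le> exp (\<beta> * x)"
    by (rule exp_ge_add_one_self)
  then have "\<beta> * x \<le> exp (\<beta> * x)" by linarith
  then have "x \<le> 1 / \<beta> * exp (\<beta> * x)"
    using assms by (simp add: field_simps)
  moreover have "1 \<le> exp (\<beta> * x)"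
    using assms by simp
  ultimately show ?thesis
    unfolding distrib_right by linarith
qed

lemma integrable_line_exp_bound:
  fixes F :: "real \<Rightarrow> complex" and K \<alpha> :: real
  assumes cont: "continuous_on UNIV F" and \<alpha>: "\<alpha> > 0"
    and bound: "\<And>t. norm (F t) \<le> K * exp (- \<alpha> * \<bar>t\<bar>)"
  shows "integrable lborel F" and "norm (LINT t|lborel. F t) \<le> K * (2 / \<alpha>)"
proof -
  have K: "K \<ge> 0"
    using order.trans[OF norm_ge_zero bound[of 0]] by simp
  have int: "integrable lborel (\<lambda>t. K * exp (- \<alpha> * \<bar>t\<bar>))"
    by (intro integrable_mult_right integrable_exp_neg_abs \<alpha>)
  show F: "integrable lborel F"
  proof (rule Bochner_Integration.integrable_bound[OF int])
    show "F \<in> borel_measurable lborel"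
      using borel_measurable_continuous_onI[OF cont] by simp
    show "AE t in lborel. norm (F t) \<le> norm (K * exp (- \<alpha> * \<bar>t\<bar>))"
      using bound K by (intro AE_I2) (simp add: abs_mult)
  qed
  have "norm (LINT t|lborel. F t) \<le> (LINT t|lborel. norm (F t))"
    by (rule integral_norm_bound)
  also have "\<dots> \<le> (LINT t|lborel. K * exp (- \<alpha> * \<bar>t\<bar>))"
    by (intro integral_mono integrable_norm F int bound)
  also have "\<dots> = K * (LINT t|lborel. exp (- \<alpha> * \<bar>t\<bar>))"
    by simp
  also have "\<dots> \<le> K * (2 / \<alpha>)"
    by (intro mult_left_mono integrable_exp_neg_abs \<alpha> K)
  finally show "norm (LINT t|lborel. F t) \<le> K * (2 / \<alpha>)" .
qed

text \<open>A simple pole is presented as the explicit factor \<open>1 / (s - z)\<close>, so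
  Cauchy's formula does the work and the residue is \<open>g z\<close>. Heights
  \<open>\<bar>t\<bar> \<ge> 1\<close> keep away from the real point \<open>z\<close>; letting the
  rectangle grow removes the horizontal sides.\<close>

lemma line_shift_pole:
  fixes g :: "complex \<Rightarrow> complex" and a b :: real and M :: "real \<Rightarrow> real"
  assumes S: "convex S" "open S" "g holomorphic_on S"
    and sub: "{s. a \<le> Re s \<and> Re s \<le> b} \<subseteq> S"
    and z: "a < Re z" "Re z < b" "Im z = 0"
    and int: "integrable lborel (\<lambda>t. g (Complex a t) / (Complex a t - z))"
             "integrable lborel (\<lambda>t. g (Complex b t) / (Complex b t - z))"
    and M: "\<And>x t. a \<le> x \<Longrightarrow> x \<le> b \<Longrightarrow> \<bar>t\<bar> \<ge> 1 \<Longrightarrow> norm (g (Complex x t) / (Complex x t - z)) \<le> M \<bar>t\<bar>"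
    and lim: "(M \<longlongrightarrow> 0) at_top"
  shows "(LINT t|lborel. g (Complex b t) / (Complex b t - z)) - (LINT t|lborel. g (Complex a t) / (Complex a t - z))
           = 2 * of_real pi * g z"
proof -
  have L: "(\<lambda>n. integral {- real n..real n} F) \<longlonglongrightarrow> (LINT t|lborel. F t)" if "integrable lborel F" for F :: "real \<Rightarrow> complex"
  proof -
    have "(\<lambda>n. integral {- real n..real n} F) \<longlonglongrightarrow> (LINT t:UNIV|lborel. F t)"
    proof (rule set_lebesgue_integral_limit)
      fix t :: real
      have "eventually (\<lambda>n. real n \<ge> \<bar>t\<bar>) sequentially"
        using eventually_ge_at_top[of "nat \<lceil>\<bar>t\<bar>\<rceil>"] by eventually_elim linarith
      then show "eventually (\<lambda>n. t \<in> {- real n..real n}) sequentially"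
        by eventually_elim auto
    qed (use that in \<open>auto simp: set_integrable_def\<close>)
    then show ?thesis by (simp add: set_lebesgue_integral_def)
  qed
  define Fa Fb where "Fa = (\<lambda>t. g (Complex a t) / (Complex a t - z))" and "Fb = (\<lambda>t. g (Complex b t) / (Complex b t - z))"
  define X where "X = 2 * of_real pi * g z"
  have bd: "norm (X - (integral {- real n..real n} Fb - integral {- real n..real n} Fa)) \<le> (b - a) * (M (real n) + M (real n))"
    if n: "n \<ge> 1" for n :: nat
    unfolding X_def Fa_def Fb_def
    using n z sub by (intro Cauchy_rectangle_formula[OF S]) (auto intro: order.trans[OF M])
  have "(\<lambda>n. norm (X - (integral {- real n..real n} Fb - integral {- real n..real n} Fa))) \<longlonglongrightarrow> norm (X - ((LINT t|lborel. Fb t) - (LINT t|lborel. Fa t)))"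
    using int unfolding Fa_def Fb_def by (intro tendsto_intros L)
  moreover have "(\<lambda>n. (b - a) * (M (real n) + M (real n))) \<longlonglongrightarrow> (b - a) * (0 + 0)"
    by (intro tendsto_intros filterlim_compose[OF lim filterlim_real_sequentially])
  ultimately have "norm (X - ((LINT t|lborel. Fb t) - (LINT t|lborel. Fa t))) \<le> (b - a) * (0 + 0)"
    using bd by (intro LIMSEQ_le) auto
  then show ?thesis
    by (simp add: X_def Fa_def Fb_def)
qed

section \<open>Mellin inversion of the exponential\<close>

lemma norm_exp_Complex_mult:
  "norm (exp (- (Complex a t) * l)) = exp (- a * Re l) * exp (t * Im l)"
  by (simp add: exp_add[symmetric])

lemma continuous_on_Gamma_line:
  assumes "\<And>t. Complex a t \<notin> \<int>\<^sub>\<le>\<^sub>0"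
  shows "continuous_on A (\<lambda>t. Gamma (Complex a t))"
proof (rule continuous_on_compose2[of "- \<int>\<^sub>\<le>\<^sub>0" Gamma])
  show "continuous_on (- \<int>\<^sub>\<le>\<^sub>0) (Gamma :: complex \<Rightarrow> complex)"
    by (intro continuous_on_Gamma) auto
  show "continuous_on A (\<lambda>t. Complex a t)"
    unfolding Complex_eq by (intro continuous_intros)
qed (use assms in auto)

text \<open>
  Mellin inversion of the exponential, with complex \<open>x = exp l\<close> in the right half-plane: moving the line
  to the left past the poles of \<open>\<Gamma>\<close> produces the exponential series.
\<close>

lemma Gamma_inversion:
  fixes l :: complex
  assumes l: "\<bar>Im l\<bar> < pi / 2"
  shows "integrable lborel (\<lambda>t. Gamma (Complex (3/2) t) * exp (- Complex (3/2) t * l))"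
    and "(LINT t|lborel. Gamma (Complex (3/2) t) * exp (- Complex (3/2) t * l)) = 2 * of_real pi * exp (- exp l)"
proof -
  \<comment> \<open>The rate that remains when the decay
    \<open>exp (- pi * \<bar>t\<bar> / 2)\<close> of \<open>Gamma\<close> meets the growth
    \<open>exp (t * Im l)\<close>.\<close>
  define \<delta> where "\<delta> = pi / 2 - \<bar>Im l\<bar>"
  have \<delta>: "\<delta> > 0" using l by (simp add: \<delta>_def)
  define F where "F = (\<lambda>a t. Gamma (Complex a t) * exp (- Complex a t * l))"
  define x where "x = exp (Re l)"
  obtain C where C: "C > 0"
    "\<And>a t. 1/2 \<le> a \<Longrightarrow> a \<le> 3/2 \<Longrightarrow> norm (Gamma (Complex a t)) \<le> C * (1 + \<bar>t\<bar>) * exp (- pi * \<bar>t\<bar> / 2)"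
    using norm_Gamma_strip by blast
  have dec: "exp (- pi * \<bar>t\<bar> / 2) * exp (t * Im l) \<le> exp (- \<delta> * \<bar>t\<bar>)" for t
  proof -
    have "t * Im l \<le> \<bar>t\<bar> * \<bar>Im l\<bar>"
      by (metis abs_ge_self abs_mult)
    then show ?thesis
      by (subst exp_add[symmetric]) (simp add: \<delta>_def algebra_simps)
  qed
  have lin: "(1 + \<bar>t\<bar>) * exp (- \<delta> * \<bar>t\<bar>) \<le> (1 + 2 / \<delta>) * exp (- (\<delta> / 2) * \<bar>t\<bar>)" for t
  proof -
    have "(1 + \<bar>t\<bar>) * exp (- \<delta> * \<bar>t\<bar>) \<le> ((1 + 1 / (\<delta> / 2)) * exp ((\<delta> / 2) * \<bar>t\<bar>)) * exp (- \<delta> * \<bar>t\<bar>)"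
      using \<delta> by (intro mult_right_mono add_le_exp) auto
    also have "\<dots> = (1 + 1 / (\<delta> / 2)) * (exp ((\<delta> / 2) * \<bar>t\<bar>) * exp (- \<delta> * \<bar>t\<bar>))"
      by (rule mult.assoc)
    also have "exp ((\<delta> / 2) * \<bar>t\<bar>) * exp (- \<delta> * \<bar>t\<bar>) = exp (- (\<delta> / 2) * \<bar>t\<bar>)"
      by (subst exp_add[symmetric]) (simp add: field_simps)
    finally show ?thesis by simp
  qed
  \<comment> \<open>\<open>Gamma\<close> sits at the abscissa \<open>a + y\<close> inside the strip,
    the exponential at \<open>y\<close>. The offset \<open>a\<close> serves lines far to the left,
    where the recurrence first moves \<open>Gamma\<close> into the strip.\<close>
  have strip: "norm (Gamma (Complex (a + y) t) * exp (- Complex y t * l)) \<le> C * ((1 + \<bar>t\<bar>) * exp (- \<delta> * \<bar>t\<bar>)) * exp (\<bar>y\<bar> * \<bar>Re l\<bar>)"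
    if a: "1/2 \<le> a + y" "a + y \<le> 3/2" for a y t
  proof -
    have "- y * Re l \<le> \<bar>y\<bar> * \<bar>Re l\<bar>"
      by (metis abs_ge_self abs_mult abs_minus_cancel)
    then have "norm (exp (- Complex y t * l)) \<le> exp (\<bar>y\<bar> * \<bar>Re l\<bar>) * exp (t * Im l)"
      unfolding norm_exp_Complex_mult by (intro mult_right_mono) auto
    then have "norm (Gamma (Complex (a + y) t) * exp (- Complex y t * l)) \<le>
      (C * (1 + \<bar>t\<bar>) * exp (- pi * \<bar>t\<bar> / 2)) * (exp (\<bar>y\<bar> * \<bar>Re l\<bar>) * exp (t * Im l))"
      unfolding norm_mult using C a by (intro mult_mono) auto
    also have "\<dots> = C * (1 + \<bar>t\<bar>) * exp (\<bar>y\<bar> * \<bar>Re l\<bar>) * (exp (- pi * \<bar>t\<bar> / 2) * exp (t * Im l))"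
      by (simp only: mult_ac)
    also have "\<dots> \<le> C * (1 + \<bar>t\<bar>) * exp (\<bar>y\<bar> * \<bar>Re l\<bar>) * exp (- \<delta> * \<bar>t\<bar>)"
      using C by (intro mult_left_mono dec) auto
    finally show ?thesis by (simp only: mult_ac)
  qed
  have cont: "continuous_on UNIV (F a)" if "\<And>t. Complex a t \<notin> \<int>\<^sub>\<le>\<^sub>0" for a
    unfolding F_def using continuous_on_Gamma_line[OF that]
    by (intro continuous_on_mult) (auto intro!: continuous_intros simp: Complex_eq)
  have np: "s \<notin> \<int>\<^sub>\<le>\<^sub>0" if "Re s > 0" for s :: complex
    using that by (auto elim!: nonpos_Ints_cases)
  have nph: "Complex (1/2 - real k) t \<notin> \<int>\<^sub>\<le>\<^sub>0" for k t
  proof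
    assume "Complex (1/2 - real k) t \<in> \<int>\<^sub>\<le>\<^sub>0"
    then obtain m :: int where "Complex (1/2 - real k) t = of_int m"
      by (auto elim!: nonpos_Ints_cases)
    then have "1/2 - real k = of_int m"
      by (simp add: complex_eq_iff)
    then have "real_of_int 1 = real_of_int (2 * (m + int k))"
      by simp
    then have "1 = 2 * (m + int k)"
      by (simp only: of_int_eq_iff)
    then show False by presburger
  qed
  have F32: "norm (F (3/2) t) \<le> (C * (1 + 2 / \<delta>) * exp (3/2 * \<bar>Re l\<bar>)) * exp (- (\<delta> / 2) * \<bar>t\<bar>)" for t
  proof -
    have "norm (F (3/2) t) \<le> C * ((1 + \<bar>t\<bar>) * exp (- \<delta> * \<bar>t\<bar>)) * exp (3/2 * \<bar>Re l\<bar>)"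
      using strip[of 0 "3/2" t] by (simp add: F_def)
    also have "\<dots> \<le> C * ((1 + 2 / \<delta>) * exp (- (\<delta> / 2) * \<bar>t\<bar>)) * exp (3/2 * \<bar>Re l\<bar>)"
      using C by (intro mult_right_mono mult_left_mono lin) auto
    finally show ?thesis by (simp only: mult_ac)
  qed
  have int32: "integrable lborel (F (3/2))"
    by (rule integrable_line_exp_bound(1)[OF cont _ F32]) (use \<delta> np in auto)
  then show "integrable lborel (\<lambda>t. Gamma (Complex (3/2) t) * exp (- Complex (3/2) t * l))"
    by (simp add: F_def)
  \<comment> \<open>On the line at \<open>1/2 - k\<close>, half-way between two poles, the
    recurrence \<open>Gamma s = Gamma (s + 1) / s\<close> has been used \<open>k\<close> times with
    denominators of modulus at least \<open>1/2\<close>, \<open>3/2\<close>, and so on. Their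
    product \<open>pochhammer (1/2) k\<close> beats \<open>x ^ k\<close>, so the integrals tend to
    0.\<close>
  define B where "B = (\<lambda>k. 3 * exp (- Re l / 2) * (x ^ k / pochhammer (1/2) k))"
  have poch: "pochhammer (1/2 :: real) k > 0" for k
    by (intro pochhammer_pos) auto
  have FB: "norm (F (1/2 - real k) t) \<le> B k * exp (- \<delta> * \<bar>t\<bar>)" for k t
  proof (induction k)
    case 0
    have "norm (F (1/2) t) \<le> (3 * exp (- pi * \<bar>t\<bar> / 2)) * (exp (- Re l / 2) * exp (t * Im l))"
      unfolding F_def norm_mult norm_exp_Complex_mult by (intro mult_mono norm_Gamma_half) auto
    also have "\<dots> = 3 * exp (- Re l / 2) * (exp (- pi * \<bar>t\<bar> / 2) * exp (t * Im l))"
      by (simp only: mult_ac)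
    also have "\<dots> \<le> 3 * exp (- Re l / 2) * exp (- \<delta> * \<bar>t\<bar>)"
      by (intro mult_left_mono dec) auto
    finally show ?case by (simp add: B_def)
  next
    case (Suc k)
    define s where "s = Complex (1/2 - real (Suc k)) t"
    have s1: "Complex (1/2 - real k) t = s + 1"
      by (simp add: s_def complex_eq_iff)
    have ns: "norm s \<ge> 1/2 + real k"
      using abs_Re_le_cmod[of s] by (simp add: s_def)
    have s0: "s \<noteq> 0"
      using ns by auto
    have "Gamma s = Gamma (s + 1) / s"
      using Gamma_plus1[of s] nph[of "Suc k" t] s0 by (simp add: s_def)
    moreover have "exp (- s * l) = exp (- (s + 1) * l) * exp l"
      by (subst exp_add[symmetric]) (simp add: algebra_simps)
    ultimately have "F (1/2 - real (Suc k)) t = F (1/2 - real k) t * exp l / s"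
      unfolding F_def s1 s_def[symmetric] by simp
    then have "norm (F (1/2 - real (Suc k)) t) = norm (F (1/2 - real k) t) * (x / norm s)"
      by (simp add: norm_mult norm_divide x_def)
    also have "\<dots> \<le> (B k * exp (- \<delta> * \<bar>t\<bar>)) * (x / (1/2 + real k))"
    proof -
      have "0 \<le> B k * exp (- \<delta> * \<bar>t\<bar>)"
        by (rule order.trans[OF norm_ge_zero Suc.IH])
      then show ?thesis
        using Suc.IH ns by (intro mult_mono divide_left_mono mult_pos_pos) (auto simp: x_def)
    qed
    also have "\<dots> = B (Suc k) * exp (- \<delta> * \<bar>t\<bar>)"
      by (simp add: B_def pochhammer_Suc)
    finally show ?case .
  qed
  define J where "J = (\<lambda>k. LINT t|lborel. F (1/2 - real k) t)"
  have intk: "integrable lborel (F (1/2 - real k))" and Jk: "norm (J k) \<le> B k * (2 / \<delta>)" for k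
    using integrable_line_exp_bound[OF cont \<delta> FB[of k]] nph by (auto simp: J_def)
  have Blim: "B \<longlonglongrightarrow> 0"
  proof -
    have pf: "fact k / 2 ^ k \<le> pochhammer (1/2 :: real) k" for k
    proof (induction k)
      case (Suc k)
      have "fact (Suc k) / 2 ^ Suc k = fact k / 2 ^ k * ((1 + real k) / 2)"
        by (simp add: mult_ac)
      also have "\<dots> \<le> pochhammer (1/2) k * (1/2 + real k)"
        using poch[of k] by (intro mult_mono Suc) auto
      finally show ?case by (simp add: pochhammer_Suc)
    qed simp
    have "(\<lambda>k. inverse (fact k) * (2 * x) ^ k) \<longlonglongrightarrow> 0"
      by (intro summable_LIMSEQ_zero summable_exp)
    then have lim: "(\<lambda>k. 3 * exp (- Re l / 2) * (inverse (fact k) * (2 * x) ^ k)) \<longlonglongrightarrow> 0"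
      by (rule tendsto_mult_right_zero)
    show ?thesis
    proof (rule tendsto_sandwich[OF _ _ tendsto_const lim]; intro always_eventually allI)
      fix k
      show "0 \<le> B k"
        unfolding B_def using poch[of k] by (intro mult_nonneg_nonneg divide_nonneg_nonneg) (auto simp: x_def)
      have "x ^ k / pochhammer (1/2) k \<le> x ^ k / (fact k / 2 ^ k)"
        using poch[of k] pf[of k] by (intro divide_left_mono mult_pos_pos) (auto simp: x_def)
      also have "\<dots> = inverse (fact k) * (2 * x) ^ k"
        by (simp add: field_simps)
      finally show "B k \<le> 3 * exp (- Re l / 2) * (inverse (fact k) * (2 * x) ^ k)"
        unfolding B_def by (intro mult_left_mono) auto
    qed
  qed
  have Jlim: "J \<longlonglongrightarrow> 0"
  proof (rule Lim_null_comparison)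
    show "eventually (\<lambda>k. norm (J k) \<le> B k * (2 / \<delta>)) sequentially"
      using Jk by auto
    show "(\<lambda>k. B k * (2 / \<delta>)) \<longlonglongrightarrow> 0"
      by (rule tendsto_mult_left_zero[OF Blim])
  qed
  have Mlim: "((\<lambda>t. C * ((1 + t) * exp (- \<delta> * t)) * K) \<longlongrightarrow> 0) at_top" for K :: real
    using \<delta> by real_asymp
  have J0: "J 0 = (LINT t|lborel. F (3/2) t)"
  proof -
    \<comment> \<open>No pole separates the lines \<open>1/2\<close> and \<open>3/2\<close>. The
      factor \<open>s - 1\<close> creates a removable one at 1 with \<open>g 1 = 0\<close>, so that
      \<open>line_shift_pole\<close> applies with residue 0.\<close>
    define g where "g = (\<lambda>s. Gamma s * exp (- s * l) * (s - 1))"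
    have gF: "g (Complex a t) / (Complex a t - 1) = F a t" if "a \<noteq> 1" for a t
      using that by (simp add: g_def F_def complex_eq_iff)
    have gF': "norm (g (Complex a t) / (Complex a t - 1)) \<le> norm (F a t)" for a t
      by (cases "Complex a t = 1") (auto simp: g_def F_def norm_mult norm_divide)
    have "(LINT t|lborel. g (Complex (3/2) t) / (Complex (3/2) t - 1)) - (LINT t|lborel. g (Complex (1/2) t) / (Complex (1/2) t - 1))
           = 2 * of_real pi * g 1"
    proof (rule line_shift_pole[where S = "{s. Re s > 0}" and M = "\<lambda>t. C * ((1 + t) * exp (- \<delta> * t)) * exp (3/2 * \<bar>Re l\<bar>)"])
      show "g holomorphic_on {s. Re s > 0}"
        unfolding g_def using np by (intro holomorphic_intros) auto
      show "integrable lborel (\<lambda>t. g (Complex (1/2) t) / (Complex (1/2) t - 1))"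
        "integrable lborel (\<lambda>t. g (Complex (3/2) t) / (Complex (3/2) t - 1))"
        using intk[of 0] int32 by (simp_all add: gF)
      fix a t :: real assume a: "1/2 \<le> a" "a \<le> 3/2" "\<bar>t\<bar> \<ge> 1"
      have "norm (g (Complex a t) / (Complex a t - 1)) \<le> norm (F a t)"
        by (rule gF')
      also have "\<dots> \<le> C * ((1 + \<bar>t\<bar>) * exp (- \<delta> * \<bar>t\<bar>)) * exp (\<bar>a\<bar> * \<bar>Re l\<bar>)"
        using strip[of 0 a t] a by (simp add: F_def)
      also have "\<dots> \<le> C * ((1 + \<bar>t\<bar>) * exp (- \<delta> * \<bar>t\<bar>)) * exp (3/2 * \<bar>Re l\<bar>)"
      proof (intro mult_left_mono)
        show "exp (\<bar>a\<bar> * \<bar>Re l\<bar>) \<le> exp (3/2 * \<bar>Re l\<bar>)"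
          using mult_right_mono[of "\<bar>a\<bar>" "3/2" "\<bar>Re l\<bar>"] a by simp
      qed (use C in auto)
      finally show "norm (g (Complex a t) / (Complex a t - 1)) \<le> C * ((1 + \<bar>t\<bar>) * exp (- \<delta> * \<bar>t\<bar>)) * exp (3/2 * \<bar>Re l\<bar>)" .
    qed (use Mlim in \<open>auto simp: convex_halfspace_Re_gt open_halfspace_Re_gt\<close>)
    then show ?thesis
      by (simp add: gF) (simp add: g_def J_def)
  qed
  have step: "J k - J (Suc k) = 2 * of_real pi * ((- exp l) ^ k /\<^sub>R fact k)" for k
  proof -
    \<comment> \<open>Away from the poles this equals
      \<open>Gamma s * exp (- s * l) * (s + k)\<close>. Written with
      \<open>Gamma (s + of_nat (Suc k))\<close>, whose argument has positive real part between the
      two lines, it is visibly holomorphic at \<open>- k\<close>.\<close>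
    define g where "g = (\<lambda>s. Gamma (s + of_nat (Suc k)) * exp (- s * l) / pochhammer s k)"
    have gF: "g s / (s - (- of_nat k)) = Gamma s * exp (- s * l)" if "s \<notin> \<int>\<^sub>\<le>\<^sub>0" for s
    proof -
      have "Gamma (s + of_nat (Suc k)) = Gamma s * pochhammer s (Suc k)"
        using pochhammer_Gamma[OF that, of "Suc k"] that by (simp add: Gamma_eq_zero_iff)
      moreover have "pochhammer s (Suc k) = pochhammer s k * (s - (- of_nat k))"
        by (simp add: pochhammer_Suc)
      moreover have "pochhammer s (Suc k) \<noteq> 0"
        using that by (auto simp: pochhammer_eq_0_iff)
      ultimately show ?thesis
        unfolding g_def by auto
    qed
    have lines: "(\<lambda>t. g (Complex (1/2 - real j) t) / (Complex (1/2 - real j) t - (- of_nat k))) = F (1/2 - real j)" for j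
      unfolding F_def using gF[OF nph] by blast
    have "(LINT t|lborel. g (Complex (1/2 - real k) t) / (Complex (1/2 - real k) t - (- of_nat k)))
        - (LINT t|lborel. g (Complex (1/2 - real (Suc k)) t) / (Complex (1/2 - real (Suc k)) t - (- of_nat k)))
           = 2 * of_real pi * g (- of_nat k)"
    proof (rule line_shift_pole[where S = "{s. Re s > - real k - 1} \<inter> {s. Re s < 1 - real k}"
          and M = "\<lambda>t. C * ((1 + t) * exp (- \<delta> * t)) * exp ((real k + 1) * \<bar>Re l\<bar>)"])
      show "g holomorphic_on ({s. Re s > - real k - 1} \<inter> {s. Re s < 1 - real k})"
      proof -
        have "pochhammer s k \<noteq> 0" if "Re s < 1 - real k" for s
          using that by (auto simp: pochhammer_eq_0_iff)
        then show ?thesis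
          unfolding g_def pochhammer_prod by (intro holomorphic_intros np) (auto simp: pochhammer_prod)
      qed
      show "integrable lborel (\<lambda>t. g (Complex (1/2 - real (Suc k)) t) / (Complex (1/2 - real (Suc k)) t - (- of_nat k)))"
        "integrable lborel (\<lambda>t. g (Complex (1/2 - real k) t) / (Complex (1/2 - real k) t - (- of_nat k)))"
        unfolding lines by (rule intk)+
      fix a t :: real assume a: "1/2 - real (Suc k) \<le> a" "a \<le> 1/2 - real k" "\<bar>t\<bar> \<ge> 1"
      define s where "s = Complex a t"
      have ge1: "norm (pochhammer s k * (s - (- of_nat k))) \<ge> 1"
      proof -
        have "1 \<le> (\<Prod>i=0..<Suc k. norm (s + of_nat i))"
        proof (rule prod_ge_1)
          fix i
          have "\<bar>t\<bar> \<le> norm (s + of_nat i)"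
            using abs_Im_le_cmod[of "s + of_nat i"] by (simp add: s_def)
          then show "1 \<le> norm (s + of_nat i)" using a by simp
        qed
        also have "\<dots> = norm (pochhammer s (Suc k))"
          by (simp only: pochhammer_prod prod_norm)
        finally show ?thesis by (simp add: pochhammer_Suc)
      qed
      have "norm (g s / (s - (- of_nat k))) =
          norm (Gamma (Complex ((real k + 1) + a) t) * exp (- Complex a t * l)) / norm (pochhammer s k * (s - (- of_nat k)))"
      proof -
        have "s + of_nat (Suc k) = Complex ((real k + 1) + a) t"
          by (simp add: s_def complex_eq_iff)
        then show ?thesis
          by (simp add: g_def norm_divide norm_mult s_def[symmetric])
      qed
      also have "\<dots> \<le> norm (Gamma (Complex ((real k + 1) + a) t) * exp (- Complex a t * l)) / 1"
        using ge1 by (intro divide_left_mono mult_pos_pos) auto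
      also have "\<dots> \<le> C * ((1 + \<bar>t\<bar>) * exp (- \<delta> * \<bar>t\<bar>)) * exp (\<bar>a\<bar> * \<bar>Re l\<bar>)"
        using strip[of "real k + 1" a t] a by simp
      also have "\<dots> \<le> C * ((1 + \<bar>t\<bar>) * exp (- \<delta> * \<bar>t\<bar>)) * exp ((real k + 1) * \<bar>Re l\<bar>)"
      proof (intro mult_left_mono)
        show "exp (\<bar>a\<bar> * \<bar>Re l\<bar>) \<le> exp ((real k + 1) * \<bar>Re l\<bar>)"
          using mult_right_mono[of "\<bar>a\<bar>" "real k + 1" "\<bar>Re l\<bar>"] a by simp
      qed (use C in auto)
      finally show "norm (g (Complex a t) / (Complex a t - (- of_nat k))) \<le>
          C * ((1 + \<bar>t\<bar>) * exp (- \<delta> * \<bar>t\<bar>)) * exp ((real k + 1) * \<bar>Re l\<bar>)"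
        by (simp add: s_def)
    qed (use Mlim in \<open>auto intro!: convex_Int open_Int convex_halfspace_Re_gt open_halfspace_Re_gt convex_halfspace_Re_lt open_halfspace_Re_lt\<close>)
    moreover have "g (- of_nat k) = (- exp l) ^ k /\<^sub>R fact k"
    proof -
      have "g (- of_nat k) = exp (of_nat k * l) / ((-1) ^ k * fact k)"
        by (simp add: g_def pochhammer_same)
      also have "exp (of_nat k * l) = exp l ^ k"
        by (rule exp_of_nat_mult)
      also have "exp l ^ k / ((-1) ^ k * fact k) = ((-1) ^ k * exp l ^ k) / fact k"
        by (cases "even k") auto
      also have "(-1) ^ k * exp l ^ k = (- exp l) ^ k"
        by (rule power_minus[symmetric])
      finally show ?thesis
        by (simp add: scaleR_conv_of_real divide_inverse mult.commute)
    qed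
    ultimately show ?thesis
      unfolding lines by (simp add: J_def)
  qed
  have part: "J 0 - J K = (\<Sum>k<K. 2 * of_real pi * ((- exp l) ^ k /\<^sub>R fact k))" for K
  proof (induction K)
    case (Suc K)
    have "J 0 - J (Suc K) = (J 0 - J K) + (J K - J (Suc K))"
      by simp
    then show ?case
      by (simp only: Suc.IH step sum.lessThan_Suc)
  qed simp
  have "(\<lambda>K. J 0 - J K) \<longlonglongrightarrow> J 0 - 0"
    by (intro tendsto_intros Jlim)
  moreover have "(\<lambda>k. 2 * of_real pi * ((- exp l) ^ k /\<^sub>R fact k)) sums (2 * of_real pi * exp (- exp l))"
    by (intro sums_mult exp_converges)
  ultimately have "J 0 = 2 * of_real pi * exp (- exp l)"
    unfolding part sums_def by (metis LIMSEQ_unique diff_zero)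
  then show "(LINT t|lborel. Gamma (Complex (3/2) t) * exp (- Complex (3/2) t * l)) = 2 * of_real pi * exp (- exp l)"
    unfolding J0 by (simp add: F_def)
qed

section \<open>The Laplace transform of the squared zeta-function\<close>

text \<open>Enumerates the products of all pairs of positive integers. A series over
  \<open>k\<close> is thus a series over \<open>n\<close> in which each \<open>n\<close> occurs once
  for every factorisation into two factors, that is, with weight the number of divisors of
  \<open>n\<close>.\<close>

definition pair_prod :: "nat \<Rightarrow> nat" where
  "pair_prod k = Suc (fst (prod_decode k)) * Suc (snd (prod_decode k))"

lemma pair_prod_pos: "pair_prod k > 0" "pair_prod k \<ge> 1"
  by (simp_all add: pair_prod_def)

text \<open>Absolute convergence makes the order of the pairs irrelevant, so the product of the
  series with itself may be enumerated by \<open>prod_decode\<close>.\<close>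

lemma sums_prod_decode:
  fixes u :: "nat \<Rightarrow> complex"
  assumes sm: "summable (\<lambda>n. norm (u n))" and U: "u sums U"
  shows "(\<lambda>k. u (fst (prod_decode k)) * u (snd (prod_decode k))) sums U\<^sup>2"
    and "summable (\<lambda>k. norm (u (fst (prod_decode k)) * u (snd (prod_decode k))))"
proof -
  define f where "f = (\<lambda>p. u (fst p) * u (snd p))"
  have hs: "(u has_sum U) UNIV"
    by (rule norm_summable_imp_has_sum[OF sm U])
  have abs_u: "(\<lambda>n. norm (u n)) summable_on UNIV"
    using norm_summable_imp_summable_on[of "\<lambda>n. norm (u n)"] sm by simp
  have abs: "(\<lambda>p. norm (f p)) summable_on (UNIV \<times> UNIV)"
    unfolding Infinite_Sum.abs_summable_on_Sigma_iff
  proof (intro conjI ballI)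
    show "(\<lambda>y. norm (f (x, y))) summable_on UNIV" for x
      using summable_on_cmult_right[OF abs_u, of "norm (u x)"] by (simp add: f_def norm_mult)
    have "(\<Sum>\<^sub>\<infinity>y. norm (f (x, y))) = norm (u x) * (\<Sum>\<^sub>\<infinity>y. norm (u y))" for x
      using infsum_cmult_right[of "norm (u x)" "\<lambda>y. norm (u y)" UNIV] abs_u by (simp add: f_def norm_mult)
    then have "(\<lambda>x. norm (\<Sum>\<^sub>\<infinity>y. norm (f (x, y)))) = (\<lambda>x. norm (u x) * \<bar>\<Sum>\<^sub>\<infinity>y. norm (u y)\<bar>)"
      by (simp add: abs_mult)
    then show "(\<lambda>x. norm (\<Sum>\<^sub>\<infinity>y. norm (f (x, y)))) summable_on UNIV"
      using summable_on_cmult_left[OF abs_u, of "\<bar>\<Sum>\<^sub>\<infinity>y. norm (u y)\<bar>"] by simp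
  qed
  have fs: "f summable_on (UNIV \<times> UNIV)"
    by (rule abs_summable_summable[OF abs])
  have "infsum f (UNIV \<times> UNIV) = (\<Sum>\<^sub>\<infinity>x. \<Sum>\<^sub>\<infinity>y. f (x, y))"
    using infsum_Sigma_banach[OF fs] by simp
  also have "\<dots> = (\<Sum>\<^sub>\<infinity>x. u x * U)"
    using infsum_cmult_right[of _ u UNIV] hs by (simp add: f_def infsumI has_sum_imp_summable)
  also have "\<dots> = U * U"
    using has_sum_cmult_left[OF hs, of U] by (simp add: infsumI)
  finally have "(f has_sum U\<^sup>2) UNIV"
    using has_sum_infsum[OF fs] by (simp add: power2_eq_square)
  then have "((\<lambda>k. f (prod_decode k)) has_sum U\<^sup>2) UNIV"
    using has_sum_reindex_bij_betw[OF bij_prod_decode, of f "U\<^sup>2"] by simp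
  then show "(\<lambda>k. u (fst (prod_decode k)) * u (snd (prod_decode k))) sums U\<^sup>2"
    unfolding f_def by (rule has_sum_imp_sums)
  have "((\<lambda>p. norm (f p)) has_sum (infsum (\<lambda>p. norm (f p)) UNIV)) UNIV"
    using abs by (intro has_sum_infsum) simp
  then have "((\<lambda>k. norm (f (prod_decode k))) has_sum (infsum (\<lambda>p. norm (f p)) UNIV)) UNIV"
    using has_sum_reindex_bij_betw[OF bij_prod_decode, of "\<lambda>p. norm (f p)"] by simp
  then show "summable (\<lambda>k. norm (u (fst (prod_decode k)) * u (snd (prod_decode k))))"
    unfolding f_def by (intro sums_summable has_sum_imp_sums)
qed

lemma zeta_square_sums:
  assumes s: "Re s > 1"
  shows "(\<lambda>k. of_nat (pair_prod k) powr (- s)) sums (zeta s)\<^sup>2"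
    and "summable (\<lambda>k. real (pair_prod k) powr (- Re s))"
proof -
  define u where "u = (\<lambda>n. of_nat (Suc n) powr (- s))"
  have nu: "norm (u n) = real (Suc n) powr (- Re s)" for n
    by (simp add: u_def norm_powr_real_powr del: of_nat_Suc)
  have sm: "summable (\<lambda>n. norm (u n))"
    unfolding nu using s summable_real_powr_iff[of "- Re s"] by (subst summable_Suc_iff) simp
  have U: "u sums zeta s"
    unfolding u_def by (rule zeta_sums[OF s])
  have eq: "u (fst (prod_decode k)) * u (snd (prod_decode k)) = of_nat (pair_prod k) powr (- s)" for k
    unfolding u_def pair_prod_def of_nat_mult by (subst powr_times_real) auto
  show "(\<lambda>k. of_nat (pair_prod k) powr (- s)) sums (zeta s)\<^sup>2"
    using sums_prod_decode(1)[OF sm U] unfolding eq .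
  show "summable (\<lambda>k. real (pair_prod k) powr (- Re s))"
    using sums_prod_decode(2)[OF sm U] unfolding eq by (simp add: norm_powr_real_powr)
qed

text \<open>The cube collects one linear factor from \<open>Gamma\<close> and two from the squared
  zeta-function. Each is paid for with a sixth of the rate, in all one half.\<close>

lemma cube_exp_bound:
  fixes x \<alpha> :: real
  assumes "\<alpha> > 0" "x \<ge> 0"
  shows "(2 + x) ^ 3 * exp (- \<alpha> * x) \<le> (2 * (1 + 6 / \<alpha>)) ^ 3 * exp (- (\<alpha> / 2) * x)"
proof -
  have "1 + x \<le> (1 + 1 / (\<alpha> / 6)) * exp ((\<alpha> / 6) * x)"
    using assms by (intro add_le_exp) auto
  then have "1 + x \<le> (1 + 6 / \<alpha>) * exp ((\<alpha> / 6) * x)"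
    by simp
  then have "2 + x \<le> 2 * (1 + 6 / \<alpha>) * exp ((\<alpha> / 6) * x)"
    using assms unfolding mult.assoc by linarith
  then have "(2 + x) ^ 3 \<le> (2 * (1 + 6 / \<alpha>) * exp ((\<alpha> / 6) * x)) ^ 3"
    using assms by (intro power_mono) auto
  also have "\<dots> = (2 * (1 + 6 / \<alpha>)) ^ 3 * exp ((\<alpha> / 2) * x)"
    by (simp only: power_mult_distrib exp_of_nat_mult[symmetric]) (simp add: field_simps)
  finally have "(2 + x) ^ 3 * exp (- \<alpha> * x) \<le> (2 * (1 + 6 / \<alpha>)) ^ 3 * exp ((\<alpha> / 2) * x) * exp (- \<alpha> * x)"
    by (rule mult_right_mono) auto
  also have "\<dots> = (2 * (1 + 6 / \<alpha>)) ^ 3 * (exp ((\<alpha> / 2) * x) * exp (- \<alpha> * x))"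
    by (simp only: mult.assoc)
  also have "exp ((\<alpha> / 2) * x) * exp (- \<alpha> * x) = exp (- (\<alpha> / 2) * x)"
    by (subst exp_add[symmetric]) (simp add: field_simps)
  finally show ?thesis .
qed

text \<open>
  By the functional equation, on the critical line this kernel times $\zeta^2$ is essentially
  $e^{iz/2} |\zeta|^2 e^{-zt}$ for $t > 0$ and decays exponentially for $t < 0$.
\<close>

definition shifted_kernel :: "complex \<Rightarrow> complex \<Rightarrow> complex" where
  "shifted_kernel z s = Gamma s * exp (- s * (of_real (ln (2 * pi)) + \<i> * (of_real (pi / 2) - z)))"

text \<open>On this line the series of the squared zeta-function converges absolutely, and each term
  is an instance of \<open>Gamma_inversion\<close> with the logarithm shifted by
  \<open>ln (pair_prod k)\<close>; \<open>Re z > 0\<close> keeps its imaginary part below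
  \<open>pi / 2\<close>. Since \<open>pair_prod k\<close> is an integer, 1 may be subtracted from
  \<open>exp (- \<i> * z)\<close> by periodicity, which leaves a variable close to \<open>z\<close>
  for small \<open>z\<close>.\<close>

lemma shifted_kernel_line:
  fixes z :: complex
  assumes z: "0 < Re z" "norm z \<le> 1"
  shows "integrable lborel (\<lambda>t. shifted_kernel z (Complex (3/2) t) * (zeta (Complex (3/2) t))\<^sup>2)"
    and "(\<lambda>k. 2 * of_real pi * exp (- 2 * of_real pi * of_nat (pair_prod k) * (\<i> * (exp (- \<i> * z) - 1))))
           sums (LINT t|lborel. shifted_kernel z (Complex (3/2) t) * (zeta (Complex (3/2) t))\<^sup>2)"
proof -
  define l0 where "l0 = of_real (ln (2 * pi)) + \<i> * (of_real (pi / 2) - z)"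
  have im: "\<bar>Im l0\<bar> < pi / 2"
    using z complex_Re_le_cmod[of z] pi_gt3 by (auto simp: l0_def)
  define F where "F = (\<lambda>t. shifted_kernel z (Complex (3/2) t))"
  have F_eq: "F t = Gamma (Complex (3/2) t) * exp (- Complex (3/2) t * l0)" for t
    by (simp add: F_def shifted_kernel_def l0_def)
  define G where "G = (\<lambda>k t. F t * of_nat (pair_prod k) powr (- Complex (3/2) t))"
  have G_eq: "G k = (\<lambda>t. Gamma (Complex (3/2) t) * exp (- Complex (3/2) t * (l0 + of_real (ln (real (pair_prod k))))))" for k
  proof
    fix t
    have "of_nat (pair_prod k) powr (- Complex (3/2) t) = exp (- Complex (3/2) t * of_real (ln (real (pair_prod k))))"
      using pair_prod_pos[of k] Ln_of_real[of "real (pair_prod k)"] by (simp add: powr_def)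
    then show "G k t = Gamma (Complex (3/2) t) * exp (- Complex (3/2) t * (l0 + of_real (ln (real (pair_prod k)))))"
      unfolding G_def F_eq by (simp only: distrib_left exp_add mult.assoc)
  qed
  have im': "\<bar>Im (l0 + of_real (ln (real (pair_prod k))))\<bar> < pi / 2" for k
    using im by simp
  have Gint: "integrable lborel (G k)" for k
    unfolding G_eq by (rule Gamma_inversion(1)[OF im'])
  have Fint: "integrable lborel F"
    unfolding F_eq[abs_def] by (rule Gamma_inversion(1)[OF im])
  have Gval: "(LINT t|lborel. G k t) = 2 * of_real pi * exp (- 2 * of_real pi * of_nat (pair_prod k) * (\<i> * (exp (- \<i> * z) - 1)))" for k
  proof -
    have "(LINT t|lborel. G k t) = 2 * of_real pi * exp (- exp (l0 + of_real (ln (real (pair_prod k)))))"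
      unfolding G_eq by (rule Gamma_inversion(2)[OF im'])
    also have "exp (l0 + of_real (ln (real (pair_prod k)))) = 2 * of_real pi * of_nat (pair_prod k) * (\<i> * exp (- \<i> * z))"
    proof -
      have e1: "exp (of_real (ln (2 * pi))) = (2 * of_real pi :: complex)"
        by (simp add: exp_of_real)
      have e2: "exp (of_real (ln (real (pair_prod k)))) = (of_nat (pair_prod k) :: complex)"
        using pair_prod_pos[of k] by (simp add: exp_of_real)
      have e3: "exp (\<i> * (of_real (pi / 2) - z)) = \<i> * exp (- \<i> * z)"
      proof -
        have "exp (\<i> * (of_real (pi / 2) - z)) = exp (\<i> * of_real (pi / 2)) * exp (- \<i> * z)"
          by (subst exp_add[symmetric]) (simp add: algebra_simps)
        also have "exp (\<i> * of_real (pi / 2)) = \<i>"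
          by (simp only: cis_conv_exp[symmetric] cis_pi_half)
        finally show ?thesis .
      qed
      show ?thesis
        unfolding l0_def exp_add e1 e2 e3 by (simp only: mult_ac)
    qed
    also have "exp (- (2 * of_real pi * of_nat (pair_prod k) * (\<i> * exp (- \<i> * z)))) =
        exp (- 2 * of_real pi * of_nat (pair_prod k) * (\<i> * (exp (- \<i> * z) - 1)))"
    proof -
      have "exp (- (2 * of_real pi * of_nat (pair_prod k) * (\<i> * exp (- \<i> * z)))) =
        exp (- 2 * of_real pi * of_nat (pair_prod k) * (\<i> * (exp (- \<i> * z) - 1)) + - (2 * of_nat (pair_prod k) * of_real pi * \<i>))"
        by (rule arg_cong[of _ _ exp]) (simp add: algebra_simps)
      also have "\<dots> = exp (- 2 * of_real pi * of_nat (pair_prod k) * (\<i> * (exp (- \<i> * z) - 1))) * exp (- (2 * of_nat (pair_prod k) * of_real pi * \<i>))"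
        by (rule exp_add)
      also have "exp (- (2 * of_nat (pair_prod k) * of_real pi * \<i>)) = 1"
        using exp_two_pi_i exp_of_nat_mult[of "pair_prod k" "2 * of_real pi * \<i>"]
        by (simp add: exp_minus mult_ac)
      finally show ?thesis by simp
    qed
    finally show ?thesis .
  qed
  have nG: "norm (G k t) = norm (F t) * real (pair_prod k) powr (- 3/2)" for k t
    by (simp add: G_def norm_mult norm_powr_real_powr)
  have sm: "summable (\<lambda>k. real (pair_prod k) powr (- 3/2))"
    using zeta_square_sums(2)[of "3/2"] by simp
  have c1: "AE t in lborel. summable (\<lambda>k. norm (G k t))"
    unfolding nG by (intro AE_I2 summable_mult sm)
  have c2: "summable (\<lambda>k. LINT t|lborel. norm (G k t))"
    unfolding nG using sm by (simp add: summable_mult)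
  have suminf: "(\<Sum>k. G k t) = F t * (zeta (Complex (3/2) t))\<^sup>2" for t
    unfolding G_def using zeta_square_sums(1)[of "Complex (3/2) t"] by (simp add: suminf_mult sums_iff)
  show "integrable lborel (\<lambda>t. shifted_kernel z (Complex (3/2) t) * (zeta (Complex (3/2) t))\<^sup>2)"
    using integrable_suminf[OF Gint c1 c2] unfolding suminf F_def .
  show "(\<lambda>k. 2 * of_real pi * exp (- 2 * of_real pi * of_nat (pair_prod k) * (\<i> * (exp (- \<i> * z) - 1))))
           sums (LINT t|lborel. shifted_kernel z (Complex (3/2) t) * (zeta (Complex (3/2) t))\<^sup>2)"
    using sums_integral[OF Gint c1 c2] unfolding suminf Gval F_def .
qed

lemma shifted_kernel_bound:
  obtains C where "C > 0"
    "\<And>z a t. \<lbrakk>0 < Re z; norm z \<le> 1; 1/2 \<le> a; a \<le> 3/2\<rbrakk> \<Longrightarrow>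
        norm (shifted_kernel z (Complex a t)) \<le> C * (1 + \<bar>t\<bar>) * exp (- pi * \<bar>t\<bar> / 2 + t * (pi / 2 - Re z))"
proof -
  obtain C where C: "C > 0"
    "\<And>a t. 1/2 \<le> a \<Longrightarrow> a \<le> 3/2 \<Longrightarrow> norm (Gamma (Complex a t)) \<le> C * (1 + \<bar>t\<bar>) * exp (- pi * \<bar>t\<bar> / 2)"
    using norm_Gamma_strip by blast
  \<comment> \<open>Since \<open>Im z \<ge> -1\<close>, this keeps the real part of the logarithm
    \<open>l0\<close> below nonnegative, and the factor it produces is at most 1.\<close>
  have ln2pi: "ln (2 * pi) \<ge> 1"
  proof -
    have "exp 1 \<le> 2 * pi"
      using exp_le pi_gt3 by linarith
    then show ?thesis
      by (subst ln_ge_iff) auto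
  qed
  show thesis
  proof (rule that[OF C(1)])
    fix z a t assume z: "0 < Re z" "norm z \<le> 1" and a: "1/2 \<le> a" "a \<le> (3/2::real)"
    define l0 where "l0 = of_real (ln (2 * pi)) + \<i> * (of_real (pi / 2) - z)"
    have "Re l0 = ln (2 * pi) + Im z" "Im l0 = pi / 2 - Re z"
      by (simp_all add: l0_def)
    moreover have "- a * (ln (2 * pi) + Im z) \<le> 0"
    proof -
      have "ln (2 * pi) + Im z \<ge> 0"
        using ln2pi abs_Im_le_cmod[of z] z by linarith
      then show ?thesis using a by (simp add: mult_nonneg_nonneg)
    qed
    ultimately have "norm (exp (- Complex a t * l0)) \<le> 1 * exp (t * (pi / 2 - Re z))"
      unfolding norm_exp_Complex_mult by (intro mult_mono) auto
    then have "norm (shifted_kernel z (Complex a t)) \<le> (C * (1 + \<bar>t\<bar>) * exp (- pi * \<bar>t\<bar> / 2)) * (1 * exp (t * (pi / 2 - Re z)))"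
      unfolding shifted_kernel_def norm_mult l0_def[symmetric] using C a by (intro mult_mono) auto
    also have "\<dots> = C * (1 + \<bar>t\<bar>) * exp (- pi * \<bar>t\<bar> / 2 + t * (pi / 2 - Re z))"
      unfolding exp_add by (simp only: mult_1_left mult.assoc)
    finally show "norm (shifted_kernel z (Complex a t)) \<le> C * (1 + \<bar>t\<bar>) * exp (- pi * \<bar>t\<bar> / 2 + t * (pi / 2 - Re z))" .
  qed
qed

text \<open>The functional equation trades \<open>Gamma s * zeta s\<close> for
  \<open>cnj (zeta s)\<close>, divided by a power of \<open>2 * pi\<close> and by
  \<open>2 * cos (pi * s / 2)\<close>. The constants in \<open>shifted_kernel\<close> cancel the
  power and one exponential of the cosine; the rest of the cosine is
  \<open>1 + exp (\<i> * pi * s)\<close>, and on this line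
  \<open>exp (\<i> * pi * s) = \<i> * exp (- pi * t)\<close>.\<close>

lemma shifted_kernel_critical_line:
  fixes t :: real and z :: complex
  defines "s \<equiv> Complex (1/2) t"
  shows "shifted_kernel z s * (zeta s)\<^sup>2 =
           of_real ((cmod (zeta s))\<^sup>2) * exp (\<i> * z / 2) * exp (- z * of_real t) / (1 + \<i> * of_real (exp (- pi * t)))"
proof -
  have s1: "1 - s = cnj s"
    by (simp add: s_def complex_eq_iff)
  have "zeta (1 - s) = 2 * of_real (2 * pi) powr (- s) * cos (of_real pi * s / 2) * Gamma s * zeta s"
    by (rule zeta_functional_equation) (auto simp: s_def complex_eq_iff)
  then have fe: "cnj (zeta s) = 2 * of_real (2 * pi) powr (- s) * cos (of_real pi * s / 2) * Gamma s * zeta s"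
    by (simp only: cnj_zeta s1)
  have p: "of_real (2 * pi) powr (- s) = exp (- s * of_real (ln (2 * pi)))"
    by (subst powr_def) (auto simp: Ln_of_real simp del: of_real_mult)
  define u where "u = exp (\<i> * of_real pi * s)"
  have u: "u = \<i> * of_real (exp (- pi * t))"
  proof -
    have "\<i> * of_real pi * s = \<i> * of_real (pi / 2) + of_real (- pi * t)"
      by (simp add: s_def complex_eq_iff)
    then have "u = exp (\<i> * of_real (pi / 2)) * exp (of_real (- pi * t))"
      unfolding u_def by (simp only: exp_add)
    also have "exp (\<i> * of_real (pi / 2)) = \<i>"
      by (simp only: cis_conv_exp[symmetric] cis_pi_half)
    finally show ?thesis by (simp only: exp_of_real)
  qed
  have u1: "1 + u \<noteq> 0"
    by (simp add: u complex_eq_iff)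
  have c: "2 * cos (of_real pi * s / 2) = exp (- s * (\<i> * of_real (pi / 2))) * (1 + u)"
  proof -
    have "2 * cos (of_real pi * s / 2) = exp (\<i> * (of_real pi * s / 2)) + exp (- (\<i> * (of_real pi * s / 2)))"
      by (simp add: cos_exp_eq)
    moreover have "exp (- s * (\<i> * of_real (pi / 2))) * u = exp (\<i> * (of_real pi * s / 2))"
      unfolding u_def by (subst exp_add[symmetric]) (simp add: field_simps)
    moreover have "exp (- s * (\<i> * of_real (pi / 2))) = exp (- (\<i> * (of_real pi * s / 2)))"
      by (simp add: field_simps)
    ultimately show ?thesis
      by (simp add: distrib_left)
  qed
  have e: "exp (- s * (of_real (ln (2 * pi)) + \<i> * (of_real (pi / 2) - z))) =
      exp (- s * of_real (ln (2 * pi))) * exp (- s * (\<i> * of_real (pi / 2))) * exp (\<i> * s * z)"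
    by (simp add: exp_add[symmetric] algebra_simps)
  have z: "exp (\<i> * s * z) = exp (\<i> * z / 2) * exp (- z * of_real t)"
  proof -
    have "\<i> * s = \<i> / 2 - of_real t"
      by (simp add: s_def complex_eq_iff)
    then have "\<i> * s * z = (\<i> / 2 - of_real t) * z"
      by (simp only:)
    also have "\<dots> = \<i> * z / 2 + - z * of_real t"
      by (simp add: algebra_simps)
    finally have "\<i> * s * z = \<i> * z / 2 + - z * of_real t" .
    then show ?thesis by (simp only: exp_add)
  qed
  have "cnj (zeta s) = (exp (- s * of_real (ln (2 * pi))) * exp (- s * (\<i> * of_real (pi / 2))) * Gamma s * zeta s) * (1 + u)"
    unfolding fe p using c by (simp add: mult_ac)
  then have "cnj (zeta s) / (1 + u) = exp (- s * of_real (ln (2 * pi))) * exp (- s * (\<i> * of_real (pi / 2))) * Gamma s * zeta s"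
    using u1 by simp
  then have "shifted_kernel z s * (zeta s)\<^sup>2 = cnj (zeta s) / (1 + u) * zeta s * exp (\<i> * s * z)"
    unfolding shifted_kernel_def e by (simp add: power2_eq_square mult_ac)
  also have "\<dots> = (zeta s * cnj (zeta s)) * exp (\<i> * z / 2) * exp (- z * of_real t) / (1 + u)"
    unfolding z by simp
  also have "zeta s * cnj (zeta s) = of_real ((cmod (zeta s))\<^sup>2)"
    by (simp only: complex_norm_square)
  finally show ?thesis unfolding u .
qed

section \<open>The squared modulus on the critical line against the pair sum\<close>

definition zeta_sq :: "real \<Rightarrow> real" where
  "zeta_sq t = (cmod (zeta (Complex (1/2) t)))\<^sup>2"

lemma zeta_sq_nonneg: "zeta_sq t \<ge> 0"
  by (simp add: zeta_sq_def)

lemma continuous_on_zeta_line: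
  assumes "\<And>t. t \<in> A \<Longrightarrow> Complex a t \<noteq> 1"
  shows "continuous_on A (\<lambda>t. zeta (Complex a t))"
  using assms by (intro zeta_continuous_on) (auto simp: Complex_eq intro!: continuous_intros)

lemma continuous_on_zeta_sq: "continuous_on A zeta_sq"
proof -
  have "continuous_on A (\<lambda>t. zeta (Complex (1/2) t))"
    by (intro continuous_on_zeta_line) (auto simp: complex_eq_iff)
  then show ?thesis
    unfolding zeta_sq_def[abs_def] by (intro continuous_intros)
qed

lemma zeta_strip_bound:
  obtains K where "K \<ge> 1"
    "\<And>a t. \<lbrakk>1/2 \<le> a; a \<le> 3/2; \<bar>t\<bar> \<ge> 1 \<or> a = 1/2 \<or> a = 3/2\<rbrakk> \<Longrightarrow> norm (zeta (Complex a t)) \<le> K * (2 + \<bar>t\<bar>)"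
proof -
  obtain K where K: "K \<ge> 1" "\<And>s. Re s \<ge> 1/2 \<Longrightarrow> norm (s - 1) \<ge> 1/2 \<Longrightarrow> norm (zeta s) \<le> K * norm s"
    using zeta_half_plane_bound by blast
  show thesis
  proof (rule that[OF K(1)])
    fix a t :: real assume a: "1/2 \<le> a" "a \<le> 3/2" "\<bar>t\<bar> \<ge> 1 \<or> a = 1/2 \<or> a = 3/2"
    have "norm (Complex a t - 1) \<ge> 1/2"
      using a abs_Re_le_cmod[of "Complex a t - 1"] abs_Im_le_cmod[of "Complex a t - 1"] by auto
    then have "norm (zeta (Complex a t)) \<le> K * norm (Complex a t)"
      using a by (intro K) auto
    also have "norm (Complex a t) \<le> 2 + \<bar>t\<bar>"
      using cmod_le[of "Complex a t"] a by simp
    finally show "norm (zeta (Complex a t)) \<le> K * (2 + \<bar>t\<bar>)"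
      using K(1) by (simp add: mult_left_mono)
  qed
qed

lemma zeta_sq_bound:
  obtains K where "K \<ge> 1" "\<And>t. zeta_sq t \<le> K * (2 + \<bar>t\<bar>)\<^sup>2"
proof -
  obtain K where K: "K \<ge> 1"
    "\<And>a t. \<lbrakk>1/2 \<le> a; a \<le> 3/2; \<bar>t\<bar> \<ge> 1 \<or> a = 1/2 \<or> a = 3/2\<rbrakk> \<Longrightarrow> norm (zeta (Complex a t)) \<le> K * (2 + \<bar>t\<bar>)"
    using zeta_strip_bound by blast
  show thesis
  proof (rule that)
    show "K\<^sup>2 \<ge> 1"
      using K(1) by (rule one_le_power)
    show "zeta_sq t \<le> K\<^sup>2 * (2 + \<bar>t\<bar>)\<^sup>2" for t
      unfolding zeta_sq_def power_mult_distrib[symmetric] by (intro power_mono K) auto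
  qed
qed

lemma set_integrable_cube_exp:
  fixes F :: "real \<Rightarrow> complex" and c M \<alpha> :: real
  assumes c: "c \<ge> 0" and cont: "continuous_on {c..} F" and \<alpha>: "\<alpha> > 0" and M: "M \<ge> 0"
    and bd: "\<And>t. t \<ge> c \<Longrightarrow> norm (F t) \<le> M * ((2 + t) ^ 3 * exp (- \<alpha> * t))"
  shows "set_integrable lborel {c..} F"
    and "norm (LINT t:{c..}|lborel. F t) \<le> M * (2 * (1 + 6 / \<alpha>)) ^ 3 * (2 / \<alpha>)"
proof -
  define A where "A = (2 * (1 + 6 / \<alpha>)) ^ 3"
  have A: "A \<ge> 0" using \<alpha> by (simp add: A_def)
  have bd': "norm (F t) \<le> M * A * exp (- (\<alpha> / 2) * t)" if "t \<ge> c" for t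
  proof -
    have "norm (F t) \<le> M * ((2 + t) ^ 3 * exp (- \<alpha> * t))"
      by (rule bd[OF that])
    also have "\<dots> \<le> M * (A * exp (- (\<alpha> / 2) * t))"
      unfolding A_def using c that \<alpha> M by (intro mult_left_mono cube_exp_bound) auto
    finally show ?thesis by (simp only: mult.assoc)
  qed
  have int: "set_integrable lborel {c..} (\<lambda>t. M * A * exp (- (\<alpha> / 2) * t))"
    using integrable_exp_neg_Ici(1)[of "\<alpha> / 2" c] \<alpha> by (intro set_integrable_mult_right) auto
  show F: "set_integrable lborel {c..} F"
  proof (rule set_integrable_bound[OF int])
    show "set_borel_measurable lborel {c..} F"
      unfolding set_borel_measurable_def using borel_measurable_continuous_on_indicator[OF _ cont] by simp
    show "AE t in lborel. t \<in> {c..} \<longrightarrow> norm (F t) \<le> norm (M * A * exp (- (\<alpha> / 2) * t))"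
      using bd' A M by (intro AE_I2) (auto simp: abs_mult)
  qed
  have "norm (LINT t:{c..}|lborel. F t) \<le> (LINT t:{c..}|lborel. norm (F t))"
    by (rule set_integral_norm_bound[OF F])
  also have "\<dots> \<le> (LINT t:{c..}|lborel. M * A * exp (- (\<alpha> / 2) * t))"
    by (rule set_integral_mono[OF set_integrable_norm[OF F] int]) (rule bd', simp)
  also have "\<dots> = M * A * (exp (- (\<alpha> / 2) * c) / (\<alpha> / 2))"
    using integrable_exp_neg_Ici(2)[of "\<alpha> / 2" c] \<alpha> by (subst set_integral_mult_right) auto
  also have "\<dots> \<le> M * A * (1 / (\<alpha> / 2))"
    using c \<alpha> M A by (intro mult_left_mono divide_right_mono) auto
  finally show "norm (LINT t:{c..}|lborel. F t) \<le> M * (2 * (1 + 6 / \<alpha>)) ^ 3 * (2 / \<alpha>)"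
    by (simp add: A_def)
qed

text \<open>The lower limit 7 exceeds \<open>2 * pi\<close>, so that the comparison density
  \<open>ln (t / (2 * pi)) + 2 * c\<close> is nonnegative from there on; leaving out
  \<open>{0..7}\<close> costs a bounded amount.\<close>

lemma zeta_sq_laplace_integrable:
  assumes "Re z > 0"
  shows "set_integrable lborel {7..} (\<lambda>t. of_real (zeta_sq t) * exp (- z * of_real t))"
proof -
  obtain K where K: "K \<ge> 1" "\<And>t. zeta_sq t \<le> K * (2 + \<bar>t\<bar>)\<^sup>2"
    using zeta_sq_bound by blast
  show ?thesis
  proof (rule set_integrable_cube_exp(1)[where M = K and \<alpha> = "Re z"])
    show "continuous_on {7..} (\<lambda>t. of_real (zeta_sq t) * exp (- z * of_real t))"
      by (intro continuous_intros continuous_on_zeta_sq)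
    fix t :: real assume t: "t \<ge> 7"
    have "norm (of_real (zeta_sq t) * exp (- z * of_real t)) = zeta_sq t * exp (- Re z * t)"
      using zeta_sq_nonneg[of t] by (simp add: norm_mult)
    also have "\<dots> \<le> (K * (2 + \<bar>t\<bar>)\<^sup>2) * exp (- Re z * t)"
      by (intro mult_right_mono K) auto
    also have "\<dots> \<le> (K * (2 + t) ^ 3) * exp (- Re z * t)"
      using t K power_increasing[of 2 3 "2 + t"] by (intro mult_right_mono mult_left_mono) auto
    finally show "norm (of_real (zeta_sq t) * exp (- z * of_real t)) \<le> K * ((2 + t) ^ 3 * exp (- Re z * t))"
      by (simp only: mult.assoc)
  qed (use assms K in auto)
qed

text \<open>Moving the line from \<open>1/2\<close> to \<open>3/2\<close> only above height 7 stays
  clear of the pole of zeta at 1. What remains is bounded uniformly in \<open>z\<close>: the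
  horizontal side at height 7, the part \<open>t < 7\<close> of the line \<open>3/2\<close>, where
  the kernel decays for negative \<open>t\<close>, and the replacement of
  \<open>1 + \<i> * exp (- pi * t)\<close> by 1 on the critical line.\<close>

lemma zeta_sq_laplace_pair_sum:
  obtains B where "B > 0"
    "\<And>z S. \<lbrakk>0 < Re z; norm z \<le> 1;
        (\<lambda>k. 2 * of_real pi * exp (- 2 * of_real pi * of_nat (pair_prod k) * (\<i> * (exp (- \<i> * z) - 1)))) sums S\<rbrakk>
      \<Longrightarrow> norm (exp (\<i> * z / 2) * (LINT t:{7..}|lborel. of_real (zeta_sq t) * exp (- z * of_real t)) - S) \<le> B"
proof -
  obtain C where C: "C > 0"
    "\<And>z a t. \<lbrakk>0 < Re z; norm z \<le> 1; 1/2 \<le> a; a \<le> 3/2\<rbrakk> \<Longrightarrow>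
        norm (shifted_kernel z (Complex a t)) \<le> C * (1 + \<bar>t\<bar>) * exp (- pi * \<bar>t\<bar> / 2 + t * (pi / 2 - Re z))"
    using shifted_kernel_bound by blast
  obtain K where K: "K \<ge> 1"
    "\<And>a t. \<lbrakk>1/2 \<le> a; a \<le> 3/2; \<bar>t\<bar> \<ge> 1 \<or> a = 1/2 \<or> a = 3/2\<rbrakk> \<Longrightarrow> norm (zeta (Complex a t)) \<le> K * (2 + \<bar>t\<bar>)"
    using zeta_strip_bound by blast
  define M where "M = C * K\<^sup>2"
  have M: "M \<ge> 0" using C by (simp add: M_def)
  \<comment> \<open>\<open>9\<close> is \<open>2 + 7\<close> on the horizontal side at height 7;
    \<open>exp 14\<close> with rate 2 dominates the kernel for all \<open>t < 7\<close> of either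
    sign; the rate \<open>pi\<close> in \<open>B3\<close> is that of \<open>exp (- pi * t)\<close>,
    and its factor 3 bounds \<open>exp 1\<close>.\<close>
  define B1 B2 B3 where "B1 = M * 9 ^ 3" and "B2 = M * exp 14 * (2 * (1 + 6 / 2)) ^ 3 * 2"
    and "B3 = 3 * K\<^sup>2 * (2 * (1 + 6 / pi)) ^ 3 * (2 / pi)"
  have B3: "B3 > 0" using K pi_gt_zero by (auto simp: B3_def intro!: mult_pos_pos divide_pos_pos zero_less_power add_pos_pos)
  have B12: "B1 \<ge> 0" "B2 \<ge> 0" using M by (auto simp: B1_def B2_def)
  show thesis
  proof (rule that)
    show "B1 + B2 + B3 > 0" using B3 B12 by simp
    fix z S assume z: "0 < Re z" "norm z \<le> 1"
      and S: "(\<lambda>k. 2 * of_real pi * exp (- 2 * of_real pi * of_nat (pair_prod k) * (\<i> * (exp (- \<i> * z) - 1)))) sums S"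
    define x where "x = Re z"
    have x: "0 < x" "x \<le> 1"
      using z complex_Re_le_cmod[of z] by (auto simp: x_def)
    define f where "f = (\<lambda>s. shifted_kernel z s * (zeta s)\<^sup>2)"
    define f1 f3 where "f1 = (\<lambda>t. f (Complex (1/2) t))" and "f3 = (\<lambda>t. f (Complex (3/2) t))"
    have S_eq: "S = (LINT t|lborel. f3 t)" and f3_int: "integrable lborel f3"
      using shifted_kernel_line[OF z] S unfolding f3_def f_def by (auto dest: sums_unique2)
    have np: "s \<notin> \<int>\<^sub>\<le>\<^sub>0" if "Re s > 0" for s :: complex
      using that by (auto elim!: nonpos_Ints_cases)
    have f_holo: "f holomorphic_on ({s. Re s > 0} \<inter> {s. Im s > 0})"
      unfolding f_def shifted_kernel_def using np by (intro holomorphic_intros zeta_holomorphic) auto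
    have fb: "norm (f (Complex a t)) \<le> M * ((2 + \<bar>t\<bar>) ^ 3 * exp (- pi * \<bar>t\<bar> / 2 + t * (pi / 2 - x)))"
      if a: "1/2 \<le> a" "a \<le> 3/2" "\<bar>t\<bar> \<ge> 1 \<or> a = 1/2 \<or> a = 3/2" for a t
    proof -
      have "norm (f (Complex a t)) \<le> (C * (1 + \<bar>t\<bar>) * exp (- pi * \<bar>t\<bar> / 2 + t * (pi / 2 - x))) * (K * (2 + \<bar>t\<bar>))\<^sup>2"
        unfolding f_def norm_mult norm_power x_def using C a z by (intro mult_mono power_mono K) auto
      also have "\<dots> \<le> (C * (2 + \<bar>t\<bar>) * exp (- pi * \<bar>t\<bar> / 2 + t * (pi / 2 - x))) * (K * (2 + \<bar>t\<bar>))\<^sup>2"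
        using C by (intro mult_right_mono mult_left_mono) auto
      also have "\<dots> = M * ((2 + \<bar>t\<bar>) ^ 3 * exp (- pi * \<bar>t\<bar> / 2 + t * (pi / 2 - x)))"
        by (simp add: M_def power2_eq_square power3_eq_cube)
      finally show ?thesis .
    qed
    have fb': "norm (f (Complex a t)) \<le> M * ((2 + t) ^ 3 * exp (- x * t))"
      if a: "1/2 \<le> a" "a \<le> 3/2" "t \<ge> 7" for a t
    proof -
      have "- pi * \<bar>t\<bar> / 2 + t * (pi / 2 - x) = - x * t"
        using a by (simp add: algebra_simps)
      then show ?thesis
        using fb[of a t] a by simp
    qed
    have contf: "continuous_on {7..} (\<lambda>t. f (Complex a t))" if "a > 0" for a
    proof (rule continuous_on_compose2[OF holomorphic_on_imp_continuous_on[OF f_holo]])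
      show "continuous_on {7..} (\<lambda>t. Complex a t)"
        unfolding Complex_eq by (intro continuous_intros)
    qed (use that in auto)
    have int1: "set_integrable lborel {7..} f1" and int3: "set_integrable lborel {7..} f3"
      unfolding f1_def f3_def using x M contf fb'
      by (auto intro!: set_integrable_cube_exp(1)[where M = M and \<alpha> = x])
    have shift: "norm ((LINT t:{7..}|lborel. f3 t) - (LINT t:{7..}|lborel. f1 t)) \<le> B1"
    proof -
      have lim: "(\<lambda>n. integral {7..real n} F) \<longlonglongrightarrow> (LINT t:{7..}|lborel. F t)"
        if "set_integrable lborel {7..} F" for F :: "real \<Rightarrow> complex"
      proof (rule set_lebesgue_integral_limit[OF that])
        fix t :: real
        show "eventually (\<lambda>n. t \<in> {7..real n}) sequentially" if "t \<in> {7..}"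
          using eventually_ge_at_top[of "nat \<lceil>t\<rceil>"] by eventually_elim (use that in \<open>auto; linarith\<close>)
      qed auto
      have "(\<lambda>n. norm (integral {7..real n} f3 - integral {7..real n} f1)) \<longlonglongrightarrow> norm ((LINT t:{7..}|lborel. f3 t) - (LINT t:{7..}|lborel. f1 t))"
        by (intro tendsto_intros lim int1 int3)
      moreover have "(\<lambda>n. B1 + M * ((2 + real n) ^ 3 * exp (- x * real n))) \<longlonglongrightarrow> B1 + M * 0"
        using x by (intro tendsto_intros) real_asymp
      moreover have "norm (integral {7..real n} f3 - integral {7..real n} f1) \<le> B1 + M * ((2 + real n) ^ 3 * exp (- x * real n))"
        if n: "n \<ge> 8" for n
      proof -
        have "norm (integral {7..real n} f3 - integral {7..real n} f1) \<le> (3/2 - 1/2) * (B1 + M * ((2 + real n) ^ 3 * exp (- x * real n)))"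
          unfolding f1_def f3_def
        proof (rule Cauchy_rectangle_zero[OF _ _ _ f_holo])
          show "convex ({s. Re s > 0} \<inter> {s. Im s > 0})"
            by (intro convex_Int convex_halfspace_Re_gt convex_halfspace_Im_gt)
          fix a :: real assume a: "1/2 \<le> a" "a \<le> 3/2"
          show "norm (f (Complex a (real n))) \<le> M * ((2 + real n) ^ 3 * exp (- x * real n))"
            using a n by (intro fb') auto
          have "norm (f (Complex a 7)) \<le> M * ((2 + 7) ^ 3 * exp (- x * 7))"
            using a by (intro fb') auto
          also have "\<dots> \<le> M * ((2 + 7) ^ 3 * 1)"
            using M x by (intro mult_left_mono) auto
          finally show "norm (f (Complex a 7)) \<le> B1" by (simp add: B1_def)
        qed (use n in auto)
        then show ?thesis by simp
      qed
      ultimately have "norm ((LINT t:{7..}|lborel. f3 t) - (LINT t:{7..}|lborel. f1 t)) \<le> B1 + M * 0"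
        by (intro LIMSEQ_le[where X = "\<lambda>n. norm (integral {7..real n} f3 - integral {7..real n} f1)"]) auto
      then show ?thesis by simp
    qed
    have low: "norm (S - (LINT t:{7..}|lborel. f3 t)) \<le> B2"
    proof -
      have i7: "set_integrable lborel {..<7} f3"
        using f3_int unfolding set_integrable_def by (intro integrable_mult_indicator) auto
      have "S = (LINT t:{..<7} \<union> {7..}|lborel. f3 t)"
      proof -
        have "{..<7} \<union> {7..} = (UNIV :: real set)" by auto
        then show ?thesis by (simp add: S_eq set_lebesgue_integral_def)
      qed
      also have "\<dots> = (LINT t:{..<7}|lborel. f3 t) + (LINT t:{7..}|lborel. f3 t)"
        by (rule set_integral_Un) (use i7 int3 in auto)
      finally have "S - (LINT t:{7..}|lborel. f3 t) = (LINT t|lborel. indicator {..<7} t *\<^sub>R f3 t)"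
        by (simp add: set_lebesgue_integral_def)
      also have "norm \<dots> \<le> (LINT t|lborel. norm (indicator {..<7} t *\<^sub>R f3 t))"
        by (rule integral_norm_bound)
      also have "\<dots> \<le> (LINT t|lborel. (M * exp 14 * (2 * (1 + 6 / 2)) ^ 3) * exp (- 1 * \<bar>t\<bar>))"
      proof (rule integral_mono)
        show "integrable lborel (\<lambda>t. norm (indicator {..<7} t *\<^sub>R f3 t))"
          using i7 unfolding set_integrable_def by (rule integrable_norm)
        show "integrable lborel (\<lambda>t. (M * exp 14 * (2 * (1 + 6 / 2)) ^ 3) * exp (- 1 * \<bar>t\<bar>))"
          by (intro integrable_mult_right integrable_exp_neg_abs) auto
        fix t :: real
        show "norm (indicator {..<7} t *\<^sub>R f3 t) \<le> (M * exp 14 * (2 * (1 + 6 / 2)) ^ 3) * exp (- 1 * \<bar>t\<bar>)"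
        proof (cases "t < 7")
          case True
          have "- pi * \<bar>t\<bar> / 2 + t * (pi / 2 - x) \<le> 14 + (- 2) * \<bar>t\<bar>"
          proof (cases "t \<ge> 0")
            case t: True
            have "- pi * \<bar>t\<bar> / 2 + t * (pi / 2 - x) = - (t * x)"
              using t by (simp add: algebra_simps)
            also have "\<dots> \<le> 0"
              using t x by simp
            finally show ?thesis using True t by simp
          next
            case t: False
            have "- pi * \<bar>t\<bar> / 2 + t * (pi / 2 - x) = (- t) * (x - pi)"
              using t by (simp add: algebra_simps)
            also have "\<dots> \<le> (- t) * (- 2)"
              using t x pi_gt3 by (intro mult_left_mono) auto
            finally show ?thesis using t by simp
          qed
          then have "exp (- pi * \<bar>t\<bar> / 2 + t * (pi / 2 - x)) \<le> exp 14 * exp (- 2 * \<bar>t\<bar>)"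
            by (simp add: exp_add[symmetric])
          then have "norm (f3 t) \<le> M * ((2 + \<bar>t\<bar>) ^ 3 * (exp 14 * exp (- 2 * \<bar>t\<bar>)))"
            unfolding f3_def using M by (intro order.trans[OF fb] mult_left_mono) auto
          also have "\<dots> = M * exp 14 * ((2 + \<bar>t\<bar>) ^ 3 * exp (- 2 * \<bar>t\<bar>))"
            by (simp only: mult_ac)
          also have "\<dots> \<le> M * exp 14 * ((2 * (1 + 6 / 2)) ^ 3 * exp (- (2 / 2) * \<bar>t\<bar>))"
            using M by (intro mult_left_mono cube_exp_bound) auto
          finally show ?thesis
            using True by (simp add: mult.assoc)
        qed (use M in auto)
      qed
      also have "\<dots> = (M * exp 14 * (2 * (1 + 6 / 2)) ^ 3) * (LINT t|lborel. exp (- 1 * \<bar>t\<bar>))"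
        by simp
      also have "\<dots> \<le> (M * exp 14 * (2 * (1 + 6 / 2)) ^ 3) * (2 / 1)"
        using M by (intro mult_left_mono integrable_exp_neg_abs) auto
      finally show ?thesis by (simp add: B2_def)
    qed
    define g where "g = (\<lambda>t. exp (\<i> * z / 2) * (of_real (zeta_sq t) * exp (- z * of_real t)))"
    have gint: "set_integrable lborel {7..} g"
      unfolding g_def using zeta_sq_laplace_integrable[OF z(1)] by (intro set_integrable_mult_right) auto
    have crit: "norm (LINT t:{7..}|lborel. g t - f1 t) \<le> B3"
      unfolding B3_def
    proof (rule set_integrable_cube_exp(2))
      show "continuous_on {7..} (\<lambda>t. g t - f1 t)"
        unfolding g_def f1_def by (intro continuous_intros continuous_on_zeta_sq contf) auto
      fix t :: real assume t: "t \<ge> 7"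
      define u where "u = exp (- pi * t)"
      have u: "u > 0" by (simp add: u_def)
      have "f1 t = g t / (1 + \<i> * of_real u)"
        unfolding f1_def f_def shifted_kernel_critical_line g_def zeta_sq_def u_def by simp
      moreover have nz: "1 + \<i> * of_real u \<noteq> 0"
        by (simp add: complex_eq_iff)
      ultimately have "g t - f1 t = g t * (\<i> * of_real u) / (1 + \<i> * of_real u)"
        by (simp add: field_simps)
      then have "norm (g t - f1 t) = norm (g t) * u / norm (1 + \<i> * of_real u)"
        using u by (simp add: norm_divide norm_mult)
      also have "\<dots> \<le> norm (g t) * u / 1"
        using u abs_Re_le_cmod[of "1 + \<i> * of_real u"] by (intro divide_left_mono mult_nonneg_nonneg) auto
      also have "norm (g t) \<le> 3 * (K\<^sup>2 * (2 + t) ^ 3)"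
      proof -
        have "norm (exp (\<i> * z / 2)) \<le> exp 1"
          using abs_Im_le_cmod[of z] z by simp
        also have "\<dots> \<le> 3" by (rule exp_le)
        finally have 1: "norm (exp (\<i> * z / 2)) \<le> 3" .
        have "zeta_sq t \<le> (K * (2 + \<bar>t\<bar>))\<^sup>2"
          unfolding zeta_sq_def by (intro power_mono K) auto
        also have "\<dots> \<le> K\<^sup>2 * (2 + t) ^ 3"
          using t power_increasing[of 2 3 "2 + t"] by (simp add: power_mult_distrib mult_left_mono)
        finally have 2: "zeta_sq t \<le> K\<^sup>2 * (2 + t) ^ 3" .
        have 3: "norm (exp (- z * of_real t)) \<le> 1"
          using t z by simp
        have "norm (g t) = norm (exp (\<i> * z / 2)) * (zeta_sq t * norm (exp (- z * of_real t)))"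
          unfolding g_def norm_mult using zeta_sq_nonneg[of t] by simp
        also have "\<dots> \<le> 3 * ((K\<^sup>2 * (2 + t) ^ 3) * 1)"
          using 1 2 3 zeta_sq_nonneg[of t] t by (intro mult_mono) auto
        finally show ?thesis by simp
      qed
      finally show "norm (g t - f1 t) \<le> 3 * K\<^sup>2 * ((2 + t) ^ 3 * exp (- pi * t))"
        using u by (simp add: u_def mult_right_mono mult.assoc)
    qed auto
    have "exp (\<i> * z / 2) * (LINT t:{7..}|lborel. of_real (zeta_sq t) * exp (- z * of_real t)) = (LINT t:{7..}|lborel. g t)"
      unfolding g_def by (rule set_integral_mult_right[symmetric])
    also have "(LINT t:{7..}|lborel. g t) - S = (LINT t:{7..}|lborel. g t - f1 t) -
        ((LINT t:{7..}|lborel. f3 t) - (LINT t:{7..}|lborel. f1 t)) - (S - (LINT t:{7..}|lborel. f3 t))"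
      using set_integral_diff(2)[OF gint int1] by simp
    finally have eq: "exp (\<i> * z / 2) * (LINT t:{7..}|lborel. of_real (zeta_sq t) * exp (- z * of_real t)) - S = \<dots>" .
    show "norm (exp (\<i> * z / 2) * (LINT t:{7..}|lborel. of_real (zeta_sq t) * exp (- z * of_real t)) - S) \<le> B1 + B2 + B3"
      unfolding eq using shift low crit by (intro order.trans[OF norm_triangle_ineq4] order.trans[OF add_mono[OF norm_triangle_ineq4 order.refl]]) linarith
  qed
qed

section \<open>Pairs of positive integers with bounded product\<close>

text \<open>The summatory function of the number of divisors.\<close>

definition pair_count :: "real \<Rightarrow> nat" where
  "pair_count x = card {k. real (pair_prod k) \<le> x}"

lemma finite_pair_count: "finite {k. real (pair_prod k) \<le> x}"
proof (rule finite_subset)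
  show "{k. real (pair_prod k) \<le> x} \<subseteq> prod_encode ` ({..nat \<lceil>x\<rceil>} \<times> {..nat \<lceil>x\<rceil>})"
  proof
    fix k assume "k \<in> {k. real (pair_prod k) \<le> x}"
    then have le: "real (pair_prod k) \<le> x" by simp
    have "fst (prod_decode k) \<le> pair_prod k" "snd (prod_decode k) \<le> pair_prod k"
      by (simp_all add: pair_prod_def)
    moreover have "pair_prod k \<le> nat \<lceil>x\<rceil>"
      using le by linarith
    ultimately have "prod_decode k \<in> {..nat \<lceil>x\<rceil>} \<times> {..nat \<lceil>x\<rceil>}"
      by (auto simp: mem_Times_iff)
    then show "k \<in> prod_encode ` ({..nat \<lceil>x\<rceil>} \<times> {..nat \<lceil>x\<rceil>})"
      by (metis image_eqI prod_decode_inverse)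
  qed
qed simp

lemma pair_count_mono: "x \<le> y \<Longrightarrow> pair_count x \<le> pair_count y"
  unfolding pair_count_def by (intro card_mono finite_pair_count) auto

lemma pair_count_eq_card:
  assumes "x \<ge> 0"
  shows "pair_count x = card {(a, b). 1 \<le> a \<and> 1 \<le> b \<and> a * b \<le> nat \<lfloor>x\<rfloor>}"
  unfolding pair_count_def
proof (rule bij_betw_same_card[of "\<lambda>k. (Suc (fst (prod_decode k)), Suc (snd (prod_decode k)))"])
  have le: "real (pair_prod k) \<le> x \<longleftrightarrow> pair_prod k \<le> nat \<lfloor>x\<rfloor>" for k
    using assms by (simp add: le_nat_iff le_floor_iff)
  show "bij_betw (\<lambda>k. (Suc (fst (prod_decode k)), Suc (snd (prod_decode k)))) {k. real (pair_prod k) \<le> x}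
     {(a, b). 1 \<le> a \<and> 1 \<le> b \<and> a * b \<le> nat \<lfloor>x\<rfloor>}"
    unfolding le unfolding pair_prod_def
    by (rule bij_betw_byWitness[where f' = "\<lambda>(a, b). prod_encode (a - 1, b - 1)"])
       (auto simp del: mult_Suc mult_Suc_right)
qed

text \<open>Dirichlet's hyperbola method: as \<open>r\<close> is the integer square root of
  \<open>N\<close>, every pair has a factor at most \<open>r\<close>, and the pairs with both
  factors at most \<open>r\<close>, which are counted twice, fill a square.\<close>

lemma card_hyperbola:
  fixes N r :: nat
  assumes r: "r\<^sup>2 \<le> N" "N < (Suc r)\<^sup>2"
  shows "card {(a, b). 1 \<le> a \<and> 1 \<le> b \<and> a * b \<le> N} + r\<^sup>2 = 2 * (\<Sum>a=1..r. N div a)"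
proof -
  define P where "P = {(a, b). 1 \<le> a \<and> 1 \<le> b \<and> a * b \<le> N}"
  define A B where "A = {(a, b). 1 \<le> a \<and> a \<le> r \<and> 1 \<le> b \<and> a * b \<le> N}"
    and "B = {(a, b). 1 \<le> b \<and> b \<le> r \<and> 1 \<le> a \<and> a * b \<le> N}"
  have A: "A = (SIGMA a:{1..r}. {1..N div a})"
    by (auto simp: A_def less_eq_div_iff_mult_less_eq mult.commute)
  have cA: "card A = (\<Sum>a=1..r. N div a)" and fA: "finite A"
    unfolding A by simp_all
  have B: "B = prod.swap ` A"
    by (auto simp: A_def B_def mult.commute image_iff)
  have cB: "card B = card A" and fB: "finite B"
    unfolding B using fA by (auto simp: card_image)
  have Int: "A \<inter> B = {1..r} \<times> {1..r}"
  proof -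
    have "a * b \<le> N" if "a \<le> r" "b \<le> r" for a b
    proof -
      have "a * b \<le> r * r" using that by (rule mult_le_mono)
      then show ?thesis using r by (simp add: power2_eq_square)
    qed
    then show ?thesis by (auto simp: A_def B_def)
  qed
  have Un: "P = A \<union> B"
  proof -
    have False if "a * b \<le> N" "\<not> a \<le> r" "\<not> b \<le> r" for a b
    proof -
      have "Suc r * Suc r \<le> a * b" using that by (intro mult_le_mono) auto
      then show False using r that by (simp add: power2_eq_square)
    qed
    then show ?thesis by (auto simp: P_def A_def B_def)
  qed
  have "card P + card (A \<inter> B) = card A + card B"
    unfolding Un using card_Un_Int[OF fA fB] by simp
  then show ?thesis
    unfolding Int cB cA by (simp add: P_def power2_eq_square)
qed

text \<open>Dirichlet's divisor estimate. Rounding \<open>r\<close> quotients, replacing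
  \<open>harm r\<close> by \<open>ln (sqrt x)\<close> plus Euler's constant, and replacing
  \<open>r\<close> by \<open>sqrt x\<close> in the square each cost a multiple of
  \<open>sqrt x\<close>.\<close>

lemma pair_count_asymp:
  assumes x: "x \<ge> 1"
  shows "\<bar>real (pair_count x) - (x * ln x + (2 * euler_mascheroni - 1) * x)\<bar> \<le> 12 * sqrt x"
proof -
  define r where "r = nat \<lfloor>sqrt x\<rfloor>"
  define N where "N = nat \<lfloor>x\<rfloor>"
  have r1: "real r \<le> sqrt x" "sqrt x < real r + 1" "r \<ge> 1"
  proof -
    have "sqrt x \<ge> 1" using x by simp
    then show "real r \<le> sqrt x" "sqrt x < real r + 1" "r \<ge> 1"
      unfolding r_def by linarith+
  qed
  have N1: "real N \<le> x" "x < real N + 1"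
    using x unfolding N_def by linarith+
  have r2: "(real r)\<^sup>2 \<le> x"
    using power_mono[OF r1(1), of 2] x by simp
  have r3: "x < (real r + 1)\<^sup>2"
    using power_strict_mono[OF r1(2), of 2] x by simp
  have rN: "r\<^sup>2 \<le> N" "N < (Suc r)\<^sup>2"
  proof -
    have "real (r\<^sup>2) < real (N + 1)"
      using r2 N1 by simp
    then have "r\<^sup>2 < N + 1" by (simp only: of_nat_less_iff)
    then show "r\<^sup>2 \<le> N" by simp
    have "real N < real ((Suc r)\<^sup>2)"
      using r3 N1 by (simp add: add.commute)
    then show "N < (Suc r)\<^sup>2" by (simp only: of_nat_less_iff)
  qed
  define T where "T = (\<Sum>a=1..r. real (N div a))"
  have "real (pair_count x + r\<^sup>2) = real (2 * (\<Sum>a=1..r. N div a))"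
    using card_hyperbola[OF rN] pair_count_eq_card[of x] x by (simp add: N_def)
  then have D: "real (pair_count x) = 2 * T - (real r)\<^sup>2"
    by (simp add: T_def)
  have dv: "x / real a - 1 \<le> real (N div a) \<and> real (N div a) \<le> x / real a" if "a \<in> {1..r}" for a
  proof
    have a: "real a > 0" using that by simp
    have "real (N div a) \<le> real N / real a"
    proof -
      have "real (N div a * a) \<le> real N"
        by (simp only: of_nat_le_iff div_times_less_eq_dividend)
      then show ?thesis using a by (simp add: field_simps)
    qed
    also have "\<dots> \<le> x / real a"
      using N1 a by (intro divide_right_mono) auto
    finally show "real (N div a) \<le> x / real a" .
    have "N < a * (N div a + 1)"
      using a dividend_less_times_div[of a N] by simp
    then have "real (N + 1) \<le> real (a * (N div a + 1))"
      by (simp only: of_nat_le_iff)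
    then have "x \<le> real a * (real (N div a) + 1)"
      using N1 by (simp add: distrib_left)
    then show "x / real a - 1 \<le> real (N div a)"
      using a by (simp add: field_simps)
  qed
  have xH: "(\<Sum>a=1..r. x / real a) = x * harm r"
    by (simp add: harm_def sum_distrib_left divide_inverse)
  have T: "x * harm r - real r \<le> T" "T \<le> x * harm r"
  proof -
    have "(\<Sum>a=1..r. x / real a - 1) \<le> T"
      unfolding T_def using dv by (intro sum_mono) auto
    then show "x * harm r - real r \<le> T"
      unfolding sum_subtractf xH by simp
    have "T \<le> (\<Sum>a=1..r. x / real a)"
      unfolding T_def using dv by (intro sum_mono) auto
    then show "T \<le> x * harm r" by (simp only: xH)
  qed
  have rp: "real r > 0" using r1 by simp
  have H1: "harm r - ln (real r) \<ge> (euler_mascheroni :: real)"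
  proof (rule LIMSEQ_le_const2[OF euler_mascheroni_LIMSEQ])
    show "\<exists>N. \<forall>n\<ge>N. harm n - ln (real n) \<le> harm r - ln (real r)"
      using r1 by (intro exI[of _ r] allI impI euler_mascheroni_sequence_decreasing) auto
  qed
  have H2: "harm r - ln (real r) \<le> (euler_mascheroni :: real) + 1 / real r"
  proof -
    have "harm r - ln (real (Suc r)) + inverse (real (2 * (r + 1))) \<le> (euler_mascheroni :: real)"
      using euler_mascheroni_bounds[of r] r1 by auto
    moreover have "inverse (real (2 * (r + 1))) \<ge> 0"
      by simp
    moreover have "ln (real (Suc r)) \<le> ln (real r) + 1 / real r"
    proof -
      have "ln (real (Suc r)) = ln (real r * (1 + 1 / real r))"
      proof -
        have "real r * (1 + 1 / real r) = real (Suc r)"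
          using rp by (simp add: distrib_left)
        then show ?thesis by (simp only:)
      qed
      also have "\<dots> = ln (real r) + ln (1 + 1 / real r)"
        using rp by (intro ln_mult_pos) (auto intro: add_pos_pos)
      also have "ln (1 + 1 / real r) \<le> 1 / real r"
        using rp by (intro ln_add_one_self_le_self) auto
      finally show ?thesis by simp
    qed
    ultimately show ?thesis by linarith
  qed
  have s: "sqrt x > 0" "sqrt x \<ge> 1" using x by auto
  have L1: "ln (sqrt x) - ln (real r) \<ge> 0"
    using ln_le_cancel_iff[OF rp s(1)] r1(1) by simp
  have L2: "ln (sqrt x) - ln (real r) \<le> 1 / real r"
  proof -
    have "ln (sqrt x) - ln (real r) = ln (sqrt x / real r)"
      using s rp by (simp add: ln_div)
    also have "\<dots> \<le> sqrt x / real r - 1"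
      using s rp by (intro ln_le_minus_one) auto
    also have "\<dots> \<le> 1 / real r"
    proof -
      have "sqrt x / real r - 1 = (sqrt x - real r) / real r"
        using rp by (simp add: diff_divide_distrib)
      also have "\<dots> \<le> 1 / real r"
        using r1 rp by (intro divide_right_mono) auto
      finally show ?thesis .
    qed
    finally show ?thesis .
  qed
  have lnx: "ln x = 2 * ln (sqrt x)"
    using x by (simp add: ln_sqrt)
  \<comment> \<open>The total defect of \<open>harm r\<close> against the logarithm. It is at most
    \<open>1 / r\<close>, which \<open>x / r \<le> 2 * sqrt x\<close> makes harmless after
    multiplication by \<open>2 * x\<close>.\<close>
  define h where "h = harm r - euler_mascheroni - ln (sqrt x)"
  have h: "\<bar>h\<bar> \<le> 1 / real r"
    using H1 H2 L1 L2 by (simp add: h_def abs_le_iff)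
  have xr: "x / real r \<le> 2 * sqrt x"
  proof -
    have "sqrt x \<le> 2 * real r"
      using r1 by linarith
    then have "sqrt x * sqrt x \<le> 2 * real r * sqrt x"
      using s by (intro mult_right_mono) auto
    then have "x \<le> 2 * real r * sqrt x"
      using x by simp
    then show ?thesis
      using rp by (simp add: field_simps)
  qed
  have hx: "\<bar>2 * x * h\<bar> \<le> 4 * sqrt x"
  proof -
    have "\<bar>2 * x * h\<bar> = 2 * x * \<bar>h\<bar>"
      using x by (simp add: abs_mult)
    also have "\<dots> \<le> 2 * x * (1 / real r)"
      using h x by (intro mult_left_mono) auto
    also have "\<dots> = 2 * (x / real r)" by simp
    finally show ?thesis using xr by linarith
  qed
  have sq: "x - (real r)\<^sup>2 \<le> 2 * sqrt x"
  proof -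
    have "x - (real r)\<^sup>2 = (sqrt x)\<^sup>2 - (real r)\<^sup>2" using x by simp
    also have "\<dots> = (sqrt x - real r) * (sqrt x + real r)"
      by (simp only: power2_eq_square) (simp add: algebra_simps)
    also have "\<dots> \<le> 1 * (2 * sqrt x)"
      using r1 s by (intro mult_mono) auto
    finally show ?thesis by simp
  qed
  have "x * ln x + (2 * euler_mascheroni - 1) * x = 2 * (x * harm r) - 2 * x * h - x"
    unfolding lnx h_def by (simp add: algebra_simps)
  then have eq: "real (pair_count x) - (x * ln x + (2 * euler_mascheroni - 1) * x) =
      2 * (T - x * harm r) + 2 * x * h + (x - (real r)\<^sup>2)"
    unfolding D by simp
  have gen: "\<bar>2 * (T' - Y) + b + e\<bar> \<le> 12 * s"
    if "Y - r' \<le> T'" "T' \<le> Y" "r' \<le> s" "\<bar>b\<bar> \<le> 4 * s" "e \<le> 2 * s" "e \<ge> 0" "s > 0" for Y T' r' b e s :: real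
  proof -
    have b: "b \<le> 4 * s" "- b \<le> 4 * s"
      using that(4) by (auto simp: abs_le_iff)
    show ?thesis
    proof (rule abs_leI)
      show "2 * (T' - Y) + b + e \<le> 12 * s"
        using that(2,5,7) b by argo
      show "- (2 * (T' - Y) + b + e) \<le> 12 * s"
        using that(1,3,6,7) b by argo
    qed
  qed
  show ?thesis
    unfolding eq by (rule gen[OF T r1(1) hx sq]) (use r2 s in auto)
qed

section \<open>The pair sum as a Laplace transform\<close>

lemma exp_neg_le_inverse_square:
  fixes y :: real
  assumes "y > 0"
  shows "exp (- y) \<le> 2 / y\<^sup>2"
proof -
  have "y\<^sup>2 / 2 \<le> exp y"
    using exp_lower_Taylor_quadratic[of y] assms by simp
  then have "inverse (exp y) \<le> inverse (y\<^sup>2 / 2)"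
    using assms by (intro le_imp_inverse_le) auto
  then show ?thesis
    by (simp add: exp_minus)
qed

lemma LINT_exp_Ici:
  fixes q :: complex
  assumes q: "Re q > 0"
  shows "set_integrable lborel {c..} (\<lambda>t. q * exp (- q * of_real t))"
    and "(LINT t:{c..}|lborel. q * exp (- q * of_real t)) = exp (- q * of_real c)"
    and "(LINT t:{c..}|lborel. norm (q * exp (- q * of_real t))) = norm q * (exp (- Re q * c) / Re q)"
proof -
  have cont: "continuous_on {c..} (\<lambda>t. q * exp (- q * of_real t))"
    by (intro continuous_intros)
  have nrm: "norm (q * exp (- q * of_real t)) = norm q * exp (- Re q * t)" for t
    by (simp add: norm_mult)
  have int: "set_integrable lborel {c..} (\<lambda>t. norm q * exp (- Re q * t))"
    using integrable_exp_neg_Ici(1)[OF q, of c] by (intro set_integrable_mult_right) auto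
  show F: "set_integrable lborel {c..} (\<lambda>t. q * exp (- q * of_real t))"
  proof (rule set_integrable_bound[OF int])
    show "set_borel_measurable lborel {c..} (\<lambda>t. q * exp (- q * of_real t))"
      unfolding set_borel_measurable_def using borel_measurable_continuous_on_indicator[OF _ cont] by simp
    show "AE t in lborel. t \<in> {c..} \<longrightarrow> norm (q * exp (- q * of_real t)) \<le> norm (norm q * exp (- Re q * t))"
      by (intro AE_I2) (simp add: norm_mult)
  qed
  show "(LINT t:{c..}|lborel. norm (q * exp (- q * of_real t))) = norm q * (exp (- Re q * c) / Re q)"
    unfolding nrm using integrable_exp_neg_Ici(2)[OF q, of c] by (subst set_integral_mult_right) auto
  have "(\<lambda>n. integral {c..c + real n} (\<lambda>t. q * exp (- q * of_real t))) \<longlonglongrightarrow> (LINT t:{c..}|lborel. q * exp (- q * of_real t))"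
  proof (rule set_lebesgue_integral_limit[OF F])
    fix t :: real
    show "eventually (\<lambda>n. t \<in> {c..c + real n}) sequentially" if "t \<in> {c..}"
      using eventually_ge_at_top[of "nat \<lceil>t - c\<rceil>"] by eventually_elim (use that in \<open>auto; linarith\<close>)
  qed auto
  moreover have "integral {c..c + real n} (\<lambda>t. q * exp (- q * of_real t)) = exp (- q * of_real c) - exp (- q * of_real (c + real n))" for n
  proof -
    have hi: "((\<lambda>t. q * exp (- q * of_real t)) has_integral (- exp (- q * of_real (c + real n)) - - exp (- q * of_real c))) {c..c + real n}"
    proof (rule fundamental_theorem_of_calculus)
      fix t
      have "((\<lambda>w. - exp (- q * w)) has_field_derivative q * exp (- q * of_real t)) (at (of_real t))"
        by (auto intro!: derivative_eq_intros)
      then show "((\<lambda>t. - exp (- q * of_real t)) has_vector_derivative q * exp (- q * of_real t)) (at t within {c..c + real n})"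
        by (rule has_vector_derivative_real_field)
    qed auto
    show ?thesis
      unfolding integral_unique[OF hi] by (simp only: diff_conv_add_uminus minus_minus add.commute)
  qed
  ultimately have lim1: "(\<lambda>n. exp (- q * of_real c) - exp (- q * of_real (c + real n))) \<longlonglongrightarrow> (LINT t:{c..}|lborel. q * exp (- q * of_real t))"
    by simp
  have "(\<lambda>n. exp (- q * of_real (c + real n))) \<longlonglongrightarrow> 0"
  proof (rule tendsto_norm_zero_cancel)
    have "(\<lambda>n. exp (- Re q * (c + real n))) \<longlonglongrightarrow> 0"
      using q by real_asymp
    then show "(\<lambda>n. norm (exp (- q * of_real (c + real n)))) \<longlonglongrightarrow> 0"
      by simp
  qed
  then have "(\<lambda>n. exp (- q * of_real c) - exp (- q * of_real (c + real n))) \<longlonglongrightarrow> exp (- q * of_real c) - 0"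
    by (intro tendsto_intros)
  with lim1 show "(LINT t:{c..}|lborel. q * exp (- q * of_real t)) = exp (- q * of_real c)"
    by (simp add: LIMSEQ_unique)
qed

text \<open>Abel summation in integral form: \<open>exp (- p * q)\<close> is the integral of
  \<open>q * exp (- q * t)\<close> over \<open>t \<ge> p\<close>, and exchanging sum and integral
  collects the terms into the staircase \<open>R\<close>. The scale \<open>2 * pi\<close> makes
  \<open>R\<close> directly comparable with the mean square.\<close>

lemma pair_sum_eq_laplace:
  fixes q :: complex
  assumes q: "Re q > 0"
  defines "R \<equiv> \<lambda>t. 2 * pi * real (pair_count (t / (2 * pi)))"
  shows "(\<lambda>k. 2 * of_real pi * exp (- 2 * of_real pi * of_nat (pair_prod k) * q)) sums
            (LINT t:{0..}|lborel. of_real (R t) * (q * exp (- q * of_real t)))"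
    and "set_integrable lborel {0..} (\<lambda>t. of_real (R t) * (q * exp (- q * of_real t)))"
proof -
  define a where "a = (\<lambda>k. 2 * pi * real (pair_prod k))"
  have a0: "a k > 0" for k using pair_prod_pos[of k] by (simp add: a_def)
  define e where "e = (\<lambda>t. q * exp (- q * of_real t))"
  define f where "f = (\<lambda>k t. 2 * of_real pi * (indicator {a k..} t *\<^sub>R e t))"
  have fint: "integrable lborel (f k)" for k
    using LINT_exp_Ici(1)[OF q, of "a k"] unfolding f_def e_def set_integrable_def by (rule integrable_mult_right)
  have fval: "(LINT t|lborel. f k t) = 2 * of_real pi * exp (- 2 * of_real pi * of_nat (pair_prod k) * q)" for k
  proof -
    have "(LINT t|lborel. f k t) = 2 * of_real pi * (LINT t:{a k..}|lborel. e t)"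
      unfolding f_def set_lebesgue_integral_def by (rule integral_mult_right_zero)
    also have "(LINT t:{a k..}|lborel. e t) = exp (- q * of_real (a k))"
      unfolding e_def by (rule LINT_exp_Ici(2)[OF q])
    also have "- q * of_real (a k) = - 2 * of_real pi * of_nat (pair_prod k) * q"
      by (simp add: a_def)
    finally show ?thesis .
  qed
  have fnorm: "(LINT t|lborel. norm (f k t)) = 2 * pi * (norm q * (exp (- Re q * a k) / Re q))" for k
  proof -
    have "(LINT t|lborel. norm (f k t)) = (LINT t|lborel. 2 * pi * (indicator {a k..} t *\<^sub>R norm (e t)))"
      by (intro Bochner_Integration.integral_cong) (auto simp: f_def norm_mult)
    also have "\<dots> = 2 * pi * (LINT t:{a k..}|lborel. norm (e t))"
      unfolding set_lebesgue_integral_def by simp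
    also have "(LINT t:{a k..}|lborel. norm (e t)) = norm q * (exp (- Re q * a k) / Re q)"
      unfolding e_def by (rule LINT_exp_Ici(3)[OF q])
    finally show ?thesis .
  qed
  have supp: "{k. f k t \<noteq> 0} \<subseteq> {k. real (pair_prod k) \<le> t / (2 * pi)}" for t
    by (auto simp: f_def a_def indicator_def field_simps split: if_splits)
  have fin: "finite {k. real (pair_prod k) \<le> t / (2 * pi)}" for t
    by (rule finite_pair_count)
  have c1: "AE t in lborel. summable (\<lambda>k. norm (f k t))"
  proof (rule AE_I2)
    fix t
    show "summable (\<lambda>k. norm (f k t))"
      by (rule summable_finite[OF fin[of t]]) (use supp[of t] in auto)
  qed
  have c2: "summable (\<lambda>k. LINT t|lborel. norm (f k t))"
    unfolding fnorm
  proof (intro summable_mult summable_divide)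
    have sm: "summable (\<lambda>k. (2 / (Re q * (2 * pi))\<^sup>2) * real (pair_prod k) powr (- 2))"
      using zeta_square_sums(2)[of 2] by (intro summable_mult) simp
    show "summable (\<lambda>k. exp (- Re q * a k))"
    proof (rule summable_comparison_test'[OF sm])
      fix k :: nat
      have "exp (- (Re q * a k)) \<le> 2 / (Re q * a k)\<^sup>2"
        using q a0[of k] by (intro exp_neg_le_inverse_square) auto
      also have "\<dots> = (2 / (Re q * (2 * pi))\<^sup>2) * real (pair_prod k) powr (- 2)"
        using pair_prod_pos[of k] by (simp add: a_def powr_minus power_mult_distrib field_simps)
      finally show "norm (exp (- Re q * a k)) \<le> (2 / (Re q * (2 * pi))\<^sup>2) * real (pair_prod k) powr (- 2)"
        by simp
    qed
  qed
  have suminf: "(\<Sum>k. f k t) = indicator {0..} t *\<^sub>R (of_real (R t) * e t)" for t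
  proof -
    have "(\<Sum>k. f k t) = (\<Sum>k\<in>{k. real (pair_prod k) \<le> t / (2 * pi)}. f k t)"
      by (rule suminf_finite[OF fin]) (use supp[of t] in auto)
    also have "\<dots> = (\<Sum>k\<in>{k. real (pair_prod k) \<le> t / (2 * pi)}. 2 * of_real pi * e t)"
      by (intro sum.cong) (auto simp: f_def a_def indicator_def field_simps)
    also have "\<dots> = of_real (R t) * e t"
      by (simp add: R_def pair_count_def)
    also have "\<dots> = indicator {0..} t *\<^sub>R (of_real (R t) * e t)"
    proof (cases "t \<ge> 0")
      case False
      have "{k. real (pair_prod k) \<le> t / (2 * pi)} = {}"
      proof -
        have "t / (2 * pi) < 0" using False by (simp add: divide_neg_pos)
        then show ?thesis
          by (auto simp: not_le intro: less_le_trans)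
      qed
      then show ?thesis using False by (simp add: R_def pair_count_def)
    qed auto
    finally show ?thesis .
  qed
  show "(\<lambda>k. 2 * of_real pi * exp (- 2 * of_real pi * of_nat (pair_prod k) * q)) sums
            (LINT t:{0..}|lborel. of_real (R t) * (q * exp (- q * of_real t)))"
    using sums_integral[OF fint c1 c2] unfolding suminf fval set_lebesgue_integral_def e_def .
  show "set_integrable lborel {0..} (\<lambda>t. of_real (R t) * (q * exp (- q * of_real t)))"
    using integrable_suminf[OF fint c1 c2] unfolding suminf set_integrable_def e_def .
qed

lemma LINT_powr_exp_bound:
  fixes F :: "real \<Rightarrow> complex" and p m M :: real
  assumes p: "p > -1" and m: "m > 0" and M: "M \<ge> 0"
    and meas: "set_borel_measurable lborel {7..} F"
    and bd: "\<And>t. t \<ge> 7 \<Longrightarrow> norm (F t) \<le> M * (t powr p * exp (- m * t))"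
  shows "set_integrable lborel {7..} F"
    and "norm (LINT t:{7..}|lborel. F t) \<le> M * (Gamma (p + 1) * m powr (- p - 1))"
proof -
  define G where "G = (\<lambda>t. indicator {0<..} t * (t powr p * exp (- m * t)))"
  have Gnn: "G t \<ge> 0" for t by (auto simp: G_def indicator_def)
  have hb: "has_bochner_integral lborel G (Gamma (p + 1) * m powr (- p - 1))"
  proof (rule has_bochner_integral_nn_integral)
    show "(\<integral>\<^sup>+t. ennreal (G t) \<partial>lborel) = ennreal (Gamma (p + 1) * m powr (- p - 1))"
      unfolding nn_integral_powr_exp[OF p m, symmetric] G_def
      by (intro nn_integral_cong) (auto simp: indicator_def)
    show "0 \<le> Gamma (p + 1) * m powr (- p - 1)"
      using p by (intro mult_nonneg_nonneg less_imp_le[OF Gamma_real_pos]) auto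
  qed (auto simp: G_def indicator_def)
  have MG: "integrable lborel (\<lambda>t. M * G t)"
    using hb by (intro integrable_mult_right) (simp add: has_bochner_integral_iff)
  have bd': "norm (indicator {7..} t *\<^sub>R F t) \<le> M * G t" for t
    using bd[of t] M by (auto simp: G_def indicator_def)
  show F: "set_integrable lborel {7..} F"
    unfolding set_integrable_def
  proof (rule Bochner_Integration.integrable_bound[OF MG])
    show "(\<lambda>t. indicator {7..} t *\<^sub>R F t) \<in> borel_measurable lborel"
      using meas by (simp add: set_borel_measurable_def)
    show "AE t in lborel. norm (indicator {7..} t *\<^sub>R F t) \<le> norm (M * G t)"
    proof (rule AE_I2)
      fix t
      have "norm (M * G t) = M * G t"
        using M Gnn[of t] by simp
      then show "norm (indicator {7..} t *\<^sub>R F t) \<le> norm (M * G t)"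
        using bd'[of t] by (simp only:)
    qed
  qed
  have "norm (LINT t:{7..}|lborel. F t) \<le> (LINT t|lborel. norm (indicator {7..} t *\<^sub>R F t))"
    unfolding set_lebesgue_integral_def by (rule integral_norm_bound)
  also have "\<dots> \<le> (LINT t|lborel. M * G t)"
    using F unfolding set_integrable_def by (intro integral_mono integrable_norm MG bd')
  also have "\<dots> = M * (Gamma (p + 1) * m powr (- p - 1))"
    using hb by (simp add: has_bochner_integral_iff)
  finally show "norm (LINT t:{7..}|lborel. F t) \<le> M * (Gamma (p + 1) * m powr (- p - 1))" .
qed

lemma set_borel_measurable_continuous:
  fixes F :: "real \<Rightarrow> complex"
  assumes "continuous_on {c..} F"
  shows "set_borel_measurable lborel {c..} F"
  unfolding set_borel_measurable_def using borel_measurable_continuous_on_indicator[OF _ assms] by simp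

definition log_density :: "real \<Rightarrow> real" where
  "log_density t = ln (t / (2 * pi)) + 2 * euler_mascheroni"

text \<open>This is \<open>2 * pi\<close> times Dirichlet's main term at
  \<open>t / (2 * pi)\<close>. The same function approximates the staircase of the pair sum and the
  mean square of zeta, which is how the two are tied together.\<close>

definition log_primitive :: "real \<Rightarrow> real" where
  "log_primitive t = t * ln (t / (2 * pi)) + (2 * euler_mascheroni - 1) * t"

text \<open>A square root in place of the logarithm keeps the later estimates in the form of Gamma
  integrals; the power of \<open>Re z\<close> lost in this way is affordable in the Tauberian
  step.\<close>

lemma log_density_bounds:
  assumes t: "t \<ge> 7"
  shows "0 \<le> log_density t" "log_density t \<le> 4 * t powr (1/2)"
proof -
  have pi2: "2 * pi \<le> 7"
    using pi_approx by simp
  have "ln (t / (2 * pi)) \<ge> 0"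
    using t pi2 by (intro ln_ge_zero) (auto simp: field_simps)
  then show "0 \<le> log_density t"
    using euler_mascheroni_pos by (simp add: log_density_def)
  have "ln (t / (2 * pi)) \<le> ln t"
    using t pi_gt3 by (intro ln_mono) (auto simp: field_simps)
  also have "ln t = 2 * ln (sqrt t)"
    using t by (simp add: ln_sqrt)
  also have "ln (sqrt t) \<le> sqrt t - 1"
    using t by (intro ln_le_minus_one) auto
  finally have "log_density t \<le> 2 * (sqrt t - 1) + 2"
    using euler_mascheroni_less_13_over_22 by (simp add: log_density_def)
  also have "\<dots> \<le> 4 * sqrt t"
    using t by simp
  finally show "log_density t \<le> 4 * t powr (1/2)"
    using t by (simp add: powr_half_sqrt)
qed

lemma continuous_on_log_density: "continuous_on {7..} log_density"
  unfolding log_density_def[abs_def] by (intro continuous_intros) auto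

lemma log_primitive_deriv:
  "t > 0 \<Longrightarrow> (log_primitive has_real_derivative log_density t) (at t)"
  unfolding log_primitive_def[abs_def] log_density_def
  by (auto intro!: derivative_eq_intros simp: field_simps)

lemma log_density_laplace:
  fixes z :: complex
  assumes z: "Re z > 0"
  shows "set_integrable lborel {7..} (\<lambda>t. of_real (log_density t) * exp (- z * of_real t))"
    and "norm (LINT t:{7..}|lborel. of_real (log_density t) * exp (- z * of_real t)) \<le> 4 * (Gamma (3/2) * Re z powr (- 3/2))"
proof -
  have meas: "set_borel_measurable lborel {7..} (\<lambda>t. of_real (log_density t) * exp (- z * of_real t))"
    by (intro set_borel_measurable_continuous continuous_intros continuous_on_log_density)
  have bd: "norm (of_real (log_density t) * exp (- z * of_real t)) \<le> 4 * (t powr (1/2) * exp (- Re z * t))"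
    if t: "t \<ge> 7" for t
  proof -
    have "norm (of_real (log_density t) * exp (- z * of_real t)) = log_density t * exp (- Re z * t)"
      using log_density_bounds(1)[OF t] by (simp add: norm_mult)
    also have "\<dots> \<le> (4 * t powr (1/2)) * exp (- Re z * t)"
      by (intro mult_right_mono log_density_bounds t) auto
    finally show ?thesis
      by (simp only: mult.assoc)
  qed
  have *: "set_integrable lborel {7..} (\<lambda>t. of_real (log_density t) * exp (- z * of_real t))"
    "norm (LINT t:{7..}|lborel. of_real (log_density t) * exp (- z * of_real t)) \<le> 4 * (Gamma (1/2 + 1) * Re z powr (- (1/2) - 1))"
    by (rule LINT_powr_exp_bound[OF _ z _ meas bd]; simp)+
  show "set_integrable lborel {7..} (\<lambda>t. of_real (log_density t) * exp (- z * of_real t))"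
    by (rule *(1))
  show "norm (LINT t:{7..}|lborel. of_real (log_density t) * exp (- z * of_real t)) \<le> 4 * (Gamma (3/2) * Re z powr (- 3/2))"
  proof -
    have eqs: "1/2 + 1 = (3/2 :: real)" "- (1/2) - 1 = (- 3/2 :: real)"
      by simp_all
    show ?thesis
      using *(2) unfolding eqs .
  qed
qed

lemma norm_exp_diff_le:
  fixes a b :: complex
  assumes "Re a \<le> r" "Re b \<le> r"
  shows "norm (exp a - exp b) \<le> exp r * norm (a - b)"
proof (rule field_differentiable_bound[where S = "{w. Re w \<le> r}"])
  show "convex {w. Re w \<le> r}" by (rule convex_halfspace_Re_le)
  show "(exp has_field_derivative exp w) (at w within {w. Re w \<le> r})" for w
    by (rule has_field_derivative_at_within[OF DERIV_exp])
qed (use assms in auto)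

text \<open>In the variable \<open>q = z + O(z^2)\<close> the pair sum is an ordinary Laplace
  transform. The quadratic estimate alone could not keep \<open>q\<close> in the right half-plane
  when \<open>Re z\<close> is much smaller than \<open>(norm z)^2\<close>; the exact formula
  \<open>Re q = exp (Im z) * sin (Re z)\<close> does. The radius \<open>1/3\<close> is what makes
  \<open>3 * (norm z)^2 \<le> norm z\<close>.\<close>

lemma rotated_variable_bounds:
  fixes z :: complex
  assumes z: "0 < Re z" "norm z \<le> 1/3"
  defines "q \<equiv> \<i> * (exp (- \<i> * z) - 1)"
  shows "norm (q - z) \<le> 3 * (norm z)\<^sup>2" "norm q \<le> 2 * norm z" "Re q \<ge> Re z / 2"
proof -
  define w where "w = - \<i> * z"
  have "norm (exp w - (\<Sum>k\<le>1. w ^ k / fact k)) \<le> exp \<bar>Re w\<bar> * norm w ^ Suc 1 / fact 1"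
    by (rule Taylor_exp)
  then have "norm (exp w - (1 + w)) \<le> exp \<bar>Re w\<bar> * (norm w)\<^sup>2"
    by (simp add: numeral_2_eq_2)
  also have "norm w = norm z"
    by (simp add: w_def norm_mult)
  also have "exp \<bar>Re w\<bar> \<le> exp 1"
    using abs_Im_le_cmod[of z] z by (simp add: w_def)
  also have "exp 1 \<le> (3::real)" by (rule exp_le)
  finally have 1: "norm (exp w - (1 + w)) \<le> 3 * (norm z)\<^sup>2"
    by (simp add: mult_right_mono)
  have "q - z = \<i> * (exp w - (1 + w))"
    by (simp add: q_def w_def algebra_simps)
  then show d: "norm (q - z) \<le> 3 * (norm z)\<^sup>2"
    using 1 by (simp add: norm_mult)
  have "3 * (norm z)\<^sup>2 \<le> norm z"
    using mult_right_mono[OF z(2), of "norm z"] by (simp add: power2_eq_square)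
  then show "norm q \<le> 2 * norm z"
    using d norm_triangle_ineq[of "q - z" z] by simp
  have "Re q = exp (Im z) * sin (Re z)"
    by (simp add: q_def Re_exp Im_exp)
  moreover have "exp (Im z) * sin (Re z) \<ge> (2/3) * (3/4 * Re z)"
  proof (intro mult_mono)
    have "1 + Im z \<le> exp (Im z)" by (rule exp_ge_add_one_self)
    then show "2 / 3 \<le> exp (Im z)"
      using abs_Im_le_cmod[of z] z by linarith
    have x: "0 < Re z" "Re z \<le> 1/3"
      using z complex_Re_le_cmod[of z] by auto
    have "\<bar>sin (Re z) - (\<Sum>m<3. sin_coeff m * Re z ^ m)\<bar> \<le> inverse (fact 3) * \<bar>Re z\<bar> ^ 3"
      by (rule Maclaurin_sin_bound)
    then have "\<bar>sin (Re z) - Re z\<bar> \<le> Re z ^ 3 / 6"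
      using x by (simp add: sin_coeff_def numeral_3_eq_3 fact_numeral field_simps)
    moreover have "Re z ^ 3 \<le> Re z * (1/3)"
    proof -
      have "Re z * (Re z * Re z) \<le> Re z * (1/3 * 1)"
        using x by (intro mult_left_mono mult_mono) auto
      then show ?thesis by (simp add: power3_eq_cube mult.assoc)
    qed
    ultimately show "3/4 * Re z \<le> sin (Re z)"
      using x by linarith
  qed (use z in auto)
  ultimately show "Re q \<ge> Re z / 2" by simp
qed

text \<open>Shows that the weight \<open>n^2 * x powr (- 5/2)\<close> dominates the smaller errors,
  so that all of them can be reported in one form.\<close>

lemma laplace_weight_bounds:
  fixes x n :: real
  assumes x: "0 < x" "x \<le> 1" "x \<le> n"
  shows "n * x powr (- 3/2) \<le> n\<^sup>2 * x powr (- 5/2)" "1 \<le> n\<^sup>2 * x powr (- 5/2)"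
proof -
  have "n * x powr (- 3/2) = (n * x) * x powr (- 5/2)"
    using x powr_add[of x 1 "- 5/2"] by simp
  also have "\<dots> \<le> (n * n) * x powr (- 5/2)"
    using x by (intro mult_right_mono mult_left_mono) auto
  finally show 1: "n * x powr (- 3/2) \<le> n\<^sup>2 * x powr (- 5/2)"
    by (simp add: power2_eq_square)
  have "1 \<le> x powr (- 1/2)"
    using x powr_mono'[of "- 1/2" 0 x] by simp
  also have "\<dots> = x * x powr (- 3/2)"
    using x powr_add[of x 1 "- 3/2"] by simp
  also have "\<dots> \<le> n * x powr (- 3/2)"
    using x by (intro mult_right_mono) auto
  finally show "1 \<le> n\<^sup>2 * x powr (- 5/2)" using 1 by simp
qed

text \<open>The staircase is replaced by \<open>log_primitive\<close>, at the price of Dirichlet's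
  error term; an integration by parts leads to \<open>log_density\<close>; finally the exponent
  \<open>q\<close> is exchanged for \<open>z\<close>. The interval below 7 is split off because
  \<open>log_density\<close> enters only from there on.\<close>

lemma pair_sum_laplace:
  obtains C where "C > 0"
    "\<And>z S. \<lbrakk>0 < Re z; norm z \<le> 1/3;
        (\<lambda>k. 2 * of_real pi * exp (- 2 * of_real pi * of_nat (pair_prod k) * (\<i> * (exp (- \<i> * z) - 1)))) sums S\<rbrakk>
      \<Longrightarrow> norm (S - (LINT t:{7..}|lborel. of_real (log_density t) * exp (- z * of_real t)))
           \<le> C * ((norm z)\<^sup>2 * Re z powr (- 5/2))"
proof -
  define R where "R = (\<lambda>t. 2 * pi * real (pair_count (t / (2 * pi))))"
  have R0: "R t \<ge> 0" for t by (simp add: R_def)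
  \<comment> \<open>\<open>48\<close> comes from \<open>2 * pi * 12 * sqrt y\<close> with
    \<open>pi < 4\<close> and \<open>sqrt y \<le> sqrt t / 2\<close>, the next factor 2 from
    \<open>norm q \<le> 2 * norm z\<close>. In \<open>K2\<close>, \<open>12\<close> is the 4 of
    \<open>log_density_bounds\<close> times the 3 in the bound for \<open>norm (q - z)\<close>. The
    powers of \<open>1/2\<close> reflect \<open>Re q \<ge> x / 2\<close>.\<close>
  define K1 :: real where "K1 = 48 * 2 * (Gamma (3/2) * (1/2) powr (- 3/2)) "
  define K2 :: real where "K2 = 12 * (Gamma (5/2) * (1/2) powr (- 5/2))"
  define K0 where "K0 = 14 * R 7 + \<bar>log_primitive 7\<bar>"
  have K: "K0 \<ge> 0" "K1 \<ge> 0" "K2 > 0"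
    using R0[of 7] Gamma_real_pos[of "3/2"] Gamma_real_pos[of "5/2"] by (auto simp: K0_def K1_def K2_def)
  show thesis
  proof (rule that)
    show "K0 + K1 + K2 > 0" using K by simp
    fix z S assume z: "0 < Re z" "norm z \<le> 1/3"
      and S: "(\<lambda>k. 2 * of_real pi * exp (- 2 * of_real pi * of_nat (pair_prod k) * (\<i> * (exp (- \<i> * z) - 1)))) sums S"
    define q where "q = \<i> * (exp (- \<i> * z) - 1)"
    note qb = rotated_variable_bounds[OF z, folded q_def]
    define x where "x = Re z"
    have x: "x > 0" "x \<le> norm z" "x \<le> 1"
      using z complex_Re_le_cmod[of z] by (auto simp: x_def)
    have q: "Re q > 0" "Re q \<ge> x / 2"
      using qb(3) z by (auto simp: x_def)
    define m where "m = x / 2"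
    have m: "m > 0" using x by (simp add: m_def)
    define e where "e = (\<lambda>t. exp (- q * of_real t))"
    have e_norm: "norm (e t) \<le> exp (- m * t)" if "t \<ge> 0" for t
      using mult_right_mono[OF q(2) that] by (simp add: e_def m_def)
    define f where "f = (\<lambda>t. of_real (R t) * (q * e t))"
    define g where "g = (\<lambda>t. of_real (log_primitive t) * (q * e t))"
    define h where "h = (\<lambda>t. of_real (log_density t) * e t)"
    have S_eq: "S = (LINT t:{0..}|lborel. f t)" and fint: "set_integrable lborel {0..} f"
      using pair_sum_eq_laplace[OF q(1)] S unfolding f_def e_def R_def q_def by (auto dest: sums_unique2)
    have f7: "set_integrable lborel {7..} f" and f07: "set_integrable lborel {0..<7} f"
      by (rule set_integrable_subset[OF fint]; auto)+
    have split: "S = (LINT t:{0..<7}|lborel. f t) + (LINT t:{7..}|lborel. f t)"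
    proof -
      have "{0..<7} \<union> {7..} = {0::real..}" by auto
      moreover have "(LINT t:{0..<7} \<union> {7..}|lborel. f t) = (LINT t:{0..<7}|lborel. f t) + (LINT t:{7..}|lborel. f t)"
        by (rule set_integral_Un) (use f7 f07 in auto)
      ultimately show ?thesis by (simp add: S_eq)
    qed
    have p1: "norm (LINT t:{0..<7}|lborel. f t) \<le> 14 * R 7 * norm z"
    proof -
      have "norm (LINT t:{0..<7}|lborel. f t) \<le> (LINT t|lborel. norm (indicator {0..<7} t *\<^sub>R f t))"
        unfolding set_lebesgue_integral_def by (rule integral_norm_bound)
      also have "\<dots> \<le> (LINT t|lborel. (R 7 * (2 * norm z)) * indicator {0..<7::real} t)"
      proof (rule integral_mono)
        show "integrable lborel (\<lambda>t. norm (indicator {0..<7} t *\<^sub>R f t))"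
          using f07 unfolding set_integrable_def by (rule integrable_norm)
        show "integrable lborel (\<lambda>t. R 7 * (2 * norm z) * indicator {0..<7::real} t)"
          by (intro integrable_mult_right integrable_real_indicator) auto
        fix t :: real
        have "norm (f t) \<le> R 7 * (2 * norm z)" if t: "0 \<le> t" "t < 7"
        proof -
          have "R t \<le> R 7"
            unfolding R_def using t by (intro mult_left_mono of_nat_mono pair_count_mono divide_right_mono) auto
          moreover have "norm (e t) \<le> 1"
            using e_norm[OF t(1)] m t by (auto intro: order.trans)
          ultimately have "R t * (norm q * norm (e t)) \<le> R 7 * (2 * norm z * 1)"
            using qb(2) R0 by (intro mult_mono mult_nonneg_nonneg) auto
          then show ?thesis using R0[of t] by (simp add: f_def norm_mult)
        qed
        then show "norm (indicator {0..<7} t *\<^sub>R f t) \<le> R 7 * (2 * norm z) * indicator {0..<7} t"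
          by (auto simp: indicator_def)
      qed
      also have "\<dots> = 14 * R 7 * norm z" by simp
      finally show ?thesis .
    qed
    have contg: "continuous_on {7..} g"
      unfolding g_def e_def log_primitive_def by (intro continuous_intros) auto
    have gm: "set_borel_measurable lborel {7..} g"
      by (rule set_borel_measurable_continuous[OF contg])
    have dm: "set_borel_measurable lborel {7..} (\<lambda>t. f t - g t)"
      using f7 gm borel_measurable_diff[of "\<lambda>t. indicator {7..} t *\<^sub>R f t" lborel "\<lambda>t. indicator {7..} t *\<^sub>R g t"]
      by (auto simp: set_borel_measurable_def set_integrable_def scaleR_diff_right dest: borel_measurable_integrable)
    have bd2: "norm (f t - g t) \<le> 48 * (2 * norm z) * (t powr (1/2) * exp (- m * t))" if t: "t \<ge> 7" for t
    proof -
      have pi2: "2 * pi \<le> 7"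
        using pi_approx by simp
      define y where "y = t / (2 * pi)"
      have y: "y \<ge> 1" "t = 2 * pi * y"
        using t pi2 by (auto simp: y_def field_simps)
      have lp: "log_primitive t = 2 * pi * (y * ln y + (2 * euler_mascheroni - 1) * y)"
        unfolding log_primitive_def y_def[symmetric] by (simp add: y(2) algebra_simps)
      have "\<bar>R t - log_primitive t\<bar> = 2 * pi * \<bar>real (pair_count y) - (y * ln y + (2 * euler_mascheroni - 1) * y)\<bar>"
        unfolding lp R_def y_def[symmetric] right_diff_distrib[symmetric] by (simp add: abs_mult)
      also have "\<dots> \<le> 2 * pi * (12 * sqrt y)"
        using pair_count_asymp[OF y(1)] by (intro mult_left_mono) auto
      also have "\<dots> \<le> 2 * 4 * (12 * (sqrt t / 2))"
      proof (intro mult_mono)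
        have "sqrt y \<le> sqrt (t / 4)"
          using pi_gt3 t by (auto simp: y_def field_simps)
        also have "\<dots> = sqrt t / 2"
          by (simp add: real_sqrt_divide)
        finally show "sqrt y \<le> sqrt t / 2" .
      qed (use pi_less_4 y in auto)
      also have "\<dots> = 48 * t powr (1/2)"
        using t by (simp add: powr_half_sqrt)
      finally have 1: "\<bar>R t - log_primitive t\<bar> \<le> 48 * t powr (1/2)" .
      have "f t - g t = of_real (R t - log_primitive t) * (q * e t)"
        by (simp add: f_def g_def algebra_simps)
      then have "norm (f t - g t) = \<bar>R t - log_primitive t\<bar> * (norm q * norm (e t))"
        by (simp only: norm_mult norm_of_real)
      also have "\<dots> \<le> (48 * t powr (1/2)) * ((2 * norm z) * exp (- m * t))"
        using t by (intro mult_mono 1 qb e_norm) auto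
      finally show ?thesis
        by (simp only: mult_ac)
    qed
    have p2: "set_integrable lborel {7..} (\<lambda>t. f t - g t)"
      "norm (LINT t:{7..}|lborel. f t - g t) \<le> (48 * (2 * norm z)) * (Gamma (1/2 + 1) * m powr (- (1/2) - 1))"
      by (rule LINT_powr_exp_bound[OF _ m _ dm bd2]; simp)+
    have g7: "set_integrable lborel {7..} g"
      using set_integral_diff(1)[OF f7 p2(1)] by simp
    have h7: "set_integrable lborel {7..} h"
      unfolding h_def e_def by (rule log_density_laplace(1)[OF q(1)])
    \<comment> \<open>Integration by parts: \<open>g - h\<close> is the derivative of
      \<open>- log_primitive * e\<close>, which vanishes at infinity, so that the boundary value at
      7 remains.\<close>
    have p3: "norm ((LINT t:{7..}|lborel. g t) - (LINT t:{7..}|lborel. h t)) \<le> \<bar>log_primitive 7\<bar>"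
    proof -
      have "(\<lambda>n. integral {7..7 + real n} (\<lambda>t. g t - h t)) \<longlonglongrightarrow> (LINT t:{7..}|lborel. g t - h t)"
      proof (rule set_lebesgue_integral_limit)
        fix t :: real
        show "eventually (\<lambda>n. t \<in> {7..7 + real n}) sequentially" if "t \<in> {7..}"
          using eventually_ge_at_top[of "nat \<lceil>t - 7\<rceil>"] by eventually_elim (use that in \<open>auto; linarith\<close>)
      qed (use g7 h7 in auto)
      moreover have "integral {7..7 + real n} (\<lambda>t. g t - h t) =
          - (of_real (log_primitive (7 + real n)) * e (7 + real n)) - - (of_real (log_primitive 7) * e 7)" for n
      proof (rule integral_unique, rule fundamental_theorem_of_calculus)
        fix t assume t: "t \<in> {7..7 + real n}"
        have "((\<lambda>t. complex_of_real (log_primitive t)) has_vector_derivative of_real (log_density t)) (at t within {7..7 + real n})"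
        proof -
          have "(log_primitive has_vector_derivative log_density t) (at t within {7..7 + real n})"
            using has_field_derivative_at_within[OF log_primitive_deriv[of t]] t
            by (simp add: has_real_derivative_iff_has_vector_derivative)
          then show ?thesis
            by (rule bounded_linear.has_vector_derivative[OF bounded_linear_of_real])
        qed
        moreover have "(e has_vector_derivative (- q * e t)) (at t within {7..7 + real n})"
        proof -
          have "((\<lambda>w. exp (- q * w)) has_field_derivative - q * exp (- q * of_real t)) (at (of_real t))"
            by (auto intro!: derivative_eq_intros)
          then show ?thesis
            unfolding e_def by (rule has_vector_derivative_real_field)
        qed
        ultimately have "((\<lambda>t. of_real (log_primitive t) * e t) has_vector_derivative
            of_real (log_primitive t) * (- q * e t) + of_real (log_density t) * e t) (at t within {7..7 + real n})"
          by (rule has_vector_derivative_mult)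
        then have "((\<lambda>t. - (of_real (log_primitive t) * e t)) has_vector_derivative
            - (of_real (log_primitive t) * (- q * e t) + of_real (log_density t) * e t)) (at t within {7..7 + real n})"
          by (rule has_vector_derivative_minus)
        also have "- (of_real (log_primitive t) * (- q * e t) + of_real (log_density t) * e t) = g t - h t"
          by (simp add: g_def h_def)
        finally show "((\<lambda>t. - (of_real (log_primitive t) * e t)) has_vector_derivative g t - h t) (at t within {7..7 + real n})" .
      qed auto
      ultimately have lim: "(\<lambda>n. - (of_real (log_primitive (7 + real n)) * e (7 + real n)) - - (of_real (log_primitive 7) * e 7))
          \<longlonglongrightarrow> (LINT t:{7..}|lborel. g t - h t)"
        by simp
      have "(\<lambda>n. of_real (log_primitive (7 + real n)) * e (7 + real n)) \<longlonglongrightarrow> 0"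
      proof (rule tendsto_norm_zero_cancel)
        have "(\<lambda>n. \<bar>log_primitive (7 + real n)\<bar> * exp (- Re q * (7 + real n))) \<longlonglongrightarrow> 0"
        proof -
          have "(\<lambda>n. log_primitive (7 + real n) * exp (- Re q * (7 + real n))) \<longlonglongrightarrow> 0"
            unfolding log_primitive_def using q(1) by real_asymp
          then have "(\<lambda>n. \<bar>log_primitive (7 + real n) * exp (- Re q * (7 + real n))\<bar>) \<longlonglongrightarrow> 0"
            by (rule tendsto_rabs_zero)
          then show ?thesis by (simp add: abs_mult)
        qed
        then show "(\<lambda>n. norm (of_real (log_primitive (7 + real n)) * e (7 + real n))) \<longlonglongrightarrow> 0"
          by (simp add: e_def norm_mult)
      qed
      then have "(\<lambda>n. - (of_real (log_primitive (7 + real n)) * e (7 + real n)) - - (of_real (log_primitive 7) * e 7))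
          \<longlonglongrightarrow> - 0 - - (of_real (log_primitive 7) * e 7)"
        by (intro tendsto_intros)
      with lim have "(LINT t:{7..}|lborel. g t - h t) = - 0 - - (of_real (log_primitive 7) * e 7)"
        by (rule LIMSEQ_unique)
      then have "norm (LINT t:{7..}|lborel. g t - h t) = \<bar>log_primitive 7\<bar> * norm (e 7)"
        by (simp add: norm_mult)
      also have "\<dots> \<le> \<bar>log_primitive 7\<bar> * 1"
        using e_norm[of 7] m by (intro mult_left_mono) (auto intro: order.trans)
      finally show ?thesis
        using set_integral_diff(2)[OF g7 h7] by simp
    qed
    define r where "r = (\<lambda>t. of_real (log_density t) * exp (- z * of_real t))"
    have r7: "set_integrable lborel {7..} r"
      unfolding r_def by (rule log_density_laplace(1)[OF z(1)])
    \<comment> \<open>Replacing \<open>q\<close> by \<open>z\<close> costs a factor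
      \<open>norm (q - z) * t\<close>, of order \<open>(norm z)^2 * t\<close>. The extra
      \<open>t\<close> raises the exponent to \<open>- 5/2\<close>; this error determines the final
      weight.\<close>
    have p4: "norm (LINT t:{7..}|lborel. h t - r t) \<le> (12 * (norm z)\<^sup>2) * (Gamma (3/2 + 1) * m powr (- (3/2) - 1))"
    proof (rule LINT_powr_exp_bound(2)[OF _ m])
      show "set_borel_measurable lborel {7..} (\<lambda>t. h t - r t)"
        unfolding h_def r_def e_def
        by (intro set_borel_measurable_continuous continuous_intros continuous_on_log_density)
      fix t :: real assume t: "t \<ge> 7"
      have "norm (e t - exp (- z * of_real t)) \<le> exp (- m * t) * norm (- q * of_real t - - z * of_real t)"
        unfolding e_def
      proof (rule norm_exp_diff_le)
        show "Re (- q * of_real t) \<le> - m * t" "Re (- z * of_real t) \<le> - m * t"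
          using q(2) t x by (auto simp: m_def x_def intro!: mult_right_mono)
      qed
      also have "- q * of_real t - - z * of_real t = (z - q) * of_real t"
        by (simp add: algebra_simps)
      also have "norm ((z - q) * of_real t) = norm (q - z) * t"
        using t by (simp add: norm_mult norm_minus_commute)
      finally have 1: "norm (e t - exp (- z * of_real t)) \<le> exp (- m * t) * (norm (q - z) * t)" .
      have "norm (h t - r t) = log_density t * norm (e t - exp (- z * of_real t))"
        using log_density_bounds(1)[OF t] unfolding h_def r_def right_diff_distrib[symmetric] by (simp add: norm_mult)
      also have "\<dots> \<le> (4 * t powr (1/2)) * (exp (- m * t) * (3 * (norm z)\<^sup>2 * t))"
      proof (intro mult_mono log_density_bounds[OF t])
        show "norm (e t - exp (- z * of_real t)) \<le> exp (- m * t) * (3 * (norm z)\<^sup>2 * t)"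
          using t by (intro order.trans[OF 1] mult_left_mono mult_right_mono qb) auto
      qed auto
      also have "\<dots> = 12 * (norm z)\<^sup>2 * ((t powr (1/2) * t) * exp (- m * t))"
        by simp
      also have "t powr (1/2) * t = t powr (3/2)"
        using t powr_add[of t "1/2" 1] by simp
      finally show "norm (h t - r t) \<le> 12 * (norm z)\<^sup>2 * (t powr (3/2) * exp (- m * t))" .
    qed auto
    define Q where "Q = (norm z)\<^sup>2 * x powr (- 5/2)"
    have Q1: "norm z * x powr (- 3/2) \<le> Q" and Q2: "1 \<le> Q"
      unfolding Q_def by (rule laplace_weight_bounds[OF x(1,3,2)])+
    have p1': "14 * R 7 * norm z \<le> 14 * R 7 * Q"
      using Q2 z R0[of 7] by (intro mult_left_mono) auto
    have p2': "(48 * (2 * norm z)) * (Gamma (1/2 + 1) * m powr (- (1/2) - 1)) \<le> K1 * Q"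
    proof -
      have "m powr (- (1/2) - 1) = x powr (- 3/2) * (1/2) powr (- 3/2)"
        using x powr_mult[of x "1/2" "- 3/2"] by (simp add: m_def)
      then have "(48 * (2 * norm z)) * (Gamma (1/2 + 1) * m powr (- (1/2) - 1)) = K1 * (norm z * x powr (- 3/2))"
        by (simp add: K1_def)
      also have "\<dots> \<le> K1 * Q"
        by (intro mult_left_mono Q1 K)
      finally show ?thesis .
    qed
    have p3': "\<bar>log_primitive 7\<bar> \<le> \<bar>log_primitive 7\<bar> * Q"
      using mult_left_mono[OF Q2, of "\<bar>log_primitive 7\<bar>"] by simp
    have p4': "(12 * (norm z)\<^sup>2) * (Gamma (3/2 + 1) * m powr (- (3/2) - 1)) = K2 * Q"
    proof -
      have "m powr (- (3/2) - 1) = x powr (- 5/2) * (1/2) powr (- 5/2)"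
        using x powr_mult[of x "1/2" "- 5/2"] by (simp add: m_def)
      then show ?thesis
        by (simp add: K2_def Q_def)
    qed
    have "S - (LINT t:{7..}|lborel. r t) = (LINT t:{0..<7}|lborel. f t) + (LINT t:{7..}|lborel. f t - g t) +
        ((LINT t:{7..}|lborel. g t) - (LINT t:{7..}|lborel. h t)) + (LINT t:{7..}|lborel. h t - r t)"
      unfolding split set_integral_diff(2)[OF f7 g7] set_integral_diff(2)[OF h7 r7] by simp
    also have "norm \<dots> \<le> norm (LINT t:{0..<7}|lborel. f t) + norm (LINT t:{7..}|lborel. f t - g t) +
        norm ((LINT t:{7..}|lborel. g t) - (LINT t:{7..}|lborel. h t)) + norm (LINT t:{7..}|lborel. h t - r t)"
      by (intro norm_triangle_le add_mono order.refl)
    also have "\<dots> \<le> 14 * R 7 * Q + K1 * Q + \<bar>log_primitive 7\<bar> * Q + K2 * Q"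
      by (intro add_mono order.trans[OF p1 p1'] order.trans[OF p2(2) p2'] order.trans[OF p3 p3'] order.trans[OF p4 eq_refl[OF p4']])
    also have "\<dots> = (K0 + K1 + K2) * Q"
      by (simp add: K0_def algebra_simps)
    finally show "norm (S - (LINT t:{7..}|lborel. of_real (log_density t) * exp (- z * of_real t)))
        \<le> (K0 + K1 + K2) * ((norm z)\<^sup>2 * Re z powr (- 5/2))"
      by (simp add: r_def Q_def x_def)
  qed
qed


section \<open>Comparison of the two Laplace transforms\<close>

lemma LINT_laplace_of_real:
  "(LINT t:A|lborel. of_real (g t) * exp (- of_real x * of_real t)) = complex_of_real (LINT t:A|lborel. g t * exp (- x * t))"
proof -
  have "of_real (g t) * exp (- of_real x * of_real t) = complex_of_real (g t * exp (- x * t))" for t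
    by (simp add: exp_of_real[symmetric])
  then show ?thesis
    by (simp only: set_integral_complex_of_real)
qed

text \<open>Near 0 the two comparisons through the pair sum combine. Far from 0, but with
  \<open>Re z \<le> 1/3\<close>, each transform is trivially of size
  \<open>Re z powr (- 3/2)\<close>, and the factor \<open>(norm z)^2\<close>, now bounded below,
  covers this. Quadratic growth in \<open>z\<close> is thus the price of a bound valid on entire
  vertical lines, as the Gaussian smoothing requires.\<close>

lemma zeta_sq_laplace:
  obtains C where "C > 0"
    "\<And>z. \<lbrakk>0 < Re z; Re z \<le> 1/3\<rbrakk> \<Longrightarrow>
       norm ((LINT t:{7..}|lborel. of_real (zeta_sq t) * exp (- z * of_real t)) -
             (LINT t:{7..}|lborel. of_real (log_density t) * exp (- z * of_real t)))
         \<le> C * ((norm z)\<^sup>2 * Re z powr (- 5/2))"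
    "\<And>x. \<lbrakk>0 < x; x \<le> 1/3\<rbrakk> \<Longrightarrow> (LINT t:{7..}|lborel. zeta_sq t * exp (- x * t)) \<le> C * x powr (- 3/2)"
    "\<And>x. \<lbrakk>0 < x; x \<le> 1/3\<rbrakk> \<Longrightarrow> (LINT t:{7..}|lborel. log_density t * exp (- x * t)) \<le> C * x powr (- 3/2)"
proof -
  define L where "L = (\<lambda>z. LINT t:{7..}|lborel. of_real (zeta_sq t) * exp (- z * complex_of_real t))"
  define I where "I = (\<lambda>z. LINT t:{7..}|lborel. of_real (log_density t) * exp (- z * complex_of_real t))"
  obtain B where B: "B > 0"
    "\<And>z S. \<lbrakk>0 < Re z; norm z \<le> 1;
        (\<lambda>k. 2 * of_real pi * exp (- 2 * of_real pi * of_nat (pair_prod k) * (\<i> * (exp (- \<i> * z) - 1)))) sums S\<rbrakk>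
      \<Longrightarrow> norm (exp (\<i> * z / 2) * (LINT t:{7..}|lborel. of_real (zeta_sq t) * exp (- z * of_real t)) - S) \<le> B"
    using zeta_sq_laplace_pair_sum by blast
  obtain C1 where C1: "C1 > 0"
    "\<And>z S. \<lbrakk>0 < Re z; norm z \<le> 1/3;
        (\<lambda>k. 2 * of_real pi * exp (- 2 * of_real pi * of_nat (pair_prod k) * (\<i> * (exp (- \<i> * z) - 1)))) sums S\<rbrakk>
      \<Longrightarrow> norm (S - (LINT t:{7..}|lborel. of_real (log_density t) * exp (- z * of_real t)))
           \<le> C1 * ((norm z)\<^sup>2 * Re z powr (- 5/2))"
    using pair_sum_laplace by blast
  define G where "G = Gamma (3/2 :: real)"
  have G: "G > 0" by (simp add: G_def Gamma_real_pos)
  have Ib: "norm (I z) \<le> 4 * (G * Re z powr (- 3/2))" if "0 < Re z" for z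
    unfolding I_def G_def using log_density_laplace(2)[OF that] .
  define C2 where "C2 = 3 * B + 3 * C1 + 12 * G"
  have C2: "C2 > 0" using B C1 G by (simp add: C2_def)
  have small: "norm (L z - I z) \<le> C2 * ((norm z)\<^sup>2 * Re z powr (- 5/2))"
    if z: "0 < Re z" "norm z \<le> 1/3" for z
  proof -
    define Q where "Q = (norm z)\<^sup>2 * Re z powr (- 5/2)"
    have Q: "norm z * Re z powr (- 3/2) \<le> Q" "1 \<le> Q"
      unfolding Q_def using z complex_Re_le_cmod[of z] by (intro laplace_weight_bounds; simp)+
    obtain S where S: "(\<lambda>k. 2 * of_real pi * exp (- 2 * of_real pi * of_nat (pair_prod k) * (\<i> * (exp (- \<i> * z) - 1)))) sums S"
      using shifted_kernel_line(2)[of z] z by auto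
    define w where "w = exp (- (\<i> * z / 2))"
    have w: "norm w \<le> 3"
    proof -
      have "norm w \<le> exp 1"
        using abs_Im_le_cmod[of z] z by (simp add: w_def)
      also have "\<dots> \<le> 3" by (rule exp_le)
      finally show ?thesis .
    qed
    have w1: "norm (w - 1) \<le> 3 * norm z"
    proof -
      have "norm (exp (- (\<i> * z / 2)) - exp 0) \<le> exp 1 * norm (- (\<i> * z / 2) - 0)"
        using abs_Im_le_cmod[of z] z by (intro norm_exp_diff_le) auto
      also have "\<dots> \<le> 3 * norm z"
        using exp_le by (intro mult_mono) (auto simp: norm_mult norm_divide)
      finally show ?thesis by (simp add: w_def)
    qed
    have ww: "w * exp (\<i> * z / 2) = 1"
      by (simp add: w_def exp_minus)
    have 1: "norm (exp (\<i> * z / 2) * L z - S) \<le> B"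
      unfolding L_def using z S by (intro B) auto
    have 2: "norm (S - I z) \<le> C1 * Q"
      unfolding I_def Q_def using z S by (intro C1) auto
    \<comment> \<open>\<open>w\<close> undoes the phase \<open>exp (\<i> * z / 2)\<close>. Since
      \<open>w - 1\<close> is of order \<open>norm z\<close>, its effect on \<open>I z\<close> is
      \<open>norm z * Re z powr (- 3/2)\<close>, which is within the weight.\<close>
    have "L z - I z = w * (exp (\<i> * z / 2) * L z - S) + w * (S - I z) + (w - 1) * I z"
    proof -
      have a: "w * (exp (\<i> * z / 2) * L z - S) = L z - w * S"
        by (simp only: right_diff_distrib mult.assoc[symmetric] ww mult_1_left)
      show ?thesis
        unfolding a by (simp add: left_diff_distrib right_diff_distrib)
    qed
    also have "norm \<dots> \<le> norm w * norm (exp (\<i> * z / 2) * L z - S) + norm w * norm (S - I z) + norm (w - 1) * norm (I z)"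
      unfolding norm_mult[symmetric] by (intro norm_triangle_le add_mono order.refl)
    also have "\<dots> \<le> 3 * (B * Q) + 3 * (C1 * Q) + (3 * norm z) * (4 * (G * Re z powr (- 3/2)))"
    proof (intro add_mono mult_mono w w1 2 Ib z)
      show "norm (exp (\<i> * z / 2) * L z - S) \<le> B * Q"
        using 1 mult_left_mono[OF Q(2) less_imp_le[OF B(1)]] by linarith
    qed (use B(1) C1(1) Q(2) in auto)
    also have "(3 * norm z) * (4 * (G * Re z powr (- 3/2))) = 12 * G * (norm z * Re z powr (- 3/2))"
      by simp
    also have "\<dots> \<le> 12 * G * Q"
      using G by (intro mult_left_mono Q) auto
    also have "3 * (B * Q) + 3 * (C1 * Q) + 12 * G * Q = C2 * Q"
      by (simp add: C2_def algebra_simps)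
    finally show ?thesis by (simp add: Q_def)
  qed
  define C3 where "C3 = 4 * G + C2"
  have C3: "C3 > 0" using G C2 by (simp add: C3_def)
  have realL: "L (of_real x) = of_real (LINT t:{7..}|lborel. zeta_sq t * exp (- x * t))" for x
    unfolding L_def by (rule LINT_laplace_of_real)
  have realI: "I (of_real x) = of_real (LINT t:{7..}|lborel. log_density t * exp (- x * t))" for x
    unfolding I_def by (rule LINT_laplace_of_real)
  have Lx: "(LINT t:{7..}|lborel. zeta_sq t * exp (- x * t)) \<le> C3 * x powr (- 3/2)"
    and Ix: "(LINT t:{7..}|lborel. log_density t * exp (- x * t)) \<le> C3 * x powr (- 3/2)"
    if x: "0 < x" "x \<le> 1/3" for x
  proof -
    have i: "norm (I (of_real x)) \<le> 4 * (G * x powr (- 3/2))"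
      using Ib[of "of_real x"] x by simp
    have "(LINT t:{7..}|lborel. log_density t * exp (- x * t)) \<le> norm (I (of_real x))"
      unfolding realI by simp
    then show "(LINT t:{7..}|lborel. log_density t * exp (- x * t)) \<le> C3 * x powr (- 3/2)"
      using i mult_right_mono[of "4 * G" C3 "x powr (- 3/2)"] C2 by (simp add: C3_def)
    have "x\<^sup>2 * x powr (- 5/2) = x powr 2 * x powr (- 5/2)"
      using x by simp
    also have "\<dots> = x powr (- 1/2)"
      by (subst powr_add[symmetric]) simp
    also have "\<dots> \<le> x powr (- 3/2)"
      using x by (intro powr_mono') auto
    finally have xx: "x\<^sup>2 * x powr (- 5/2) \<le> x powr (- 3/2)" .
    have "(LINT t:{7..}|lborel. zeta_sq t * exp (- x * t)) \<le> norm (L (of_real x))"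
      unfolding realL by simp
    also have "\<dots> \<le> norm (I (of_real x)) + norm (L (of_real x) - I (of_real x))"
      using norm_triangle_ineq[of "I (of_real x)" "L (of_real x) - I (of_real x)"] by simp
    also have "\<dots> \<le> 4 * (G * x powr (- 3/2)) + C2 * (x\<^sup>2 * x powr (- 5/2))"
      using small[of "of_real x"] x i by (intro add_mono) auto
    also have "\<dots> \<le> 4 * (G * x powr (- 3/2)) + C2 * x powr (- 3/2)"
      using C2 xx by (intro add_mono mult_left_mono order.refl) auto
    also have "\<dots> = C3 * x powr (- 3/2)"
      by (simp add: C3_def algebra_simps)
    finally show "(LINT t:{7..}|lborel. zeta_sq t * exp (- x * t)) \<le> C3 * x powr (- 3/2)" .
  qed
  define C where "C = C2 + 9 * (C3 + 4 * G)"
  have CC: "C > 0" "C2 \<le> C" "C3 \<le> C"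
    using C2 C3 G by (auto simp: C_def)
  show thesis
  proof (rule that[OF CC(1)])
    fix z :: complex assume z: "0 < Re z" "Re z \<le> 1/3"
    show "norm ((LINT t:{7..}|lborel. of_real (zeta_sq t) * exp (- z * of_real t)) -
             (LINT t:{7..}|lborel. of_real (log_density t) * exp (- z * of_real t)))
         \<le> C * ((norm z)\<^sup>2 * Re z powr (- 5/2))"
    proof (cases "norm z \<le> 1/3")
      case True
      have "norm (L z - I z) \<le> C2 * ((norm z)\<^sup>2 * Re z powr (- 5/2))"
        by (rule small[OF z(1) True])
      also have "\<dots> \<le> C * ((norm z)\<^sup>2 * Re z powr (- 5/2))"
        by (intro mult_right_mono CC) auto
      finally show ?thesis by (simp add: L_def I_def)
    next
      case False
      have "norm (L z) \<le> (LINT t:{7..}|lborel. norm (of_real (zeta_sq t) * exp (- z * complex_of_real t)))"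
        unfolding L_def by (rule set_integral_norm_bound[OF zeta_sq_laplace_integrable[OF z(1)]])
      also have "\<dots> = (LINT t:{7..}|lborel. zeta_sq t * exp (- Re z * t))"
        by (simp add: norm_mult zeta_sq_nonneg)
      also have "\<dots> \<le> C3 * Re z powr (- 3/2)"
        by (rule Lx[OF z])
      finally have "norm (L z - I z) \<le> C3 * Re z powr (- 3/2) + 4 * (G * Re z powr (- 3/2))"
        using Ib[OF z(1)] norm_triangle_ineq4[of "L z" "I z"] by linarith
      also have "\<dots> = (C3 + 4 * G) * Re z powr (- 3/2)"
        by (simp add: algebra_simps)
      \<comment> \<open>\<open>9\<close> is the inverse square of the radius \<open>1/3\<close>; a
        whole power of \<open>Re z\<close> is given away.\<close>
      also have "Re z powr (- 3/2) \<le> 9 * ((norm z)\<^sup>2 * Re z powr (- 5/2))"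
      proof -
        have "1 \<le> 9 * (norm z)\<^sup>2"
          using False power_strict_mono[of "1/3" "norm z" 2] by (simp add: power_divide)
        then have "1 * Re z powr (- 5/2) \<le> (9 * (norm z)\<^sup>2) * Re z powr (- 5/2)"
          by (intro mult_right_mono) auto
        moreover have "Re z powr (- 3/2) \<le> Re z powr (- 5/2)"
          using z by (intro powr_mono') auto
        ultimately show ?thesis by simp
      qed
      also have "(C3 + 4 * G) * (9 * ((norm z)\<^sup>2 * Re z powr (- 5/2))) \<le> C * ((norm z)\<^sup>2 * Re z powr (- 5/2))"
      proof -
        have "(9 * (C3 + 4 * G)) * ((norm z)\<^sup>2 * Re z powr (- 5/2)) \<le> C * ((norm z)\<^sup>2 * Re z powr (- 5/2))"
          using C2 by (intro mult_right_mono) (auto simp: C_def)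
        then show ?thesis by (simp only: mult_ac)
      qed
      finally show ?thesis
        using C3 G by (simp add: L_def I_def)
    qed
  next
    fix x :: real assume x: "0 < x" "x \<le> 1/3"
    show "(LINT t:{7..}|lborel. zeta_sq t * exp (- x * t)) \<le> C * x powr (- 3/2)"
      using Lx[OF x] mult_right_mono[OF CC(3), of "x powr (- 3/2)"] by simp
    show "(LINT t:{7..}|lborel. log_density t * exp (- x * t)) \<le> C * x powr (- 3/2)"
      using Ix[OF x] mult_right_mono[OF CC(3), of "x powr (- 3/2)"] by simp
  qed
qed

section \<open>A Tauberian theorem with Gaussian weights\<close>

text \<open>
  The Gaussian is written as a superposition of its Fourier modes, each of which turns the integral
  into a value of the Laplace transform on the line $\mathrm{Re}\,z = x$.
\<close>

lemma gaussian_laplace_bound: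
  fixes u :: "real \<Rightarrow> real" and a x D C :: real
  assumes int: "\<And>z. Re z > 0 \<Longrightarrow> set_integrable lborel {7..} (\<lambda>t. of_real (u t) * exp (- z * of_real t))"
    and bd: "\<And>z. \<lbrakk>0 < Re z; Re z \<le> 1/3\<rbrakk> \<Longrightarrow>
       norm (LINT t:{7..}|lborel. of_real (u t) * exp (- z * of_real t)) \<le> C * ((norm z)\<^sup>2 * Re z powr (- 5/2))"
    and x: "0 < x" "x \<le> 1/3" and D: "D > 0"
  shows "\<bar>LINT t:{7..}|lborel. u t * exp (- x * t) * exp (- ((t - a) / D)\<^sup>2 / 2)\<bar>
           \<le> C * x powr (- 5/2) * (x\<^sup>2 + 1 / D\<^sup>2)"
proof -
  define G :: "real \<Rightarrow> complex" where "G = (\<lambda>t. indicator {7..} t *\<^sub>R (of_real (u t) * exp (- of_real x * of_real t)))"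
  \<comment> \<open>A Gaussian of width \<open>D\<close> is the average of the modes with frequency
    \<open>y / D\<close>, where \<open>y\<close> is standard normal. Along these points
    \<open>(norm (z y))^2 = x^2 + y^2 / D^2\<close>, so the second moment of \<open>y\<close> yields
    the term \<open>1 / D^2\<close> of the result.\<close>
  define z :: "real \<Rightarrow> complex" where "z = (\<lambda>y. Complex x (- y / D))"
  define L :: "real \<Rightarrow> complex" where "L = (\<lambda>y. LINT t:{7..}|lborel. of_real (u t) * exp (- z y * of_real t))"
  have G: "integrable lborel G"
    using int[of "of_real x"] x by (simp add: G_def set_integrable_def)
  have [measurable]: "G \<in> borel_measurable borel"
    using borel_measurable_integrable[OF G] by simp
  define F :: "real \<Rightarrow> real \<Rightarrow> complex" where
    "F = (\<lambda>t y. G t * (std_normal_density y *\<^sub>R iexp ((t - a) / D * y)))"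
  have Fint: "integrable (lborel \<Otimes>\<^sub>M lborel) (case_prod F)"
  proof (rule lborel_pair.Fubini_integrable)
    show "case_prod F \<in> borel_measurable (lborel \<Otimes>\<^sub>M lborel)"
      unfolding F_def by measurable
    have "(\<lambda>t. LINT y|lborel. norm (case_prod F (t, y))) = (\<lambda>t. norm (G t))"
      by (simp add: F_def norm_mult integral_normal_density)
    then show "integrable lborel (\<lambda>t. LINT y|lborel. norm (case_prod F (t, y)))"
      using G by simp
    show "AE t in lborel. integrable lborel (\<lambda>y. case_prod F (t, y))"
    proof (rule AE_I2)
      fix t
      have "integrable lborel (\<lambda>y. norm (G t) * std_normal_density y)"
        by (intro integrable_mult_right integrable_normal_density) simp
      then show "integrable lborel (\<lambda>y. case_prod F (t, y))"
        by (rule Bochner_Integration.integrable_bound) (auto simp: F_def norm_mult)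
    qed
  qed
  have inner1: "(LINT y|lborel. F t y) = G t * of_real (exp (- ((t - a) / D)\<^sup>2 / 2))" for t
  proof -
    have "(LINT y|lborel. std_normal_density y *\<^sub>R iexp ((t - a) / D * y)) = char std_normal_distribution ((t - a) / D)"
      unfolding char_def by (subst integral_density) auto
    also have "\<dots> = of_real (exp (- ((t - a) / D)\<^sup>2 / 2))"
      by (simp add: char_std_normal_distribution)
    finally show ?thesis
      unfolding F_def by (simp only: integral_mult_right_zero)
  qed
  have inner2: "(LINT t|lborel. F t y) = std_normal_density y *\<^sub>R (iexp (- a / D * y) * L y)" for y
  proof -
    have "F t y = (std_normal_density y *\<^sub>R iexp (- a / D * y)) * (indicator {7..} t *\<^sub>R (of_real (u t) * exp (- z y * of_real t)))" for t
    proof -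
      have "exp (- of_real x * of_real t) * iexp ((t - a) / D * y) = iexp (- a / D * y) * exp (- z y * complex_of_real t)"
        unfolding exp_add[symmetric] z_def
        by (rule arg_cong[of _ _ exp]) (use D in \<open>simp add: complex_eq_iff field_simps\<close>)
      then show ?thesis
        unfolding F_def G_def by (simp add: scaleR_conv_of_real mult_ac)
    qed
    then have "(LINT t|lborel. F t y) = (LINT t|lborel. (std_normal_density y *\<^sub>R iexp (- a / D * y)) * (indicator {7..} t *\<^sub>R (of_real (u t) * exp (- z y * of_real t))))"
      by (simp only:)
    also have "\<dots> = (std_normal_density y *\<^sub>R iexp (- a / D * y)) * L y"
      unfolding L_def set_lebesgue_integral_def by (rule integral_mult_right_zero)
    finally show ?thesis by (simp only: mult_scaleR_left)
  qed
  have "complex_of_real (LINT t:{7..}|lborel. u t * exp (- x * t) * exp (- ((t - a) / D)\<^sup>2 / 2)) = (LINT t|lborel. LINT y|lborel. F t y)"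
    unfolding inner1 set_lebesgue_integral_def
    unfolding integral_complex_of_real[symmetric]
  proof (intro Bochner_Integration.integral_cong refl)
    fix t
    have e: "exp (- of_real x * of_real t) = complex_of_real (exp (- x * t))"
      by (simp flip: exp_of_real)
    show "complex_of_real (indicator {7..} t *\<^sub>R (u t * exp (- x * t) * exp (- ((t - a) / D)\<^sup>2 / 2))) =
          G t * of_real (exp (- ((t - a) / D)\<^sup>2 / 2))"
      unfolding G_def e by (simp only: scaleR_conv_of_real of_real_mult mult_ac of_real_eq_id id_apply)
  qed
  also have "\<dots> = (LINT y|lborel. LINT t|lborel. F t y)"
    by (rule lborel_pair.Fubini_integral[symmetric]) (rule Fint)
  also have "norm \<dots> \<le> (LINT y|lborel. C * x powr (- 5/2) * (x\<^sup>2 * (std_normal_density y * y ^ (2 * 0)) + 1 / D\<^sup>2 * (std_normal_density y * y ^ (2 * 1))))"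
  proof (rule Bochner_Integration.integral_norm_bound_integral)
    show "integrable lborel (\<lambda>y. LINT t|lborel. F t y)"
      by (rule lborel_pair.integrable_snd) (rule Fint)
    show "integrable lborel (\<lambda>y. C * x powr (- 5/2) * (x\<^sup>2 * (std_normal_density y * y ^ (2 * 0)) + 1 / D\<^sup>2 * (std_normal_density y * y ^ (2 * 1))))"
      by (intro integrable_mult_right integrable_add integrable_std_normal_moment Bochner_Integration.integrable_add)
    fix y :: real
    have "norm (L y) \<le> C * ((norm (z y))\<^sup>2 * Re (z y) powr (- 5/2))"
      unfolding L_def by (rule bd) (use x in \<open>auto simp: z_def\<close>)
    also have "(norm (z y))\<^sup>2 = x\<^sup>2 + 1 / D\<^sup>2 * y\<^sup>2"
      by (simp add: z_def cmod_power2 power_divide)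
    also have "Re (z y) = x" by (simp add: z_def)
    finally have Ly: "norm (L y) \<le> C * ((x\<^sup>2 + 1 / D\<^sup>2 * y\<^sup>2) * x powr (- 5/2))" .
    have "norm (LINT t|lborel. F t y) = std_normal_density y * norm (L y)"
      unfolding inner2 by (simp add: norm_mult)
    also have "\<dots> \<le> std_normal_density y * (C * ((x\<^sup>2 + 1 / D\<^sup>2 * y\<^sup>2) * x powr (- 5/2)))"
      by (intro mult_left_mono Ly) simp
    also have "\<dots> = C * x powr (- 5/2) * (x\<^sup>2 * (std_normal_density y * y ^ (2 * 0)) + 1 / D\<^sup>2 * (std_normal_density y * y ^ (2 * 1)))"
      by (simp add: field_simps power2_eq_square)
    finally show "norm (LINT t|lborel. F t y) \<le> C * x powr (- 5/2) * (x\<^sup>2 * (std_normal_density y * y ^ (2 * 0)) + 1 / D\<^sup>2 * (std_normal_density y * y ^ (2 * 1)))" .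
  qed
  also have "\<dots> = C * x powr (- 5/2) * (x\<^sup>2 + 1 / D\<^sup>2)"
  proof -
    have "(LINT y|lborel. x\<^sup>2 * (std_normal_density y * y ^ (2 * 0)) + 1 / D\<^sup>2 * (std_normal_density y * y ^ (2 * 1))) = x\<^sup>2 + 1 / D\<^sup>2"
      by (subst Bochner_Integration.integral_add)
         (intro integrable_mult_right integrable_std_normal_moment,
          intro integrable_mult_right integrable_std_normal_moment,
          simp only: integral_mult_right_zero integral_std_normal_moment_even, simp)
    then show ?thesis
      by (simp only: integral_mult_right_zero)
  qed
  finally show ?thesis
    by (simp only: norm_of_real)
qed

text \<open>Completing the square. This supplies the factor \<open>exp (- t / T)\<close> on which
  the Laplace transform acts; the centre moves by \<open>D^2 / T\<close>.\<close>

lemma normal_density_tilt: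
  assumes T: "T > 0" and D: "D > 0"
  shows "normal_density b D t = (exp (b / T + D\<^sup>2 / (2 * T\<^sup>2)) / sqrt (2 * pi * D\<^sup>2)) *
           (exp (- (1 / T) * t) * exp (- ((t - (b + D\<^sup>2 / T)) / D)\<^sup>2 / 2))"
proof -
  have "- (t - b)\<^sup>2 / (2 * D\<^sup>2) = (b / T + D\<^sup>2 / (2 * T\<^sup>2)) + (- (1 / T) * t + - ((t - (b + D\<^sup>2 / T)) / D)\<^sup>2 / 2)"
    using T D by (simp add: field_simps power2_eq_square)
  then show ?thesis
    unfolding normal_density_def by (simp only: exp_add) simp
qed

text \<open>The exponent is at most \<open>3 + 1/2\<close>, and the square root is at least
  \<open>D\<close>. The centre \<open>b\<close> may also be negative.\<close>

lemma normal_density_tilt_factor: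
  assumes T: "T > 0" and D: "0 < D" "D \<le> T" and b: "b \<le> 3 * T"
  shows "exp (b / T + D\<^sup>2 / (2 * T\<^sup>2)) / sqrt (2 * pi * D\<^sup>2) \<le> exp 4 / D"
proof (rule frac_le)
  have "D\<^sup>2 \<le> T\<^sup>2" using D by (intro power_mono) auto
  then have "D\<^sup>2 / (2 * T\<^sup>2) \<le> 1/2" using T by (simp add: field_simps)
  moreover have "b / T \<le> 3" using b T by (simp add: field_simps)
  ultimately show "exp (b / T + D\<^sup>2 / (2 * T\<^sup>2)) \<le> exp 4" by simp
  have "1 * D\<^sup>2 \<le> 2 * pi * D\<^sup>2" using pi_gt3 by (intro mult_right_mono) auto
  then show "D \<le> sqrt (2 * pi * D\<^sup>2)" using D by (intro real_le_rsqrt) auto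
qed (use D in auto)

text \<open>Tilting with \<open>x = 1 / T\<close>. In the result, \<open>T powr (5/2)\<close> is
  \<open>x powr (- 5/2)\<close>, two of the factors \<open>1 / D\<close> bound the weight
  \<open>x^2 + 1 / D^2\<close> because \<open>D \<le> T\<close>, and the third is the normalisation
  of the density.\<close>

lemma gaussian_mean_bound:
  fixes u :: "real \<Rightarrow> real" and b D T C :: real
  assumes int: "\<And>z. Re z > 0 \<Longrightarrow> set_integrable lborel {7..} (\<lambda>t. of_real (u t) * exp (- z * of_real t))"
    and bd: "\<And>z. \<lbrakk>0 < Re z; Re z \<le> 1/3\<rbrakk> \<Longrightarrow>
       norm (LINT t:{7..}|lborel. of_real (u t) * exp (- z * of_real t)) \<le> C * ((norm z)\<^sup>2 * Re z powr (- 5/2))"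
    and T: "T \<ge> 3" and D: "0 < D" "D \<le> T" and b: "b \<le> 3 * T" and C: "C \<ge> 0"
  shows "\<bar>LINT t:{7..}|lborel. u t * normal_density b D t\<bar> \<le> 2 * exp 4 * C * T powr (5/2) / D ^ 3"
proof -
  define K where "K = exp (b / T + D\<^sup>2 / (2 * T\<^sup>2)) / sqrt (2 * pi * D\<^sup>2)"
  have K: "0 \<le> K" "K \<le> exp 4 / D"
    using normal_density_tilt_factor[of T D b] T D b by (auto simp: K_def)
  define J where "J = (LINT t:{7..}|lborel. u t * exp (- (1 / T) * t) * exp (- ((t - (b + D\<^sup>2 / T)) / D)\<^sup>2 / 2))"
  have J: "\<bar>J\<bar> \<le> C * (1 / T) powr (- 5/2) * ((1 / T)\<^sup>2 + 1 / D\<^sup>2)"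
    unfolding J_def
  proof (rule gaussian_laplace_bound[where u = u and x = "1 / T" and a = "b + D\<^sup>2 / T" and D = D and C = C])
    show "0 < 1 / T" "1 / T \<le> 1/3" "D > 0" using T D by auto
  qed (fact int, fact bd)
  have "u t * normal_density b D t =
      K * (u t * exp (- (1 / T) * t) * exp (- ((t - (b + D\<^sup>2 / T)) / D)\<^sup>2 / 2))" for t
    unfolding K_def by (subst normal_density_tilt[of T D]) (use T D in \<open>auto simp: mult_ac\<close>)
  then have eq: "(LINT t:{7..}|lborel. u t * normal_density b D t) = K * J"
    unfolding J_def by (simp only: set_integral_mult_right)
  have "\<bar>LINT t:{7..}|lborel. u t * normal_density b D t\<bar> = K * \<bar>J\<bar>"
    unfolding eq using K(1) by (simp only: abs_mult abs_of_nonneg)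
  also have "\<dots> \<le> (exp 4 / D) * (C * (1 / T) powr (- 5/2) * ((1 / T)\<^sup>2 + 1 / D\<^sup>2))"
    using K J D by (intro mult_mono) simp_all
  also have "(1 / T) powr (- 5/2) = T powr (5/2)"
    using T by (simp add: powr_divide powr_minus_divide)
  also have "(exp 4 / D) * (C * T powr (5/2) * ((1 / T)\<^sup>2 + 1 / D\<^sup>2)) \<le> (exp 4 / D) * (C * T powr (5/2) * (2 / D\<^sup>2))"
  proof (intro mult_left_mono)
    have "(1 / T)\<^sup>2 \<le> (1 / D)\<^sup>2" using D T by (intro power_mono frac_le) auto
    then show "(1 / T)\<^sup>2 + 1 / D\<^sup>2 \<le> 2 / D\<^sup>2" by (simp add: power_divide)
  qed (use C D in auto)
  also have "\<dots> = 2 * exp 4 * C * T powr (5/2) / D ^ 3"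
    using D by (simp add: field_simps power2_eq_square power3_eq_cube)
  finally show ?thesis .
qed

text \<open>Tilting with \<open>T = 1\<close> dominates the Gaussian by a multiple of
  \<open>exp (- t)\<close>.\<close>

lemma set_integrable_normal_density_laplace:
  fixes u :: "real \<Rightarrow> real" and b D :: real
  assumes int: "\<And>z. Re z > 0 \<Longrightarrow> set_integrable lborel {7..} (\<lambda>t. of_real (u t) * exp (- z * of_real t) :: complex)"
    and u: "continuous_on {7..} u" and D: "D > 0"
  shows "set_integrable lborel {7..} (\<lambda>t. u t * normal_density b D t)"
proof -
  define K where "K = exp (b / 1 + D\<^sup>2 / (2 * 1\<^sup>2)) / sqrt (2 * pi * D\<^sup>2)"
  have "integrable lborel (\<lambda>t. K * norm (indicator {7..} t *\<^sub>R (of_real (u t) * exp (- 1 * of_real t) :: complex)))"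
    using int[of 1] unfolding set_integrable_def by (intro integrable_mult_right integrable_norm) simp
  then show ?thesis
    unfolding set_integrable_def
  proof (rule Bochner_Integration.integrable_bound)
    have "continuous_on {7..} (\<lambda>t. u t * normal_density b D t)"
      using D u unfolding normal_density_def by (intro continuous_intros) auto
    then show "(\<lambda>t. indicator {7..} t *\<^sub>R (u t * normal_density b D t)) \<in> borel_measurable lborel"
      using borel_measurable_continuous_on_indicator[of "{7..}" "\<lambda>t. u t * normal_density b D t"] by simp
    have K: "K \<ge> 0" by (simp add: K_def)
    have nd: "normal_density b D t \<le> K * exp (- t)" for t
      unfolding K_def by (subst normal_density_tilt[of 1 D]) (use D in \<open>auto intro!: mult_left_mono divide_right_mono\<close>)
    show "AE t in lborel. norm (indicator {7..} t *\<^sub>R (u t * normal_density b D t))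
            \<le> norm (K * norm (indicator {7..} t *\<^sub>R (of_real (u t) * exp (- 1 * of_real t) :: complex)))"
    proof (rule AE_I2)
      fix t
      have "norm (indicator {7..} t *\<^sub>R (u t * normal_density b D t)) = indicator {7..} t * (\<bar>u t\<bar> * normal_density b D t)"
        by (simp add: abs_mult)
      also have "\<dots> \<le> indicator {7..} t * (\<bar>u t\<bar> * (K * exp (- t)))"
        by (intro mult_left_mono nd) auto
      also have "\<dots> = norm (K * norm (indicator {7..} t *\<^sub>R (of_real (u t) * exp (- 1 * of_real t) :: complex)))"
        using K by (simp add: abs_mult norm_mult mult_ac)
      finally show "norm (indicator {7..} t *\<^sub>R (u t * normal_density b D t))
            \<le> norm (K * norm (indicator {7..} t *\<^sub>R (of_real (u t) * exp (- 1 * of_real t) :: complex)))" .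
    qed
  qed
qed

section \<open>Averaging Gaussian means over their centres\<close>

lemma nn_integral_continuous_Icc:
  fixes g :: "real \<Rightarrow> real"
  assumes g: "continuous_on {a..b} g" and nn: "\<And>t. t \<in> {a..b} \<Longrightarrow> g t \<ge> 0"
  shows "(\<integral>\<^sup>+t. ennreal (indicator {a..b} t * g t) \<partial>lborel) = ennreal (integral {a..b} g)"
proof -
  have i: "set_integrable lborel {a..b} g"
    using borel_integrable_compact[OF compact_Icc g] by (simp add: set_integrable_def)
  have "(\<integral>\<^sup>+t. ennreal (indicator {a..b} t * g t) \<partial>lborel) = ennreal (LINT t|lborel. indicator {a..b} t * g t)"
    by (rule nn_integral_eq_integral) (use i nn in \<open>auto simp: set_integrable_def indicator_def\<close>)
  also have "(LINT t|lborel. indicator {a..b} t * g t) = integral {a..b} g"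
    using set_borel_integral_eq_integral(2)[OF i] by (simp add: set_lebesgue_integral_def)
  finally show ?thesis .
qed

lemma normal_density_swap: "normal_density b D t = normal_density t D b"
  by (simp add: normal_density_def power2_commute)

text \<open>Chebyshev's inequality: the interval contains all points within \<open>lam\<close> of
  the mean \<open>t\<close>, and the variance is \<open>D^2\<close>.\<close>

lemma gaussian_mass_Icc:
  fixes t D lam b1 b2 :: real
  assumes D: "D > 0" and lam: "lam > 0" and b: "b1 \<le> t - lam" "t + lam \<le> b2"
  shows "ennreal (1 - D\<^sup>2 / lam\<^sup>2) \<le> (\<integral>\<^sup>+s. ennreal (indicator {b1..b2} s * normal_density t D s) \<partial>lborel)"
proof -
  have i: "integrable lborel (normal_density t D)" using D by simp
  have i': "integrable lborel (\<lambda>s. indicator {b1..b2} s * normal_density t D s)"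
    using integrable_mult_indicator[OF _ i, of "{b1..b2}"] by simp
  have m: "has_bochner_integral lborel (\<lambda>s. normal_density t D s * (s - t)\<^sup>2) (D\<^sup>2)"
    using normal_moment_even[OF D, of t 1] by simp
  have "1 - D\<^sup>2 / lam\<^sup>2 = (LINT s|lborel. normal_density t D s - (normal_density t D s * (s - t)\<^sup>2) / lam\<^sup>2)"
    using m i D by (subst Bochner_Integration.integral_diff) (auto simp: has_bochner_integral_iff integral_normal_density)
  also have "\<dots> \<le> (LINT s|lborel. indicator {b1..b2} s * normal_density t D s)"
  proof (rule integral_mono)
    show "integrable lborel (\<lambda>s. normal_density t D s - (normal_density t D s * (s - t)\<^sup>2) / lam\<^sup>2)"
      using m i by (auto simp: has_bochner_integral_iff)
    fix s
    have nd: "normal_density t D s \<ge> 0" by simp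
    show "normal_density t D s - (normal_density t D s * (s - t)\<^sup>2) / lam\<^sup>2 \<le> indicator {b1..b2} s * normal_density t D s"
    proof (cases "s \<in> {b1..b2}")
      case True
      then show ?thesis using nd by (auto intro!: divide_nonneg_nonneg mult_nonneg_nonneg)
    next
      case False
      then have "lam \<le> \<bar>s - t\<bar>" using b by auto
      then have "lam\<^sup>2 \<le> (s - t)\<^sup>2" using lam by (metis abs_le_square_iff abs_of_pos)
      then have "1 \<le> (s - t)\<^sup>2 / lam\<^sup>2" using lam by (simp add: field_simps)
      then have "normal_density t D s * 1 \<le> normal_density t D s * ((s - t)\<^sup>2 / lam\<^sup>2)"
        by (intro mult_left_mono nd)
      then show ?thesis using False by simp
    qed
  qed (rule i')
  also have "ennreal \<dots> = (\<integral>\<^sup>+s. ennreal (indicator {b1..b2} s * normal_density t D s) \<partial>lborel)"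
    by (rule nn_integral_eq_integral[symmetric]) (use i' in auto)
  finally show ?thesis by (simp add: ennreal_leI)
qed

text \<open>The tail is measured against \<open>exp (- t / T)\<close> because beyond the window only
  a Laplace integral of \<open>h\<close> is at hand. From \<open>t - b \<ge> (t - T) / 2\<close> and
  \<open>t - T \<ge> 2 * lam\<close> the Gaussian exponent is at least twice
  \<open>(t - T) * lam / (8 * D^2)\<close>; one copy yields \<open>t / T - 1\<close> by the
  condition \<open>8 * D^2 \<le> lam * T\<close>, the other the constant
  \<open>lam^2 / (4 * D^2)\<close>.\<close>

lemma gaussian_tail:
  fixes t b D lam T :: real
  assumes D: "D > 0" and lam: "lam > 0" "T > 0" "8 * D\<^sup>2 \<le> lam * T"
    and b: "b \<le> T + lam" and t: "T + 2 * lam \<le> t"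
  shows "normal_density t D b \<le> exp (1 - lam\<^sup>2 / (4 * D\<^sup>2)) / D * exp (- (1 / T) * t)"
proof -
  have 1: "(t - T) / 2 \<le> t - b" using b t by simp
  then have "((t - T) / 2)\<^sup>2 \<le> (t - b)\<^sup>2" using t lam by (intro power_mono) auto
  moreover have "(t - T) * (2 * lam) \<le> (t - T) * (t - T)" using t lam by (intro mult_left_mono) auto
  ultimately have "(t - T) * lam / 2 \<le> (t - b)\<^sup>2"
    by (simp add: power2_eq_square field_simps)
  then have 2: "((t - T) * lam / 2) / (2 * D\<^sup>2) \<le> (t - b)\<^sup>2 / (2 * D\<^sup>2)"
    by (intro divide_right_mono) auto
  have 3: "(t - T) / T \<le> (t - T) * lam / (8 * D\<^sup>2)"
  proof -
    have "(t - T) * (8 * D\<^sup>2) \<le> (t - T) * (lam * T)" using t lam by (intro mult_left_mono) auto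
    then show ?thesis using D lam by (simp add: divide_simps mult_ac)
  qed
  have 4: "lam\<^sup>2 / (4 * D\<^sup>2) \<le> (t - T) * lam / (8 * D\<^sup>2)"
  proof -
    have "(2 * lam) * lam \<le> (t - T) * lam" using t lam by (intro mult_right_mono) auto
    then have "(2 * lam) * lam / (8 * D\<^sup>2) \<le> (t - T) * lam / (8 * D\<^sup>2)" by (intro divide_right_mono) auto
    then show ?thesis by (simp add: power2_eq_square)
  qed
  have 5: "(t - T) / T = t / T - 1" using lam by (simp add: field_simps)
  have "((t - T) * lam / 2) / (2 * D\<^sup>2) = (t - T) * lam / (8 * D\<^sup>2) + (t - T) * lam / (8 * D\<^sup>2)"
    using D by (simp add: field_simps)
  then have "- (b - t)\<^sup>2 / (2 * D\<^sup>2) \<le> (1 - lam\<^sup>2 / (4 * D\<^sup>2)) + - (1 / T) * t"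
    using 2 3 4 5 by (simp add: power2_commute[of b t])
  then have e: "exp (- (b - t)\<^sup>2 / (2 * D\<^sup>2)) \<le> exp (1 - lam\<^sup>2 / (4 * D\<^sup>2)) * exp (- (1 / T) * t)"
    unfolding exp_add[symmetric] by simp
  have "1 * D\<^sup>2 \<le> 2 * pi * D\<^sup>2" using pi_gt3 by (intro mult_right_mono) auto
  then have "D \<le> sqrt (2 * pi * D\<^sup>2)" using D by (intro real_le_rsqrt) auto
  then have "1 / sqrt (2 * pi * D\<^sup>2) \<le> 1 / D" using D by (intro divide_left_mono) auto
  then have "normal_density t D b \<le> 1 / D * (exp (1 - lam\<^sup>2 / (4 * D\<^sup>2)) * exp (- (1 / T) * t))"
    unfolding normal_density_def using e D by (intro mult_mono) auto
  then show ?thesis by simp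
qed

text \<open>Tonelli, together with the symmetry of the density in centre and argument.\<close>

lemma gaussian_average_swap:
  fixes u :: "real \<Rightarrow> real" and D :: real
  assumes [measurable]: "u \<in> borel_measurable borel" and u: "\<And>t. u t \<ge> 0"
  shows "(\<integral>\<^sup>+t. ennreal (u t) * (\<integral>\<^sup>+s. ennreal (indicator {b1..b2} s * normal_density t D s) \<partial>lborel) \<partial>lborel) =
         (\<integral>\<^sup>+s. ennreal (indicator {b1..b2} s) * (\<integral>\<^sup>+t. ennreal (u t * normal_density s D t) \<partial>lborel) \<partial>lborel)"
proof -
  define f where "f = (\<lambda>t s. ennreal (u t * (indicator {b1..b2} s * normal_density t D s)))"
  have f: "case_prod f \<in> borel_measurable (lborel \<Otimes>\<^sub>M lborel)"
    unfolding f_def normal_density_def by measurable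
  have [measurable]: "(\<lambda>s. normal_density t D s) \<in> borel_measurable borel" for t
    by (rule borel_measurable_normal_density)
  have 1: "ennreal (u t) * (\<integral>\<^sup>+s. ennreal (indicator {b1..b2} s * normal_density t D s) \<partial>lborel) = (\<integral>\<^sup>+s. f t s \<partial>lborel)" for t
    unfolding f_def using u by (subst nn_integral_cmult[symmetric]) (auto simp: ennreal_mult' intro!: nn_integral_cong)
  have 2: "ennreal (indicator {b1..b2} s) * (\<integral>\<^sup>+t. ennreal (u t * normal_density s D t) \<partial>lborel) = (\<integral>\<^sup>+t. f t s \<partial>lborel)" for s
  proof -
    have "(\<integral>\<^sup>+t. f t s \<partial>lborel) = (\<integral>\<^sup>+t. ennreal (indicator {b1..b2} s) * ennreal (u t * normal_density s D t) \<partial>lborel)"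
      unfolding f_def by (intro nn_integral_cong, subst ennreal_mult''[symmetric]) (auto simp: u mult_ac normal_density_swap[of _ D s])
    also have "\<dots> = ennreal (indicator {b1..b2} s) * (\<integral>\<^sup>+t. ennreal (u t * normal_density s D t) \<partial>lborel)"
      by (rule nn_integral_cmult) measurable
    finally show ?thesis ..
  qed
  show ?thesis
    unfolding 1 2 by (rule lborel_pair.Fubini'[OF f, symmetric])
qed

text \<open>The comparison of Gaussian means is integrated over all centres between
  \<open>7 - lam\<close> and \<open>T + lam\<close>. The weight that a point \<open>t\<close>
  receives is nearly 1 on \<open>{7..T}\<close>, never exceeds 1, and is negligible beyond
  \<open>T + 2 * lam\<close>; nonnegativity of \<open>g\<close> and \<open>h\<close> turns this into
  a one-sided bound with an enlarged interval on the right.\<close>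

lemma gaussian_tauberian_bound:
  fixes g h :: "real \<Rightarrow> real" and T D lam \<epsilon> H :: real
  assumes cg: "continuous_on {7..} g" and nng: "\<And>t. t \<ge> 7 \<Longrightarrow> 0 \<le> g t"
    and ch: "continuous_on {7..} h" and nnh: "\<And>t. t \<ge> 7 \<Longrightarrow> 0 \<le> h t"
    and T: "T \<ge> 7" and D: "0 < D" "D \<le> lam" "8 * D\<^sup>2 \<le> lam * T"
    and cmp: "\<And>b. b \<le> T + lam \<Longrightarrow>
        (\<integral>\<^sup>+t. ennreal (indicator {7..} t * g t * normal_density b D t) \<partial>lborel) \<le>
        (\<integral>\<^sup>+t. ennreal (indicator {7..} t * h t * normal_density b D t) \<partial>lborel) + ennreal \<epsilon>"
    and eps: "\<epsilon> \<ge> 0"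
    and H: "(\<integral>\<^sup>+t. ennreal (indicator {7..} t * h t * exp (- (1 / T) * t)) \<partial>lborel) \<le> ennreal H" "H \<ge> 0"
  shows "(1 - D\<^sup>2 / lam\<^sup>2) * integral {7..T} g \<le>
           integral {7..T + 2 * lam} h + \<epsilon> * (T + 2 * lam) + (T + 2 * lam) * (exp (1 - lam\<^sup>2 / (4 * D\<^sup>2)) / D) * H"
proof -
  define b1 b2 where "b1 = 7 - lam" and "b2 = T + lam"
  have lam: "lam > 0" using D by simp
  have b: "b1 \<le> b2" "b2 - b1 \<le> T + 2 * lam" using T lam by (auto simp: b1_def b2_def)
  \<comment> \<open>The weight left on the point \<open>t\<close> after averaging over the centres:
    by symmetry, the mass which a Gaussian centred at \<open>t\<close> gives to the interval of
    centres.\<close>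
  define \<Phi> where "\<Phi> = (\<lambda>t. \<integral>\<^sup>+s. ennreal (indicator {b1..b2} s * normal_density t D s) \<partial>lborel)"
  have [measurable]: "(\<lambda>s. normal_density t D s) \<in> borel_measurable borel" for t
    by (rule borel_measurable_normal_density)
  have [measurable]: "(\<lambda>t. indicator {7..} t * g t) \<in> borel_measurable borel"
    using borel_measurable_continuous_on_indicator[OF _ cg] by simp
  have [measurable]: "(\<lambda>t. indicator {7..} t * h t) \<in> borel_measurable borel"
    using borel_measurable_continuous_on_indicator[OF _ ch] by simp
  define M where "M = (T + 2 * lam) * (exp (1 - lam\<^sup>2 / (4 * D\<^sup>2)) / D)"
  have M: "M \<ge> 0" using T lam D by (simp add: M_def)
  have Phi_le1: "\<Phi> t \<le> 1" for t
  proof -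
    have "\<Phi> t \<le> (\<integral>\<^sup>+s. ennreal (normal_density t D s) \<partial>lborel)"
      unfolding \<Phi>_def by (intro nn_integral_mono ennreal_leI) (auto simp: indicator_def)
    also have "\<dots> = ennreal (LINT s|lborel. normal_density t D s)"
      by (rule nn_integral_eq_integral) (use D in auto)
    finally show ?thesis using D by (simp add: integral_normal_density)
  qed
  have em: "(\<integral>\<^sup>+s. ennreal (indicator {b1..b2} s * c) \<partial>lborel) \<le> ennreal ((T + 2 * lam) * c)" if c: "c \<ge> 0" for c
  proof -
    have "(\<integral>\<^sup>+s. ennreal (indicator {b1..b2} s * c) \<partial>lborel) = (\<integral>\<^sup>+s. ennreal c * indicator {b1..b2} s \<partial>lborel)"
      by (intro nn_integral_cong) (auto simp: indicator_def)
    also have "\<dots> = ennreal c * ennreal (b2 - b1)"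
      using b by (subst nn_integral_cmult_indicator) auto
    also have "\<dots> = ennreal (c * (b2 - b1))" using c b by (simp add: ennreal_mult)
    also have "\<dots> \<le> ennreal ((T + 2 * lam) * c)"
      using b c by (intro ennreal_leI) (simp add: mult.commute mult_left_mono)
    finally show ?thesis .
  qed
  have Phi_tail: "\<Phi> t \<le> ennreal (M * exp (- (1 / T) * t))" if t: "t \<ge> T + 2 * lam" for t
  proof -
    have "\<Phi> t \<le> (\<integral>\<^sup>+s. ennreal (indicator {b1..b2} s * (exp (1 - lam\<^sup>2 / (4 * D\<^sup>2)) / D * exp (- (1 / T) * t))) \<partial>lborel)"
      unfolding \<Phi>_def
    proof (intro nn_integral_mono ennreal_leI)
      fix s
      show "indicator {b1..b2} s * normal_density t D s \<le> indicator {b1..b2} s * (exp (1 - lam\<^sup>2 / (4 * D\<^sup>2)) / D * exp (- (1 / T) * t))"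
        using gaussian_tail[of D lam T s t] D lam T t by (auto simp: indicator_def b2_def)
    qed
    also have "\<dots> \<le> ennreal ((T + 2 * lam) * (exp (1 - lam\<^sup>2 / (4 * D\<^sup>2)) / D * exp (- (1 / T) * t)))"
      by (rule em) (use D in auto)
    finally show ?thesis by (simp add: M_def mult_ac)
  qed
  have kap: "0 \<le> 1 - D\<^sup>2 / lam\<^sup>2"
  proof -
    have "D\<^sup>2 \<le> lam\<^sup>2" using D by (intro power_mono) auto
    then show ?thesis using lam by simp
  qed
  have "ennreal ((1 - D\<^sup>2 / lam\<^sup>2) * integral {7..T} g) = ennreal (1 - D\<^sup>2 / lam\<^sup>2) * (\<integral>\<^sup>+t. ennreal (indicator {7..T} t * g t) \<partial>lborel)"
    using kap by (subst nn_integral_continuous_Icc) (auto intro: continuous_on_subset[OF cg] nng simp: ennreal_mult')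
  also have "\<dots> = (\<integral>\<^sup>+t. ennreal (1 - D\<^sup>2 / lam\<^sup>2) * ennreal (indicator {7..T} t * (indicator {7..} t * g t)) \<partial>lborel)"
  proof -
    have "(\<integral>\<^sup>+t. ennreal (indicator {7..T} t * g t) \<partial>lborel) = (\<integral>\<^sup>+t. ennreal (indicator {7..T} t * (indicator {7..} t * g t)) \<partial>lborel)"
      by (intro nn_integral_cong) (auto simp: indicator_def)
    then show ?thesis by (simp only:) (rule nn_integral_cmult[symmetric], measurable)
  qed
  also have "\<dots> \<le> (\<integral>\<^sup>+t. ennreal (indicator {7..} t * g t) * \<Phi> t \<partial>lborel)"
  proof (rule nn_integral_mono)
    fix t
    show "ennreal (1 - D\<^sup>2 / lam\<^sup>2) * ennreal (indicator {7..T} t * (indicator {7..} t * g t)) \<le> ennreal (indicator {7..} t * g t) * \<Phi> t"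
    proof (cases "t \<in> {7..T}")
      case True
      have "ennreal (1 - D\<^sup>2 / lam\<^sup>2) \<le> \<Phi> t"
        unfolding \<Phi>_def by (rule gaussian_mass_Icc) (use True D lam in \<open>auto simp: b1_def b2_def\<close>)
      from mult_left_mono[OF this, of "ennreal (g t)"] show ?thesis
        using True by (simp add: mult.commute)
    qed simp
  qed
  also have "\<dots> = (\<integral>\<^sup>+s. ennreal (indicator {b1..b2} s) * (\<integral>\<^sup>+t. ennreal (indicator {7..} t * g t * normal_density s D t) \<partial>lborel) \<partial>lborel)"
    unfolding \<Phi>_def by (rule gaussian_average_swap) (measurable, auto simp: indicator_def nng)
  also have "\<dots> \<le> (\<integral>\<^sup>+s. ennreal (indicator {b1..b2} s) * (\<integral>\<^sup>+t. ennreal (indicator {7..} t * h t * normal_density s D t) \<partial>lborel)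
                       + ennreal (indicator {b1..b2} s * \<epsilon>) \<partial>lborel)"
  proof (rule nn_integral_mono)
    fix s
    show "ennreal (indicator {b1..b2} s) * (\<integral>\<^sup>+t. ennreal (indicator {7..} t * g t * normal_density s D t) \<partial>lborel) \<le>
          ennreal (indicator {b1..b2} s) * (\<integral>\<^sup>+t. ennreal (indicator {7..} t * h t * normal_density s D t) \<partial>lborel) + ennreal (indicator {b1..b2} s * \<epsilon>)"
      using cmp[of s] by (auto simp: indicator_def b2_def)
  qed
  also have "\<dots> = (\<integral>\<^sup>+s. ennreal (indicator {b1..b2} s) * (\<integral>\<^sup>+t. ennreal (indicator {7..} t * h t * normal_density s D t) \<partial>lborel) \<partial>lborel)
       + (\<integral>\<^sup>+s. ennreal (indicator {b1..b2} s * \<epsilon>) \<partial>lborel)"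
  proof (rule nn_integral_add)
    show "(\<lambda>s. ennreal (indicator {b1..b2} s) * (\<integral>\<^sup>+t. ennreal (indicator {7..} t * h t * normal_density s D t) \<partial>lborel)) \<in> borel_measurable lborel"
      unfolding normal_density_def by measurable
  qed measurable
  also have "(\<integral>\<^sup>+s. ennreal (indicator {b1..b2} s) * (\<integral>\<^sup>+t. ennreal (indicator {7..} t * h t * normal_density s D t) \<partial>lborel) \<partial>lborel)
       = (\<integral>\<^sup>+t. ennreal (indicator {7..} t * h t) * \<Phi> t \<partial>lborel)"
    unfolding \<Phi>_def by (rule gaussian_average_swap[symmetric]) (measurable, auto simp: indicator_def nnh)
  also have "\<dots> + (\<integral>\<^sup>+s. ennreal (indicator {b1..b2} s * \<epsilon>) \<partial>lborel) \<le>
      (ennreal (integral {7..T + 2 * lam} h) + ennreal (M * H)) + ennreal (\<epsilon> * (T + 2 * lam))"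
  proof (rule add_mono)
    have "(\<integral>\<^sup>+t. ennreal (indicator {7..} t * h t) * \<Phi> t \<partial>lborel) \<le>
          (\<integral>\<^sup>+t. ennreal (indicator {7..T + 2 * lam} t * (indicator {7..} t * h t)) + ennreal M * ennreal (indicator {7..} t * h t * exp (- (1 / T) * t)) \<partial>lborel)"
    proof (rule nn_integral_mono)
      fix t
      show "ennreal (indicator {7..} t * h t) * \<Phi> t \<le>
          ennreal (indicator {7..T + 2 * lam} t * (indicator {7..} t * h t)) + ennreal M * ennreal (indicator {7..} t * h t * exp (- (1 / T) * t))"
      proof (cases "t \<le> T + 2 * lam")
        case True
        have "ennreal (indicator {7..} t * h t) * \<Phi> t \<le> ennreal (indicator {7..} t * h t) * 1"
          by (intro mult_left_mono Phi_le1) auto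
        also have "\<dots> = ennreal (indicator {7..T + 2 * lam} t * (indicator {7..} t * h t))"
          using True by (auto simp: indicator_def)
        finally show ?thesis by (rule order_trans) simp
      next
        case False
        have "ennreal (indicator {7..} t * h t) * \<Phi> t \<le> ennreal (indicator {7..} t * h t) * ennreal (M * exp (- (1 / T) * t))"
          using False by (intro mult_left_mono Phi_tail) auto
        also have "\<dots> = ennreal M * ennreal (indicator {7..} t * h t * exp (- (1 / T) * t))"
          using M nnh[of t] by (auto simp: indicator_def ennreal_mult[symmetric] mult_ac)
        finally show ?thesis by (rule order_trans) simp
      qed
    qed
    also have "\<dots> = (\<integral>\<^sup>+t. ennreal (indicator {7..T + 2 * lam} t * (indicator {7..} t * h t)) \<partial>lborel)
         + (\<integral>\<^sup>+t. ennreal M * ennreal (indicator {7..} t * h t * exp (- (1 / T) * t)) \<partial>lborel)"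
      by (rule nn_integral_add) measurable
    also have "(\<integral>\<^sup>+t. ennreal (indicator {7..T + 2 * lam} t * (indicator {7..} t * h t)) \<partial>lborel) = (\<integral>\<^sup>+t. ennreal (indicator {7..T + 2 * lam} t * h t) \<partial>lborel)"
      by (intro nn_integral_cong) (auto simp: indicator_def)
    also have "\<dots> = ennreal (integral {7..T + 2 * lam} h)"
      by (rule nn_integral_continuous_Icc) (auto intro: continuous_on_subset[OF ch] nnh)
    also have "(\<integral>\<^sup>+t. ennreal M * ennreal (indicator {7..} t * h t * exp (- (1 / T) * t)) \<partial>lborel) =
        ennreal M * (\<integral>\<^sup>+t. ennreal (indicator {7..} t * h t * exp (- (1 / T) * t)) \<partial>lborel)"
      by (rule nn_integral_cmult) measurable
    also have "\<dots> \<le> ennreal M * ennreal H"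
      by (intro mult_left_mono H) simp
    also have "\<dots> = ennreal (M * H)" using M H by (simp add: ennreal_mult)
    finally show "(\<integral>\<^sup>+t. ennreal (indicator {7..} t * h t) * \<Phi> t \<partial>lborel) \<le> ennreal (integral {7..T + 2 * lam} h) + ennreal (M * H)"
      by (simp add: add_left_mono)
    show "(\<integral>\<^sup>+s. ennreal (indicator {b1..b2} s * \<epsilon>) \<partial>lborel) \<le> ennreal (\<epsilon> * (T + 2 * lam))"
      using em[OF eps] by (simp add: mult.commute)
  qed
  also have "\<dots> = ennreal (integral {7..T + 2 * lam} h + M * H + \<epsilon> * (T + 2 * lam))"
  proof -
    have "0 \<le> integral {7..T + 2 * lam} h"
      by (rule integral_nonneg) (use ch nnh in \<open>auto intro!: integrable_continuous_interval elim: continuous_on_subset\<close>)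
    then show ?thesis using M H eps T lam by (simp add: ennreal_plus)
  qed
  finally have "ennreal ((1 - D\<^sup>2 / lam\<^sup>2) * integral {7..T} g) \<le> ennreal (integral {7..T + 2 * lam} h + M * H + \<epsilon> * (T + 2 * lam))" .
  moreover have "0 \<le> integral {7..T + 2 * lam} h + M * H + \<epsilon> * (T + 2 * lam)"
  proof -
    have "0 \<le> integral {7..T + 2 * lam} h"
      by (rule integral_nonneg) (use ch nnh in \<open>auto intro!: integrable_continuous_interval elim: continuous_on_subset\<close>)
    then show ?thesis using M H eps T lam by simp
  qed
  ultimately show ?thesis
    by (simp add: M_def)
qed

lemma nn_integral_set_LINT:
  fixes f :: "real \<Rightarrow> real"
  assumes "set_integrable lborel A f" "\<And>t. t \<in> A \<Longrightarrow> f t \<ge> 0"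
  shows "(\<integral>\<^sup>+t. ennreal (indicator A t * f t) \<partial>lborel) = ennreal (LINT t:A|lborel. f t)"
    and "(LINT t:A|lborel. f t) \<ge> 0"
proof -
  have nn: "indicator A t * f t \<ge> 0" for t using assms(2) by (auto simp: indicator_def)
  show "(\<integral>\<^sup>+t. ennreal (indicator A t * f t) \<partial>lborel) = ennreal (LINT t:A|lborel. f t)"
    using nn_integral_eq_integral[of lborel "\<lambda>t. indicator A t * f t"] assms(1) nn
    by (simp add: set_integrable_def set_lebesgue_integral_def)
  show "(LINT t:A|lborel. f t) \<ge> 0"
    unfolding set_lebesgue_integral_def using nn by simp
qed

text \<open>
  For Gaussians of width \<open>D\<close> the transform bound contributes $T^{7/2} D^{-3}$, so \<open>D\<close> must exceed
  $T^{5/6}$; the proof takes $D = T^{9/10}$.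
\<close>

lemma laplace_tauberian:
  fixes g h :: "real \<Rightarrow> real" and C :: real
  assumes cg: "continuous_on {7..} g" and nng: "\<And>t. t \<ge> 7 \<Longrightarrow> 0 \<le> g t"
    and ch: "continuous_on {7..} h" and nnh: "\<And>t. t \<ge> 7 \<Longrightarrow> 0 \<le> h t"
    and ig: "\<And>z. Re z > 0 \<Longrightarrow> set_integrable lborel {7..} (\<lambda>t. of_real (g t) * exp (- z * of_real t) :: complex)"
    and ih: "\<And>z. Re z > 0 \<Longrightarrow> set_integrable lborel {7..} (\<lambda>t. of_real (h t) * exp (- z * of_real t) :: complex)"
    and C: "C \<ge> 0"
    and bd: "\<And>z :: complex. \<lbrakk>0 < Re z; Re z \<le> 1/3\<rbrakk> \<Longrightarrow>
       norm ((LINT t:{7..}|lborel. of_real (g t) * exp (- z * of_real t)) - (LINT t:{7..}|lborel. of_real (h t) * exp (- z * of_real t)))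
         \<le> C * ((norm z)\<^sup>2 * Re z powr (- 5/2))"
    and bh: "\<And>x. \<lbrakk>0 < x; x \<le> 1/3\<rbrakk> \<Longrightarrow> (LINT t:{7..}|lborel. h t * exp (- x * t)) \<le> C * x powr (- 3/2)"
  shows "eventually (\<lambda>T. (1 - T powr (- 1/10)) * integral {7..T} g \<le>
            integral {7..T + 2 * T powr (19/20)} h + 2 * C * T powr (9/10)) at_top"
proof -
  \<comment> \<open>The margin \<open>lam = T powr (19/20)\<close> is placed between
    \<open>D = T powr (9/10)\<close> and \<open>T\<close>: the mass defect
    \<open>D^2 / lam^2\<close> is \<open>T powr (- 1/10)\<close>, the tail carries
    \<open>exp (- T powr (1/10) / 4)\<close>, and the smoothing error over the whole window has
    order \<open>T powr (4/5)\<close>.\<close>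
  have ev: "eventually (\<lambda>T::real. T \<ge> 7) at_top" "eventually (\<lambda>T::real. T powr (9/10) \<le> T powr (19/20)) at_top"
    "eventually (\<lambda>T::real. 8 * (T powr (9/10))\<^sup>2 \<le> T powr (19/20) * T) at_top"
    "eventually (\<lambda>T::real. T powr (19/20) \<le> T) at_top"
    "eventually (\<lambda>T::real. 2 * exp 4 * T powr (5/2) / (T powr (9/10)) ^ 3 * (T + 2 * T powr (19/20)) \<le> T powr (9/10)) at_top"
    "eventually (\<lambda>T::real. (T + 2 * T powr (19/20)) * (exp (1 - (T powr (19/20))\<^sup>2 / (4 * (T powr (9/10))\<^sup>2)) / T powr (9/10)) * T powr (3/2) \<le> T powr (9/10)) at_top"
    by real_asymp+
  then show ?thesis
  proof eventually_elim
    case (elim T)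
    define D lam where "D = T powr (9/10)" and "lam = T powr (19/20)"
    have pos: "T > 0" "D > 0" "lam > 0" using elim(1) by (auto simp: D_def lam_def)
    define u where "u = (\<lambda>t. g t - h t)"
    define \<epsilon> where "\<epsilon> = 2 * exp 4 * C * T powr (5/2) / D ^ 3"
    have \<epsilon>: "\<epsilon> \<ge> 0" using C pos by (simp add: \<epsilon>_def)
    have iu: "set_integrable lborel {7..} (\<lambda>t. of_real (u t) * exp (- z * of_real t) :: complex)"
      and lu: "(LINT t:{7..}|lborel. of_real (u t) * exp (- z * of_real t)) =
         (LINT t:{7..}|lborel. of_real (g t) * exp (- z * of_real t)) - (LINT t:{7..}|lborel. of_real (h t) * exp (- z * of_real t))"
      if "Re z > 0" for z
      using set_integral_diff[OF ig[OF that] ih[OF that]] by (simp_all add: u_def left_diff_distrib)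
    have cmp: "(\<integral>\<^sup>+t. ennreal (indicator {7..} t * g t * normal_density b D t) \<partial>lborel) \<le>
        (\<integral>\<^sup>+t. ennreal (indicator {7..} t * h t * normal_density b D t) \<partial>lborel) + ennreal \<epsilon>"
      if b: "b \<le> T + lam" for b
    proof -
      have g: "set_integrable lborel {7..} (\<lambda>t. g t * normal_density b D t)"
        by (rule set_integrable_normal_density_laplace[OF ig cg pos(2)])
      have h: "set_integrable lborel {7..} (\<lambda>t. h t * normal_density b D t)"
        by (rule set_integrable_normal_density_laplace[OF ih ch pos(2)])
      have "\<bar>LINT t:{7..}|lborel. u t * normal_density b D t\<bar> \<le> \<epsilon>"
        unfolding \<epsilon>_def
      proof (rule gaussian_mean_bound)
        show "norm (LINT t:{7..}|lborel. of_real (u t) * exp (- z * of_real t)) \<le> C * ((norm z)\<^sup>2 * Re z powr (- 5/2))"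
          if "0 < Re z" "Re z \<le> 1/3" for z
          using bd[OF that] lu[OF that(1)] by (simp only:)
        show "D \<le> T" using elim(2,4) by (simp add: D_def lam_def)
        show "b \<le> 3 * T" using b elim(1,4) by (simp add: lam_def)
      qed (use iu pos elim(1) C in auto)
      moreover have "(LINT t:{7..}|lborel. u t * normal_density b D t) =
          (LINT t:{7..}|lborel. g t * normal_density b D t) - (LINT t:{7..}|lborel. h t * normal_density b D t)"
        using set_integral_diff(2)[OF g h] by (simp add: u_def left_diff_distrib)
      ultimately have le: "(LINT t:{7..}|lborel. g t * normal_density b D t) \<le> (LINT t:{7..}|lborel. h t * normal_density b D t) + \<epsilon>"
        by linarith
      have "(\<integral>\<^sup>+t. ennreal (indicator {7..} t * (g t * normal_density b D t)) \<partial>lborel) \<le>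
          (\<integral>\<^sup>+t. ennreal (indicator {7..} t * (h t * normal_density b D t)) \<partial>lborel) + ennreal \<epsilon>"
        using nn_integral_set_LINT[OF g] nn_integral_set_LINT[OF h] nng nnh le \<epsilon>
        by (simp add: ennreal_plus[symmetric] ennreal_leI del: ennreal_plus)
      then show ?thesis by (simp only: mult.assoc)
    qed
    have H: "(\<integral>\<^sup>+t. ennreal (indicator {7..} t * h t * exp (- (1 / T) * t)) \<partial>lborel) \<le> ennreal (C * T powr (3/2))"
    proof -
      have "set_integrable lborel {7..} (\<lambda>t. Re (of_real (h t) * exp (- of_real (1 / T) * of_real t)))"
        using ih[of "of_real (1 / T)"] pos integrable_Re unfolding set_integrable_def by fastforce
      moreover have "Re (of_real (h t) * exp (- of_real (1 / T) * of_real t)) = h t * exp (- (1 / T) * t)" for t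
      proof -
        have "exp (- of_real (1 / T) * of_real t) = complex_of_real (exp (- (1 / T) * t))"
          by (simp flip: exp_of_real)
        then show ?thesis by simp
      qed
      ultimately have i: "set_integrable lborel {7..} (\<lambda>t. h t * exp (- (1 / T) * t))"
        by (simp only:)
      have "(LINT t:{7..}|lborel. h t * exp (- (1 / T) * t)) \<le> C * (1 / T) powr (- 3/2)"
        by (rule bh) (use elim(1) in auto)
      also have "(1 / T) powr (- 3/2) = T powr (3/2)"
        using pos by (simp add: powr_divide powr_minus_divide)
      finally have "(\<integral>\<^sup>+t. ennreal (indicator {7..} t * (h t * exp (- (1 / T) * t))) \<partial>lborel) \<le> ennreal (C * T powr (3/2))"
        using nn_integral_set_LINT(1)[OF i] nnh by (simp add: ennreal_leI)
      then show ?thesis by (simp only: mult.assoc)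
    qed
    have main: "(1 - D\<^sup>2 / lam\<^sup>2) * integral {7..T} g \<le>
           integral {7..T + 2 * lam} h + \<epsilon> * (T + 2 * lam) + (T + 2 * lam) * (exp (1 - lam\<^sup>2 / (4 * D\<^sup>2)) / D) * (C * T powr (3/2))"
      by (rule gaussian_tauberian_bound[OF cg nng ch nnh _ _ _ _ cmp \<epsilon> H])
         (use elim pos C in \<open>auto simp: D_def lam_def\<close>)
    have k: "D\<^sup>2 / lam\<^sup>2 = T powr (- 1/10)"
    proof -
      have "D\<^sup>2 = T powr (18/10)" "lam\<^sup>2 = T powr (19/10)"
        unfolding D_def lam_def by (simp_all add: power2_eq_square powr_add[symmetric])
      then show ?thesis by (simp add: powr_diff[symmetric])
    qed
    have 1: "\<epsilon> * (T + 2 * lam) \<le> C * T powr (9/10)"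
      using mult_left_mono[OF elim(5) C] by (simp add: \<epsilon>_def D_def lam_def mult_ac)
    have 2: "(T + 2 * lam) * (exp (1 - lam\<^sup>2 / (4 * D\<^sup>2)) / D) * (C * T powr (3/2)) \<le> C * T powr (9/10)"
      using mult_left_mono[OF elim(6) C] by (simp add: D_def lam_def mult_ac)
    show ?case
      using main 1 2 unfolding k by (simp add: lam_def)
  qed
qed

section \<open>The mean square on the critical line\<close>

lemma integral_log_density:
  assumes "T \<ge> 7"
  shows "integral {7..T} log_density = log_primitive T - log_primitive 7"
proof (rule integral_unique, rule fundamental_theorem_of_calculus[OF assms])
  fix x assume "x \<in> {7..T}"
  then show "(log_primitive has_vector_derivative log_density x) (at x within {7..T})"
    using log_primitive_deriv[of x]
    by (auto simp: has_real_derivative_iff_has_vector_derivative intro: has_vector_derivative_at_within)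
qed

text \<open>The Tauberian bound is one-sided, so it is applied twice with the roles of
  \<open>zeta_sq\<close> and \<open>log_density\<close> exchanged. Each application enlarges an
  interval by \<open>2 * T powr (19/20)\<close>, over which \<open>log_primitive\<close> grows by
  only \<open>o(T)\<close>.\<close>

lemma zeta_sq_mean:
  "((\<lambda>T. (integral {0..T} zeta_sq - log_primitive T) / T) \<longlongrightarrow> 0) at_top"
proof -
  define J where "J = (\<lambda>T. integral {7..T} zeta_sq)"
  define l7 where "l7 = log_primitive 7"
  define e where "e = (2 * euler_mascheroni - 1 :: real)"
  have lp: "log_primitive t = t * ln (t / (2 * pi)) + e * t" for t
    by (simp add: log_primitive_def e_def)
  obtain C where C: "C > 0"
    and 1: "\<And>z :: complex. \<lbrakk>0 < Re z; Re z \<le> 1/3\<rbrakk> \<Longrightarrow>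
       norm ((LINT t:{7..}|lborel. of_real (zeta_sq t) * exp (- z * of_real t)) -
             (LINT t:{7..}|lborel. of_real (log_density t) * exp (- z * of_real t))) \<le> C * ((norm z)\<^sup>2 * Re z powr (- 5/2))"
    and 2: "\<And>x. \<lbrakk>0 < x; x \<le> 1/3\<rbrakk> \<Longrightarrow> (LINT t:{7..}|lborel. zeta_sq t * exp (- x * t)) \<le> C * x powr (- 3/2)"
    and 3: "\<And>x. \<lbrakk>0 < x; x \<le> 1/3\<rbrakk> \<Longrightarrow> (LINT t:{7..}|lborel. log_density t * exp (- x * t)) \<le> C * x powr (- 3/2)"
    by (rule zeta_sq_laplace) blast
  have C0: "C \<ge> 0" using C by simp
  have up: "eventually (\<lambda>T. (1 - T powr (- 1/10)) * J T \<le>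
            integral {7..T + 2 * T powr (19/20)} log_density + 2 * C * T powr (9/10)) at_top"
    unfolding J_def
    by (rule laplace_tauberian[OF continuous_on_zeta_sq zeta_sq_nonneg continuous_on_log_density log_density_bounds(1)
          zeta_sq_laplace_integrable log_density_laplace(1) C0 1 3])
  have lo: "eventually (\<lambda>T. (1 - T powr (- 1/10)) * integral {7..T} log_density \<le>
            J (T + 2 * T powr (19/20)) + 2 * C * T powr (9/10)) at_top"
    unfolding J_def
  proof (rule laplace_tauberian[OF continuous_on_log_density log_density_bounds(1) continuous_on_zeta_sq zeta_sq_nonneg
          log_density_laplace(1) zeta_sq_laplace_integrable C0 _ 2])
    fix z :: complex assume z: "0 < Re z" "Re z \<le> 1/3"
    show "norm ((LINT t:{7..}|lborel. of_real (log_density t) * exp (- z * of_real t)) -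
             (LINT t:{7..}|lborel. of_real (zeta_sq t) * exp (- z * of_real t))) \<le> C * ((norm z)\<^sup>2 * Re z powr (- 5/2))"
      using 1[OF z] by (simp only: norm_minus_commute)
  qed
  have Jmono: "J a \<le> J b" if "a \<le> b" for a b
    unfolding J_def using that
    by (intro integral_subset_le integrable_continuous_interval continuous_on_zeta_sq) (auto simp: zeta_sq_nonneg)
  define U where "U = (\<lambda>T. ((log_primitive (T + 2 * T powr (19/20)) - l7 + 2 * C * T powr (9/10)) / (1 - T powr (- 1/10)) - log_primitive T) / T)"
  \<comment> \<open>Chosen so that the enlargement of \<open>{7..S T}\<close> stays inside
    \<open>{7..T}\<close>; this turns the second application into a lower bound for
    \<open>J T\<close>.\<close>
  define S where "S = (\<lambda>T::real. T - 2 * T powr (19/20))"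
  define L where "L = (\<lambda>T. ((1 - S T powr (- 1/10)) * (log_primitive (S T) - l7) - 2 * C * S T powr (9/10) - log_primitive T) / T)"
  have U: "(U \<longlongrightarrow> 0) at_top" unfolding U_def lp by real_asymp
  have L: "(L \<longlongrightarrow> 0) at_top" unfolding L_def S_def lp by real_asymp
  have S: "filterlim S at_top at_top" unfolding S_def by real_asymp
  have *: "((\<lambda>T. (J T - log_primitive T) / T) \<longlongrightarrow> 0) at_top"
  proof (rule tendsto_sandwich[OF _ _ L U])
    have "eventually (\<lambda>T::real. T powr (- 1/10) < 1) at_top" "eventually (\<lambda>T::real. T \<ge> 7) at_top" by real_asymp+
    with up show "eventually (\<lambda>T. (J T - log_primitive T) / T \<le> U T) at_top"
    proof eventually_elim
      case (elim T)
      have "J T * (1 - T powr (- 1/10)) \<le> log_primitive (T + 2 * T powr (19/20)) - l7 + 2 * C * T powr (9/10)"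
      proof -
        have "7 + 0 \<le> T + 2 * T powr (19/20)" using elim(3) by (intro add_mono) auto
        then show ?thesis
          using elim(1) integral_log_density[of "T + 2 * T powr (19/20)"] by (simp add: l7_def mult.commute)
      qed
      then have "J T \<le> (log_primitive (T + 2 * T powr (19/20)) - l7 + 2 * C * T powr (9/10)) / (1 - T powr (- 1/10))"
        using elim(2) by (subst pos_le_divide_eq) auto
      then show ?case unfolding U_def using elim(3) by (intro divide_right_mono) auto
    qed
    have "eventually (\<lambda>T. S T + 2 * S T powr (19/20) \<le> T) at_top" "eventually (\<lambda>T. S T \<ge> 7) at_top" "eventually (\<lambda>T::real. T \<ge> 7) at_top"
      unfolding S_def by real_asymp+
    moreover have "eventually (\<lambda>T. (1 - S T powr (- 1/10)) * integral {7..S T} log_density \<le>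
            J (S T + 2 * S T powr (19/20)) + 2 * C * S T powr (9/10)) at_top"
      by (rule eventually_compose_filterlim[OF lo S])
    ultimately show "eventually (\<lambda>T. L T \<le> (J T - log_primitive T) / T) at_top"
    proof eventually_elim
      case (elim T)
      have "(1 - S T powr (- 1/10)) * (log_primitive (S T) - l7) \<le> J T + 2 * C * S T powr (9/10)"
        using elim(4) Jmono[OF elim(1)] elim(2) by (simp add: integral_log_density l7_def)
      then show ?case unfolding L_def using elim(3) by (intro divide_right_mono) auto
    qed
  qed
  have lim: "((\<lambda>T. integral {0..7} zeta_sq / T + (J T - log_primitive T) / T) \<longlongrightarrow> 0 + 0) at_top"
    by (intro tendsto_add * tendsto_divide_0[OF tendsto_const] filterlim_at_top_imp_at_infinity filterlim_ident)
  have ev: "eventually (\<lambda>T. integral {0..7} zeta_sq / T + (J T - log_primitive T) / T = (integral {0..T} zeta_sq - log_primitive T) / T) at_top"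
    using eventually_ge_at_top[of "7::real"]
  proof eventually_elim
    case (elim T)
    have "integral {0..7} zeta_sq + J T = integral {0..T} zeta_sq"
      unfolding J_def
      by (rule Henstock_Kurzweil_Integration.integral_combine)
         (use elim in \<open>auto intro!: integrable_continuous_interval continuous_on_zeta_sq\<close>)
    then show ?case unfolding add_divide_distrib[symmetric] by simp
  qed
  show ?thesis
    using Lim_transform_eventually[OF lim ev] by simp
qed

section \<open>The mean square to the right of the critical line\<close>

lemma zeta_norm_le_real:
  assumes "Re s > 1"
  shows "norm (zeta s) \<le> Re (zeta (of_real (Re s)))"
proof (rule norm_sums_le[OF zeta_sums[OF assms] zeta_real_sums[OF assms]])
  fix n show "norm ((of_nat (Suc n) :: complex) powr (- s)) \<le> real (Suc n) powr (- Re s)"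
    by (simp add: norm_powr_real_powr del: of_nat_Suc)
qed

text \<open>
  Cauchy's formula for $\zeta(s)^2 X^{s-s_0} e^{(s-s_0)^2}$ on a rectangle reaching from the
  critical line into the half-plane of absolute convergence.
\<close>

lemma zeta_line_pointwise:
  fixes \<sigma> :: real
  assumes \<sigma>: "\<sigma> > 1/2"
  obtains C where "C > 0"
    "\<And>X t h. \<lbrakk>X \<ge> 1; h \<ge> 1; h + 1 \<le> t\<rbrakk> \<Longrightarrow> (cmod (zeta (Complex \<sigma> t)))\<^sup>2 \<le>
       C * (X powr (1/2 - \<sigma>) * integral {t - h..t + h} (\<lambda>v. zeta_sq v * exp (- (v - t)\<^sup>2)) +
            X * integral {t - h..t + h} (\<lambda>v. exp (- (v - t)\<^sup>2)) + X * (t + h + \<sigma> + 1)\<^sup>2 * exp (- h\<^sup>2))"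
proof -
  define \<delta> where "\<delta> = \<sigma> - 1/2"
  have \<delta>: "\<delta> > 0" using \<sigma> by (simp add: \<delta>_def)
  \<comment> \<open>Bounds \<open>exp ((Re s - \<sigma>)^2)\<close> on the rectangle, whose vertical
    sides lie at the distances \<open>\<delta>\<close> and 1 from \<open>\<sigma>\<close>.\<close>
  define E where "E = exp (\<delta>\<^sup>2 + 1)"
  define Z where "Z = Re (zeta (of_real (\<sigma> + 1)))"
  have Z: "Z > 0" unfolding Z_def by (rule zeta_real_pos) (use \<sigma> in auto)
  obtain K where K: "K \<ge> 1" "\<And>s. Re s \<ge> 1/2 \<Longrightarrow> norm (s - 1) \<ge> 1/2 \<Longrightarrow> norm (zeta s) \<le> K * norm s"
    using zeta_half_plane_bound by blast
  \<comment> \<open>One summand for each kind of side: the left one at distance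
    \<open>\<delta>\<close> from the pole, the right one at distance 1 with zeta bounded by
    \<open>Z\<close>, and the two horizontal ones with the linear growth of zeta.\<close>
  define C where "C = E / \<delta> + Z\<^sup>2 * E + (\<sigma> + 1/2) * (2 * (K\<^sup>2 * E))"
  have Epos: "E > 0" by (simp add: E_def)
  have parts: "E / \<delta> > 0" "Z\<^sup>2 * E \<ge> 0" "(\<sigma> + 1/2) * (2 * (K\<^sup>2 * E)) \<ge> 0"
    using Epos \<delta> \<sigma> by auto
  show ?thesis
  proof (rule that)
    show "C > 0" unfolding C_def using parts by linarith
    fix X t h :: real assume X: "X \<ge> 1" and h: "h \<ge> 1" "h + 1 \<le> t"
    define s0 where "s0 = Complex \<sigma> t"
    define g where "g = (\<lambda>s. (zeta s)\<^sup>2 * (exp ((s - s0) * of_real (ln X)) * exp ((s - s0)\<^sup>2)))"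
    define S where "S = {s :: complex. Im s > 0}"
    have lnX: "ln X \<ge> 0" using X by simp
    have ng: "norm (g s) = (norm (zeta s))\<^sup>2 * (exp ((Re s - \<sigma>) * ln X) * exp ((Re s - \<sigma>)\<^sup>2 - (Im s - t)\<^sup>2))" for s
      by (simp add: g_def norm_mult norm_power norm_exp_eq_Re s0_def power2_eq_square)
    have ng_le: "norm (g s) \<le> (norm (zeta s))\<^sup>2 * (exp ((Re s - \<sigma>) * ln X) * (E * exp (- (Im s - t)\<^sup>2)))"
      if "1/2 \<le> Re s" "Re s \<le> \<sigma> + 1" for s
    proof -
      have "(Re s - \<sigma>)\<^sup>2 \<le> \<delta>\<^sup>2 + 1"
      proof (cases "Re s \<le> \<sigma>")
        case True
        then have "(\<sigma> - Re s)\<^sup>2 \<le> \<delta>\<^sup>2" using that by (intro power_mono) (auto simp: \<delta>_def)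
        then show ?thesis by (simp add: power2_commute)
      next
        case False
        then have "(Re s - \<sigma>)\<^sup>2 \<le> 1\<^sup>2" using that by (intro power_mono) auto
        moreover have "0 \<le> \<delta>\<^sup>2" by simp
        ultimately show ?thesis unfolding one_power2 by linarith
      qed
      then have "exp ((Re s - \<sigma>)\<^sup>2 - (Im s - t)\<^sup>2) \<le> E * exp (- (Im s - t)\<^sup>2)"
        unfolding E_def exp_add[symmetric] by simp
      then show ?thesis unfolding ng by (intro mult_left_mono) auto
    qed
    have hol: "g holomorphic_on S"
      unfolding g_def S_def by (intro holomorphic_intros zeta_holomorphic) auto
    have cont: "continuous_on {t - h..t + h} (\<lambda>v. g (Complex a v) / (Complex a v - s0))" if "a \<noteq> \<sigma>" for a
    proof -
      have "continuous_on {t - h..t + h} (\<lambda>v. g (Complex a v))"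
        by (rule continuous_on_compose2[OF holomorphic_on_imp_continuous_on[OF hol]])
           (use h in \<open>auto simp: S_def Complex_eq intro!: continuous_intros\<close>)
      then show ?thesis
        using that by (intro continuous_intros) (auto simp: Complex_eq s0_def complex_eq_iff intro!: continuous_intros)
    qed
    define M where "M = K\<^sup>2 * (t + h + \<sigma> + 1)\<^sup>2 * (X * (E * exp (- h\<^sup>2)))"
    have horiz: "norm (g s / (s - s0)) \<le> M" if s: "1/2 \<le> Re s" "Re s \<le> \<sigma> + 1" "\<bar>Im s - t\<bar> = h" for s
    proof -
      have Im: "Im s \<ge> 1" "Im s \<le> t + h" using s(3) h by auto
      have "norm (s - 1) \<ge> 1/2" using abs_Im_le_cmod[of "s - 1"] Im by simp
      then have "norm (zeta s) \<le> K * norm s" using K(2) s by simp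
      also have "\<dots> \<le> K * (t + h + \<sigma> + 1)"
        using cmod_le[of s] Im s(1,2) K(1) by (intro mult_left_mono) auto
      finally have "(norm (zeta s))\<^sup>2 \<le> (K * (t + h + \<sigma> + 1))\<^sup>2" by (intro power_mono) auto
      then have 1: "(norm (zeta s))\<^sup>2 \<le> K\<^sup>2 * (t + h + \<sigma> + 1)\<^sup>2" by (simp add: power_mult_distrib)
      have "(Re s - \<sigma>) * ln X \<le> 1 * ln X" using s lnX by (intro mult_right_mono) auto
      then have "exp ((Re s - \<sigma>) * ln X) \<le> exp (ln X)" by simp
      then have 2: "exp ((Re s - \<sigma>) * ln X) \<le> X" using X by simp
      have 3: "(Im s - t)\<^sup>2 = h\<^sup>2" using s(3) by (metis power2_abs)
      have "norm (g s) \<le> (norm (zeta s))\<^sup>2 * (exp ((Re s - \<sigma>) * ln X) * (E * exp (- h\<^sup>2)))"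
        using ng_le[OF s(1,2)] unfolding 3 .
      also have "\<dots> \<le> M"
        unfolding M_def using 1 2 Epos X by (intro mult_mono) auto
      finally have 4: "norm (g s) \<le> M" .
      have "1 \<le> norm (s - s0)" using abs_Im_le_cmod[of "s - s0"] s(3) h by (simp add: s0_def)
      then have "norm (g s) / norm (s - s0) \<le> norm (g s) / 1" by (intro divide_left_mono) auto
      then show ?thesis using 4 by (simp add: norm_divide)
    qed
    define IL where "IL = integral {t - h..t + h} (\<lambda>v. g (Complex (1/2) v) / (Complex (1/2) v - s0))"
    define IR where "IR = integral {t - h..t + h} (\<lambda>v. g (Complex (\<sigma> + 1) v) / (Complex (\<sigma> + 1) v - s0))"
    define A where "A = integral {t - h..t + h} (\<lambda>v. zeta_sq v * exp (- (v - t)\<^sup>2))"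
    define B where "B = integral {t - h..t + h} (\<lambda>v. exp (- (v - t)\<^sup>2))"
    have AB: "A \<ge> 0" "B \<ge> 0"
      unfolding A_def B_def
      by (intro integral_nonneg integrable_continuous_interval continuous_intros continuous_on_zeta_sq;
          simp add: zeta_sq_nonneg)+
    have main: "norm (2 * of_real pi * g s0 - (IR - IL)) \<le> (\<sigma> + 1 - 1/2) * (M + M)"
      unfolding IL_def IR_def
    proof (rule Cauchy_rectangle_formula[OF _ _ hol])
      show "convex S" "open S" unfolding S_def by (auto simp: convex_halfspace_Im_gt open_halfspace_Im_gt)
      show "{z. 1/2 \<le> Re z \<and> Re z \<le> \<sigma> + 1 \<and> t - h \<le> Im z \<and> Im z \<le> t + h} \<subseteq> S"
        using h by (auto simp: S_def)
    qed (use \<sigma> h in \<open>auto simp: s0_def intro!: horiz[unfolded s0_def]\<close>)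
    have L: "norm IL \<le> X powr (1/2 - \<sigma>) * (E / \<delta>) * A"
    proof -
      have "norm IL \<le> integral {t - h..t + h} (\<lambda>v. X powr (1/2 - \<sigma>) * (E / \<delta>) * (zeta_sq v * exp (- (v - t)\<^sup>2)))"
        unfolding IL_def
      proof (rule Henstock_Kurzweil_Integration.integral_norm_bound_integral)
        show "(\<lambda>v. g (Complex (1/2) v) / (Complex (1/2) v - s0)) integrable_on {t - h..t + h}"
          by (intro integrable_continuous_interval cont) (use \<sigma> in auto)
        show "(\<lambda>v. X powr (1/2 - \<sigma>) * (E / \<delta>) * (zeta_sq v * exp (- (v - t)\<^sup>2))) integrable_on {t - h..t + h}"
          by (intro integrable_continuous_interval continuous_intros continuous_on_zeta_sq)
        fix v
        have "norm (g (Complex (1/2) v)) \<le> zeta_sq v * (X powr (1/2 - \<sigma>) * (E * exp (- (v - t)\<^sup>2)))"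
          using ng_le[of "Complex (1/2) v"] \<sigma> X by (simp add: zeta_sq_def powr_def)
        moreover have "\<delta> \<le> norm (Complex (1/2) v - s0)"
          using abs_Re_le_cmod[of "Complex (1/2) v - s0"] \<sigma> by (simp add: s0_def \<delta>_def)
        ultimately have "norm (g (Complex (1/2) v)) / norm (Complex (1/2) v - s0) \<le> (zeta_sq v * (X powr (1/2 - \<sigma>) * (E * exp (- (v - t)\<^sup>2)))) / \<delta>"
          using \<delta> Epos by (intro frac_le) (auto simp: zeta_sq_nonneg)
        then show "norm (g (Complex (1/2) v) / (Complex (1/2) v - s0)) \<le> X powr (1/2 - \<sigma>) * (E / \<delta>) * (zeta_sq v * exp (- (v - t)\<^sup>2))"
          by (simp add: norm_divide mult_ac)
      qed
      then show ?thesis by (simp add: A_def)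
    qed
    have R: "norm IR \<le> X * (Z\<^sup>2 * E) * B"
    proof -
      have "norm IR \<le> integral {t - h..t + h} (\<lambda>v. X * (Z\<^sup>2 * E) * exp (- (v - t)\<^sup>2))"
        unfolding IR_def
      proof (rule Henstock_Kurzweil_Integration.integral_norm_bound_integral)
        show "(\<lambda>v. g (Complex (\<sigma> + 1) v) / (Complex (\<sigma> + 1) v - s0)) integrable_on {t - h..t + h}"
          by (intro integrable_continuous_interval cont) auto
        show "(\<lambda>v. X * (Z\<^sup>2 * E) * exp (- (v - t)\<^sup>2)) integrable_on {t - h..t + h}"
          by (intro integrable_continuous_interval continuous_intros)
        fix v
        have "norm (zeta (Complex (\<sigma> + 1) v)) \<le> Z"
          using zeta_norm_le_real[of "Complex (\<sigma> + 1) v"] \<sigma> by (simp add: Z_def)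
        then have "(norm (zeta (Complex (\<sigma> + 1) v)))\<^sup>2 \<le> Z\<^sup>2" by (intro power_mono) auto
        then have "(norm (zeta (Complex (\<sigma> + 1) v)))\<^sup>2 * (X * (E * exp (- (v - t)\<^sup>2))) \<le> Z\<^sup>2 * (X * (E * exp (- (v - t)\<^sup>2)))"
          using X Epos by (intro mult_right_mono) auto
        moreover have "norm (g (Complex (\<sigma> + 1) v)) \<le> (norm (zeta (Complex (\<sigma> + 1) v)))\<^sup>2 * (X * (E * exp (- (v - t)\<^sup>2)))"
          using ng_le[of "Complex (\<sigma> + 1) v"] \<sigma> X by simp
        ultimately have "norm (g (Complex (\<sigma> + 1) v)) \<le> Z\<^sup>2 * (X * (E * exp (- (v - t)\<^sup>2)))"
          by (rule order_trans[rotated])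
        moreover have "1 \<le> norm (Complex (\<sigma> + 1) v - s0)"
          using abs_Re_le_cmod[of "Complex (\<sigma> + 1) v - s0"] by (simp add: s0_def)
        ultimately have "norm (g (Complex (\<sigma> + 1) v)) / norm (Complex (\<sigma> + 1) v - s0) \<le> (Z\<^sup>2 * (X * (E * exp (- (v - t)\<^sup>2)))) / 1"
          using X Epos by (intro frac_le) auto
        then show "norm (g (Complex (\<sigma> + 1) v) / (Complex (\<sigma> + 1) v - s0)) \<le> X * (Z\<^sup>2 * E) * exp (- (v - t)\<^sup>2)"
          by (simp add: norm_divide mult_ac)
      qed
      then show ?thesis by (simp add: B_def)
    qed
    have gs0: "g s0 = (zeta (Complex \<sigma> t))\<^sup>2" by (simp add: g_def s0_def)
    have n0: "norm (2 * of_real pi * g s0) = 2 * pi * (cmod (zeta (Complex \<sigma> t)))\<^sup>2"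
      by (simp add: gs0 norm_mult norm_power)
    have "norm (2 * of_real pi * g s0) \<le> norm (IR - IL) + (\<sigma> + 1 - 1/2) * (M + M)"
      using main norm_triangle_ineq2[of "2 * of_real pi * g s0" "IR - IL"] by linarith
    also have "norm (IR - IL) \<le> X * (Z\<^sup>2 * E) * B + X powr (1/2 - \<sigma>) * (E / \<delta>) * A"
      using L R norm_triangle_ineq4[of IR IL] by linarith
    finally have fin: "2 * pi * (cmod (zeta (Complex \<sigma> t)))\<^sup>2 \<le>
        (X * (Z\<^sup>2 * E) * B + X powr (1/2 - \<sigma>) * (E / \<delta>) * A) + (\<sigma> + 1 - 1/2) * (M + M)"
      unfolding n0 by simp
    define m where "m = X * (t + h + \<sigma> + 1)\<^sup>2 * exp (- h\<^sup>2)"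
    have m: "m \<ge> 0" using X by (simp add: m_def)
    have Mm: "(\<sigma> + 1 - 1/2) * (M + M) = (\<sigma> + 1/2) * (2 * (K\<^sup>2 * E)) * m"
      by (simp add: M_def m_def algebra_simps)
    have "1 * (cmod (zeta (Complex \<sigma> t)))\<^sup>2 \<le> 2 * pi * (cmod (zeta (Complex \<sigma> t)))\<^sup>2"
      using pi_gt3 by (intro mult_right_mono) auto
    also have "\<dots> \<le> (Z\<^sup>2 * E) * (X * B) + (E / \<delta>) * (X powr (1/2 - \<sigma>) * A) + (\<sigma> + 1/2) * (2 * (K\<^sup>2 * E)) * m"
      using fin unfolding Mm by (simp add: mult_ac)
    also have "\<dots> \<le> C * (X * B) + C * (X powr (1/2 - \<sigma>) * A) + C * m"
      using parts AB X m by (intro add_mono mult_right_mono) (auto simp: C_def)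
    finally show "(cmod (zeta (Complex \<sigma> t)))\<^sup>2 \<le> C * (X powr (1/2 - \<sigma>) * integral {t - h..t + h} (\<lambda>v. zeta_sq v * exp (- (v - t)\<^sup>2)) +
            X * integral {t - h..t + h} (\<lambda>v. exp (- (v - t)\<^sup>2)) + X * (t + h + \<sigma> + 1)\<^sup>2 * exp (- h\<^sup>2))"
      unfolding A_def[symmetric] B_def[symmetric] m_def[symmetric] by (simp add: distrib_left)
  qed
qed

lemma nn_integral_gaussian:
  "(\<integral>\<^sup>+t. ennreal (exp (- (v - t)\<^sup>2)) \<partial>lborel) = ennreal (sqrt pi)" for v :: real
proof -
  have "exp (- (v - t)\<^sup>2) = sqrt pi * normal_density v (1 / sqrt 2) t" for t
    by (simp add: normal_density_def power2_commute power_divide)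
  then have "(\<integral>\<^sup>+t. ennreal (exp (- (v - t)\<^sup>2)) \<partial>lborel) = (\<integral>\<^sup>+t. ennreal (sqrt pi * normal_density v (1 / sqrt 2) t) \<partial>lborel)"
    by (simp only:)
  also have "\<dots> = ennreal (LINT t|lborel. sqrt pi * normal_density v (1 / sqrt 2) t)"
    by (rule nn_integral_eq_integral) auto
  finally show ?thesis by simp
qed

text \<open>After integration over \<open>t\<close> the Gaussian kernel contributes its mass
  \<open>sqrt pi\<close>. The parameter \<open>X\<close> stays free, to balance the two vertical
  sides against each other later.\<close>

lemma zeta_line_mean_bound:
  fixes \<sigma> :: real
  assumes \<sigma>: "\<sigma> > 1/2"
  obtains C where "C > 0"
    "\<And>X T T' h. \<lbrakk>X \<ge> 1; h \<ge> 1; h + 1 \<le> T; T \<le> T'\<rbrakk> \<Longrightarrow>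
       integral {T..T'} (\<lambda>t. (cmod (zeta (Complex \<sigma> t)))\<^sup>2) \<le>
       C * (X powr (1/2 - \<sigma>) * sqrt pi * integral {T - h..T' + h} zeta_sq +
            (T' - T) * (X * sqrt pi + X * (T' + h + \<sigma> + 1)\<^sup>2 * exp (- h\<^sup>2)))"
proof -
  obtain C where C: "C > 0" and pt: "\<And>X t h. \<lbrakk>X \<ge> 1; h \<ge> 1; h + 1 \<le> t\<rbrakk> \<Longrightarrow> (cmod (zeta (Complex \<sigma> t)))\<^sup>2 \<le>
       C * (X powr (1/2 - \<sigma>) * integral {t - h..t + h} (\<lambda>v. zeta_sq v * exp (- (v - t)\<^sup>2)) +
            X * integral {t - h..t + h} (\<lambda>v. exp (- (v - t)\<^sup>2)) + X * (t + h + \<sigma> + 1)\<^sup>2 * exp (- h\<^sup>2))"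
    using zeta_line_pointwise[OF \<sigma>] by blast
  show ?thesis
  proof (rule that[OF C])
    fix X T T' h :: real
    assume X: "X \<ge> 1" and h: "h \<ge> 1" "h + 1 \<le> T" "T \<le> T'"
    \<comment> \<open>Extending the inner integral to one fixed interval decouples its range from
      \<open>t\<close>, so that Tonelli yields the full mass of the Gaussian.\<close>
    define z where "z = (\<lambda>v. indicator {T - h..T' + h} v * zeta_sq v)"
    have znn: "z v \<ge> 0" for v by (simp add: z_def zeta_sq_nonneg)
    have [measurable]: "z \<in> borel_measurable borel"
      using borel_measurable_continuous_on_indicator[OF _ continuous_on_zeta_sq, of "{T - h..T' + h}"] by (simp add: z_def)
    define W where "W = (\<lambda>t. \<integral>\<^sup>+v. ennreal (z v * exp (- (v - t)\<^sup>2)) \<partial>lborel)"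
    define c1 where "c1 = X * sqrt pi + X * (T' + h + \<sigma> + 1)\<^sup>2 * exp (- h\<^sup>2)"
    define Xd where "Xd = X powr (1/2 - \<sigma>)"
    have nn: "c1 \<ge> 0" "Xd \<ge> 0" using X by (simp_all add: c1_def Xd_def)
    have cz: "continuous_on {T..T'} (\<lambda>t. (cmod (zeta (Complex \<sigma> t)))\<^sup>2)"
      by (intro continuous_intros continuous_on_zeta_line) (use h in \<open>auto simp: complex_eq_iff\<close>)
    have W: "W \<in> borel_measurable lborel"
      unfolding W_def by measurable
    have step: "ennreal (indicator {T..T'} t * (cmod (zeta (Complex \<sigma> t)))\<^sup>2) \<le>
                ennreal (C * Xd) * W t + ennreal (C * c1) * indicator {T..T'} t" for t
    proof (cases "t \<in> {T..T'}")
      case True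
      define A where "A = integral {t - h..t + h} (\<lambda>v. zeta_sq v * exp (- (v - t)\<^sup>2))"
      define B where "B = integral {t - h..t + h} (\<lambda>v. exp (- (v - t)\<^sup>2))"
      have A0: "A \<ge> 0" unfolding A_def
        by (intro integral_nonneg integrable_continuous_interval continuous_intros continuous_on_zeta_sq)
           (simp add: zeta_sq_nonneg)
      have "ennreal A = (\<integral>\<^sup>+v. ennreal (indicator {t - h..t + h} v * (zeta_sq v * exp (- (v - t)\<^sup>2))) \<partial>lborel)"
        unfolding A_def
        by (rule nn_integral_continuous_Icc[symmetric])
           (auto intro!: continuous_intros continuous_on_zeta_sq simp: zeta_sq_nonneg)
      also have "\<dots> \<le> W t"
        unfolding W_def
        by (intro nn_integral_mono ennreal_leI) (use True in \<open>auto simp: z_def indicator_def zeta_sq_nonneg\<close>)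
      finally have A: "ennreal A \<le> W t" .
      have "ennreal B = (\<integral>\<^sup>+v. ennreal (indicator {t - h..t + h} v * exp (- (v - t)\<^sup>2)) \<partial>lborel)"
        unfolding B_def by (rule nn_integral_continuous_Icc[symmetric]) (auto intro!: continuous_intros)
      also have "\<dots> \<le> (\<integral>\<^sup>+v. ennreal (exp (- (t - v)\<^sup>2)) \<partial>lborel)"
        by (intro nn_integral_mono ennreal_leI) (auto simp: indicator_def power2_commute)
      finally have B: "B \<le> sqrt pi"
        unfolding nn_integral_gaussian by (simp add: ennreal_le_iff)
      have "X * (t + h + \<sigma> + 1)\<^sup>2 * exp (- h\<^sup>2) \<le> X * (T' + h + \<sigma> + 1)\<^sup>2 * exp (- h\<^sup>2)"
        using True h X \<sigma> by (intro mult_right_mono mult_left_mono power_mono) auto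
      moreover have "X * B \<le> X * sqrt pi" using B X by (intro mult_left_mono) auto
      ultimately have le: "Xd * A + X * B + X * (t + h + \<sigma> + 1)\<^sup>2 * exp (- h\<^sup>2) \<le> Xd * A + c1"
        unfolding c1_def by linarith
      have "(cmod (zeta (Complex \<sigma> t)))\<^sup>2 \<le> C * (Xd * A + X * B + X * (t + h + \<sigma> + 1)\<^sup>2 * exp (- h\<^sup>2))"
        unfolding A_def B_def Xd_def by (rule pt) (use X h True in auto)
      also have "\<dots> \<le> C * (Xd * A + c1)"
        using C le by (intro mult_left_mono) auto
      finally have "ennreal ((cmod (zeta (Complex \<sigma> t)))\<^sup>2) \<le> ennreal (C * Xd * A + C * c1)"
        by (intro ennreal_leI) (simp add: distrib_left mult.assoc)
      also have "\<dots> = ennreal (C * Xd) * ennreal A + ennreal (C * c1)"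
        using C nn A0 by (simp add: ennreal_plus ennreal_mult)
      also have "\<dots> \<le> ennreal (C * Xd) * W t + ennreal (C * c1)"
        by (intro add_right_mono mult_left_mono A) simp
      finally show ?thesis using True by simp
    qed simp
    have Wint: "(\<integral>\<^sup>+t. W t \<partial>lborel) = ennreal (sqrt pi * integral {T - h..T' + h} zeta_sq)"
    proof -
      have "(\<integral>\<^sup>+t. W t \<partial>lborel) = (\<integral>\<^sup>+v. \<integral>\<^sup>+t. ennreal (z v * exp (- (v - t)\<^sup>2)) \<partial>lborel \<partial>lborel)"
        unfolding W_def by (rule lborel_pair.Fubini') measurable
      also have "\<dots> = (\<integral>\<^sup>+v. ennreal (sqrt pi) * ennreal (z v) \<partial>lborel)"
      proof (intro nn_integral_cong)
        fix v
        have "(\<integral>\<^sup>+t. ennreal (z v * exp (- (v - t)\<^sup>2)) \<partial>lborel) = (\<integral>\<^sup>+t. ennreal (z v) * ennreal (exp (- (v - t)\<^sup>2)) \<partial>lborel)"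
          using znn by (simp add: ennreal_mult)
        also have "\<dots> = ennreal (z v) * (\<integral>\<^sup>+t. ennreal (exp (- (v - t)\<^sup>2)) \<partial>lborel)"
          by (rule nn_integral_cmult) measurable
        finally show "(\<integral>\<^sup>+t. ennreal (z v * exp (- (v - t)\<^sup>2)) \<partial>lborel) = ennreal (sqrt pi) * ennreal (z v)"
          unfolding nn_integral_gaussian by (simp only: mult.commute)
      qed
      also have "\<dots> = ennreal (sqrt pi) * (\<integral>\<^sup>+v. ennreal (z v) \<partial>lborel)"
        by (rule nn_integral_cmult) measurable
      also have "(\<integral>\<^sup>+v. ennreal (z v) \<partial>lborel) = ennreal (integral {T - h..T' + h} zeta_sq)"
        unfolding z_def by (rule nn_integral_continuous_Icc[OF continuous_on_zeta_sq zeta_sq_nonneg])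
      also have "ennreal (sqrt pi) * \<dots> = ennreal (sqrt pi * integral {T - h..T' + h} zeta_sq)"
        by (simp add: ennreal_mult')
      finally show ?thesis .
    qed
    have I0: "integral {T - h..T' + h} zeta_sq \<ge> 0"
      by (intro integral_nonneg integrable_continuous_interval continuous_on_zeta_sq zeta_sq_nonneg)
    have "ennreal (integral {T..T'} (\<lambda>t. (cmod (zeta (Complex \<sigma> t)))\<^sup>2)) =
        (\<integral>\<^sup>+t. ennreal (indicator {T..T'} t * (cmod (zeta (Complex \<sigma> t)))\<^sup>2) \<partial>lborel)"
      by (rule nn_integral_continuous_Icc[symmetric, OF cz]) auto
    also have "\<dots> \<le> (\<integral>\<^sup>+t. ennreal (C * Xd) * W t + ennreal (C * c1) * indicator {T..T'} t \<partial>lborel)"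
      by (intro nn_integral_mono step)
    also have "\<dots> = (\<integral>\<^sup>+t. ennreal (C * Xd) * W t \<partial>lborel) + (\<integral>\<^sup>+t. ennreal (C * c1) * indicator {T..T'} t \<partial>lborel)"
      using W by (intro nn_integral_add) auto
    also have "(\<integral>\<^sup>+t. ennreal (C * Xd) * W t \<partial>lborel) = ennreal (C * Xd) * ennreal (sqrt pi * integral {T - h..T' + h} zeta_sq)"
      unfolding Wint[symmetric] by (rule nn_integral_cmult[OF W])
    also have "(\<integral>\<^sup>+t. ennreal (C * c1) * indicator {T..T'} t \<partial>lborel) = ennreal (C * c1) * ennreal (T' - T)"
      using h by (subst nn_integral_cmult_indicator) auto
    also have "ennreal (C * Xd) * ennreal (sqrt pi * integral {T - h..T' + h} zeta_sq) + ennreal (C * c1) * ennreal (T' - T) =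
        ennreal (C * Xd * (sqrt pi * integral {T - h..T' + h} zeta_sq) + C * c1 * (T' - T))"
      using C nn I0 h by (simp add: ennreal_plus ennreal_mult[symmetric])
    finally have "integral {T..T'} (\<lambda>t. (cmod (zeta (Complex \<sigma> t)))\<^sup>2) \<le> C * Xd * (sqrt pi * integral {T - h..T' + h} zeta_sq) + C * c1 * (T' - T)"
      using C nn I0 h by (subst (asm) ennreal_le_iff) auto
    then show "integral {T..T'} (\<lambda>t. (cmod (zeta (Complex \<sigma> t)))\<^sup>2) \<le>
       C * (X powr (1/2 - \<sigma>) * sqrt pi * integral {T - h..T' + h} zeta_sq +
            (T' - T) * (X * sqrt pi + X * (T' + h + \<sigma> + 1)\<^sup>2 * exp (- h\<^sup>2)))"
      unfolding c1_def[symmetric] Xd_def[symmetric] by (simp add: distrib_left mult_ac)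
  qed
qed

section \<open>Windows whose length is small against their position\<close>

lemma log_primitive_diff_le:
  assumes "7 \<le> a" "a \<le> b"
  shows "log_primitive b - log_primitive a \<le> (b - a) * (4 * b powr (1/2))"
proof (cases "a = b")
  case False
  then obtain x where x: "a < x" "x < b" "log_primitive b - log_primitive a = (b - a) * log_density x"
    using MVT2[of a b log_primitive log_density] log_primitive_deriv assms by force
  have "log_density x \<le> 4 * x powr (1/2)" using log_density_bounds[of x] assms x by simp
  also have "\<dots> \<le> 4 * b powr (1/2)" using x assms by (intro mult_left_mono powr_mono2) auto
  finally show ?thesis using x assms by (simp add: mult_left_mono)
qed simp

text \<open>The window has length \<open>o(Y)\<close> and carries critical-line mass
  \<open>O(Y)\<close>. First \<open>X\<close> is fixed so large that
  \<open>X powr (1/2 - \<sigma>)\<close> reduces this mass to a small multiple of \<open>Y\<close>;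
  then \<open>Y\<close> grows, and the term \<open>X * (J Y - Y)\<close> becomes
  \<open>o(Y)\<close>. With \<open>h = sqrt Y\<close> the horizontal sides contribute
  \<open>exp (- Y)\<close> against polynomials.\<close>

lemma zeta_line_mean_small:
  fixes \<sigma> \<kappa> :: real and J :: "real \<Rightarrow> real"
  assumes \<sigma>: "\<sigma> > 1/2"
    and ge: "eventually (\<lambda>Y. Y \<le> J Y) at_top" and lim: "((\<lambda>Y. J Y / Y) \<longlongrightarrow> 1) at_top"
    and I: "((\<lambda>Y. integral {Y..J Y} zeta_sq / Y) \<longlongrightarrow> \<kappa>) at_top"
  shows "((\<lambda>Y. integral {Y..J Y} (\<lambda>t. (cmod (zeta (Complex \<sigma> t)))\<^sup>2) / Y) \<longlongrightarrow> 0) at_top"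
proof -
  obtain C where C: "C > 0" and mb: "\<And>X T T' h. \<lbrakk>X \<ge> 1; h \<ge> 1; h + 1 \<le> T; T \<le> T'\<rbrakk> \<Longrightarrow>
       integral {T..T'} (\<lambda>t. (cmod (zeta (Complex \<sigma> t)))\<^sup>2) \<le>
       C * (X powr (1/2 - \<sigma>) * sqrt pi * integral {T - h..T' + h} zeta_sq +
            (T' - T) * (X * sqrt pi + X * (T' + h + \<sigma> + 1)\<^sup>2 * exp (- h\<^sup>2)))"
    using zeta_line_mean_bound[OF \<sigma>] by blast
  \<comment> \<open>\<open>\<kappa> + 1\<close> for the window itself and 14 for each of its two
    margins of width \<open>sqrt Y\<close>.\<close>
  define K where "K = 29 + \<kappa>"
  have int: "zeta_sq integrable_on {a..b}" for a b
    by (intro integrable_continuous_interval continuous_on_zeta_sq)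
  obtain T1 where T1: "T1 \<ge> 7" "\<And>T. T \<ge> T1 \<Longrightarrow> \<bar>integral {0..T} zeta_sq - log_primitive T\<bar> \<le> T"
  proof -
    have "eventually (\<lambda>T. \<bar>(integral {0..T} zeta_sq - log_primitive T) / T\<bar> < 1) at_top"
      using tendstoD[OF zeta_sq_mean, of 1] by simp
    then have "eventually (\<lambda>T. T \<ge> 7 \<and> \<bar>integral {0..T} zeta_sq - log_primitive T\<bar> \<le> T) at_top"
      using eventually_ge_at_top[of "7::real"] by eventually_elim (auto simp: abs_divide field_simps)
    then obtain N where "\<And>T. T \<ge> N \<Longrightarrow> T \<ge> 7 \<and> \<bar>integral {0..T} zeta_sq - log_primitive T\<bar> \<le> T"
      unfolding eventually_at_top_linorder by blast
    then show ?thesis by (intro that[of "max N 7"]) auto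
  qed
  \<comment> \<open>\<open>14\<close> is made of 8 from \<open>log_primitive\<close> and at most 3
    for the error at each of the two end points.\<close>
  have short: "integral {a..b} zeta_sq \<le> 14 * Y"
    if "T1 \<le> a" "a \<le> b" "b \<le> 3 * Y" "b - a \<le> sqrt Y" for a b Y
  proof -
    have Y: "Y > 0" using that T1 by simp
    have "integral {0..a} zeta_sq + integral {a..b} zeta_sq = integral {0..b} zeta_sq"
      by (rule Henstock_Kurzweil_Integration.integral_combine) (use that T1 int in auto)
    moreover have "\<bar>integral {0..a} zeta_sq - log_primitive a\<bar> \<le> a" "\<bar>integral {0..b} zeta_sq - log_primitive b\<bar> \<le> b"
      using T1(2) that by auto
    moreover have "log_primitive b - log_primitive a \<le> 8 * Y"
    proof -
      have "b powr (1/2) = sqrt b" using that T1 by (simp add: powr_half_sqrt)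
      also have "\<dots> \<le> sqrt (4 * Y)" using that Y by (intro real_sqrt_le_mono) auto
      also have "\<dots> = 2 * sqrt Y" by (simp add: real_sqrt_mult)
      finally have "(b - a) * (4 * b powr (1/2)) \<le> sqrt Y * (4 * (2 * sqrt Y))"
        using that Y by (intro mult_mono) auto
      also have "\<dots> = 8 * Y" using Y by simp
      finally show ?thesis using log_primitive_diff_le[of a b] that T1 by simp
    qed
    ultimately show ?thesis using that by linarith
  qed
  have wide: "eventually (\<lambda>Y. integral {Y - sqrt Y..J Y + sqrt Y} zeta_sq \<le> K * Y) at_top"
  proof -
    have "eventually (\<lambda>Y. J Y / Y < 2) at_top" "eventually (\<lambda>Y. integral {Y..J Y} zeta_sq / Y < \<kappa> + 1) at_top"
      using lim I by (auto intro: order_tendstoD)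
    moreover have "eventually (\<lambda>Y. T1 \<le> Y - sqrt Y) at_top" "eventually (\<lambda>Y::real. sqrt Y \<le> Y) at_top"
      by real_asymp+
    ultimately show ?thesis using ge eventually_gt_at_top[of "0::real"]
    proof eventually_elim
      case (elim Y)
      have J: "J Y \<le> 2 * Y" "integral {Y..J Y} zeta_sq \<le> (\<kappa> + 1) * Y"
        using elim by (auto simp: divide_less_eq)
      have s: "0 \<le> sqrt Y" using elim by simp
      have YJ: "Y \<le> J Y + sqrt Y" "T1 \<le> J Y" "J Y + sqrt Y \<le> 3 * Y" using elim(3-5) s J by linarith+
      have "integral {Y - sqrt Y..Y} zeta_sq + integral {Y..J Y + sqrt Y} zeta_sq = integral {Y - sqrt Y..J Y + sqrt Y} zeta_sq"
        by (rule Henstock_Kurzweil_Integration.integral_combine) (use elim s int YJ in auto)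
      moreover have "integral {Y..J Y} zeta_sq + integral {J Y..J Y + sqrt Y} zeta_sq = integral {Y..J Y + sqrt Y} zeta_sq"
        by (rule Henstock_Kurzweil_Integration.integral_combine) (use elim s int YJ in auto)
      moreover have "integral {Y - sqrt Y..Y} zeta_sq \<le> 14 * Y" by (rule short) (use elim s in auto)
      moreover have "integral {J Y..J Y + sqrt Y} zeta_sq \<le> 14 * Y" by (rule short) (use elim s J YJ in auto)
      ultimately show ?case using J unfolding K_def by (simp add: distrib_right)
    qed
  qed
  show ?thesis
  proof (rule order_tendstoI)
    fix a :: real assume "a < 0"
    then show "eventually (\<lambda>Y. a < integral {Y..J Y} (\<lambda>t. (cmod (zeta (Complex \<sigma> t)))\<^sup>2) / Y) at_top"
    proof (intro eventually_mono[OF eventually_gt_at_top[of "0::real"]])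
      fix Y :: real assume Y: "0 < Y"
      have "0 \<le> integral {Y..J Y} (\<lambda>t. (cmod (zeta (Complex \<sigma> t)))\<^sup>2)"
        by (intro integral_nonneg integrable_continuous_interval continuous_intros continuous_on_zeta_line)
           (use Y in \<open>auto simp: complex_eq_iff\<close>)
      then have "0 \<le> integral {Y..J Y} (\<lambda>t. (cmod (zeta (Complex \<sigma> t)))\<^sup>2) / Y" using Y by simp
      then show "a < integral {Y..J Y} (\<lambda>t. (cmod (zeta (Complex \<sigma> t)))\<^sup>2) / Y" using \<open>a < 0\<close> by linarith
    qed
  next
    fix a :: real assume a: "0 < a"
    \<comment> \<open>\<open>X\<close> is chosen before \<open>Y\<close>, depending only on
      \<open>a\<close>; half of \<open>a\<close> is kept for the term with the length of the
      window.\<close>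
    have "((\<lambda>X. C * (X powr (1/2 - \<sigma>) * sqrt pi * K)) \<longlongrightarrow> C * (0 * sqrt pi * K)) at_top"
      using \<sigma> by (intro tendsto_intros tendsto_neg_powr filterlim_ident) auto
    then have "eventually (\<lambda>X. C * (X powr (1/2 - \<sigma>) * sqrt pi * K) < a / 2 \<and> X \<ge> 1) at_top"
      using a by (intro eventually_conj eventually_ge_at_top order_tendstoD(2)) auto
    then obtain X where X: "C * (X powr (1/2 - \<sigma>) * sqrt pi * K) < a / 2" "X \<ge> 1"
      unfolding eventually_at_top_linorder by blast
    have "((\<lambda>Y. C * ((J Y / Y - 1) * (X * sqrt pi + X * (3 * Y + \<sigma> + 1)\<^sup>2 * exp (- Y)))) \<longlongrightarrow> C * ((1 - 1) * (X * sqrt pi))) at_top"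
    proof (intro tendsto_intros lim)
      show "((\<lambda>Y. X * sqrt pi + X * (3 * Y + \<sigma> + 1)\<^sup>2 * exp (- Y)) \<longlongrightarrow> X * sqrt pi) at_top"
        by real_asymp (simp add: sqrt_def)
    qed
    then have "eventually (\<lambda>Y. C * ((J Y / Y - 1) * (X * sqrt pi + X * (3 * Y + \<sigma> + 1)\<^sup>2 * exp (- Y))) < a / 2) at_top"
      using a by (intro order_tendstoD(2)) auto
    moreover have "eventually (\<lambda>Y. J Y / Y < 2) at_top"
      using lim by (auto intro: order_tendstoD)
    moreover have "eventually (\<lambda>Y::real. sqrt Y + 1 \<le> Y) at_top" by real_asymp
    ultimately show "eventually (\<lambda>Y. integral {Y..J Y} (\<lambda>t. (cmod (zeta (Complex \<sigma> t)))\<^sup>2) / Y < a) at_top"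
      using ge wide eventually_ge_at_top[of "1::real"]
    proof eventually_elim
      case (elim Y)
      have J: "J Y \<le> 2 * Y" using elim by (auto simp: divide_less_eq)
      have s: "1 \<le> sqrt Y" using elim by simp
      define c where "c = X * sqrt pi + X * (3 * Y + \<sigma> + 1)\<^sup>2 * exp (- Y)"
      have cle: "X * sqrt pi + X * (J Y + sqrt Y + \<sigma> + 1)\<^sup>2 * exp (- (sqrt Y)\<^sup>2) \<le> c"
      proof -
        have "(J Y + sqrt Y + \<sigma> + 1)\<^sup>2 \<le> (3 * Y + \<sigma> + 1)\<^sup>2"
          using J elim s \<sigma> by (intro power_mono) auto
        then have "X * (J Y + sqrt Y + \<sigma> + 1)\<^sup>2 * exp (- Y) \<le> X * (3 * Y + \<sigma> + 1)\<^sup>2 * exp (- Y)"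
          using X by (intro mult_right_mono mult_left_mono) auto
        moreover have "(sqrt Y)\<^sup>2 = Y" using elim by simp
        ultimately show ?thesis by (simp add: c_def)
      qed
      have "integral {Y..J Y} (\<lambda>t. (cmod (zeta (Complex \<sigma> t)))\<^sup>2) \<le>
         C * (X powr (1/2 - \<sigma>) * sqrt pi * integral {Y - sqrt Y..J Y + sqrt Y} zeta_sq +
            (J Y - Y) * (X * sqrt pi + X * (J Y + sqrt Y + \<sigma> + 1)\<^sup>2 * exp (- (sqrt Y)\<^sup>2)))"
        by (rule mb) (use X s elim in auto)
      also have "\<dots> \<le> C * (X powr (1/2 - \<sigma>) * sqrt pi * (K * Y) + (J Y - Y) * c)"
        using C elim cle by (intro mult_left_mono add_mono) auto
      finally have "integral {Y..J Y} (\<lambda>t. (cmod (zeta (Complex \<sigma> t)))\<^sup>2) / Y \<le>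
         C * (X powr (1/2 - \<sigma>) * sqrt pi * (K * Y) + (J Y - Y) * c) / Y"
        using elim by (intro divide_right_mono) auto
      also have "\<dots> = C * (X powr (1/2 - \<sigma>) * sqrt pi * K) + C * ((J Y / Y - 1) * c)"
        using elim by (simp add: field_simps)
      also have "\<dots> < a" using X(1) elim(1) unfolding c_def by linarith
      finally show ?case .
    qed
  qed
qed

section \<open>Jacob's ladders\<close>

lemma set_integrable_laplace_of_real:
  fixes g :: "real \<Rightarrow> real" and x :: real
  assumes "set_integrable lborel A (\<lambda>t. of_real (g t) * exp (- of_real x * of_real t) :: complex)"
  shows "set_integrable lborel A (\<lambda>t. g t * exp (- x * t))"
proof -
  have "Re (indicator A t *\<^sub>R (of_real (g t) * exp (- of_real x * of_real t))) = indicator A t *\<^sub>R (g t * exp (- x * t))" for t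
  proof -
    have "exp (- of_real x * of_real t) = complex_of_real (exp (- x * t))"
      by (simp flip: exp_of_real)
    then show ?thesis by simp
  qed
  then show ?thesis
    using integrable_Re[OF assms[unfolded set_integrable_def]] unfolding set_integrable_def by (simp only:)
qed

lemma LINT_exp_neg_Ici:
  fixes x :: real
  assumes x: "x > 0"
  shows "set_integrable lborel {c..} (\<lambda>t. exp (- x * t))"
    and "(LINT t:{c..}|lborel. exp (- x * t)) = exp (- x * c) / x"
proof -
  have i: "set_integrable lborel {c..} (\<lambda>t. of_real x * exp (- of_real x * of_real t) :: complex)"
    using LINT_exp_Ici(1)[of "of_real x" c] x by simp
  have "set_integrable lborel {c..} (\<lambda>t. inverse x * (x * exp (- x * t)))"
    by (intro set_integrable_mult_right set_integrable_laplace_of_real[OF i])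
  then show "set_integrable lborel {c..} (\<lambda>t. exp (- x * t))"
    using x by (simp only: mult.assoc[symmetric]) simp
  have "complex_of_real (LINT t:{c..}|lborel. x * exp (- x * t)) = exp (- of_real x * of_real c)"
    unfolding LINT_laplace_of_real[symmetric] using LINT_exp_Ici(2)[of "of_real x" c] x by simp
  also have "\<dots> = of_real (exp (- x * c))" by (simp flip: exp_of_real)
  finally have "x * (LINT t:{c..}|lborel. exp (- x * t)) = exp (- x * c)"
    by (simp only: of_real_eq_iff set_integral_mult_right)
  then show "(LINT t:{c..}|lborel. exp (- x * t)) = exp (- x * c) / x"
    using x by (simp add: field_simps)
qed

text \<open>
  Used for both signs of \<open>s\<close>: as \<open>s\<close> tends to \<open>0\<close>, the two resulting bounds squeeze the mean of
  $\ln (t / Y)$ to the derivative of the Gamma function at \<open>1\<close>.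
\<close>

lemma ln_laplace_bound:
  fixes Y s :: real
  assumes Y: "Y > 0" and s: "s > -1"
    and i: "set_integrable lborel {7..} (\<lambda>t. ln (t / Y) * exp (- (1 / Y) * t))"
  shows "s * (LINT t:{7..}|lborel. ln (t / Y) * exp (- (1 / Y) * t)) \<le> Y * (Gamma (1 + s) - exp (- 7 / Y))"
proof -
  define F where "F = (\<lambda>t::real. t powr s * exp (- (1 / Y) * t))"
  have e: "exp (- of_real (1 / Y) * of_real t) = complex_of_real (exp (- (1 / Y) * t))" for t
    by (simp flip: exp_of_real)
  have meas: "set_borel_measurable lborel {7..} (\<lambda>t. of_real (t powr s) * exp (- of_real (1 / Y) * of_real t) :: complex)"
    by (intro set_borel_measurable_continuous continuous_intros) auto
  have nb: "norm (of_real (t powr s) * exp (- of_real (1 / Y) * of_real t) :: complex) \<le> 1 * (t powr s * exp (- (1 / Y) * t))" if "t \<ge> 7" for t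
    unfolding e by (simp add: norm_mult)
  note L = LINT_powr_exp_bound[OF s _ _ meas nb, simplified]
  have iF: "set_integrable lborel {7..} F"
    unfolding F_def using Y by (intro set_integrable_laplace_of_real) (use L(1) in simp)
  have "norm (complex_of_real (LINT t:{7..}|lborel. F t)) \<le> Gamma (s + 1) * (1 / Y) powr (- s - 1)"
    unfolding F_def LINT_laplace_of_real[symmetric] using L(2) Y by simp
  then have F: "(LINT t:{7..}|lborel. F t) \<le> Gamma (s + 1) * (1 / Y) powr (- s - 1)" by simp
  have ex: "set_integrable lborel {7..} (\<lambda>t. exp (- (1 / Y) * t))"
    by (rule LINT_exp_neg_Ici(1)) (use Y in simp)
  have "s * (LINT t:{7..}|lborel. ln (t / Y) * exp (- (1 / Y) * t)) = (LINT t:{7..}|lborel. s * (ln (t / Y) * exp (- (1 / Y) * t)))"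
    by (rule set_integral_mult_right[symmetric])
  also have "\<dots> \<le> (LINT t:{7..}|lborel. Y powr (- s) * F t - exp (- (1 / Y) * t))"
  proof (rule set_integral_mono)
    show "set_integrable lborel {7..} (\<lambda>t. s * (ln (t / Y) * exp (- (1 / Y) * t)))"
      using i by (rule set_integrable_mult_right)
    show "set_integrable lborel {7..} (\<lambda>t. Y powr (- s) * F t - exp (- (1 / Y) * t))"
      by (rule set_integral_diff(1)[OF set_integrable_mult_right[OF iF] ex])
    fix t :: real assume "t \<in> {7..}"
    then have t: "t > 0" by simp
    have "1 + s * ln (t / Y) \<le> exp (s * ln (t / Y))" by (rule exp_ge_add_one_self)
    also have "\<dots> = (t / Y) powr s" using t Y by (simp add: powr_def)
    also have "\<dots> = Y powr (- s) * t powr s"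
      using t Y by (simp add: powr_divide powr_minus field_simps)
    finally have "(s * ln (t / Y)) * exp (- (1 / Y) * t) \<le> (Y powr (- s) * t powr s - 1) * exp (- (1 / Y) * t)"
      by (intro mult_right_mono) auto
    then show "s * (ln (t / Y) * exp (- (1 / Y) * t)) \<le> Y powr (- s) * F t - exp (- (1 / Y) * t)"
      by (simp add: F_def left_diff_distrib mult.assoc)
  qed
  also have "\<dots> = Y powr (- s) * (LINT t:{7..}|lborel. F t) - (LINT t:{7..}|lborel. exp (- (1 / Y) * t))"
    using set_integral_diff(2)[OF set_integrable_mult_right[OF iF] ex] by (simp only: set_integral_mult_right)
  also have "(LINT t:{7..}|lborel. exp (- (1 / Y) * t)) = Y * exp (- 7 / Y)"
    using LINT_exp_neg_Ici(2)[of "1 / Y" 7] Y by simp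
  also have "Y powr (- s) * (LINT t:{7..}|lborel. F t) \<le> Y powr (- s) * (Gamma (s + 1) * (1 / Y) powr (- s - 1))"
    by (intro mult_left_mono F) simp
  also have "\<dots> = Gamma (s + 1) * (Y powr (- s) * Y powr (s + 1))"
    using Y by (simp add: powr_divide powr_minus powr_diff powr_add field_simps)
  also have "Y powr (- s) * Y powr (s + 1) = Y"
    using Y by (simp add: powr_add[symmetric])
  finally show ?thesis by (simp add: algebra_simps)
qed

text \<open>Write \<open>log_density t\<close> as \<open>ln (t / Y)\<close> plus a constant in
  \<open>t\<close>. The mean of \<open>ln (t / Y)\<close> under the exponential weight of mean
  \<open>Y\<close> tends to Gamma'(1) = - c, which lowers the constant \<open>2 * c\<close> to
  \<open>c\<close>.\<close>

lemma log_density_laplace_asymp: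
  "((\<lambda>Y. (LINT t:{7..}|lborel. log_density t * exp (- (1 / Y) * t)) / Y - ln Y) \<longlongrightarrow>
      euler_mascheroni - ln (2 * pi)) at_top"
proof -
  define c where "c = (euler_mascheroni :: real)"
  define H where "H = (\<lambda>Y::real. LINT t:{7..}|lborel. ln (t / Y) * exp (- (1 / Y) * t))"
  have ld: "set_integrable lborel {7..} (\<lambda>t. log_density t * exp (- (1 / Y) * t))" if "Y > 0" for Y
    by (intro set_integrable_laplace_of_real log_density_laplace(1)) (use that in simp)
  have ex: "set_integrable lborel {7..} (\<lambda>t. (ln Y - ln (2 * pi) + 2 * c) * exp (- (1 / Y) * t))" if "Y > 0" for Y
    by (intro set_integrable_mult_right LINT_exp_neg_Ici(1)) (use that in simp)
  have split: "indicator {7..} t *\<^sub>R (ln (t / Y) * exp (- (1 / Y) * t)) =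
      indicator {7..} t *\<^sub>R (log_density t * exp (- (1 / Y) * t) - (ln Y - ln (2 * pi) + 2 * c) * exp (- (1 / Y) * t))"
    if "Y > 0" for t Y :: real
    using that by (auto simp: indicator_def log_density_def c_def ln_div algebra_simps)
  have iH: "set_integrable lborel {7..} (\<lambda>t. ln (t / Y) * exp (- (1 / Y) * t))" if "Y > 0" for Y :: real
    using set_integral_diff(1)[OF ld[OF that] ex[OF that]] unfolding set_integrable_def split[OF that] .
  have Heq: "(LINT t:{7..}|lborel. log_density t * exp (- (1 / Y) * t)) / Y - ln Y =
      H Y / Y + (exp (- 7 / Y) * (ln Y - ln (2 * pi) + 2 * c) - ln Y)" if "Y > 0" for Y
  proof -
    have "H Y = (LINT t:{7..}|lborel. log_density t * exp (- (1 / Y) * t)) -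
        (ln Y - ln (2 * pi) + 2 * c) * (LINT t:{7..}|lborel. exp (- (1 / Y) * t))"
      using set_integral_diff(2)[OF ld[OF that] ex[OF that]]
      unfolding H_def set_lebesgue_integral_def split[OF that]
      by (simp only: set_integral_mult_right[unfolded set_lebesgue_integral_def])
    also have "(LINT t:{7..}|lborel. exp (- (1 / Y) * t)) = Y * exp (- 7 / Y)"
      using LINT_exp_neg_Ici(2)[of "1 / Y" 7] that by simp
    finally show ?thesis using that by (simp add: field_simps)
  qed
  \<comment> \<open>The derivative of \<open>Gamma\<close> at 1 as a difference quotient;
    \<open>Digamma 1\<close> is \<open>- euler_mascheroni\<close>.\<close>
  have der: "((\<lambda>s. (Gamma (1 + s) - 1) / s) \<longlongrightarrow> - c) (at 0)"
  proof -
    have "(Gamma has_real_derivative Gamma 1 * Digamma 1) (at (1::real))"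
      by (rule has_field_derivative_Gamma) auto
    then show ?thesis by (simp add: DERIV_def c_def)
  qed
  have lim: "((\<lambda>Y. (Gamma (1 + s) - exp (- 7 / Y)) / s) \<longlongrightarrow> (Gamma (1 + s) - 1) / s) at_top" for s :: real
  proof (cases "s = 0")
    case False
    have "((\<lambda>Y::real. exp (- 7 / Y)) \<longlongrightarrow> 1) at_top" by real_asymp
    then show ?thesis by (intro tendsto_divide tendsto_diff tendsto_const False)
  qed simp
  \<comment> \<open>\<open>s\<close> is fixed first, close to 0 on the side that fits the
    inequality: dividing \<open>ln_laplace_bound\<close> by a negative \<open>s\<close> gives a
    lower bound, by a positive one an upper bound. Only then does \<open>Y\<close> grow.\<close>
  have H: "((\<lambda>Y. H Y / Y) \<longlongrightarrow> - c) at_top"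
  proof (rule order_tendstoI)
    fix a :: real assume a: "a < - c"
    have "eventually (\<lambda>s. a < (Gamma (1 + s) - 1) / s) (at_left 0)"
      using order_tendstoD(1)[OF der a] by (simp add: eventually_at_split)
    moreover have "eventually (\<lambda>s::real. s < 0) (at_left 0)" by (simp add: eventually_at_filter)
    moreover have "eventually (\<lambda>s::real. s > -1) (at_left 0)"
      by (rule eventually_at_leftI[of "-1"]) auto
    ultimately have "eventually (\<lambda>s. a < (Gamma (1 + s) - 1) / s \<and> s < 0 \<and> s > -1) (at_left 0)"
      by eventually_elim auto
    then obtain s where s: "a < (Gamma (1 + s) - 1) / s" "s < 0" "s > -1"
      using eventually_happens'[OF trivial_limit_at_left_real] by blast
    show "eventually (\<lambda>Y. a < H Y / Y) at_top"
      using order_tendstoD(1)[OF lim s(1)] eventually_gt_at_top[of "0::real"]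
    proof eventually_elim
      case (elim Y)
      have "s * H Y \<le> Y * (Gamma (1 + s) - exp (- 7 / Y))"
        unfolding H_def by (rule ln_laplace_bound[OF elim(2) s(3) iH[OF elim(2)]])
      then have "(Gamma (1 + s) - exp (- 7 / Y)) / s \<le> H Y / Y"
        using elim(2) s(2) by (simp add: field_simps)
      then show ?case using elim(1) by linarith
    qed
  next
    fix a :: real assume a: "- c < a"
    have "eventually (\<lambda>s. (Gamma (1 + s) - 1) / s < a) (at_right 0)"
      using order_tendstoD(2)[OF der a] by (simp add: eventually_at_split)
    moreover have "eventually (\<lambda>s::real. s > 0) (at_right 0)" by (simp add: eventually_at_filter)
    ultimately have "eventually (\<lambda>s. (Gamma (1 + s) - 1) / s < a \<and> s > 0) (at_right 0)"
      by eventually_elim auto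
    then obtain s where s: "(Gamma (1 + s) - 1) / s < a" "s > 0"
      using eventually_happens'[OF trivial_limit_at_right_real] by blast
    show "eventually (\<lambda>Y. H Y / Y < a) at_top"
      using order_tendstoD(2)[OF lim s(1)] eventually_gt_at_top[of "0::real"]
    proof eventually_elim
      case (elim Y)
      have "s * H Y \<le> Y * (Gamma (1 + s) - exp (- 7 / Y))"
        unfolding H_def by (rule ln_laplace_bound[OF elim(2) _ iH[OF elim(2)]]) (use s in simp)
      then have "H Y / Y \<le> (Gamma (1 + s) - exp (- 7 / Y)) / s"
        using elim(2) s(2) by (simp add: field_simps)
      then show ?case using elim(1) by linarith
    qed
  qed
  have R: "((\<lambda>Y. exp (- 7 / Y) * (ln Y - ln (2 * pi) + 2 * c) - ln Y) \<longlongrightarrow> 2 * c - ln (2 * pi)) at_top"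
    by real_asymp
  have "((\<lambda>Y. H Y / Y + (exp (- 7 / Y) * (ln Y - ln (2 * pi) + 2 * c) - ln Y)) \<longlongrightarrow> - c + (2 * c - ln (2 * pi))) at_top"
    by (rule tendsto_add[OF H R])
  then have "((\<lambda>Y. (LINT t:{7..}|lborel. log_density t * exp (- (1 / Y) * t)) / Y - ln Y) \<longlongrightarrow> - c + (2 * c - ln (2 * pi))) at_top"
    by (rule Lim_transform_eventually, intro eventually_mono[OF eventually_gt_at_top[of "0::real"]])
       (rule Heq[symmetric])
  then show ?thesis by (simp add: c_def)
qed

text \<open>\<open>14 * Y * ln (2 * Y)\<close> is the admissibility bound for \<open>\<mu>\<close>
  at \<open>2 * Y\<close>. Beyond it, half of the exponent already gives
  \<open>(2 * Y) powr (- 7)\<close>, and the other half leaves the transform at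
  \<open>1 / (2 * Y)\<close>, of size \<open>Y powr (3/2)\<close>; the cut-off is therefore
  invisible in the limit.\<close>

lemma zeta_sq_truncated_laplace_asymp:
  assumes m: "\<And>Y. Y \<ge> Y0 \<Longrightarrow> m Y \<ge> 14 * Y * ln (2 * Y)"
  shows "((\<lambda>Y. integral {0..m Y} (\<lambda>t. zeta_sq t * exp (- (1 / Y) * t)) / Y - ln Y) \<longlongrightarrow>
      euler_mascheroni - ln (2 * pi)) at_top"
proof -
  obtain C where C: "C > 0"
    and 1: "\<And>z :: complex. \<lbrakk>0 < Re z; Re z \<le> 1/3\<rbrakk> \<Longrightarrow>
       norm ((LINT t:{7..}|lborel. of_real (zeta_sq t) * exp (- z * of_real t)) -
             (LINT t:{7..}|lborel. of_real (log_density t) * exp (- z * of_real t))) \<le> C * ((norm z)\<^sup>2 * Re z powr (- 5/2))"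
    and 2: "\<And>x. \<lbrakk>0 < x; x \<le> 1/3\<rbrakk> \<Longrightarrow> (LINT t:{7..}|lborel. zeta_sq t * exp (- x * t)) \<le> C * x powr (- 3/2)"
    by (rule zeta_sq_laplace) blast
  define f where "f = (\<lambda>Y t. zeta_sq t * exp (- (1 / Y) * t))"
  define Lz where "Lz = (\<lambda>Y. LINT t:{7..}|lborel. f Y t)"
  define Ld where "Ld = (\<lambda>Y. LINT t:{7..}|lborel. log_density t * exp (- (1 / Y) * t))"
  define F where "F = (\<lambda>Y. integral {0..m Y} (f Y))"
  define I7 where "I7 = integral {0..7} zeta_sq"
  have fnn: "f Y t \<ge> 0" for Y t by (simp add: f_def zeta_sq_nonneg)
  have cf: "continuous_on A (f Y)" for A Y
    unfolding f_def by (intro continuous_intros continuous_on_zeta_sq)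
  have fi: "set_integrable lborel {7..} (f Y)" if "Y > 0" for Y
    unfolding f_def by (intro set_integrable_laplace_of_real zeta_sq_laplace_integrable) (use that in simp)
  \<comment> \<open>Contributions of \<open>{0..7}\<close>, of the comparison of transforms at
    \<open>x = 1 / Y\<close>, where \<open>x^2 * x powr (- 5/2) = sqrt Y\<close>, and of the tail
    that was cut off.\<close>
  define B where "B = (\<lambda>Y::real. I7 + C * sqrt Y + C * ((2 * Y) powr (- 7) * (2 * Y) powr (3/2)))"
  have B: "eventually (\<lambda>Y. \<bar>F Y / Y - Ld Y / Y\<bar> \<le> B Y / Y) at_top"
  proof -
    have "eventually (\<lambda>Y::real. 14 * Y * ln (2 * Y) \<ge> 7) at_top" by real_asymp
    then show ?thesis using eventually_ge_at_top[of Y0] eventually_ge_at_top[of "3::real"]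
    proof eventually_elim
      case (elim Y)
      have Y: "Y > 0" using elim by simp
      have m7: "7 \<le> m Y" using m[OF elim(2)] elim(1) by linarith
      have "integral {0..7} (f Y) + integral {7..m Y} (f Y) = F Y"
        unfolding F_def
        by (rule Henstock_Kurzweil_Integration.integral_combine) (use m7 cf in \<open>auto intro!: integrable_continuous_interval\<close>)
      moreover have "0 \<le> integral {0..7} (f Y)"
        by (intro integral_nonneg integrable_continuous_interval cf fnn)
      moreover have "integral {0..7} (f Y) \<le> I7"
        unfolding I7_def
      proof (intro integral_le integrable_continuous_interval cf continuous_on_zeta_sq)
        fix t :: real assume "t \<in> {0..7}"
        then have "exp (- (1 / Y) * t) \<le> 1" using Y by simp
        then show "f Y t \<le> zeta_sq t" unfolding f_def using zeta_sq_nonneg[of t] by (intro mult_left_le)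
      qed
      moreover have tail: "Lz Y - C * ((2 * Y) powr (- 7) * (2 * Y) powr (3/2)) \<le> integral {7..m Y} (f Y)" "integral {7..m Y} (f Y) \<le> Lz Y"
      proof -
        have i1: "set_integrable lborel {7..m Y} (f Y)"
          by (rule set_integrable_subset[OF fi[OF Y]]) auto
        have i2: "set_integrable lborel {m Y<..} (f Y)"
          by (rule set_integrable_subset[OF fi[OF Y]]) (use m7 in auto)
        have "Lz Y = (LINT t:{7..m Y} \<union> {m Y<..}|lborel. f Y t)"
          unfolding Lz_def using m7 by (intro arg_cong[where f = "\<lambda>S. LINT t:S|lborel. f Y t"]) auto
        also have "\<dots> = (LINT t:{7..m Y}|lborel. f Y t) + (LINT t:{m Y<..}|lborel. f Y t)"
          by (rule set_integral_Un) (use i1 i2 in auto)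
        also have "(LINT t:{7..m Y}|lborel. f Y t) = integral {7..m Y} (f Y)"
          by (rule set_borel_integral_eq_integral(2)[OF i1])
        finally have eq: "Lz Y = integral {7..m Y} (f Y) + (LINT t:{m Y<..}|lborel. f Y t)" .
        have "(LINT t:{m Y<..}|lborel. f Y t) \<ge> 0"
          unfolding set_lebesgue_integral_def using fnn by (intro integral_nonneg_AE) auto
        with eq show "integral {7..m Y} (f Y) \<le> Lz Y" by linarith
        have "(LINT t:{m Y<..}|lborel. f Y t) \<le> (LINT t:{7..}|lborel. (2 * Y) powr (- 7) * f (2 * Y) t)"
          unfolding set_lebesgue_integral_def
        proof (rule integral_mono)
          show "integrable lborel (\<lambda>t. indicator {m Y<..} t *\<^sub>R f Y t)" using i2 by (simp add: set_integrable_def)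
          show "integrable lborel (\<lambda>t. indicator {7..} t *\<^sub>R ((2 * Y) powr (- 7) * f (2 * Y) t))"
            using set_integrable_mult_right[OF fi[of "2 * Y"]] Y by (simp add: set_integrable_def)
          fix t
          show "indicator {m Y<..} t *\<^sub>R f Y t \<le> indicator {7..} t *\<^sub>R ((2 * Y) powr (- 7) * f (2 * Y) t)"
          proof (cases "m Y < t")
            case True
            have "14 * Y * ln (2 * Y) \<le> t" using m[OF elim(2)] True by simp
            then have "- (1 / (2 * Y)) * t \<le> - 7 * ln (2 * Y)" using Y by (simp add: field_simps)
            then have "exp (- (1 / (2 * Y)) * t) \<le> (2 * Y) powr (- 7)" using Y by (simp add: powr_def)
            then have "zeta_sq t * (exp (- (1 / (2 * Y)) * t) * exp (- (1 / (2 * Y)) * t)) \<le>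
                zeta_sq t * ((2 * Y) powr (- 7) * exp (- (1 / (2 * Y)) * t))"
              by (intro mult_left_mono mult_right_mono zeta_sq_nonneg) auto
            also have "exp (- (1 / (2 * Y)) * t) * exp (- (1 / (2 * Y)) * t) = exp (- (1 / Y) * t)"
              unfolding exp_add[symmetric] by (simp add: field_simps)
            finally show ?thesis using True m7 by (simp add: f_def mult_ac)
          qed (use fnn in simp)
        qed
        also have "\<dots> = (2 * Y) powr (- 7) * (LINT t:{7..}|lborel. f (2 * Y) t)"
          by (rule set_integral_mult_right)
        also have "\<dots> \<le> (2 * Y) powr (- 7) * (C * (2 * Y) powr (3/2))"
        proof (intro mult_left_mono)
          have "(LINT t:{7..}|lborel. f (2 * Y) t) \<le> C * (1 / (2 * Y)) powr (- 3/2)"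
            unfolding f_def by (rule 2) (use elim in auto)
          then show "(LINT t:{7..}|lborel. f (2 * Y) t) \<le> C * (2 * Y) powr (3/2)"
            using Y by (simp add: powr_divide powr_minus_divide)
        qed simp
        finally show "Lz Y - C * ((2 * Y) powr (- 7) * (2 * Y) powr (3/2)) \<le> integral {7..m Y} (f Y)"
          using eq by (simp add: mult_ac)
      qed
      moreover have "\<bar>Lz Y - Ld Y\<bar> \<le> C * sqrt Y"
      proof -
        have "norm (complex_of_real (Lz Y) - of_real (Ld Y)) \<le> C * ((norm (complex_of_real (1 / Y)))\<^sup>2 * Re (complex_of_real (1 / Y)) powr (- 5/2))"
          unfolding Lz_def Ld_def f_def LINT_laplace_of_real[symmetric] by (rule 1) (use elim in auto)
        also have "(norm (complex_of_real (1 / Y)))\<^sup>2 * Re (complex_of_real (1 / Y)) powr (- 5/2) = sqrt Y"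
        proof -
          have "(norm (complex_of_real (1 / Y)))\<^sup>2 = Y powr (- 2)"
            using Y by (simp add: norm_divide powr_minus powr_numeral power_divide inverse_eq_divide)
          moreover have "Re (complex_of_real (1 / Y)) powr (- 5/2) = Y powr (5/2)"
            using Y by (simp add: powr_divide powr_minus_divide)
          ultimately show ?thesis
            using Y by (simp add: powr_add[symmetric] powr_half_sqrt)
        qed
        also have "norm (complex_of_real (Lz Y) - of_real (Ld Y)) = \<bar>Lz Y - Ld Y\<bar>"
          by (metis norm_of_real of_real_diff)
        finally show ?thesis .
      qed
      ultimately have "\<bar>F Y - Ld Y\<bar> \<le> B Y"
        unfolding B_def using C by (auto simp: abs_le_iff)
      then have "\<bar>F Y - Ld Y\<bar> / Y \<le> B Y / Y" using Y by (intro divide_right_mono) auto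
      then show ?case using Y by (simp add: abs_divide diff_divide_distrib[symmetric])
    qed
  qed
  have "((\<lambda>Y. B Y / Y) \<longlongrightarrow> 0) at_top" unfolding B_def by real_asymp
  then have "((\<lambda>Y. F Y / Y - Ld Y / Y) \<longlongrightarrow> 0) at_top"
    by (rule Lim_null_comparison[rotated]) (use B in \<open>simp add: real_norm_def\<close>)
  from tendsto_add[OF this log_density_laplace_asymp] show ?thesis
    by (simp add: F_def f_def Ld_def)
qed

section \<open>The ladder equation and the inverse ladder\<close>

lemma zeta_sq_integrable: "zeta_sq integrable_on {a..b}"
  by (intro integrable_continuous_interval continuous_on_zeta_sq)

lemma zeta_sq_integral_mono: "a \<le> b \<Longrightarrow> integral {0..a} zeta_sq \<le> integral {0..b} zeta_sq"
  by (intro integral_subset_le zeta_sq_integrable) (auto simp: zeta_sq_nonneg)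

lemma zeta_sq_mean_asymp:
  "((\<lambda>T. integral {0..T} zeta_sq / T - ln T) \<longlongrightarrow> 2 * euler_mascheroni - 1 - ln (2 * pi)) at_top"
proof -
  have "((\<lambda>T. (integral {0..T} zeta_sq - log_primitive T) / T + (2 * euler_mascheroni - 1 - ln (2 * pi)))
      \<longlongrightarrow> 0 + (2 * euler_mascheroni - 1 - ln (2 * pi))) at_top"
    by (intro tendsto_add zeta_sq_mean tendsto_const)
  then have "((\<lambda>T. (integral {0..T} zeta_sq - log_primitive T) / T + (2 * euler_mascheroni - 1 - ln (2 * pi)))
      \<longlongrightarrow> 2 * euler_mascheroni - 1 - ln (2 * pi)) at_top" by simp
  then show ?thesis
  proof (rule Lim_transform_eventually, intro eventually_mono[OF eventually_gt_at_top[of "0::real"]])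
    fix T :: real assume "T > 0"
    then show "(integral {0..T} zeta_sq - log_primitive T) / T + (2 * euler_mascheroni - 1 - ln (2 * pi)) =
        integral {0..T} zeta_sq / T - ln T"
      by (simp add: log_primitive_def ln_div field_simps)
  qed
qed

text \<open>Increasing \<open>x\<close> raises the integrand at every \<open>t > 0\<close> with
  \<open>zeta_sq t \<noteq> 0\<close>, and \<open>m'\<close> only widens the range; equal integrals
  therefore force the integrand to vanish on the smaller range. This degenerate case is recorded as
  a zero integral and is excluded later, where the common value is positive.\<close>

lemma zeta_sq_laplace_strict:
  fixes x x' m m' :: real
  assumes x: "0 < x" "x < x'" and m: "m \<le> m'"
    and eq: "integral {0..m} (\<lambda>t. zeta_sq t * exp (- (2 / x) * t)) = integral {0..m'} (\<lambda>t. zeta_sq t * exp (- (2 / x') * t))"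
  shows "integral {0..m} (\<lambda>t. zeta_sq t * exp (- (2 / x) * t)) = 0"
proof (cases "m > 0")
  case True
  define f where "f = (\<lambda>x t. zeta_sq t * exp (- (2 / x) * t))"
  have cf: "continuous_on A (f y)" for A y
    unfolding f_def by (intro continuous_intros continuous_on_zeta_sq)
  have fi: "f y integrable_on {a..b}" for y a b
    by (intro integrable_continuous_interval cf)
  have fnn: "f y t \<ge> 0" for y t by (simp add: f_def zeta_sq_nonneg)
  have le: "f x t \<le> f x' t" if "t \<ge> 0" for t
  proof -
    have "2 / x' \<le> 2 / x" using x by (intro divide_left_mono) auto
    then have "(2 / x') * t \<le> (2 / x) * t" using that by (intro mult_right_mono)
    then show ?thesis unfolding f_def by (intro mult_left_mono zeta_sq_nonneg) auto
  qed
  define D where "D = integral {0..m} (\<lambda>t. f x' t - f x t)"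
  have "D \<ge> 0" unfolding D_def
    by (rule integral_nonneg) (use fi le in \<open>auto intro!: integrable_diff\<close>)
  moreover have "D = integral {0..m} (f x') - integral {0..m} (f x)"
    unfolding D_def by (rule Henstock_Kurzweil_Integration.integral_diff[OF fi fi])
  moreover have "integral {0..m} (f x') \<le> integral {0..m'} (f x')"
    by (intro integral_subset_le fi) (use m fnn in auto)
  moreover have "integral {0..m} (f x) = integral {0..m'} (f x')" using eq by (simp add: f_def)
  ultimately have "D = 0" by linarith
  moreover have "D = 0 \<longleftrightarrow> (\<forall>t\<in>{0..m}. f x' t - f x t = 0)"
    unfolding D_def by (rule integral_eq_0_iff) (use True le cf in \<open>auto intro!: continuous_on_diff\<close>)
  ultimately have z: "f x' t = f x t" if "t \<in> {0..m}" for t using that by auto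
  have "f x t = 0" if t: "t \<in> {0..m} - {0}" for t
  proof -
    have "2 / x' < 2 / x" using x by (intro divide_strict_left_mono) auto
    then have "(2 / x') * t < (2 / x) * t" using t by (intro mult_strict_right_mono) auto
    then have "- (2 / x') * t \<noteq> - (2 / x) * t" by linarith
    then have "exp (- (2 / x') * t) \<noteq> exp (- (2 / x) * t)" unfolding exp_inj_iff .
    then show ?thesis using z[of t] t by (auto simp: f_def)
  qed
  then have "integral {0..m} (f x) = integral {0..m} (\<lambda>t. 0)"
    by (intro integral_spike[of "{0}"]) auto
  then show ?thesis by (simp add: f_def)
next
  case False
  then consider "m = 0" | "m < 0" by linarith
  then show ?thesis by cases auto
qed

text \<open>\<open>ladder_inv\<close> is meaningful at \<open>Y\<close> only if \<open>Y\<close> is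
  attained. The intermediate value theorem for the mean square gives a \<open>T\<close> at which the
  right-hand side of the ladder equation equals its left-hand side for the argument
  \<open>2 * Y\<close>; as the left-hand side determines its argument,
  \<open>\<phi> T = 2 * Y\<close>, that is, \<open>\<phi>1 T = Y\<close>.\<close>

lemma ladder_inv_equation:
  assumes "jacobs_ladder T0 \<phi>1"
  obtains m Y0 where "\<And>Y. Y \<ge> Y0 \<Longrightarrow> m Y \<ge> 14 * Y * ln (2 * Y)"
    "eventually (\<lambda>Y. integral {0..ladder_inv T0 \<phi>1 Y} zeta_sq =
        integral {0..m Y} (\<lambda>t. zeta_sq t * exp (- (1 / Y) * t))) at_top"
proof -
  obtain y0 \<mu> \<phi> where adm: "ladder_admissible y0 \<mu>" and sol: "solves_ladder_equation y0 \<mu> T0 \<phi>"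
    and \<phi>1: "\<And>T. T \<ge> T0 \<Longrightarrow> \<phi>1 T = \<phi> T / 2" and T0: "T0 > 0"
    using assms unfolding jacobs_ladder_def by blast
  define I where "I = (\<lambda>T. integral {0..T} zeta_sq)"
  define G where "G = (\<lambda>x. integral {0..\<mu> x} (\<lambda>t. zeta_sq t * exp (- (2 / x) * t)))"
  have y0: "y0 > 0" and mono: "mono_on {y0..} \<mu>" and \<mu>: "\<And>y. y \<ge> y0 \<Longrightarrow> \<mu> y \<ge> 7 * y * ln y"
    using adm by (auto simp: ladder_admissible_def)
  have re: "integral {a..b} (\<lambda>t. complex_of_real (g t)) = of_real (integral {a..b} g)"
    if "continuous_on {a..b} g" for a b :: real and g :: "real \<Rightarrow> real"
    using integral_linear[OF integrable_continuous_interval[OF that] bounded_linear_of_real[where 'a = complex]]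
    by (simp add: o_def)
  have eq: "\<phi> T \<ge> y0" "G (\<phi> T) = I T" if "T \<ge> T0" for T
  proof -
    show "\<phi> T \<ge> y0" using sol that by (simp add: solves_ladder_equation_def)
    then have ne: "\<phi> T \<noteq> 0" using y0 by simp
    have "integral {0..\<mu> (\<phi> T)} (\<lambda>t. (hardy_Z t)\<^sup>2 * of_real (exp (- (2 / \<phi> T) * t))) = integral {0..T} (\<lambda>t. (hardy_Z t)\<^sup>2)"
      using sol that by (simp only: solves_ladder_equation_def)
    then have "integral {0..\<mu> (\<phi> T)} (\<lambda>t. complex_of_real (zeta_sq t * exp (- (2 / \<phi> T) * t))) = integral {0..T} (\<lambda>t. complex_of_real (zeta_sq t))"
      by (simp only: hardy_Z_square zeta_sq_def of_real_mult)
    then have "complex_of_real (G (\<phi> T)) = of_real (I T)"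
      unfolding G_def I_def
      by (subst (asm) (1 2) re) (use ne in \<open>auto intro!: continuous_intros continuous_on_zeta_sq\<close>)
    then show "G (\<phi> T) = I T" by (simp only: of_real_eq_iff)
  qed
  have inj: "x = x'" if "y0 \<le> x" "y0 \<le> x'" "G x = G x'" "G x \<noteq> 0" for x x'
  proof (rule linorder_cases[of x x'])
    assume "x < x'"
    then show ?thesis
      using zeta_sq_laplace_strict[of x x' "\<mu> x" "\<mu> x'"] mono_onD[OF mono, of x x'] that y0 by (simp add: G_def)
  next
    assume "x' < x"
    then show ?thesis
      using zeta_sq_laplace_strict[of x' x "\<mu> x'" "\<mu> x"] mono_onD[OF mono, of x' x] that y0 by (simp add: G_def)
  qed
  define m where "m = (\<lambda>Y. \<mu> (2 * Y))"
  define F where "F = (\<lambda>Y. integral {0..m Y} (\<lambda>t. zeta_sq t * exp (- (1 / Y) * t)))"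
  have FG: "F Y = G (2 * Y)" for Y by (simp add: F_def G_def m_def)
  have mb: "m Y \<ge> 14 * Y * ln (2 * Y)" if "Y \<ge> y0 / 2" for Y
    using \<mu>[of "2 * Y"] that by (simp add: m_def)
  have top: "filterlim g at_top at_top" if "((\<lambda>Y. g Y / Y - ln Y) \<longlongrightarrow> l) at_top" for g :: "real \<Rightarrow> real" and l
  proof -
    have "filterlim (\<lambda>Y. (g Y / Y - ln Y) + ln Y) at_top at_top"
      by (rule filterlim_tendsto_add_at_top[OF that ln_at_top])
    then have "filterlim (\<lambda>Y. Y * ((g Y / Y - ln Y) + ln Y)) at_top at_top"
      by (intro filterlim_at_top_mult_at_top filterlim_ident)
    then show ?thesis
      by (rule filterlim_cong[THEN iffD1, OF refl refl, rotated])
         (intro eventually_mono[OF eventually_gt_at_top[of "0::real"]], simp)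
  qed
  have Ftop: "filterlim F at_top at_top"
    unfolding F_def by (rule top, rule zeta_sq_truncated_laplace_asymp[OF mb])
  have Itop: "filterlim I at_top at_top"
    unfolding I_def by (rule top, rule zeta_sq_mean_asymp)
  \<comment> \<open>Requiring \<open>F Y > I T0\<close> provides the lower end for the intermediate
    value theorem, and \<open>F Y > 0\<close> the nonzero value that \<open>inj\<close> asks
    for.\<close>
  have "eventually (\<lambda>Y. I (ladder_inv T0 \<phi>1 Y) = F Y) at_top"
    using filterlim_at_top_dense[THEN iffD1, OF Ftop, rule_format, of "max 0 (I T0)"] eventually_ge_at_top[of "y0 / 2"]
  proof eventually_elim
    case (elim Y)
    have "eventually (\<lambda>T. F Y \<le> I T \<and> T0 \<le> T) at_top"
      using filterlim_at_top[THEN iffD1, OF Itop] by (intro eventually_conj eventually_ge_at_top) auto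
    then obtain N where N: "F Y \<le> I N" "T0 \<le> N"
      unfolding eventually_at_top_linorder by blast
    have "continuous_on {T0..N} I"
      unfolding I_def using indefinite_integral_continuous_1[OF zeta_sq_integrable, of 0 N]
      by (rule continuous_on_subset) (use T0 in auto)
    then obtain T where T: "T0 \<le> T" "I T = F Y"
      using IVT'[of I T0 "F Y" N] N elim(1) by auto
    have fibre: "\<phi> T' = 2 * Y" if "T0 \<le> T'" "I T' = F Y" for T'
      by (rule inj) (use eq that elim FG in auto)
    have "\<phi>1 T = Y" using \<phi>1[OF T(1)] fibre[OF T] by simp
    then have img: "Y \<in> \<phi>1 ` {T0..}" using T by auto
    \<comment> \<open>\<open>inv_into\<close> may return a preimage other than \<open>T\<close>; the
      ladder equation holds at whichever one it returns.\<close>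
    define T' where "T' = ladder_inv T0 \<phi>1 Y"
    have "T' \<ge> T0" "\<phi>1 T' = Y"
      using inv_into_into[OF img] f_inv_into_f[OF img] by (auto simp: T'_def ladder_inv_def)
    then have "\<phi> T' = 2 * Y" "T' \<ge> T0" using \<phi>1[of T'] by simp_all
    then show ?case using eq(2)[of T'] FG by (simp add: T'_def)
  qed
  then show ?thesis using mb by (intro that[of "y0 / 2" m]) (simp_all add: I_def F_def)
qed

text \<open>After subtracting \<open>ln Y\<close>, the quotient \<open>I (J Y) / Y\<close> tends to
  \<open>c - ln (2 * pi)\<close> and \<open>I Y / Y\<close> to
  \<open>2 * c - 1 - ln (2 * pi)\<close>. The gap \<open>1 - c\<close> is positive, whence
  \<open>Y < J Y\<close> by monotonicity of \<open>I\<close>, and it is the limit of the normalised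
  increment.\<close>

lemma ladder_inv_asymp:
  assumes "jacobs_ladder T0 \<phi>1"
  shows "eventually (\<lambda>Y. Y \<le> ladder_inv T0 \<phi>1 Y) at_top"
    and "((\<lambda>Y. ladder_inv T0 \<phi>1 Y / Y) \<longlongrightarrow> 1) at_top"
    and "((\<lambda>Y. integral {Y..ladder_inv T0 \<phi>1 Y} zeta_sq / Y) \<longlongrightarrow> 1 - euler_mascheroni) at_top"
proof -
  define c where "c = (euler_mascheroni :: real)"
  have c: "c < 1" using euler_mascheroni_less_13_over_22 by (simp add: c_def)
  define J where "J = ladder_inv T0 \<phi>1"
  define I where "I = (\<lambda>T. integral {0..T} zeta_sq)"
  obtain m Y0 where m: "\<And>Y. Y \<ge> Y0 \<Longrightarrow> m Y \<ge> 14 * Y * ln (2 * Y)"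
    and IJ: "eventually (\<lambda>Y. I (J Y) = integral {0..m Y} (\<lambda>t. zeta_sq t * exp (- (1 / Y) * t))) at_top"
    unfolding I_def J_def using ladder_inv_equation[OF assms] by blast
  define b where "b = (\<lambda>Y. integral {0..m Y} (\<lambda>t. zeta_sq t * exp (- (1 / Y) * t)) / Y - ln Y)"
  define a where "a = (\<lambda>T. I T / T - ln T)"
  have b: "(b \<longlongrightarrow> c - ln (2 * pi)) at_top"
    unfolding b_def c_def by (rule zeta_sq_truncated_laplace_asymp[OF m])
  have a: "(a \<longlongrightarrow> 2 * c - 1 - ln (2 * pi)) at_top"
    unfolding a_def c_def I_def by (rule zeta_sq_mean_asymp)
  have bJ: "eventually (\<lambda>Y. b Y = I (J Y) / Y - ln Y) at_top"
    using IJ by eventually_elim (simp add: b_def)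
  have mono: "x < y" if "I x < I y" for x y
    using zeta_sq_integral_mono[of y x] that unfolding I_def by linarith
  have ba: "((\<lambda>Y. b Y - a Y) \<longlongrightarrow> 1 - c) at_top"
    using tendsto_diff[OF b a] by (simp add: algebra_simps)
  have "eventually (\<lambda>Y. 0 < b Y - a Y) at_top"
    by (rule order_tendstoD(1)[OF ba]) (use c in simp)
  then have gt: "eventually (\<lambda>Y. Y < J Y) at_top"
    using bJ eventually_gt_at_top[of "0::real"]
  proof eventually_elim
    case (elim Y)
    then have "I Y / Y < I (J Y) / Y" by (simp add: a_def)
    then have "I Y < I (J Y)" using elim(3) by (simp add: divide_less_cancel)
    then show ?case by (rule mono)
  qed
  then show "eventually (\<lambda>Y. Y \<le> ladder_inv T0 \<phi>1 Y) at_top"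
    unfolding J_def by eventually_elim simp
  \<comment> \<open>If \<open>J Y\<close> reached \<open>(1 + \<eta>) * Y\<close>, the mean square
    would have gained about \<open>\<eta> * Y * ln Y\<close>, more than the bounded multiple of
    \<open>Y\<close> that is available.\<close>
  have lt: "eventually (\<lambda>Y. J Y < (1 + \<eta>) * Y) at_top" if \<eta>: "\<eta> > 0" for \<eta>
  proof -
    have "filterlim (\<lambda>Y. (1 + \<eta>) * Y) at_top at_top" using \<eta> by real_asymp
    then have "((\<lambda>Y. a ((1 + \<eta>) * Y)) \<longlongrightarrow> 2 * c - 1 - ln (2 * pi)) at_top"
      by (rule filterlim_compose[OF a])
    then have "((\<lambda>Y. (1 + \<eta>) * (a ((1 + \<eta>) * Y) + ln (1 + \<eta>)) - b Y) \<longlongrightarrow>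
        (1 + \<eta>) * ((2 * c - 1 - ln (2 * pi)) + ln (1 + \<eta>)) - (c - ln (2 * pi))) at_top"
      by (intro tendsto_intros b)
    moreover have "filterlim (\<lambda>Y. \<eta> * ln Y) at_top at_top" using \<eta> by real_asymp
    ultimately have "filterlim (\<lambda>Y. ((1 + \<eta>) * (a ((1 + \<eta>) * Y) + ln (1 + \<eta>)) - b Y) + \<eta> * ln Y) at_top at_top"
      by (rule filterlim_tendsto_add_at_top)
    then have "eventually (\<lambda>Y. 0 < ((1 + \<eta>) * (a ((1 + \<eta>) * Y) + ln (1 + \<eta>)) - b Y) + \<eta> * ln Y) at_top"
      unfolding filterlim_at_top_dense by blast
    then show ?thesis using bJ eventually_gt_at_top[of "0::real"]
    proof eventually_elim
      case (elim Y)
      have "(1 + \<eta>) * a ((1 + \<eta>) * Y) = I ((1 + \<eta>) * Y) / Y - (1 + \<eta>) * ln (1 + \<eta>) - (1 + \<eta>) * ln Y"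
      proof -
        have 1: "ln ((1 + \<eta>) * Y) = ln (1 + \<eta>) + ln Y" using \<eta> elim(3) by (intro ln_mult_pos) auto
        have 2: "(1 + \<eta>) * (x / ((1 + \<eta>) * Y)) = x / Y" for x
          using \<eta> by simp
        show ?thesis unfolding a_def 1 right_diff_distrib 2 by (simp add: distrib_left)
      qed
      then have "I (J Y) / Y < I ((1 + \<eta>) * Y) / Y"
        using elim(1,2) by (simp add: algebra_simps)
      then have "I (J Y) < I ((1 + \<eta>) * Y)" using elim(3) by (simp add: divide_less_cancel)
      then show ?case by (rule mono)
    qed
  qed
  have "((\<lambda>Y. J Y / Y) \<longlongrightarrow> 1) at_top"
  proof (rule order_tendstoI)
    fix x :: real assume "x < 1"
    show "eventually (\<lambda>Y. x < J Y / Y) at_top"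
      using gt eventually_gt_at_top[of "0::real"]
    proof eventually_elim
      case (elim Y)
      then have "1 < J Y / Y" by (simp add: less_divide_eq)
      then show ?case using \<open>x < 1\<close> by linarith
    qed
  next
    fix x :: real assume "1 < x"
    then have "eventually (\<lambda>Y. J Y < (1 + (x - 1)) * Y) at_top" by (intro lt) simp
    then show "eventually (\<lambda>Y. J Y / Y < x) at_top"
      using eventually_gt_at_top[of "0::real"] by eventually_elim (simp add: divide_less_eq)
  qed
  then show "((\<lambda>Y. ladder_inv T0 \<phi>1 Y / Y) \<longlongrightarrow> 1) at_top" by (simp add: J_def)
  have "eventually (\<lambda>Y. b Y - a Y = integral {Y..J Y} zeta_sq / Y) at_top"
    using bJ gt eventually_gt_at_top[of "0::real"]
  proof eventually_elim
    case (elim Y)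
    have "I Y + integral {Y..J Y} zeta_sq = I (J Y)"
      unfolding I_def by (rule Henstock_Kurzweil_Integration.integral_combine) (use elim zeta_sq_integrable in auto)
    then have "integral {Y..J Y} zeta_sq = I (J Y) - I Y" by simp
    then show ?case using elim(1) by (simp add: a_def diff_divide_distrib)
  qed
  then have "((\<lambda>Y. integral {Y..J Y} zeta_sq / Y) \<longlongrightarrow> 1 - c) at_top"
    by (rule Lim_transform_eventually[OF ba])
  then show "((\<lambda>Y. integral {Y..ladder_inv T0 \<phi>1 Y} zeta_sq / Y) \<longlongrightarrow> 1 - euler_mascheroni) at_top"
    by (simp add: J_def c_def)
qed

text \<open>Since the intermediate point \<open>A Y\<close> is asymptotic to \<open>Y\<close>, the
  increment of the last step may be normalised by \<open>Y\<close> instead of \<open>A Y\<close>;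
  the increments then simply add up.\<close>

lemma iterated_mean_asymp:
  fixes J :: "real \<Rightarrow> real"
  assumes ge: "eventually (\<lambda>Y. Y \<le> J Y) at_top" and lim: "((\<lambda>Y. J Y / Y) \<longlongrightarrow> 1) at_top"
    and I: "((\<lambda>Y. integral {Y..J Y} zeta_sq / Y) \<longlongrightarrow> d) at_top"
  shows "eventually (\<lambda>Y. Y \<le> (J ^^ k) Y) at_top \<and> ((\<lambda>Y. (J ^^ k) Y / Y) \<longlongrightarrow> 1) at_top \<and>
         ((\<lambda>Y. integral {Y..(J ^^ k) Y} zeta_sq / Y) \<longlongrightarrow> real k * d) at_top"
proof (induction k)
  case 0
  have "((\<lambda>Y::real. Y / Y) \<longlongrightarrow> 1) at_top" by real_asymp
  then show ?case by simp
next
  case (Suc k)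
  define A where "A = J ^^ k"
  have A: "eventually (\<lambda>Y. Y \<le> A Y) at_top" "((\<lambda>Y. A Y / Y) \<longlongrightarrow> 1) at_top"
    "((\<lambda>Y. integral {Y..A Y} zeta_sq / Y) \<longlongrightarrow> real k * d) at_top"
    using Suc.IH by (auto simp: A_def)
  have Atop: "filterlim A at_top at_top"
    by (rule filterlim_at_top_mono[OF filterlim_ident A(1)])
  have ge': "eventually (\<lambda>Y. A Y \<le> J (A Y)) at_top"
    by (rule eventually_compose_filterlim[OF ge Atop])
  have l1: "((\<lambda>Y. J (A Y) / A Y) \<longlongrightarrow> 1) at_top"
    by (rule filterlim_compose[OF lim Atop])
  have l2: "((\<lambda>Y. integral {A Y..J (A Y)} zeta_sq / A Y) \<longlongrightarrow> d) at_top"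
    by (rule filterlim_compose[OF I Atop])
  have pos: "eventually (\<lambda>Y. 0 < Y \<and> Y \<le> A Y \<and> A Y \<le> J (A Y)) at_top"
    using A(1) ge' eventually_gt_at_top[of "0::real"] by eventually_elim auto
  have "((\<lambda>Y. J (A Y) / A Y * (A Y / Y)) \<longlongrightarrow> 1 * 1) at_top"
    by (intro tendsto_mult l1 A)
  then have r: "((\<lambda>Y. J (A Y) / Y) \<longlongrightarrow> 1) at_top"
    by (subst (asm) mult_1_left, elim Lim_transform_eventually)
       (use pos in eventually_elim, auto)
  have "((\<lambda>Y. integral {Y..A Y} zeta_sq / Y + integral {A Y..J (A Y)} zeta_sq / A Y * (A Y / Y)) \<longlongrightarrow> real k * d + d * 1) at_top"
    by (intro tendsto_add tendsto_mult l2 A)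
  moreover have "eventually (\<lambda>Y. integral {Y..A Y} zeta_sq / Y + integral {A Y..J (A Y)} zeta_sq / A Y * (A Y / Y) =
      integral {Y..J (A Y)} zeta_sq / Y) at_top"
    using pos
  proof eventually_elim
    case (elim Y)
    have "integral {Y..A Y} zeta_sq + integral {A Y..J (A Y)} zeta_sq = integral {Y..J (A Y)} zeta_sq"
      by (rule Henstock_Kurzweil_Integration.integral_combine) (use elim zeta_sq_integrable in auto)
    then show ?case using elim by (simp add: add_divide_distrib[symmetric])
  qed
  ultimately have "((\<lambda>Y. integral {Y..J (A Y)} zeta_sq / Y) \<longlongrightarrow> real k * d + d * 1) at_top"
    by (rule Lim_transform_eventually)
  moreover have "eventually (\<lambda>Y. Y \<le> J (A Y)) at_top"
    using pos by eventually_elim auto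
  ultimately show ?case using r by (simp add: A_def algebra_simps)
qed

text \<open>The integral is asymptotic to \<open>\<zeta>2\<sigma> * k * (1 - c) * Y\<close>, all of
  it from the critical line, while the term with weight \<open>1 - c\<close> has limit 0 after
  division by \<open>Y\<close>. The lower end point is \<open>r * \<tau>\<close> divided by exactly
  this constant, so \<open>r\<close> is what remains.\<close>

lemma ladder_mean_limit:
  fixes \<phi>1 :: "real \<Rightarrow> real" and T0 \<sigma> r :: real and k :: nat
  assumes jl: "jacobs_ladder T0 \<phi>1" and \<sigma>: "\<sigma> > 1/2" and k: "k \<ge> 1" and r: "r > 0"
  defines "c \<equiv> euler_mascheroni :: real" and "\<zeta>2\<sigma> \<equiv> Re (zeta (of_real (2 * \<sigma>)))"
  defines "Y \<equiv> \<lambda>\<tau>. r * (\<tau> / (real k * (1 - c) * \<zeta>2\<sigma>))"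
  shows "((\<lambda>\<tau>. 1 / \<tau> * integral {Y \<tau>..(ladder_inv T0 \<phi>1 ^^ k) (Y \<tau>)}
             (\<lambda>t. \<zeta>2\<sigma> * (cmod (zeta (Complex (1/2) t)))\<^sup>2 + (1 - c) * (cmod (zeta (Complex \<sigma> t)))\<^sup>2)) \<longlongrightarrow> r) at_top"
proof -
  have c: "c < 1" using euler_mascheroni_less_13_over_22 by (simp add: c_def)
  have \<zeta>: "\<zeta>2\<sigma> > 0" unfolding \<zeta>2\<sigma>_def by (rule zeta_real_pos) (use \<sigma> in simp)
  define A where "A = ladder_inv T0 \<phi>1 ^^ k"
  have A: "eventually (\<lambda>Y. Y \<le> A Y) at_top" "((\<lambda>Y. A Y / Y) \<longlongrightarrow> 1) at_top"
     "((\<lambda>Y. integral {Y..A Y} zeta_sq / Y) \<longlongrightarrow> real k * (1 - c)) at_top"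
    using iterated_mean_asymp[OF ladder_inv_asymp[OF jl], of k] by (auto simp: A_def c_def)
  define s where "s = (\<lambda>t. (cmod (zeta (Complex \<sigma> t)))\<^sup>2)"
  have s: "((\<lambda>Y. integral {Y..A Y} s / Y) \<longlongrightarrow> 0) at_top"
    unfolding s_def by (rule zeta_line_mean_small[OF \<sigma> A])
  define q where "q = r / (real k * (1 - c) * \<zeta>2\<sigma>)"
  have q: "q > 0" using r k c \<zeta> by (simp add: q_def)
  have Yq: "Y \<tau> = q * \<tau>" for \<tau> by (simp add: Y_def q_def)
  have Ytop: "filterlim Y at_top at_top" unfolding Yq using q by real_asymp
  have "((\<lambda>Y. \<zeta>2\<sigma> * (integral {Y..A Y} zeta_sq / Y) + (1 - c) * (integral {Y..A Y} s / Y)) \<longlongrightarrow>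
      \<zeta>2\<sigma> * (real k * (1 - c)) + (1 - c) * 0) at_top"
    by (intro tendsto_add tendsto_mult tendsto_const A s)
  then have "((\<lambda>\<tau>. \<zeta>2\<sigma> * (integral {Y \<tau>..A (Y \<tau>)} zeta_sq / Y \<tau>) + (1 - c) * (integral {Y \<tau>..A (Y \<tau>)} s / Y \<tau>)) \<longlongrightarrow>
      \<zeta>2\<sigma> * (real k * (1 - c)) + (1 - c) * 0) at_top"
    by (rule filterlim_compose[OF _ Ytop])
  then have "((\<lambda>\<tau>. q * (\<zeta>2\<sigma> * (integral {Y \<tau>..A (Y \<tau>)} zeta_sq / Y \<tau>) + (1 - c) * (integral {Y \<tau>..A (Y \<tau>)} s / Y \<tau>))) \<longlongrightarrow>
      q * (\<zeta>2\<sigma> * (real k * (1 - c)) + (1 - c) * 0)) at_top"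
    by (rule tendsto_mult_left)
  also have "q * (\<zeta>2\<sigma> * (real k * (1 - c)) + (1 - c) * 0) = r"
    using k c \<zeta> by (simp add: q_def)
  finally show ?thesis
  proof (rule Lim_transform_eventually, intro eventually_mono[OF eventually_gt_at_top[of "0::real"]])
    fix \<tau> :: real assume \<tau>: "0 < \<tau>"
    have Y: "Y \<tau> > 0" using q \<tau> by (simp add: Yq)
    have si: "s integrable_on {Y \<tau>..A (Y \<tau>)}"
      unfolding s_def
      by (intro integrable_continuous_interval continuous_intros continuous_on_zeta_line) (use Y in \<open>auto simp: complex_eq_iff\<close>)
    have "integral {Y \<tau>..A (Y \<tau>)} (\<lambda>t. \<zeta>2\<sigma> * zeta_sq t + (1 - c) * s t) =
        integral {Y \<tau>..A (Y \<tau>)} (\<lambda>t. \<zeta>2\<sigma> * zeta_sq t) + integral {Y \<tau>..A (Y \<tau>)} (\<lambda>t. (1 - c) * s t)"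
      by (rule Henstock_Kurzweil_Integration.integral_add) (intro integrable_on_mult_right zeta_sq_integrable si)+
    also have "\<dots> = \<zeta>2\<sigma> * integral {Y \<tau>..A (Y \<tau>)} zeta_sq + (1 - c) * integral {Y \<tau>..A (Y \<tau>)} s"
      by (simp only: Henstock_Kurzweil_Integration.integral_mult_right)
    finally have "1 / \<tau> * integral {Y \<tau>..A (Y \<tau>)} (\<lambda>t. \<zeta>2\<sigma> * zeta_sq t + (1 - c) * s t) =
        1 / \<tau> * (\<zeta>2\<sigma> * integral {Y \<tau>..A (Y \<tau>)} zeta_sq + (1 - c) * integral {Y \<tau>..A (Y \<tau>)} s)" by simp
    moreover have "q / Y \<tau> = 1 / \<tau>" using q \<tau> by (simp add: Yq)
    then have "q * (\<zeta>2\<sigma> * (x / Y \<tau>) + (1 - c) * (y / Y \<tau>)) = 1 / \<tau> * (\<zeta>2\<sigma> * x + (1 - c) * y)" for x y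
    proof -
      have "q * (\<zeta>2\<sigma> * (x / Y \<tau>) + (1 - c) * (y / Y \<tau>)) = (q / Y \<tau>) * (\<zeta>2\<sigma> * x + (1 - c) * y)"
        using Y by (simp add: field_simps)
      then show ?thesis using \<open>q / Y \<tau> = 1 / \<tau>\<close> by (simp only:)
    qed
    ultimately show "q * (\<zeta>2\<sigma> * (integral {Y \<tau>..A (Y \<tau>)} zeta_sq / Y \<tau>) + (1 - c) * (integral {Y \<tau>..A (Y \<tau>)} s / Y \<tau>)) =
        1 / \<tau> * integral {Y \<tau>..(ladder_inv T0 \<phi>1 ^^ k) (Y \<tau>)}
             (\<lambda>t. \<zeta>2\<sigma> * (cmod (zeta (Complex (1/2) t)))\<^sup>2 + (1 - c) * (cmod (zeta (Complex \<sigma> t)))\<^sup>2)"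
      unfolding A_def s_def zeta_sq_def by (simp only:)
  qed
qed

text \<open>The condition on the limit is written as the existence of a limit
  \<open>L \<noteq> 1\<close>, which makes convergence part of the claim. Taking \<open>Re\<close>
  loses nothing, because zeta is real at the real point \<open>2 * \<sigma>\<close>.\<close>

theorem theorem4:
  fixes \<phi>1 :: "real \<Rightarrow> real" and T0 \<epsilon> \<sigma> :: real and k :: nat
  assumes "jacobs_ladder T0 \<phi>1"
    and "\<epsilon> > 0"
    and "k \<ge> 1"
    and "\<sigma> \<ge> 1/2 + \<epsilon>"
  shows "(\<not> (\<exists>(x::nat) (y::nat) (z::nat) (n::nat). x > 0 \<and> y > 0 \<and> z > 0 \<and> n \<ge> 3 \<and> x ^ n + y ^ n = z ^ n)) \<longleftrightarrow>
    (\<forall>(x::nat) (y::nat) (z::nat) (n::nat). x > 0 \<longrightarrow> y > 0 \<longrightarrow> z > 0 \<longrightarrow> n \<ge> 3 \<longrightarrow>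
      (let c = euler_mascheroni :: real;
           \<zeta>2\<sigma> = Re (zeta (of_real (2 * \<sigma>)));
           Y = (\<lambda>\<tau>. (real x ^ n + real y ^ n) / real z ^ n * (\<tau> / (real k * (1 - c) * \<zeta>2\<sigma>)))
       in \<exists>L. ((\<lambda>\<tau>. 1 / \<tau> *
                integral {Y \<tau>..(ladder_inv T0 \<phi>1 ^^ k) (Y \<tau>)}
                  (\<lambda>t. \<zeta>2\<sigma> * (cmod (zeta (Complex (1/2) t)))\<^sup>2 +
                       (1 - c) * (cmod (zeta (Complex \<sigma> t)))\<^sup>2)) \<longlongrightarrow> L) at_top \<and>
              L \<noteq> 1))"
proof -
  have \<sigma>: "\<sigma> > 1/2" using assms by simp
  have lim: "(let c = euler_mascheroni :: real;
           \<zeta>2\<sigma> = Re (zeta (of_real (2 * \<sigma>)));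
           Y = (\<lambda>\<tau>. (real x ^ n + real y ^ n) / real z ^ n * (\<tau> / (real k * (1 - c) * \<zeta>2\<sigma>)))
       in \<exists>L. ((\<lambda>\<tau>. 1 / \<tau> *
                integral {Y \<tau>..(ladder_inv T0 \<phi>1 ^^ k) (Y \<tau>)}
                  (\<lambda>t. \<zeta>2\<sigma> * (cmod (zeta (Complex (1/2) t)))\<^sup>2 +
                       (1 - c) * (cmod (zeta (Complex \<sigma> t)))\<^sup>2)) \<longlongrightarrow> L) at_top \<and>
              L \<noteq> 1) \<longleftrightarrow> x ^ n + y ^ n \<noteq> z ^ n"
    if pos: "x > 0" "y > 0" "z > 0" for x y z n :: nat
  proof -
    define r where "r = (real x ^ n + real y ^ n) / real z ^ n"
    have r: "r > 0" using pos by (simp add: r_def add_pos_pos)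
    have "r = 1 \<longleftrightarrow> real (x ^ n + y ^ n) = real (z ^ n)"
      using pos by (auto simp: r_def)
    then have r1: "r \<noteq> 1 \<longleftrightarrow> x ^ n + y ^ n \<noteq> z ^ n" by (simp only: of_nat_eq_iff)
    \<comment> \<open>Limits at infinity are unique, so the existence of a limit
      \<open>L \<noteq> 1\<close> reduces to \<open>r \<noteq> 1\<close>.\<close>
    have L: "\<And>L. (f \<longlongrightarrow> L) at_top \<longleftrightarrow> L = r" if "(f \<longlongrightarrow> r) at_top" for f :: "real \<Rightarrow> real"
      using tendsto_unique[OF trivial_limit_at_top_linorder that] that by blast
    show ?thesis
      unfolding Let_def r_def[symmetric] L[OF ladder_mean_limit[OF assms(1) \<sigma> assms(3) r]]
      using r1 by simp
  qed
  show ?thesis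
  proof (intro iffI allI impI, goal_cases)
    case (1 x y z n)
    show ?case
      by (rule iffD2[OF lim[OF 1(2-4)]]) (use 1 in blast)
  next
    case 2
    show ?case
    proof (rule notI, elim exE conjE)
      fix x y z n :: nat
      assume pos: "x > 0" "y > 0" "z > 0" "n \<ge> 3" and eq: "x ^ n + y ^ n = z ^ n"
      show False
        using iffD1[OF lim[OF pos(1-3)] 2[rule_format, OF pos]] eq by contradiction
    qed
  qed
qed

end
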